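(* Let $1\leq p<\infty$. The system of parabolic polynomials $\{w_{\alpha}\}_{\alpha\in\mathbb{N}_0^n}$ (restricted to $\Sigma_1\cup\Sigma_3$) is complete in $L^{p}(\Sigma_{1}\cup\Sigma_{3})$; that is, the linear span of the restrictions $w_\alpha|_{\Sigma_1\cup\Sigma_3}$ is dense in $L^p(\Sigma_1\cup\Sigma_3)$.
   Context: Setting: $n\geq 3$; $\Omega\subset\mathbb{R}^n$ is a bounded domain with $C^1$ boundary such that $\mathbb{R}^n\setminus\overline{\Omega}$ is connected; $T>0$; $\Omega_T=\Omega\times(0,T)\subset\mathbb{R}^{n+1}$, with points written $(x,t)$, $x\in\mathbb{R}^n$, $t\in\mathbb{R}$. $\Sigma_1=\{(x,T): x\in\Omega\}$ and $\Sigma_3=\partial\Omega\times(0,T)$; $L^p(\Sigma_1\cup\Sigma_3)$ is the space of real-valued functions whose $p$-th power is integrable with respect to the surface measure $d\sigma$ (Lebesgue measure on $\Sigma_1$; the product of surface measure on $\partial\Omega$ and Lebesgue measure in $t$ on $\Sigma_3$). $(a_{hk})$ is a constant real symmetric positive definite $n\times n$ matrix, and $H^*=\sum_{h,k=1}^n a_{hk}\frac{\partial^2}{\partial x_h\partial x_k}+\frac{\partial}{\partial t}$. For a multiindex $\alpha\in\mathbb{N}_0^n$ the polynomial $w_\alpha$ (which satisfies $H^*w_\alpha=0$) is $$w_{\alpha}(x,t)=D^{\alpha}_{\xi}\Big(\exp\big[\langle x,\xi\rangle-t\sum_{h,k=1}^n a_{hk}\xi_h\xi_k\big]\Big)\Big|_{\xi=0}.$$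 *)

theory Defs
  imports "HOL-Analysis.Analysis"
begin

definition hausdorff_gauge :: "real \<Rightarrow> real \<Rightarrow> 'a::metric_space set \<Rightarrow> ennreal" where
  "hausdorff_gauge s \<delta> U =
     (if bounded U \<and> diameter U \<le> \<delta>
      then ennreal (unit_ball_vol s * (diameter U / 2) powr s) else top)"

definition hausdorff_content :: "real \<Rightarrow> real \<Rightarrow> 'a::metric_space set \<Rightarrow> ennreal" where
  "hausdorff_content s \<delta> A =
     (INF U\<in>{U :: nat \<Rightarrow> 'a set. A \<subseteq> (\<Union>i. U i)}. \<Sum>i. hausdorff_gauge s \<delta> (U i))"

definition hausdorff_outer :: "real \<Rightarrow> 'a::metric_space set \<Rightarrow> ennreal" where
  "hausdorff_outer s A = (SUP \<delta>\<in>{0<..}. hausdorff_content s \<delta> A)"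

text \<open>
  The \<open>s\<close>-dimensional Hausdorff measure on the Borel sets, for \<open>s > 0\<close>. The factor
  \<open>unit_ball_vol s / 2 powr s\<close> in the gauge normalises it so that for integer \<open>s\<close> it is the
  \<open>s\<close>-dimensional surface measure. (For \<open>s = 0\<close> the convention \<open>0 powr 0 = 0\<close> makes it
  vanish instead of counting points.)
\<close>

definition hausdorff_measure :: "real \<Rightarrow> 'a::metric_space measure" where
  "hausdorff_measure s = measure_of UNIV (sets borel) (hausdorff_outer s)"

lemma hausdorff_gauge_mono:
  assumes "0 \<le> s" "U \<subseteq> V"
  shows "hausdorff_gauge s \<delta> U \<le> hausdorff_gauge s \<delta> V"
proof (cases "bounded V \<and> diameter V \<le> \<delta>")
  case True
  have b: "bounded U" using True assms bounded_subset by blast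
  have d: "diameter U \<le> diameter V" using diameter_subset assms True by blast
  have "(diameter U / 2) powr s \<le> (diameter V / 2) powr s"
    using d diameter_ge_0[OF b] assms by (intro powr_mono2) auto
  then show ?thesis using True b d assms
    by (auto simp: hausdorff_gauge_def intro!: ennreal_leI mult_left_mono)
qed (auto simp: hausdorff_gauge_def)

lemma hausdorff_gauge_antimono:
  "\<delta> \<le> \<delta>' \<Longrightarrow> hausdorff_gauge s \<delta>' U \<le> hausdorff_gauge s \<delta> U"
  by (auto simp: hausdorff_gauge_def)

lemma hausdorff_gauge_empty: "0 \<le> \<delta> \<Longrightarrow> hausdorff_gauge s \<delta> {} = 0"
  by (simp add: hausdorff_gauge_def)

lemma hausdorff_content_mono:
  "A \<subseteq> B \<Longrightarrow> hausdorff_content s \<delta> A \<le> hausdorff_content s \<delta> B"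
  unfolding hausdorff_content_def by (rule INF_superset_mono) auto

lemma hausdorff_content_antimono:
  "\<delta> \<le> \<delta>' \<Longrightarrow> hausdorff_content s \<delta>' A \<le> hausdorff_content s \<delta> A"
  unfolding hausdorff_content_def
  by (rule INF_mono) (auto intro!: suminf_le hausdorff_gauge_antimono)

lemma hausdorff_content_eq_outer_measure:
  assumes "0 \<le> s" "0 < \<delta>"
  shows "hausdorff_content s \<delta> = outer_measure (Pow UNIV) (hausdorff_gauge s \<delta>)"
proof
  fix A :: "'a set"
  interpret P: ring_of_sets UNIV "Pow (UNIV :: 'a set)" by (rule ring_of_sets_Pow)
  have pos: "positive (Pow UNIV) (hausdorff_gauge s \<delta> :: 'a set \<Rightarrow> _)"
    using assms by (simp add: positive_def hausdorff_gauge_empty)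
  have inc: "increasing (Pow UNIV) (hausdorff_gauge s \<delta> :: 'a set \<Rightarrow> _)"
    using assms by (auto simp: increasing_def hausdorff_gauge_mono)
  show "hausdorff_content s \<delta> A = outer_measure (Pow UNIV) (hausdorff_gauge s \<delta>) A"
  proof (rule antisym)
    show "hausdorff_content s \<delta> A \<le> outer_measure (Pow UNIV) (hausdorff_gauge s \<delta>) A"
      unfolding hausdorff_content_def outer_measure_def by (rule INF_superset_mono) auto
    show "outer_measure (Pow UNIV) (hausdorff_gauge s \<delta>) A \<le> hausdorff_content s \<delta> A"
      unfolding hausdorff_content_def
      using P.outer_measure_le[OF pos inc] by (intro INF_greatest) auto
  qed
qed

lemma outer_measure_space_hausdorff_content:
  assumes "0 \<le> s" "0 < \<delta>"
  shows "outer_measure_space (Pow UNIV) (hausdorff_content s \<delta> :: 'a::metric_space set \<Rightarrow> _)"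
proof -
  interpret P: ring_of_sets UNIV "Pow (UNIV :: 'a set)" by (rule ring_of_sets_Pow)
  show ?thesis
    unfolding hausdorff_content_eq_outer_measure[OF assms]
    using assms
    by (intro P.outer_measure_space_outer_measure)
       (auto simp: positive_def increasing_def hausdorff_gauge_empty hausdorff_gauge_mono)
qed

lemma hausdorff_content_le_outer:
  "0 < \<delta> \<Longrightarrow> hausdorff_content s \<delta> A \<le> hausdorff_outer s A"
  unfolding hausdorff_outer_def by (rule SUP_upper) auto

lemma outer_measure_space_hausdorff:
  assumes "0 \<le> s"
  shows "outer_measure_space (Pow UNIV) (hausdorff_outer s :: 'a::metric_space set \<Rightarrow> _)"
  unfolding outer_measure_space_def
proof (intro conjI)
  note C = outer_measure_space_hausdorff_content[OF assms, unfolded outer_measure_space_def]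
  show "positive (Pow UNIV) (hausdorff_outer s :: 'a set \<Rightarrow> _)"
    using C by (auto simp: positive_def hausdorff_outer_def intro!: SUP_eq_const)
  show "increasing (Pow UNIV) (hausdorff_outer s :: 'a set \<Rightarrow> _)"
    unfolding increasing_def hausdorff_outer_def
    by (auto intro!: SUP_mono' hausdorff_content_mono)
  show "countably_subadditive (Pow UNIV) (hausdorff_outer s :: 'a set \<Rightarrow> _)"
    unfolding countably_subadditive_def
  proof safe
    fix A :: "nat \<Rightarrow> 'a set" assume dis: "disjoint_family A"
    show "hausdorff_outer s (\<Union>(range A)) \<le> (\<Sum>i. hausdorff_outer s (A i))"
      unfolding hausdorff_outer_def[of s "\<Union>(range A)"]
    proof (rule SUP_least)
      fix \<delta> :: real assume d: "\<delta> \<in> {0<..}"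
      then have "countably_subadditive (Pow UNIV) (hausdorff_content s \<delta> :: 'a set \<Rightarrow> _)"
        using C by auto
      then have "hausdorff_content s \<delta> (\<Union>(range A)) \<le> (\<Sum>i. hausdorff_content s \<delta> (A i))"
        using dis by (auto simp: countably_subadditive_def)
      also have "\<dots> \<le> (\<Sum>i. hausdorff_outer s (A i))"
        using d by (intro suminf_le) (auto intro!: hausdorff_content_le_outer)
      finally show "hausdorff_content s \<delta> (\<Union>(range A)) \<le> (\<Sum>i. hausdorff_outer s (A i))" .
    qed
  qed
qed

lemma hausdorff_content_separated:
  assumes d: "0 < \<delta>" "\<delta> < e" and sep: "\<And>a b. a \<in> A \<Longrightarrow> b \<in> B \<Longrightarrow> e \<le> dist a b"
  shows "hausdorff_content s \<delta> A + hausdorff_content s \<delta> B \<le> hausdorff_content s \<delta> (A \<union> B)"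
  unfolding hausdorff_content_def[of s \<delta> "A \<union> B"]
proof (rule INF_greatest)
  fix U :: "nat \<Rightarrow> 'a set" assume U: "U \<in> {U. A \<union> B \<subseteq> (\<Union>i. U i)}"
  let ?V = "\<lambda>C i. if U i \<inter> C \<noteq> {} then U i else {}"
  have le: "hausdorff_content s \<delta> C \<le> (\<Sum>i. hausdorff_gauge s \<delta> (?V C i))"
    if "C \<subseteq> A \<union> B" for C
    unfolding hausdorff_content_def
  proof (rule INF_lower, clarify)
    fix x assume "x \<in> C"
    then have "x \<in> (\<Union>i. U i)" using U that by blast
    then obtain i where "x \<in> U i" by blast
    then show "x \<in> (\<Union>i. ?V C i)" using \<open>x \<in> C\<close> by (intro UN_I[of i]) auto
  qed
  have g: "hausdorff_gauge s \<delta> (?V A i) + hausdorff_gauge s \<delta> (?V B i) \<le> hausdorff_gauge s \<delta> (U i)"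
    for i
  proof (cases "U i \<inter> A \<noteq> {} \<and> U i \<inter> B \<noteq> {}")
    case True
    then obtain a b where ab: "a \<in> U i" "a \<in> A" "b \<in> U i" "b \<in> B" by blast
    have "\<not> (bounded (U i) \<and> diameter (U i) \<le> \<delta>)"
      using diameter_bounded_bound[OF _ ab(1,3)] sep[OF ab(2,4)] d by force
    then show ?thesis by (auto simp: hausdorff_gauge_def)
  next
    case False
    then show ?thesis using d by (auto simp: hausdorff_gauge_empty)
  qed
  have "hausdorff_content s \<delta> A + hausdorff_content s \<delta> B
    \<le> (\<Sum>i. hausdorff_gauge s \<delta> (?V A i)) + (\<Sum>i. hausdorff_gauge s \<delta> (?V B i))"
    by (intro add_mono le) auto
  also have "\<dots> = (\<Sum>i. hausdorff_gauge s \<delta> (?V A i) + hausdorff_gauge s \<delta> (?V B i))"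
    by (rule suminf_add) auto
  also have "\<dots> \<le> (\<Sum>i. hausdorff_gauge s \<delta> (U i))"
    by (intro suminf_le g) auto
  finally show "hausdorff_content s \<delta> A + hausdorff_content s \<delta> B \<le> (\<Sum>i. hausdorff_gauge s \<delta> (U i))" .
qed

lemma hausdorff_outer_separated:
  assumes e: "0 < e" and sep: "\<And>a b. a \<in> A \<Longrightarrow> b \<in> B \<Longrightarrow> e \<le> dist a b"
  shows "hausdorff_outer s A + hausdorff_outer s B \<le> hausdorff_outer s (A \<union> B)"
proof -
  have 1: "hausdorff_content s d1 A + hausdorff_content s d2 B \<le> hausdorff_outer s (A \<union> B)"
    if "0 < d1" "0 < d2" for d1 d2
  proof -
    define d where "d = min (min d1 d2) (e / 2)"
    have d: "0 < d" "d < e" "d \<le> d1" "d \<le> d2" using that e by (auto simp: d_def)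
    have "hausdorff_content s d1 A + hausdorff_content s d2 B
      \<le> hausdorff_content s d A + hausdorff_content s d B"
      using d by (intro add_mono hausdorff_content_antimono)
    also have "\<dots> \<le> hausdorff_content s d (A \<union> B)"
      using d sep by (intro hausdorff_content_separated)
    also have "\<dots> \<le> hausdorff_outer s (A \<union> B)" using d by (intro hausdorff_content_le_outer)
    finally show ?thesis .
  qed
  have ne: "{0::real<..} \<noteq> {}" by (auto intro: gt_ex)
  have 2: "hausdorff_outer s A + hausdorff_content s d2 B \<le> hausdorff_outer s (A \<union> B)"
    if "0 < d2" for d2
    unfolding hausdorff_outer_def[of s A]
    by (subst ennreal_SUP_add_left[OF ne, symmetric]) (use 1 that in \<open>auto intro!: SUP_least\<close>)
  show ?thesis
    unfolding hausdorff_outer_def[of s B]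
    by (subst ennreal_SUP_add_right[OF ne]) (use 2 in \<open>auto intro!: SUP_least\<close>)
qed

lemma closed_lambda_system_metric_outer:
  fixes f :: "'a::metric_space set \<Rightarrow> ennreal"
  assumes oms: "outer_measure_space (Pow UNIV) f"
    and sep: "\<And>e A B. 0 < e \<Longrightarrow> (\<And>a b. a \<in> A \<Longrightarrow> b \<in> B \<Longrightarrow> e \<le> dist a b) \<Longrightarrow> f A + f B \<le> f (A \<union> B)"
    and C: "closed C"
  shows "C \<in> lambda_system UNIV (Pow UNIV) f"
proof -
  interpret sigma_algebra UNIV "Pow (UNIV :: 'a set)" by (rule sigma_algebra_Pow)
  have pos: "f {} = 0" and mono: "\<And>A B. A \<subseteq> B \<Longrightarrow> f A \<le> f B"
    and sub: "countably_subadditive (Pow UNIV) f"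
    using oms by (auto simp: outer_measure_space_def positive_def increasing_def)
  have sub2: "f (A \<union> B) \<le> f A + f B" for A B
  proof -
    have "f (A \<union> (B - A)) \<le> f A + f (B - A)"
      using subadditiveD[OF countably_subadditive_subadditive[OF _ sub], of A "B - A"] pos
      by (auto simp: positive_def)
    also have "\<dots> \<le> f A + f B" by (intro add_left_mono mono) auto
    finally show ?thesis by simp
  qed
  have key: "f (A \<inter> C) + f (A - C) \<le> f A" for A
  proof (cases "C = {} \<or> f A = top")
    case True
    then show ?thesis using pos by auto
  next
    case False
    then have Cne: "C \<noteq> {}" and fin: "f A < top" by (auto simp: less_top)
    define D where "D k = {x\<in>A. 1 / real (Suc k) \<le> infdist x C}" for k
    define R where "R k = D (Suc k) - D k" for k
    have D_mono: "D j \<subseteq> D k" if "j \<le> k" for j k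
    proof -
      have "1 / real (Suc k) \<le> 1 / real (Suc j)" using that by (auto simp: field_simps)
      then show ?thesis by (auto simp: D_def)
    qed
    have D_sub: "D k \<subseteq> A - C" for k
      by (auto simp: D_def)
    have infd: "infdist x C \<le> infdist y C + dist x y" for x y by (rule infdist_triangle)
    have R_upper: "infdist x C < 1 / real (Suc k)" if "x \<in> R k" for x k
      using that by (auto simp: R_def D_def)
    have R_sep: "f (D k) + f (R (Suc k)) \<le> f (D (Suc (Suc k)))" for k
    proof -
      have "f (D k) + f (R (Suc k)) \<le> f (D k \<union> R (Suc k))"
      proof (rule sep)
        show "0 < 1 / real (Suc k) - 1 / real (Suc (Suc k))"
          by (simp add: frac_less2)
        fix a b assume "a \<in> D k" "b \<in> R (Suc k)"
        then have "1 / real (Suc k) \<le> infdist a C" "infdist b C < 1 / real (Suc (Suc k))"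
          using R_upper[of b "Suc k"] by (auto simp: D_def)
        then show "1 / real (Suc k) - 1 / real (Suc (Suc k)) \<le> dist a b"
          using infd[of a b] by linarith
      qed
      also have "\<dots> \<le> f (D (Suc (Suc k)))"
        using D_mono[of k "Suc (Suc k)"] by (intro mono) (auto simp: R_def)
      finally show ?thesis .
    qed
    have sum_le: "(\<Sum>k<N. f (R (Suc (2 * k + j)))) \<le> f (D (2 * N + j))" for N j
    proof (induction N)
      case (Suc N)
      have "(\<Sum>k<Suc N. f (R (Suc (2 * k + j)))) \<le> f (D (2 * N + j)) + f (R (Suc (2 * N + j)))"
        using Suc by (simp add: add_right_mono)
      also have "\<dots> \<le> f (D (Suc (Suc (2 * N + j))))" by (rule R_sep)
      finally show ?case by simp
    qed simp
    let ?g = "\<lambda>k. f (R (Suc k))"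
    have partial: "(\<Sum>k<N. ?g k) \<le> f A + f A" for N
    proof -
      have "(\<Sum>k<N. ?g k) \<le> (\<Sum>k<2 * N. ?g k)" by (rule sum_mono2) auto
      also have "\<dots> = (\<Sum>k<N. ?g (2 * k)) + (\<Sum>k<N. ?g (2 * k + 1))"
        by (induction N) (simp_all add: ac_simps)
      also have "\<dots> \<le> f (D (2 * N)) + f (D (2 * N + 1))"
        using sum_le[where j = 0] sum_le[where j = 1] by (intro add_mono) auto
      also have "\<dots> \<le> f A + f A"
        by (intro add_mono mono) (auto simp: D_def)
      finally show ?thesis .
    qed
    have S: "suminf ?g = (SUP N. \<Sum>k<N. ?g k)" by (rule suminf_eq_SUP)
    have "suminf ?g \<le> f A + f A" unfolding S using partial by (intro SUP_least)
    also have "\<dots> < top" using fin by (simp add: less_top)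
    finally have Sfin: "suminf ?g \<noteq> top" by simp
    have exhaust: "A - C \<subseteq> D (Suc m) \<union> (\<Union>k. R (Suc (k + m)))" for m
    proof
      fix x assume x: "x \<in> A - C"
      then have "0 < infdist x C" using infdist_pos_not_in_closed[OF C Cne] by auto
      then obtain n where "1 / real (Suc n) < infdist x C"
        using reals_Archimedean by (auto simp: inverse_eq_divide)
      then have ex: "\<exists>n. x \<in> D n" using x by (auto simp: D_def intro!: exI[of _ n])
      define l where "l = (LEAST n. x \<in> D n)"
      have l: "x \<in> D l" and least: "\<And>j. j < l \<Longrightarrow> x \<notin> D j"
        unfolding l_def using ex by (auto intro: LeastI_ex dest: not_less_Least)
      show "x \<in> D (Suc m) \<union> (\<Union>k. R (Suc (k + m)))"
      proof (cases "l \<le> Suc m")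
        case True
        then show ?thesis using l D_mono by auto
      next
        case False
        then obtain i where i: "l = Suc (Suc (i + m))"
          by (metis add.commute add_Suc_right less_iff_Suc_add linorder_not_le)
        then have "x \<in> R (Suc (i + m))"
          using l least[of "Suc (i + m)"] by (simp add: R_def)
        then show ?thesis by blast
      qed
    qed
    have dis: "disjoint_family (\<lambda>k. R (Suc (k + m)))" for m
    proof -
      have "R i \<inter> R j = {}" if "i < j" for i j
        using D_mono[of "Suc i" j] that by (auto simp: R_def)
      then show ?thesis
        unfolding disjoint_family_on_def by (metis Int_commute add_right_cancel nat.inject nat_neq_iff)
    qed
    have bound: "f (A \<inter> C) + f (A - C) + (\<Sum>k<m. ?g k) \<le> f A + suminf ?g" for m
    proof -
      have "f (A - C) \<le> f (D (Suc m)) + f (\<Union>k. R (Suc (k + m)))"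
        using mono[OF exhaust] sub2 order_trans by blast
      also have "f (\<Union>k. R (Suc (k + m))) \<le> (\<Sum>k. ?g (k + m))"
        using sub dis[of m] by (auto simp: countably_subadditive_def)
      finally have "f (A \<inter> C) + f (A - C)
          \<le> f (A \<inter> C) + f (D (Suc m)) + (\<Sum>k. ?g (k + m))"
        by (simp add: add_left_mono add.assoc)
      also have "f (A \<inter> C) + f (D (Suc m)) \<le> f (A \<inter> C \<union> D (Suc m))"
      proof (rule sep[of "1 / real (Suc (Suc m))"])
        fix a b assume "a \<in> A \<inter> C" "b \<in> D (Suc m)"
        then show "1 / real (Suc (Suc m)) \<le> dist a b"
          using infdist_le[of a C b] by (auto simp: D_def dist_commute)
      qed simp
      also have "\<dots> \<le> f A" by (rule mono) (auto simp: D_def)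
      finally have "f (A \<inter> C) + f (A - C) + (\<Sum>k<m. ?g k)
          \<le> f A + (\<Sum>k. ?g (k + m)) + (\<Sum>k<m. ?g k)"
        by (simp add: add_right_mono)
      also have "\<dots> = f A + suminf ?g"
        using suminf_offset[of ?g m] by (simp add: ac_simps)
      finally show ?thesis .
    qed
    have "f (A \<inter> C) + f (A - C) + suminf ?g \<le> f A + suminf ?g"
      unfolding S
      by (subst ennreal_SUP_add_right) (use bound S in \<open>auto intro!: SUP_least\<close>)
    then show ?thesis
      using Sfin by (simp add: ennreal_add_left_cancel_le add.commute[of _ "suminf ?g"])
  qed
  show ?thesis
    unfolding lambda_system_eq
  proof (safe intro!: antisym)
    fix A :: "'a set"
    show "f (A \<inter> C) + f (A - C) \<le> f A" by (rule key)
    show "f A \<le> f (A \<inter> C) + f (A - C)"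
      using sub2[of "A \<inter> C" "A - C"] by (simp add: Int_Diff_Un)
  qed auto
qed

lemma space_hausdorff_measure [simp]: "space (hausdorff_measure s) = UNIV"
  by (simp add: hausdorff_measure_def space_measure_of_conv)

lemma sets_hausdorff_measure [simp, measurable_cong]:
  "sets (hausdorff_measure s) = sets (borel :: 'a::metric_space measure)"
  by (simp add: hausdorff_measure_def sets.sigma_sets_eq[of borel, simplified])

lemma emeasure_hausdorff_measure:
  fixes A :: "'a::metric_space set"
  assumes s: "0 \<le> s" and A: "A \<in> sets borel"
  shows "emeasure (hausdorff_measure s) A = hausdorff_outer s A"
proof -
  interpret P: sigma_algebra UNIV "Pow (UNIV :: 'a set)" by (rule sigma_algebra_Pow)
  let ?L = "lambda_system UNIV (Pow UNIV) (hausdorff_outer s :: 'a set \<Rightarrow> _)"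
  note oms = outer_measure_space_hausdorff[OF s, where ?'a = 'a]
  have ms: "measure_space UNIV ?L (hausdorff_outer s)"
    using P.caratheodory_lemma[OF oms] .
  then have sa: "sigma_algebra UNIV ?L"
    and ca: "countably_additive ?L (hausdorff_outer s)"
    by (auto simp: measure_space_def)
  have "Collect closed \<subseteq> ?L"
  proof
    fix C :: "'a set" assume "C \<in> Collect closed"
    then show "C \<in> ?L"
      by (intro closed_lambda_system_metric_outer[OF oms]) (auto intro: hausdorff_outer_separated)
  qed
  then have "sigma_sets UNIV (Collect closed) \<subseteq> ?L"
    by (rule sigma_algebra.sigma_sets_subset[OF sa])
  then have sub: "sets borel \<subseteq> ?L"
    by (simp add: borel_eq_closed)
  show ?thesis
  proof (rule emeasure_measure_of[OF hausdorff_measure_def])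
    show "positive (sets (hausdorff_measure s)) (hausdorff_outer s :: 'a set \<Rightarrow> _)"
      using oms by (auto simp: outer_measure_space_def positive_def)
    show "countably_additive (sets (hausdorff_measure s)) (hausdorff_outer s :: 'a set \<Rightarrow> _)"
      unfolding countably_additive_def
    proof safe
      fix B :: "nat \<Rightarrow> 'a set"
      assume B: "range B \<subseteq> sets (hausdorff_measure s)" "disjoint_family B"
        and U: "\<Union>(range B) \<in> sets (hausdorff_measure s)"
      have "range B \<subseteq> ?L" "\<Union>(range B) \<in> ?L"
        using B(1) U sub by (simp_all only: sets_hausdorff_measure) blast+
      then show "(\<Sum>i. hausdorff_outer s (B i)) = hausdorff_outer s (\<Union>(range B))"
        using ca B(2) unfolding countably_additive_def by blast
    qed
  qed (use A in auto)
qed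

text \<open>
  Near each boundary point, \<open>\<Omega>\<close> is the part of a ball lying above the graph of a \<open>C\<^sup>1\<close>
  function \<open>g\<close> over the hyperplane orthogonal to a unit vector \<open>\<nu>\<close>. Only the values of \<open>g\<close> on
  that hyperplane matter; \<open>g\<close> is taken as a function on the whole space to avoid a separate
  type for the hyperplane, which is no restriction since a \<open>C\<^sup>1\<close> function on the hyperplane
  extends constantly in the direction \<open>\<nu>\<close>.
\<close>

definition C1_boundary :: "'a::euclidean_space set \<Rightarrow> bool" where
  "C1_boundary \<Omega> \<longleftrightarrow>
     (\<forall>z\<in>frontier \<Omega>. \<exists>r>0. \<exists>\<nu> g G. norm \<nu> = 1 \<and>
        continuous_on UNIV G \<and> (\<forall>y. (g has_derivative (\<lambda>v. G y \<bullet> v)) (at y)) \<and>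
        \<Omega> \<inter> ball z r = {x \<in> ball z r. g (x - (x \<bullet> \<nu>) *\<^sub>R \<nu>) < x \<bullet> \<nu>})"

definition Sigma1 :: "(real^'n) set \<Rightarrow> real \<Rightarrow> ((real^'n) \<times> real) set" where
  "Sigma1 \<Omega> T = \<Omega> \<times> {T}"

definition Sigma3 :: "(real^'n) set \<Rightarrow> real \<Rightarrow> ((real^'n) \<times> real) set" where
  "Sigma3 \<Omega> T = frontier \<Omega> \<times> {0<..<T}"

definition sigma1_measure :: "(real^'n) set \<Rightarrow> real \<Rightarrow> ((real^'n) \<times> real) measure" where
  "sigma1_measure \<Omega> T = distr (restrict_space lborel \<Omega>) borel (\<lambda>x. (x, T))"

definition sigma3_measure :: "(real^'n) set \<Rightarrow> real \<Rightarrow> ((real^'n) \<times> real) measure" where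
  "sigma3_measure \<Omega> T =
     distr (restrict_space (hausdorff_measure (real CARD('n) - 1)) (frontier \<Omega>)
              \<Otimes>\<^sub>M restrict_space lborel {0<..<T})
       borel (\<lambda>z. z)"

definition boundary_measure :: "(real^'n) set \<Rightarrow> real \<Rightarrow> ((real^'n) \<times> real) measure" where
  "boundary_measure \<Omega> T =
     measure_of (Sigma1 \<Omega> T \<union> Sigma3 \<Omega> T)
       (sets (restrict_space borel (Sigma1 \<Omega> T \<union> Sigma3 \<Omega> T)))
       (\<lambda>A. emeasure (sigma1_measure \<Omega> T) A + emeasure (sigma3_measure \<Omega> T) A)"

lemma borel_Sigma13: "open \<Omega> \<Longrightarrow> Sigma1 \<Omega> T \<union> Sigma3 \<Omega> T \<in> sets borel"
  unfolding Sigma1_def Sigma3_def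
  by (intro sets.Un borel_Times) auto

lemma space_boundary_measure [simp]:
  "space (boundary_measure \<Omega> T) = Sigma1 \<Omega> T \<union> Sigma3 \<Omega> T"
  by (simp add: boundary_measure_def space_measure_of_conv)

lemma sets_boundary_measure:
  "sets (boundary_measure \<Omega> T) = sets (restrict_space borel (Sigma1 \<Omega> T \<union> Sigma3 \<Omega> T))"
  unfolding boundary_measure_def
  using sets.sigma_sets_eq[of "restrict_space borel (Sigma1 \<Omega> T \<union> Sigma3 \<Omega> T)"]
    sets.space_closed[of "restrict_space borel (Sigma1 \<Omega> T \<union> Sigma3 \<Omega> T)"]
  by (simp add: space_restrict_space)

lemma emeasure_boundary_measure:
  assumes "open \<Omega>" and A: "A \<in> sets (boundary_measure \<Omega> T)"
  shows "emeasure (boundary_measure \<Omega> T) A =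
           emeasure (sigma1_measure \<Omega> T) A + emeasure (sigma3_measure \<Omega> T) A"
proof (rule emeasure_measure_of[OF boundary_measure_def])
  let ?S = "Sigma1 \<Omega> T \<union> Sigma3 \<Omega> T"
  have b: "B \<in> sets borel" if "B \<in> sets (boundary_measure \<Omega> T)" for B
    using that borel_Sigma13[OF assms(1), of T]
    by (auto simp: sets_boundary_measure sets_restrict_space)
  show "sets (restrict_space borel ?S) \<subseteq> Pow ?S"
    by (auto simp: sets_restrict_space)
  show "positive (sets (boundary_measure \<Omega> T))
          (\<lambda>A. emeasure (sigma1_measure \<Omega> T) A + emeasure (sigma3_measure \<Omega> T) A)"
    by (simp add: positive_def)
  show "countably_additive (sets (boundary_measure \<Omega> T))
          (\<lambda>A. emeasure (sigma1_measure \<Omega> T) A + emeasure (sigma3_measure \<Omega> T) A)"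
    unfolding countably_additive_def
  proof safe
    fix B :: "nat \<Rightarrow> _" assume B: "range B \<subseteq> sets (boundary_measure \<Omega> T)" "disjoint_family B"
    have 1: "range B \<subseteq> sets (sigma1_measure \<Omega> T)" "range B \<subseteq> sets (sigma3_measure \<Omega> T)"
      using B(1) b by (auto simp: sigma1_measure_def sigma3_measure_def)
    show "(\<Sum>i. emeasure (sigma1_measure \<Omega> T) (B i) + emeasure (sigma3_measure \<Omega> T) (B i)) =
        emeasure (sigma1_measure \<Omega> T) (\<Union>(range B)) + emeasure (sigma3_measure \<Omega> T) (\<Union>(range B))"
      using suminf_emeasure[OF 1(1) B(2)] suminf_emeasure[OF 1(2) B(2)]
      by (subst suminf_add[symmetric]) auto
  qed
qed (use A in auto)

lemma emeasure_sigma1_measure: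
  assumes "open \<Omega>" "A \<in> sets borel"
  shows "emeasure (sigma1_measure \<Omega> T) A = emeasure lborel {x \<in> \<Omega>. (x, T) \<in> A}"
proof -
  have m: "(\<lambda>x. (x, T)) \<in> measurable (restrict_space lborel \<Omega>) borel"
    by (intro measurable_restrict_space1) (simp add: borel_measurable_continuous_onI continuous_intros)
  show ?thesis
    unfolding sigma1_measure_def using assms
    by (subst emeasure_distr[OF m])
       (auto simp: emeasure_restrict_space space_restrict_space intro!: arg_cong[of _ _ "emeasure lborel"])
qed

lemma emeasure_sigma3_measure:
  fixes \<Omega> :: "(real^'n) set"
  assumes "B \<in> sets borel" "J \<in> sets borel" "B \<subseteq> frontier \<Omega>" "J \<subseteq> {0<..<T}"
  shows "emeasure (sigma3_measure \<Omega> T) (B \<times> J) =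
           hausdorff_outer (real CARD('n) - 1) B * emeasure lborel J"
proof -
  let ?M = "restrict_space (hausdorff_measure (real CARD('n) - 1)) (frontier \<Omega>)"
  let ?N = "restrict_space lborel {0<..<T}"
  interpret N: sigma_finite_measure ?N
    by (rule sigma_finite_measure_restrict_space) (auto intro: sigma_finite_lborel)
  have "(\<lambda>z. (fst z, snd z)) \<in> measurable (?M \<Otimes>\<^sub>M ?N) (borel \<Otimes>\<^sub>M borel)"
    by (intro measurable_Pair measurable_compose[OF measurable_fst] measurable_compose[OF measurable_snd]
          measurable_restrict_space1) auto
  then have m: "(\<lambda>z. z) \<in> measurable (?M \<Otimes>\<^sub>M ?N) borel"
    by (simp add: borel_prod)
  have c: "0 \<le> real CARD('n) - 1" by (simp add: Suc_leI)
  have B: "B \<in> sets ?M" "J \<in> sets ?N"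
    using assms by (auto simp: sets_restrict_space_iff)
  have eq: "(\<lambda>z. z) -` (B \<times> J) \<inter> space (?M \<Otimes>\<^sub>M ?N) = B \<times> J"
    using assms by (auto simp: space_pair_measure space_restrict_space)
  show ?thesis
    unfolding sigma3_measure_def
    using assms B
    by (subst emeasure_distr[OF m])
       (auto simp: eq N.emeasure_pair_measure_Times emeasure_restrict_space
          emeasure_hausdorff_measure[OF c] borel_Times)
qed

definition Lp :: "real \<Rightarrow> 'a measure \<Rightarrow> ('a \<Rightarrow> real) set" where
  "Lp p M = {f \<in> borel_measurable M. integrable M (\<lambda>z. \<bar>f z\<bar> powr p)}"

definition Lp_norm :: "real \<Rightarrow> 'a measure \<Rightarrow> ('a \<Rightarrow> real) \<Rightarrow> real" where
  "Lp_norm p M f = (\<integral>z. \<bar>f z\<bar> powr p \<partial>M) powr (1 / p)"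

text \<open>
  A system of functions is complete in \<open>L\<^sup>p\<close> if its members belong to \<open>L\<^sup>p\<close> and its linear span
  is dense. Membership also ensures that \<open>Lp_norm\<close> is only applied to functions in \<open>L\<^sup>p\<close>.
\<close>

definition complete_in_Lp :: "real \<Rightarrow> 'a measure \<Rightarrow> ('i \<Rightarrow> 'a \<Rightarrow> real) \<Rightarrow> bool" where
  "complete_in_Lp p M w \<longleftrightarrow>
     (\<forall>\<alpha>. w \<alpha> \<in> Lp p M) \<and>
     (\<forall>f\<in>Lp p M. \<forall>\<epsilon>>0. \<exists>F c. finite F \<and>
        Lp_norm p M (\<lambda>z. f z - (\<Sum>\<alpha>\<in>F. c \<alpha> * w \<alpha> z)) < \<epsilon>)"

definition partial_deriv :: "'n \<Rightarrow> (real^'n \<Rightarrow> real) \<Rightarrow> real^'n \<Rightarrow> real" where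
  "partial_deriv i f \<xi> = deriv (\<lambda>s. f (\<xi> + s *\<^sub>R axis i 1)) 0"

text \<open>
  The index type carries no order, so the partial derivatives in \<open>D\<^sup>\<alpha>\<close> are taken along an
  arbitrary enumeration of it. For smooth functions the choice is immaterial.
\<close>

definition index_enum :: "'n::finite list" where
  "index_enum = (SOME xs. set xs = UNIV \<and> distinct xs)"

lemma index_enum: "set (index_enum :: 'n::finite list) = UNIV" "distinct (index_enum :: 'n list)"
proof -
  obtain xs :: "'n list" where "set xs = UNIV \<and> distinct xs"
    using finite_distinct_list[OF finite] by blast
  then have "set (index_enum :: 'n list) = UNIV \<and> distinct (index_enum :: 'n list)"
    unfolding index_enum_def by (rule someI)
  then show "set (index_enum :: 'n list) = UNIV" "distinct (index_enum :: 'n list)" by auto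
qed

definition multi_deriv :: "nat^'n \<Rightarrow> (real^'n \<Rightarrow> real) \<Rightarrow> real^'n \<Rightarrow> real" where
  "multi_deriv \<alpha> f = foldr (\<lambda>i h. (partial_deriv i ^^ (\<alpha> $ i)) h) index_enum f"

definition parabolic_poly :: "real^'n^'n \<Rightarrow> nat^'n \<Rightarrow> (real^'n) \<times> real \<Rightarrow> real" where
  "parabolic_poly a \<alpha> = (\<lambda>(x, t).
     multi_deriv \<alpha> (\<lambda>\<xi>. exp (x \<bullet> \<xi> - t * (\<Sum>h\<in>UNIV. \<Sum>k\<in>UNIV. a $ h $ k * \<xi> $ h * \<xi> $ k))) 0)"

end

theory Submission
  imports Defs "HOL-Complex_Analysis.Complex_Analysis" "HOL-Probability.Probability" "HOL-Real_Asymp.Real_Asymp"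
begin

text \<open>
  Let \<open>V\<close> be the set of uniform limits, on the compact parabolic boundary, of complex linear
  combinations of the polynomials \<open>w\<^sub>\<alpha>\<close>. Taylor expansion of the generating function puts every
  exponential solution of \<open>H\<^sup>* u = 0\<close> into \<open>V\<close>. Integrating these along rays in the complex frequency
  space gives the heat kernels whose poles are far away from the boundary. A heat kernel depends
  analytically on the space coordinates of its pole, and the complement of the closure of \<open>\<Omega>\<close> is
  connected, so \<open>V\<close> contains every heat kernel with pole outside the half-infinite cylinder
  \<open>closure \<Omega> \<times> {..T}\<close>.

  Every bounded uniformly continuous function is a uniform limit of resolvents of bounded sources.
  Killing a source inside the cylinder at a large rate sweeps it out to the exterior, and this
  changes the potential on the parabolic boundary by little, because a \<open>C\<^sup>1\<close> domain leaves a fixed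
  proportion of exterior near each boundary point at all small parabolic scales. Potentials of
  exterior sources are averages of exterior poles, so \<open>V\<close> contains all these functions. They are
  dense in \<open>L\<^sup>p\<close> because a \<open>C\<^sup>1\<close> boundary has finite surface measure.
\<close>

section \<open>Orthonormal frames of a quadratic form\<close>

text \<open>\<open>H^*\<close> is a backward heat operator: \<open>kern\<close> looks only forward
  in time, data sit on the top and the lateral side, and a kernel with pole at time \<open>t\<close>
  vanishes at all times from \<open>t\<close> on. The first obstacle is that the time difference to
  a pole changes sign on the boundary, while an integral over imaginary frequencies converges for
  one sign only. On the rays through \<open>1 + \<i>\<close> and \<open>1 - \<i>\<close> the squared
  frequency is imaginary, so the modulus of the exponentials does not depend on time at all. The
  second obstacle is to reach boundary values without solving a boundary value problem. If
  \<open>v\<close> is the potential of \<open>g\<close> killed in an exterior set \<open>E\<close>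
  at rate \<open>M\<close>, then \<open>R 1 g = v + R 1 (M * indicator E * v)\<close>: the killed
  mass is an exterior source with the same potential up to \<open>v\<close>. Only the smallness of
  \<open>v\<close> on the boundary is needed, and an averaging inequality gives it without barriers.
  A potential at rate 1 solves \<open>H^* u = u\<close> off its source, and the factor
  \<open>exp (- t)\<close> turns it into a solution of \<open>H^* u = 0\<close>. Hence the target is
  first multiplied by \<open>exp t\<close>.\<close>

lemma gram_schmidt_bilinear:
  fixes b :: "'a::real_vector \<Rightarrow> 'a \<Rightarrow> real"
  assumes lin: "\<And>x. linear (b x)" and sym: "\<And>x y. b x y = b y x" and pos: "\<And>x. x \<noteq> 0 \<Longrightarrow> b x x > 0"
    and S: "finite S"
  shows "\<exists>B. finite B \<and> span B = span S \<and> (\<forall>x\<in>B. \<forall>y\<in>B. b x y = (if x = y then 1 else 0))"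
  using S
proof (induction S rule: finite_induct)
  case empty
  show ?case by (rule exI[of _ "{}"]) auto
next
  case (insert z S)
  then obtain B where B: "finite B" "span B = span S"
    "\<And>x y. x \<in> B \<Longrightarrow> y \<in> B \<Longrightarrow> b x y = (if x = y then 1 else 0)" by blast
  note bs = linear_add[OF lin] linear_scale[OF lin] linear_diff[OF lin] linear_sum[OF lin] linear_0[OF lin]
  \<comment> \<open>\<open>p\<close> is the \<open>b\<close>-orthogonal projection of
    \<open>z\<close> onto the frame built so far, and \<open>u\<close> is the remainder. If
    \<open>u = 0\<close>, the span does not grow and the frame is kept.\<close>
  define p where "p = (\<Sum>y\<in>B. b z y *\<^sub>R y)"
  define u where "u = z - p"
  have p: "p \<in> span B" unfolding p_def by (intro span_sum span_scale span_base)
  have bp: "b x p = b z x" if "x \<in> B" for x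
  proof -
    have "b x p = (\<Sum>y\<in>B. b z y * b x y)" by (simp add: p_def bs)
    also have "\<dots> = (\<Sum>y\<in>B. if y = x then b z y else 0)"
      using B(3)[OF that] by (intro sum.cong) auto
    finally show ?thesis using that B(1) by simp
  qed
  have bu: "b x u = 0" if "x \<in> B" for x
    using bp[OF that] sym[of x z] by (simp add: u_def bs)
  have span: "span (insert z S) = span (insert u B)"
  proof -
    have "span (insert z S) = span (insert z B)"
      using B(2) by (simp add: span_insert)
    also have "\<dots> = span (insert u B)"
    proof (rule span_eq[THEN iffD2, OF conjI])
      have "z = u + p" by (simp add: u_def)
      moreover have "u + p \<in> span (insert u B)"
        using p span_mono[of B "insert u B"] by (intro span_add) (auto intro: span_base)
      ultimately show "insert z B \<subseteq> span (insert u B)" by (auto intro: span_base)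
      have "z - p \<in> span (insert z B)"
        using p span_mono[of B "insert z B"] by (intro span_diff) (auto intro: span_base)
      then show "insert u B \<subseteq> span (insert z B)" by (auto simp: u_def intro: span_base)
    qed
    finally show ?thesis .
  qed
  show ?case
  proof (cases "u = 0")
    case True
    then show ?thesis using B span by (intro exI[of _ B]) auto
  next
    case False
    define c where "c = 1 / sqrt (b u u)"
    have c: "c \<noteq> 0" "c * c * b u u = 1" using pos[OF False] by (auto simp: c_def)
    have bcu: "b (c *\<^sub>R u) x = 0" "b x (c *\<^sub>R u) = 0" if "x \<in> B" for x
      using bu[OF that] sym[of "c *\<^sub>R u" x] by (simp_all add: bs)
    have bcc: "b (c *\<^sub>R u) (c *\<^sub>R u) = 1"
      using c(2) sym[of "c *\<^sub>R u" u] by (simp add: bs mult.assoc)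
    have "c *\<^sub>R u \<notin> B" using bcu bcc by force
    moreover have "span (insert (c *\<^sub>R u) B) = span (insert u B)"
    proof (rule span_eq[THEN iffD2, OF conjI])
      show "insert (c *\<^sub>R u) B \<subseteq> span (insert u B)" by (auto intro: span_base span_scale)
      have "(1 / c) *\<^sub>R (c *\<^sub>R u) \<in> span (insert (c *\<^sub>R u) B)" by (intro span_scale span_base) simp
      then show "insert u B \<subseteq> span (insert (c *\<^sub>R u) B)" using c(1) by (auto intro: span_base)
    qed
    ultimately show ?thesis
      using B bcu bcc span by (intro exI[of _ "insert (c *\<^sub>R u) B"]) auto
  qed
qed

text \<open>In the coordinates \<open>v i \<bullet> y\<close> the second-order part of
  \<open>H^*\<close> becomes the Laplacian. The second clause says that these coordinates determine
  \<open>y\<close>.\<close>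

lemma orthonormal_frame:
  fixes a :: "real^'n^'n"
  assumes sym: "\<And>h k. a $ h $ k = a $ k $ h"
    and pos: "\<And>\<xi> :: real^'n. \<xi> \<noteq> 0 \<Longrightarrow> (\<Sum>h\<in>UNIV. \<Sum>k\<in>UNIV. a $ h $ k * \<xi> $ h * \<xi> $ k) > 0"
  shows "\<exists>v :: 'n \<Rightarrow> real^'n.
    (\<forall>i j. (\<Sum>h\<in>UNIV. \<Sum>k\<in>UNIV. a $ h $ k * v i $ h * v j $ k) = (if i = j then 1 else 0)) \<and>
    (\<forall>y. (\<forall>i. v i \<bullet> y = 0) \<longrightarrow> y = 0)"
proof -
  define b where "b x y = (\<Sum>h\<in>UNIV. \<Sum>k\<in>UNIV. a $ h $ k * x $ h * y $ k)" for x y :: "real^'n"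
  have lin: "linear (b x)" for x
    unfolding b_def by (intro linearI) (simp_all add: algebra_simps sum.distrib sum_distrib_left)
  have symb: "b x y = b y x" for x y
    unfolding b_def by (subst sum.swap) (use sym in \<open>simp add: mult_ac\<close>)
  obtain B where B: "finite B" "span B = span (Basis :: (real^'n) set)"
    "\<And>x y. x \<in> B \<Longrightarrow> y \<in> B \<Longrightarrow> b x y = (if x = y then 1 else 0)"
    using gram_schmidt_bilinear[of b "Basis :: (real^'n) set", OF lin symb] pos unfolding b_def by auto
  have ind: "independent B"
  proof (rule independent_if_scalars_zero[OF B(1)])
    fix f x assume f: "(\<Sum>x\<in>B. f x *\<^sub>R x) = 0" and x: "x \<in> B"
    have "0 = b x (\<Sum>y\<in>B. f y *\<^sub>R y)" using f linear_0[OF lin] by simp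
    also have "\<dots> = (\<Sum>y\<in>B. f y * b x y)"
      by (simp add: linear_sum[OF lin] linear_scale[OF lin])
    also have "\<dots> = (\<Sum>y\<in>B. if y = x then f y else 0)"
      using B(3)[OF x] by (intro sum.cong) auto
    finally show "f x = 0" using x B(1) by simp
  qed
  have spanB: "span B = UNIV" using B(2) by simp
  have "card B = dim (span B)" using ind by (simp add: dim_eq_card_independent)
  then have "card B = CARD('n)" using spanB by (simp add: dim_UNIV)
  then obtain v :: "'n \<Rightarrow> real^'n" where v: "bij_betw v UNIV B"
    using finite_same_card_bij[of "UNIV :: 'n set" B] B(1) by auto
  show ?thesis
  proof (intro exI[of _ v] conjI allI impI)
    fix i j
    have "v i \<in> B" "v j \<in> B" "v i = v j \<longleftrightarrow> i = j"
      using v by (auto simp: bij_betw_def inj_on_def)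
    then show "(\<Sum>h\<in>UNIV. \<Sum>k\<in>UNIV. a $ h $ k * v i $ h * v j $ k) = (if i = j then 1 else 0)"
      using B(3)[of "v i" "v j"] unfolding b_def by auto
  next
    fix y assume y: "\<forall>i. v i \<bullet> y = 0"
    have "y \<bullet> x = 0" if "x \<in> B" for x
      using y v that by (force simp: bij_betw_def inner_commute)
    then have "orthogonal y x" if "x \<in> span B" for x
      by (intro orthogonal_to_span[OF that]) (auto simp: orthogonal_def)
    then show "y = 0" using spanB by (metis UNIV_I orthogonal_self)
  qed
qed

section \<open>Uniformly closed function spaces\<close>

text \<open>Cauchy's estimates on the disc of radius \<open>\<rho>\<close> dominate the tail by a
  geometric series. The bound depends on \<open>f\<close> only through \<open>B\<close>, hence is
  uniform over a family. \<open>B + 1\<close> replaces \<open>B\<close> because the Cauchy bound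
  wants values in an open ball.\<close>

lemma holomorphic_taylor_remainder:
  fixes f :: "complex \<Rightarrow> complex"
  assumes hol: "f holomorphic_on ball 0 r" and B: "\<And>c. cmod c < r \<Longrightarrow> cmod (f c) \<le> B"
    and \<rho>: "0 < \<rho>" "\<rho> < r" and c: "cmod c < \<rho>"
  shows "cmod (f c - (\<Sum>j<n. (deriv ^^ j) f 0 / fact j * c ^ j))
    \<le> (B + 1) * (cmod c / \<rho>) ^ n / (1 - cmod c / \<rho>)"
proof -
  define a where "a j = (deriv ^^ j) f 0 / fact j" for j
  define q where "q = cmod c / \<rho>"
  have q: "0 \<le> q" "q < 1" using c \<rho> by (auto simp: q_def)
  have B0: "0 \<le> B" using B[of 0] \<rho> by (auto intro: order_trans[OF norm_ge_zero])
  have sub: "cball 0 \<rho> \<subseteq> ball (0::complex) r" using \<rho> by auto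
  have a: "cmod (a j) \<le> (B + 1) / \<rho> ^ j" for j
  proof (cases "j = 0")
    case True
    then show ?thesis using B[of 0] \<rho> by (simp add: a_def)
  next
    case False
    have "cmod ((deriv ^^ j) f 0) \<le> fact j * (B + 1) / \<rho> ^ j"
    proof (rule Cauchy_higher_deriv_bound[where y = 0])
      show "f holomorphic_on ball 0 \<rho>" using hol by (rule holomorphic_on_subset) (use \<rho> in auto)
      show "continuous_on (cball 0 \<rho>) f"
        using holomorphic_on_imp_continuous_on[OF hol] sub continuous_on_subset by blast
      show "f w \<in> ball 0 (B + 1)" if "w \<in> ball 0 \<rho>" for w
        using B[of w] that \<rho> by auto
    qed (use \<rho> False in auto)
    then show ?thesis by (simp add: a_def norm_divide field_simps)
  qed
  have S: "(\<lambda>j. a j * c ^ j) sums f c"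
    using holomorphic_power_series[OF hol, of c] c \<rho> by (simp add: a_def)
  then have S': "(\<lambda>i. a (i + n) * c ^ (i + n)) sums (f c - (\<Sum>j<n. a j * c ^ j))"
    by (rule sums_split_initial_segment)
  have g: "(\<lambda>i. (B + 1) * q ^ n * q ^ i) sums ((B + 1) * q ^ n * (1 / (1 - q)))"
    using q by (intro sums_mult geometric_sums) auto
  have "cmod (a (i + n) * c ^ (i + n)) \<le> (B + 1) * q ^ n * q ^ i" for i
  proof -
    have "cmod (a (i + n) * c ^ (i + n)) \<le> (B + 1) / \<rho> ^ (i + n) * cmod c ^ (i + n)"
      unfolding norm_mult norm_power by (intro mult_right_mono a) auto
    also have "\<dots> = (B + 1) * q ^ n * q ^ i"
      by (simp add: q_def power_divide power_add mult_ac)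
    finally show ?thesis .
  qed
  then have "cmod (\<Sum>i. a (i + n) * c ^ (i + n)) \<le> (\<Sum>i. (B + 1) * q ^ n * q ^ i)"
    by (rule norm_suminf_le) (rule sums_summable[OF g])
  then show ?thesis
    using sums_unique[OF S'] sums_unique[OF g] by (simp add: a_def q_def)
qed

text \<open>Members are functions on the whole type, but \<open>closed\<close> tests only on
  \<open>K\<close>, so membership depends on the values on \<open>K\<close> alone. Continuity of the
  members is not part of the notion.\<close>

locale closed_function_space =
  fixes K :: "'k::metric_space set" and V :: "('k \<Rightarrow> complex) set"
  assumes K: "compact K"
    and zero: "(\<lambda>k. 0) \<in> V"
    and add: "f \<in> V \<Longrightarrow> g \<in> V \<Longrightarrow> (\<lambda>k. f k + g k) \<in> V"
    and cmult: "f \<in> V \<Longrightarrow> (\<lambda>k. c * f k) \<in> V"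
    and closed: "(\<And>e. 0 < e \<Longrightarrow> \<exists>g\<in>V. \<forall>k\<in>K. cmod (f k - g k) \<le> e) \<Longrightarrow> f \<in> V"
begin

lemma cong: "g \<in> V \<Longrightarrow> (\<And>k. k \<in> K \<Longrightarrow> f k = g k) \<Longrightarrow> f \<in> V"
  by (rule closed) (auto intro!: bexI[of _ g])

lemma diff: "f \<in> V \<Longrightarrow> g \<in> V \<Longrightarrow> (\<lambda>k. f k - g k) \<in> V"
  using add[of f "\<lambda>k. - 1 * g k"] cmult[of g "-1"] by simp

lemma sum: "(\<And>i. i \<in> I \<Longrightarrow> f i \<in> V) \<Longrightarrow> (\<lambda>k. \<Sum>i\<in>I. f i k) \<in> V"
  by (induction I rule: infinite_finite_induct) (auto intro: zero add)

lemma taylor_mem: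
  assumes hol: "\<And>k. k \<in> K \<Longrightarrow> (\<lambda>c. f c k) holomorphic_on ball 0 r"
    and B: "\<And>c k. cmod c < r \<Longrightarrow> k \<in> K \<Longrightarrow> cmod (f c k) \<le> B"
    and coeff: "\<And>m. (\<lambda>k. (deriv ^^ m) (\<lambda>c. f c k) 0) \<in> V"
    and c: "cmod c < r"
  shows "f c \<in> V"
proof (rule closed)
  fix e :: real assume e: "0 < e"
  define \<rho> where "\<rho> = (cmod c + r) / 2"
  have \<rho>: "0 < \<rho>" "\<rho> < r" "cmod c < \<rho>"
    using c norm_ge_zero[of c] by (auto simp: \<rho>_def simp del: norm_ge_zero)
  define q where "q = cmod c / \<rho>"
  have q: "0 \<le> q" "q < 1" using \<rho> by (auto simp: q_def)
  have "(\<lambda>n. (B + 1) * q ^ n / (1 - q)) \<longlonglongrightarrow> (B + 1) * 0 / (1 - q)"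
    using q by (intro tendsto_intros LIMSEQ_realpow_zero) auto
  then have "\<forall>\<^sub>F n in sequentially. (B + 1) * q ^ n / (1 - q) < e"
    by (rule order_tendstoD(2)) (use e in simp)
  then obtain n where n: "(B + 1) * q ^ n / (1 - q) < e"
    using eventually_happens[of _ sequentially] by auto
  have "(\<lambda>k. \<Sum>j<n. c ^ j / fact j * (deriv ^^ j) (\<lambda>c. f c k) 0) \<in> V"
    by (intro sum cmult coeff)
  moreover have "cmod (f c k - (\<Sum>j<n. c ^ j / fact j * (deriv ^^ j) (\<lambda>c. f c k) 0)) \<le> e"
    if k: "k \<in> K" for k
  proof -
    have "cmod (f z k) \<le> B" if "cmod z < r" for z
      using B[OF that k] .
    from holomorphic_taylor_remainder[OF hol[OF k] this \<rho>]
    have "cmod (f c k - (\<Sum>j<n. (deriv ^^ j) (\<lambda>c. f c k) 0 / fact j * c ^ j)) \<le> (B + 1) * q ^ n / (1 - q)"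
      unfolding q_def .
    also have "\<dots> \<le> e" using n by simp
    finally show ?thesis by (simp add: mult.commute)
  qed
  ultimately show "\<exists>g\<in>V. \<forall>k\<in>K. cmod (f c k - g k) \<le> e"
    by (intro bexI[of _ "\<lambda>k. \<Sum>j<n. c ^ j / fact j * (deriv ^^ j) (\<lambda>c. f c k) 0"]) auto
qed

text \<open>The \<open>m\<close>-th coefficient is the limit of (\<open>f x\<close> minus the Taylor
  polynomial of lower order) divided by \<open>x ^ m\<close> as \<open>x\<close> decreases to 0. The
  lower coefficients are in \<open>V\<close> by induction, and the remainder bound makes the limit
  uniform on \<open>K\<close>.\<close>

lemma taylor_coeff_mem:
  assumes hol: "\<And>k. k \<in> K \<Longrightarrow> (\<lambda>c. f c k) holomorphic_on ball 0 r"
    and B: "\<And>c k. cmod c < r \<Longrightarrow> k \<in> K \<Longrightarrow> cmod (f c k) \<le> B"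
    and real: "\<And>x::real. 0 < x \<Longrightarrow> x < d \<Longrightarrow> f (of_real x) \<in> V"
    and r: "0 < r" and d: "0 < d"
  shows "(\<lambda>k. (deriv ^^ m) (\<lambda>c. f c k) 0) \<in> V"
proof (induction m rule: less_induct)
  case (less m)
  define a where "a j k = (deriv ^^ j) (\<lambda>c. f c k) 0" for j k
  have "(\<lambda>k. a m k / fact m) \<in> V"
  proof (rule closed)
    fix e :: real assume e: "0 < e"
    define \<rho> where "\<rho> = r / 2"
    have \<rho>: "0 < \<rho>" "\<rho> < r" using r by (auto simp: \<rho>_def)
    define C where "C = 2 * (\<bar>B\<bar> + 1) / \<rho> ^ Suc m"
    have C: "0 < C" using \<rho> by (auto simp: C_def)
    \<comment> \<open>\<open>x \<le> \<rho> / 2\<close> keeps the geometric factor below the 2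
      contained in \<open>C\<close>, \<open>x < d\<close> puts \<open>f x\<close> into
      \<open>V\<close>, and \<open>x \<le> e / C\<close> makes the final error \<open>C * x\<close>
      at most \<open>e\<close>.\<close>
    define x where "x = min (min (\<rho> / 2) (d / 2)) (e / C)"
    have x: "0 < x" "x \<le> \<rho> / 2" "x < d" "x \<le> e / C"
    proof -
      show "0 < x" using \<rho> d e C by (simp add: x_def)
      have "x \<le> d / 2" unfolding x_def by (rule min.coboundedI1[OF min.cobounded2])
      then show "x < d" using d by linarith
      show "x \<le> \<rho> / 2" unfolding x_def by (rule min.coboundedI1[OF min.cobounded1])
      show "x \<le> e / C" unfolding x_def by (rule min.cobounded2)
    qed
    let ?c = "complex_of_real x"
    let ?h = "\<lambda>k. 1 / ?c ^ m * (f ?c k - (\<Sum>j<m. ?c ^ j / fact j * a j k))"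
    have "?h \<in> V" unfolding a_def
      using less x by (intro cmult diff sum real) auto
    moreover have "cmod (a m k / fact m - ?h k) \<le> e" if k: "k \<in> K" for k
    proof -
      have B0: "0 \<le> B" using B[of 0 k] r k by (auto intro: order_trans[OF norm_ge_zero])
      have s: "(\<Sum>j<Suc m. a j k / fact j * ?c ^ j) = (\<Sum>j<m. ?c ^ j / fact j * a j k) + a m k / fact m * ?c ^ m"
        by (simp add: mult_ac)
      have "cmod (f ?c k - (\<Sum>j<Suc m. a j k / fact j * ?c ^ j))
          \<le> (B + 1) * (x / \<rho>) ^ Suc m / (1 - x / \<rho>)"
        using holomorphic_taylor_remainder[OF hol[OF k] B \<rho>, of ?c "Suc m"] x k \<rho>
        unfolding a_def by simp
      also have "\<dots> \<le> (B + 1) * (x / \<rho>) ^ Suc m / (1 / 2)"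
        using x \<rho> B0 by (intro divide_left_mono mult_nonneg_nonneg) (auto simp: field_simps)
      also have "\<dots> = C * x * x ^ m"
        using B0 by (simp add: C_def power_divide field_simps)
      finally have 1: "cmod (f ?c k - (\<Sum>j<Suc m. a j k / fact j * ?c ^ j)) \<le> C * x * x ^ m" .
      have "a m k / fact m - ?h k
          = - (f ?c k - (\<Sum>j<Suc m. a j k / fact j * ?c ^ j)) / ?c ^ m"
        unfolding s using x(1) by (simp add: field_simps)
      then have "cmod (a m k / fact m - ?h k)
          = cmod (f ?c k - (\<Sum>j<Suc m. a j k / fact j * ?c ^ j)) / x ^ m"
        using x(1) by (simp only: norm_divide norm_minus_cancel norm_power norm_of_real abs_of_pos)
      also have "\<dots> \<le> C * x * x ^ m / x ^ m"
        using 1 x(1) by (intro divide_right_mono) auto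
      also have "\<dots> = C * x" using x(1) by simp
      also have "\<dots> \<le> e" using x(4) C by (simp add: field_simps)
      finally show ?thesis .
    qed
    ultimately show "\<exists>g\<in>V. \<forall>k\<in>K. cmod (a m k / fact m - g k) \<le> e"
      by (intro bexI[of _ ?h]) auto
  qed
  from cmult[OF this, of "fact m"] show ?case by (simp add: a_def)
qed

text \<open>A short real segment ending at 0 determines all derivatives at 0, and the Taylor series
  at 0 then reaches the whole disc. This is the identity theorem with values in a closed
  subspace.\<close>

lemma analytic_continuation_mem:
  assumes hol: "\<And>k. k \<in> K \<Longrightarrow> (\<lambda>c. f c k) holomorphic_on ball 0 r"
    and B: "\<And>c k. cmod c < r \<Longrightarrow> k \<in> K \<Longrightarrow> cmod (f c k) \<le> B"
    and real: "\<And>x::real. 0 < x \<Longrightarrow> x < d \<Longrightarrow> f (of_real x) \<in> V"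
    and d: "0 < d" and c: "cmod c < r"
  shows "f c \<in> V"
proof (rule taylor_mem[OF hol B _ c])
  have r: "0 < r" using c norm_ge_zero[of c] by linarith
  show "(\<lambda>k. (deriv ^^ m) (\<lambda>c. f c k) 0) \<in> V" for m
    using taylor_coeff_mem[OF hol B real r d] .
qed

text \<open>Approximation by Riemann sums over a partition of \<open>X\<close> into small pieces.\<close>

lemma integral_mem:
  fixes H :: "'a::euclidean_space \<Rightarrow> 'k \<Rightarrow> complex" and g :: "'a \<Rightarrow> real"
  assumes X: "compact X" and H: "continuous_on (X \<times> K) (\<lambda>(x, k). H x k)"
    and mem: "\<And>x. x \<in> X \<Longrightarrow> H x \<in> V"
    and g[measurable]: "g \<in> borel_measurable borel" and gB: "\<And>x. \<bar>g x\<bar> \<le> B"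
  shows "(\<lambda>k. LINT x:X|lborel. of_real (g x) * H x k) \<in> V"
proof (rule closed)
  fix e :: real assume e: "0 < e"
  have B0: "0 \<le> B" using gB[of 0] by linarith
  have Xb[measurable]: "X \<in> sets borel" using X by (simp add: borel_compact)
  have Xfin: "emeasure lborel X < \<infinity>"
    using X by (intro emeasure_bounded_finite) (simp add: compact_imp_bounded)
  \<comment> \<open>The total error will be \<open>B * measure lborel X * \<eta>\<close>; the added
    1 keeps the quotient defined when this product vanishes.\<close>
  define \<eta> where "\<eta> = e / (B * measure lborel X + 1)"
  have \<eta>: "0 < \<eta>" using e B0 by (auto simp: \<eta>_def add_nonneg_pos)
  have "uniformly_continuous_on (X \<times> K) (\<lambda>(x, k). H x k)"
    using H X K by (intro compact_uniformly_continuous compact_Times)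
  then obtain d where d: "0 < d"
    and du: "\<And>x k x' k'. (x, k) \<in> X \<times> K \<Longrightarrow> (x', k') \<in> X \<times> K \<Longrightarrow> dist (x', k') (x, k) < d \<Longrightarrow>
      dist (H x' k') (H x k) < \<eta>"
    unfolding uniformly_continuous_on_def using \<eta> by force
  have unif: "cmod (H x' k - H x k) \<le> \<eta>" if "x \<in> X" "x' \<in> X" "k \<in> K" "dist x' x < d" for x x' k
    using du[of x k x' k] that by (auto simp: dist_Pair_Pair dist_norm)
  obtain F where F: "finite F" "F \<subseteq> X" "X \<subseteq> (\<Union>x\<in>F. ball x d)"
    using compactE_image[OF X, of X "\<lambda>x. ball x d"] d by force
  obtain xs where xs: "set xs = F" "distinct xs" using F(1) finite_distinct_list by blast
  \<comment> \<open>Each point of \<open>X\<close> goes to the first ball of the list that contains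
    it, which makes the pieces disjoint and Borel.\<close>
  define P where "P i = (ball (xs ! i) d \<inter> X) - (\<Union>j<i. ball (xs ! j) d)" for i
  have P[measurable]: "P i \<in> sets borel" for i unfolding P_def by measurable
  have disj: "disjoint_family_on P {..<length xs}"
    unfolding disjoint_family_on_def
  proof (intro ballI impI)
    fix m n assume mn: "m \<in> {..<length xs}" "n \<in> {..<length xs}" "m \<noteq> n"
    then consider "m < n" | "n < m" by linarith
    then show "P m \<inter> P n = {}" by cases (auto simp: P_def)
  qed
  have UN: "(\<Union>i<length xs. P i) = X"
  proof
    show "X \<subseteq> (\<Union>i<length xs. P i)"
    proof
      fix x assume x: "x \<in> X"
      then obtain y where "y \<in> F" "x \<in> ball y d" using F(3) by blast
      then have ex: "\<exists>i. i < length xs \<and> x \<in> ball (xs ! i) d"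
        using xs(1) by (auto simp: in_set_conv_nth)
      define i where "i = (LEAST i. i < length xs \<and> x \<in> ball (xs ! i) d)"
      have i: "i < length xs \<and> x \<in> ball (xs ! i) d" unfolding i_def using ex by (rule LeastI_ex)
      have "x \<notin> ball (xs ! j) d" if "j < i" for j
        using not_less_Least[of j "\<lambda>i. i < length xs \<and> x \<in> ball (xs ! i) d"] that i
        unfolding i_def[symmetric] by auto
      then show "x \<in> (\<Union>i<length xs. P i)" using i x by (auto simp: P_def)
    qed
  qed (auto simp: P_def)
  have xsX: "xs ! i \<in> X" if "i < length xs" for i using that xs(1) F(2) nth_mem by blast
  \<comment> \<open>Only \<open>H\<close> is frozen at the centre of a piece. The weight
    \<open>g\<close> is merely measurable, so it is integrated exactly over each piece.\<close>
  define G where "G k = (\<Sum>i<length xs. of_real (LINT x:P i|lborel. g x) * H (xs ! i) k)" for k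
  have "G \<in> V" unfolding G_def using xsX by (intro sum cmult mem) auto
  moreover have "cmod ((LINT x:X|lborel. of_real (g x) * H x k) - G k) \<le> e" if k: "k \<in> K" for k
  proof -
    have Hk: "continuous_on X (\<lambda>x. H x k)"
    proof -
      have "continuous_on X ((\<lambda>(x, k). H x k) \<circ> (\<lambda>x. (x, k)))"
        using k by (intro continuous_on_compose continuous_intros continuous_on_subset[OF H]) auto
      then show ?thesis by (simp add: o_def)
    qed
    have Hm: "(\<lambda>x. indicator X x *\<^sub>R H x k) \<in> borel_measurable borel"
      by (rule borel_measurable_continuous_on_indicator) (use Hk in auto)
    have HB: "\<exists>C. \<forall>x\<in>X. cmod (H x k) \<le> C"
      using compact_continuous_image[OF Hk X] by (auto dest!: compact_imp_bounded simp: bounded_iff)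
    then obtain C where C: "\<And>x. x \<in> X \<Longrightarrow> cmod (H x k) \<le> C" by blast
    have int: "set_integrable lborel X (\<lambda>x. of_real (g x) * H x k)"
    proof -
      have "integrable lborel (\<lambda>x. indicator X x *\<^sub>R (B * \<bar>C\<bar>))"
        using Xfin by (intro integrable_scaleR_left) (auto simp: integrable_indicator_iff)
      then show ?thesis
        unfolding set_integrable_def
      proof (rule Bochner_Integration.integrable_bound)
        have "(\<lambda>x. of_real (g x) * (indicator X x *\<^sub>R H x k)) \<in> borel_measurable borel"
          using Hm by measurable
        then show "(\<lambda>x. indicator X x *\<^sub>R (of_real (g x) * H x k)) \<in> borel_measurable lborel"
          by (simp add: mult_scaleR_right)
        show "AE x in lborel. norm (indicator X x *\<^sub>R (of_real (g x) * H x k))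
          \<le> norm (indicator X x *\<^sub>R (B * \<bar>C\<bar>))"
        proof (intro AE_I2)
          fix x
          show "norm (indicator X x *\<^sub>R (of_real (g x) * H x k)) \<le> norm (indicator X x *\<^sub>R (B * \<bar>C\<bar>))"
          proof (cases "x \<in> X")
            case True
            have "cmod (of_real (g x) * H x k) \<le> B * \<bar>C\<bar>"
              unfolding norm_mult norm_of_real
              using C[OF True] gB B0 by (intro mult_mono) auto
            then show ?thesis using True B0 by simp
          qed simp
        qed
      qed
    qed
    have sub: "P i \<subseteq> X" for i by (auto simp: P_def)
    have Pfin: "emeasure lborel (P i) < \<infinity>" for i
      using le_less_trans[OF emeasure_mono[OF sub[of i], of lborel] Xfin] by simp
    have inti: "set_integrable lborel (P i) (\<lambda>x. of_real (g x) * H x k)" for i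
      by (rule set_integrable_subset[OF int _ sub]) simp
    have gint: "set_integrable lborel (P i) g" for i
    proof -
      have "integrable lborel (\<lambda>x. indicator (P i) x *\<^sub>R B)"
        using Pfin[of i] by (intro integrable_scaleR_left) (auto simp: integrable_indicator_iff)
      then show ?thesis unfolding set_integrable_def
        by (rule Bochner_Integration.integrable_bound) (use gB B0 in \<open>auto simp: indicator_def intro!: AE_I2\<close>)
    qed
    have gint': "set_integrable lborel (P i) (\<lambda>x. of_real (g x) * H (xs ! i) k)" for i
    proof -
      have "set_integrable lborel (P i) (\<lambda>x. complex_of_real (g x))"
        using integrable_of_real[OF gint[of i, unfolded set_integrable_def], where 'a = complex]
        unfolding set_integrable_def by (simp add: scaleR_conv_of_real)
      then show ?thesis by (rule set_integrable_mult_left)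
    qed
    have e1: "(LINT x:X|lborel. of_real (g x) * H x k) = (\<Sum>i<length xs. LINT x:P i|lborel. of_real (g x) * H x k)"
      unfolding UN[symmetric]
      by (rule set_integral_finite_Union) (use disj inti in auto)
    have e2: "of_real (LINT x:P i|lborel. g x) * H (xs ! i) k = (LINT x:P i|lborel. of_real (g x) * H (xs ! i) k)" for i
      by (simp add: set_integral_complex_of_real)
    have mP: "measure lborel X = (\<Sum>i<length xs. measure lborel (P i))"
      unfolding UN[symmetric]
      by (rule measure_finite_Union) (use disj Pfin in \<open>auto simp: less_top\<close>)
    have each: "cmod ((LINT x:P i|lborel. of_real (g x) * H x k) - (LINT x:P i|lborel. of_real (g x) * H (xs ! i) k))
        \<le> B * \<eta> * measure lborel (P i)" if i: "i < length xs" for i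
    proof -
      have "(LINT x:P i|lborel. of_real (g x) * H x k) - (LINT x:P i|lborel. of_real (g x) * H (xs ! i) k)
        = (LINT x:P i|lborel. of_real (g x) * H x k - of_real (g x) * H (xs ! i) k)"
        by (rule set_integral_diff(2)[symmetric]) (rule inti gint')+
      also have "cmod \<dots> \<le> (LINT x|lborel. indicator (P i) x * (B * \<eta>))"
        unfolding set_lebesgue_integral_def
      proof (rule Bochner_Integration.integral_norm_bound_integral)
        show "integrable lborel (\<lambda>x. indicator (P i) x *\<^sub>R (of_real (g x) * H x k - of_real (g x) * H (xs ! i) k))"
          using set_integral_diff(1)[OF inti gint', of i] unfolding set_integrable_def .
        show "integrable lborel (\<lambda>x. indicator (P i) x * (B * \<eta>))"
          using Pfin[of i] by (intro integrable_mult_left) (simp add: integrable_indicator_iff)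
        fix x
        show "norm (indicator (P i) x *\<^sub>R (of_real (g x) * H x k - of_real (g x) * H (xs ! i) k))
          \<le> indicator (P i) x * (B * \<eta>)"
        proof (cases "x \<in> P i")
          case True
          then have "x \<in> X" "dist x (xs ! i) < d" by (auto simp: P_def dist_commute)
          then have "cmod (H x k - H (xs ! i) k) \<le> \<eta>" using xsX[OF i] k by (intro unif)
          moreover have "of_real (g x) * H x k - of_real (g x) * H (xs ! i) k = of_real (g x) * (H x k - H (xs ! i) k)"
            by (simp add: algebra_simps)
          ultimately show ?thesis using True gB[of x] B0
            by (simp add: norm_mult mult_mono)
        qed auto
      qed
      also have "\<dots> = B * \<eta> * measure lborel (P i)" by simp
      finally show ?thesis .
    qed
    have "cmod ((LINT x:X|lborel. of_real (g x) * H x k) - G k)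
      \<le> (\<Sum>i<length xs. B * \<eta> * measure lborel (P i))"
      unfolding e1 G_def e2 sum_subtractf[symmetric]
      by (rule order_trans[OF norm_sum sum_mono]) (use each in auto)
    also have "\<dots> = B * measure lborel X * \<eta>" by (simp add: mP sum_distrib_left mult_ac)
    also have "\<dots> \<le> (B * measure lborel X + 1) * \<eta>" using \<eta> by simp
    also have "\<dots> = e" using B0 by (simp add: \<eta>_def add_nonneg_eq_0_iff)
    finally show ?thesis .
  qed
  ultimately show "\<exists>g'\<in>V. \<forall>k\<in>K. cmod ((LINT x:X|lborel. of_real (g x) * H x k) - g' k) \<le> e" by blast
qed

end

section \<open>The generating function\<close>

text \<open>Polynomials in the frequency and in the space and time coordinates. Closure under
  differentiation in \<open>\<zeta>\<close> shows that every frequency derivative of the generating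
  function is a polynomial times that function, hence is differentiable again and jointly
  continuous.\<close>

inductive poly_fun :: "(complex^'n \<Rightarrow> (real^'n) \<times> real \<Rightarrow> complex) \<Rightarrow> bool" where
  const: "poly_fun (\<lambda>\<zeta> k. c)"
| coord: "poly_fun (\<lambda>\<zeta> k. \<zeta> $ i)"
| space: "poly_fun (\<lambda>\<zeta> k. of_real (fst k $ i))"
| time: "poly_fun (\<lambda>\<zeta> k. of_real (snd k))"
| add: "poly_fun p \<Longrightarrow> poly_fun q \<Longrightarrow> poly_fun (\<lambda>\<zeta> k. p \<zeta> k + q \<zeta> k)"
| mult: "poly_fun p \<Longrightarrow> poly_fun q \<Longrightarrow> poly_fun (\<lambda>\<zeta> k. p \<zeta> k * q \<zeta> k)"

lemma poly_fun_sum: "(\<And>i. i \<in> I \<Longrightarrow> poly_fun (f i)) \<Longrightarrow> poly_fun (\<lambda>\<zeta> k. \<Sum>i\<in>I. f i \<zeta> k)"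
  by (induction I rule: infinite_finite_induct) (auto intro: poly_fun.intros)

lemma continuous_on_poly_fun: "poly_fun p \<Longrightarrow> continuous_on UNIV (\<lambda>(\<zeta>, k). p \<zeta> k)"
  by (induction rule: poly_fun.induct) (auto simp: case_prod_beta' intro!: continuous_intros)

text \<open>The complex increment enters one coordinate only, so that one-variable complex analysis
  applies.\<close>

definition shift :: "complex^'n \<Rightarrow> 'n \<Rightarrow> complex \<Rightarrow> complex^'n" where
  "shift \<zeta> i s = (\<chi> j. if j = i then \<zeta> $ j + s else \<zeta> $ j)"

lemma shift_0 [simp]: "shift \<zeta> i 0 = \<zeta>"
  by (simp add: shift_def vec_eq_iff)

lemma poly_fun_deriv:
  assumes "poly_fun p"
  shows "\<exists>p'. poly_fun p' \<and> (\<forall>\<zeta> k s. ((\<lambda>s. p (shift \<zeta> i s) k) has_field_derivative p' (shift \<zeta> i s) k) (at s))"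
  using assms
proof (induction rule: poly_fun.induct)
  case (const c)
  show ?case by (rule exI[of _ "\<lambda>\<zeta> k. 0"]) (auto intro: poly_fun.intros)
next
  case (coord j)
  show ?case
    by (rule exI[of _ "\<lambda>\<zeta> k. if j = i then 1 else 0"])
       (auto simp: shift_def intro!: poly_fun.intros derivative_eq_intros)
next
  case (space j)
  show ?case by (rule exI[of _ "\<lambda>\<zeta> k. 0"]) (auto intro: poly_fun.intros)
next
  case time
  show ?case by (rule exI[of _ "\<lambda>\<zeta> k. 0"]) (auto intro: poly_fun.intros)
next
  case (add p q)
  then obtain p' q' where "poly_fun p'" "poly_fun q'"
    "\<And>\<zeta> k s. ((\<lambda>s. p (shift \<zeta> i s) k) has_field_derivative p' (shift \<zeta> i s) k) (at s)"
    "\<And>\<zeta> k s. ((\<lambda>s. q (shift \<zeta> i s) k) has_field_derivative q' (shift \<zeta> i s) k) (at s)" by metis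
  then show ?case
    by (intro exI[of _ "\<lambda>\<zeta> k. p' \<zeta> k + q' \<zeta> k"]) (auto intro!: poly_fun.intros DERIV_add)
next
  case (mult p q)
  then obtain p' q' where "poly_fun p'" "poly_fun q'"
    "\<And>\<zeta> k s. ((\<lambda>s. p (shift \<zeta> i s) k) has_field_derivative p' (shift \<zeta> i s) k) (at s)"
    "\<And>\<zeta> k s. ((\<lambda>s. q (shift \<zeta> i s) k) has_field_derivative q' (shift \<zeta> i s) k) (at s)" by metis
  then show ?case
    using mult.hyps
    by (intro exI[of _ "\<lambda>\<zeta> k. p' \<zeta> k * q \<zeta> k + q' \<zeta> k * p \<zeta> k"]) (auto intro!: poly_fun.intros DERIV_mult)
qed

definition gen_phase :: "real^'n^'n \<Rightarrow> complex^'n \<Rightarrow> (real^'n) \<times> real \<Rightarrow> complex" where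
  "gen_phase a \<zeta> k = (\<Sum>i\<in>UNIV. of_real (fst k $ i) * \<zeta> $ i)
     + - of_real (snd k) * (\<Sum>h\<in>UNIV. \<Sum>l\<in>UNIV. of_real (a $ h $ l) * \<zeta> $ h * \<zeta> $ l)"

definition gen_fun :: "real^'n^'n \<Rightarrow> complex^'n \<Rightarrow> (real^'n) \<times> real \<Rightarrow> complex" where
  "gen_fun a \<zeta> k = exp (gen_phase a \<zeta> k)"

lemma poly_fun_gen_phase: "poly_fun (gen_phase a)"
proof -
  have m: "poly_fun (\<lambda>\<zeta> k. - of_real (snd k))"
    using poly_fun.mult[OF poly_fun.const[of "-1"] poly_fun.time] by simp
  show ?thesis
    unfolding gen_phase_def[abs_def]
    by (intro poly_fun.intros poly_fun_sum m)
qed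

definition exp_poly :: "real^'n^'n \<Rightarrow> (complex^'n \<Rightarrow> (real^'n) \<times> real \<Rightarrow> complex) \<Rightarrow> bool" where
  "exp_poly a F \<longleftrightarrow> (\<exists>p. poly_fun p \<and> F = (\<lambda>\<zeta> k. p \<zeta> k * gen_fun a \<zeta> k))"

definition pderivc :: "'n \<Rightarrow> (complex^'n \<Rightarrow> 'k \<Rightarrow> complex) \<Rightarrow> complex^'n \<Rightarrow> 'k \<Rightarrow> complex" where
  "pderivc i F \<zeta> k = deriv (\<lambda>s. F (shift \<zeta> i s) k) 0"

lemma exp_poly_gen_fun: "exp_poly a (gen_fun a)"
  unfolding exp_poly_def by (rule exI[of _ "\<lambda>\<zeta> k. 1"]) (auto intro: poly_fun.intros)

lemma exp_poly_deriv_ex: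
  assumes "exp_poly a F"
  shows "\<exists>F'. exp_poly a F' \<and> (\<forall>\<zeta> k s. ((\<lambda>s. F (shift \<zeta> i s) k) has_field_derivative F' (shift \<zeta> i s) k) (at s))"
proof -
  obtain p where p: "poly_fun p" "F = (\<lambda>\<zeta> k. p \<zeta> k * gen_fun a \<zeta> k)"
    using assms by (auto simp: exp_poly_def)
  obtain p' where p': "poly_fun p'"
    "\<And>\<zeta> k s. ((\<lambda>s. p (shift \<zeta> i s) k) has_field_derivative p' (shift \<zeta> i s) k) (at s)"
    using poly_fun_deriv[OF p(1), of i] by blast
  obtain q where q: "poly_fun q"
    "\<And>\<zeta> k s. ((\<lambda>s. gen_phase a (shift \<zeta> i s) k) has_field_derivative q (shift \<zeta> i s) k) (at s)"
    using poly_fun_deriv[OF poly_fun_gen_phase[of a], of i] by blast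
  show ?thesis
    unfolding exp_poly_def
  proof (intro exI conjI allI)
    show "poly_fun (\<lambda>\<zeta> k. p' \<zeta> k + p \<zeta> k * q \<zeta> k)" by (intro poly_fun.intros p p' q)
    fix \<zeta> k s
    show "((\<lambda>s. F (shift \<zeta> i s) k) has_field_derivative
      (p' (shift \<zeta> i s) k + p (shift \<zeta> i s) k * q (shift \<zeta> i s) k) * gen_fun a (shift \<zeta> i s) k) (at s)"
      unfolding p(2) gen_fun_def
      by (rule derivative_eq_intros p'(2) q(2) refl)+ (simp add: algebra_simps)
  qed (rule refl)
qed

lemma exp_poly_pderivc:
  assumes "exp_poly a F"
  shows "exp_poly a (pderivc i F)"
    and "((\<lambda>s. F (shift \<zeta> i s) k) has_field_derivative pderivc i F (shift \<zeta> i s) k) (at s)"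
proof -
  obtain F' where F': "exp_poly a F'"
    "\<And>\<zeta> k s. ((\<lambda>s. F (shift \<zeta> i s) k) has_field_derivative F' (shift \<zeta> i s) k) (at s)"
    using exp_poly_deriv_ex[OF assms, of i] by blast
  have "F' = pderivc i F"
    unfolding pderivc_def using F'(2)[of _ _ 0] by (auto intro!: ext DERIV_imp_deriv[symmetric])
  then show "exp_poly a (pderivc i F)"
    "((\<lambda>s. F (shift \<zeta> i s) k) has_field_derivative pderivc i F (shift \<zeta> i s) k) (at s)"
    using F' by auto
qed

lemma exp_poly_pderivc_power: "exp_poly a F \<Longrightarrow> exp_poly a ((pderivc i ^^ m) F)"
  by (induction m) (auto intro: exp_poly_pderivc)

lemma deriv_power_shift:
  assumes "exp_poly a F"
  shows "(deriv ^^ m) (\<lambda>s. F (shift \<zeta> i s) k) = (\<lambda>s. (pderivc i ^^ m) F (shift \<zeta> i s) k)"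
proof (induction m)
  case (Suc m)
  have "(deriv ^^ Suc m) (\<lambda>s. F (shift \<zeta> i s) k) = deriv (\<lambda>s. (pderivc i ^^ m) F (shift \<zeta> i s) k)"
    by (simp add: Suc)
  also have "\<dots> = (\<lambda>s. (pderivc i ^^ Suc m) F (shift \<zeta> i s) k)"
    using exp_poly_pderivc(2)[OF exp_poly_pderivc_power[OF assms]]
    by (intro ext DERIV_imp_deriv) simp
  finally show ?case .
qed simp

definition cvec :: "real^'n \<Rightarrow> complex^'n" where
  "cvec \<xi> = (\<chi> i. of_real (\<xi> $ i))"

lemma shift_cvec: "shift (cvec \<xi>) i (of_real s) = cvec (\<xi> + s *\<^sub>R axis i 1)"
  by (simp add: shift_def cvec_def vec_eq_iff axis_def)

text \<open>Passage from the real derivatives in the definition of the polynomials to complex ones.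
  Vanishing of the imaginary part at real frequencies is carried along because iteration of the
  first claim needs it again for the derivative.\<close>

lemma partial_deriv_Re:
  assumes F: "exp_poly a F" and real: "\<And>\<xi>. Im (F (cvec \<xi>) k) = 0"
  shows "partial_deriv i (\<lambda>\<xi>. Re (F (cvec \<xi>) k)) = (\<lambda>\<xi>. Re (pderivc i F (cvec \<xi>) k))"
    and "Im (pderivc i F (cvec \<xi>) k) = 0"
proof -
  have D: "((\<lambda>s. F (cvec (\<xi> + s *\<^sub>R axis i 1)) k) has_vector_derivative pderivc i F (cvec \<xi>) k) (at 0)" for \<xi>
  proof -
    have "((\<lambda>s. of_real s :: complex) has_vector_derivative 1) (at 0)"
      using has_vector_derivative_of_real[OF DERIV_ident] by simp
    from field_vector_diff_chain_at[OF this, of "\<lambda>s. F (shift (cvec \<xi>) i s) k"]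
      exp_poly_pderivc(2)[OF F, of "cvec \<xi>" i k 0]
    show ?thesis by (simp add: o_def shift_cvec)
  qed
  have "((\<lambda>s. Re (F (cvec (\<xi> + s *\<^sub>R axis i 1)) k)) has_real_derivative Re (pderivc i F (cvec \<xi>) k)) (at 0)" for \<xi>
    using bounded_linear.has_vector_derivative[OF bounded_linear_Re D]
    by (simp add: has_real_derivative_iff_has_vector_derivative)
  then show "partial_deriv i (\<lambda>\<xi>. Re (F (cvec \<xi>) k)) = (\<lambda>\<xi>. Re (pderivc i F (cvec \<xi>) k))"
    unfolding partial_deriv_def by (auto intro!: DERIV_imp_deriv)
  have "((\<lambda>s. Im (F (cvec (\<xi> + s *\<^sub>R axis i 1)) k)) has_real_derivative Im (pderivc i F (cvec \<xi>) k)) (at 0)"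
    using bounded_linear.has_vector_derivative[OF bounded_linear_Im D]
    by (simp add: has_real_derivative_iff_has_vector_derivative)
  then show "Im (pderivc i F (cvec \<xi>) k) = 0"
    unfolding real using DERIV_unique DERIV_const by blast
qed

lemma partial_deriv_power_Re:
  assumes F: "exp_poly a F" and real: "\<And>\<xi>. Im (F (cvec \<xi>) k) = 0"
  shows "(partial_deriv i ^^ m) (\<lambda>\<xi>. Re (F (cvec \<xi>) k)) = (\<lambda>\<xi>. Re ((pderivc i ^^ m) F (cvec \<xi>) k))
    \<and> (\<forall>\<xi>. Im ((pderivc i ^^ m) F (cvec \<xi>) k) = 0)"
proof (induction m)
  case (Suc m)
  then show ?case
    using partial_deriv_Re[OF exp_poly_pderivc_power[OF F, where i = i and m = m], where k = k and i = i] by auto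
qed (use real in simp)

definition pderivs :: "nat^'n \<Rightarrow> 'n list \<Rightarrow> (complex^'n \<Rightarrow> 'k \<Rightarrow> complex) \<Rightarrow> complex^'n \<Rightarrow> 'k \<Rightarrow> complex" where
  "pderivs \<alpha> L F = foldr (\<lambda>i H. (pderivc i ^^ (\<alpha> $ i)) H) L F"

lemma exp_poly_pderivs: "exp_poly a F \<Longrightarrow> exp_poly a (pderivs \<alpha> L F)"
  unfolding pderivs_def by (induction L) (auto intro: exp_poly_pderivc_power)

lemma foldr_partial_deriv_Re:
  assumes F: "exp_poly a F" and real: "\<And>\<xi>. Im (F (cvec \<xi>) k) = 0"
  shows "foldr (\<lambda>i h. (partial_deriv i ^^ (\<alpha> $ i)) h) L (\<lambda>\<xi>. Re (F (cvec \<xi>) k)) = (\<lambda>\<xi>. Re (pderivs \<alpha> L F (cvec \<xi>) k))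
    \<and> (\<forall>\<xi>. Im (pderivs \<alpha> L F (cvec \<xi>) k) = 0)"
proof (induction L)
  case (Cons i L)
  then show ?case
    using partial_deriv_power_Re[OF exp_poly_pderivs[OF F, of \<alpha> L], where k = k and i = i and m = "\<alpha> $ i"] by (simp add: pderivs_def)
qed (use real in \<open>simp add: pderivs_def\<close>)

lemma parabolic_poly_eq_pderivs:
  fixes a :: "real^'n^'n"
  shows "of_real (parabolic_poly a \<alpha> k) = pderivs \<alpha> index_enum (gen_fun a) 0 k"
proof -
  obtain x t where k: "k = (x, t)" by (cases k)
  have ph: "gen_phase a (cvec \<xi>) k
      = of_real (x \<bullet> \<xi> - t * (\<Sum>h\<in>UNIV. \<Sum>k\<in>UNIV. a $ h $ k * \<xi> $ h * \<xi> $ k))" for \<xi>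
    by (simp add: gen_phase_def cvec_def k inner_vec_def)
  have gf: "gen_fun a (cvec \<xi>) k
      = of_real (exp (x \<bullet> \<xi> - t * (\<Sum>h\<in>UNIV. \<Sum>k\<in>UNIV. a $ h $ k * \<xi> $ h * \<xi> $ k)))" for \<xi>
    unfolding gen_fun_def ph by (rule exp_of_real)
  have "Im (gen_fun a (cvec \<xi>) k) = 0" for \<xi>
    unfolding gf by simp
  note * = foldr_partial_deriv_Re[OF exp_poly_gen_fun this, of \<alpha> index_enum]
  have c0: "cvec 0 = 0" by (simp add: cvec_def vec_eq_iff)
  have "(\<lambda>\<xi>. exp (x \<bullet> \<xi> - t * (\<Sum>h\<in>UNIV. \<Sum>k\<in>UNIV. a $ h $ k * \<xi> $ h * \<xi> $ k)))
      = (\<lambda>\<xi>. Re (gen_fun a (cvec \<xi>) k))"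
    unfolding gf by simp
  with * have "parabolic_poly a \<alpha> k = Re (pderivs \<alpha> index_enum (gen_fun a) (cvec 0) k)"
    by (simp add: parabolic_poly_def multi_deriv_def k)
  moreover have "Im (pderivs \<alpha> index_enum (gen_fun a) (cvec 0) k) = 0" using * by blast
  ultimately show ?thesis by (simp add: complex_eq_iff c0)
qed

lemma continuous_on_exp_poly_shift:
  assumes "exp_poly a F"
  shows "continuous_on UNIV (\<lambda>(c, k). F (shift \<zeta> i c) k)"
proof -
  obtain p where p: "poly_fun p" "F = (\<lambda>\<zeta> k. p \<zeta> k * gen_fun a \<zeta> k)"
    using assms by (auto simp: exp_poly_def)
  have "continuous_on UNIV (\<lambda>(\<zeta>, k). F \<zeta> k)"
    using continuous_on_poly_fun[OF p(1)] continuous_on_poly_fun[OF poly_fun_gen_phase[of a]]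
    unfolding p(2) gen_fun_def case_prod_beta' by (intro continuous_intros)
  moreover have "continuous_on UNIV (\<lambda>(c, k). (shift \<zeta> i c, k))"
    unfolding shift_def case_prod_beta'
  proof (intro continuous_intros)
    fix j
    show "continuous_on UNIV (\<lambda>x :: complex \<times> 'b. if j = i then \<zeta> $ j + fst x else \<zeta> $ j)"
      by (cases "j = i") (auto intro!: continuous_intros)
  qed
  ultimately have "continuous_on UNIV ((\<lambda>(\<zeta>, k). F \<zeta> k) \<circ> (\<lambda>(c, k). (shift \<zeta> i c, k)))"
    by (intro continuous_on_compose) (auto intro: continuous_on_subset)
  then show ?thesis by (simp add: o_def case_prod_beta')
qed

text \<open>Taylor expansion in one coordinate of \<open>\<zeta>\<close> after the other, following the enumeration of the
  indices that is used by \<open>multi_deriv\<close>.\<close>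

lemma (in closed_function_space) gen_fun_mem:
  fixes a :: "real^'n^'n"
  assumes Vw: "\<And>\<alpha>. (\<lambda>k. of_real (parabolic_poly a \<alpha> (h k))) \<in> V" and h: "continuous_on K h"
  shows "(\<lambda>k. gen_fun a \<zeta> (h k)) \<in> V"
proof -
  \<comment> \<open>Invariant: the derivatives along \<open>L2\<close> have been taken already, and
    the coordinates outside \<open>L1\<close> are still 0. Taking the last index of
    \<open>L1\<close> frees that coordinate by a Taylor series whose coefficients have this index in
    front of \<open>L2\<close>.\<close>
  have main: "(\<lambda>k. pderivs \<alpha> L2 (gen_fun a) \<zeta> (h k)) \<in> V"
    if "index_enum = L1 @ L2" "\<forall>j. j \<notin> set L1 \<longrightarrow> \<zeta> $ j = 0" for L1 L2 \<alpha> and \<zeta> :: "complex^'n"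
    using that
  proof (induction L1 arbitrary: L2 \<alpha> \<zeta> rule: rev_induct)
    case Nil
    then have "\<zeta> = 0" by (simp add: vec_eq_iff)
    then show ?case using Nil Vw[of \<alpha>] by (simp add: parabolic_poly_eq_pderivs)
  next
    case (snoc i L1)
    define F where "F = pderivs \<alpha> L2 (gen_fun a)"
    have F: "exp_poly a F" unfolding F_def by (intro exp_poly_pderivs exp_poly_gen_fun)
    define \<zeta>' where "\<zeta>' = (\<chi> j. if j = i then 0 else \<zeta> $ j)"
    have \<zeta>: "shift \<zeta>' i (\<zeta> $ i) = \<zeta>" by (simp add: \<zeta>'_def shift_def vec_eq_iff)
    have dist: "i \<notin> set L2" using index_enum(2) snoc.prems(1) by (metis distinct_append not_distinct_conv_prefix append_assoc append_Cons append_Nil distinct.simps(2))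
    have C: "continuous_on (cball 0 (cmod (\<zeta> $ i) + 1) \<times> K) (\<lambda>(c, k). F (shift \<zeta>' i c) (h k))"
    proof -
      have hc: "continuous_on (cball 0 (cmod (\<zeta> $ i) + 1) \<times> K) (\<lambda>x. h (snd x))"
        by (rule continuous_on_compose2[OF h]) (auto intro!: continuous_intros)
      have "continuous_on (cball 0 (cmod (\<zeta> $ i) + 1) \<times> K) (\<lambda>x. (fst x, h (snd x)))"
        by (intro continuous_intros hc)
      from continuous_on_compose2[OF continuous_on_exp_poly_shift[OF F, of \<zeta>' i] this]
      show ?thesis by (simp add: case_prod_beta')
    qed
    have "compact ((\<lambda>(c, k). F (shift \<zeta>' i c) (h k)) ` (cball 0 (cmod (\<zeta> $ i) + 1) \<times> K))"
      by (intro compact_continuous_image[OF C] compact_Times K) auto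
    then obtain B where "\<forall>x\<in>(\<lambda>(c, k). F (shift \<zeta>' i c) (h k)) ` (cball 0 (cmod (\<zeta> $ i) + 1) \<times> K). cmod x \<le> B"
      by (auto dest!: compact_imp_bounded simp only: bounded_iff)
    then have B: "\<And>c k. c \<in> cball 0 (cmod (\<zeta> $ i) + 1) \<Longrightarrow> k \<in> K \<Longrightarrow> cmod (F (shift \<zeta>' i c) (h k)) \<le> B"
      by force
    have "(\<lambda>k. F (shift \<zeta>' i (\<zeta> $ i)) (h k)) \<in> V"
    proof (rule taylor_mem[where r = "cmod (\<zeta> $ i) + 1" and B = B])
      fix k assume "k \<in> K"
      show "(\<lambda>c. F (shift \<zeta>' i c) (h k)) holomorphic_on ball 0 (cmod (\<zeta> $ i) + 1)"
        using exp_poly_pderivc(2)[OF F, of \<zeta>' i "h k"] by (auto simp: holomorphic_on_open)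
    next
      fix m
      \<comment> \<open>The order of differentiation in coordinate \<open>i\<close> becomes
        \<open>m\<close>. As \<open>i\<close> does not occur in \<open>L2\<close>, the derivatives
        along \<open>L2\<close> stay the same.\<close>
      define \<alpha>' where "\<alpha>' = (\<chi> j. if j = i then m else \<alpha> $ j)"
      have "pderivs \<alpha>' L2 (gen_fun a) = F"
        unfolding F_def pderivs_def using dist
        by (intro foldr_cong) (auto simp: \<alpha>'_def)
      then have "pderivs \<alpha>' (i # L2) (gen_fun a) = (pderivc i ^^ m) F"
        by (simp add: pderivs_def \<alpha>'_def)
      moreover have "(\<lambda>k. pderivs \<alpha>' (i # L2) (gen_fun a) \<zeta>' (h k)) \<in> V"
        using snoc.prems by (intro snoc.IH) (auto simp: \<zeta>'_def)
      ultimately show "(\<lambda>k. (deriv ^^ m) (\<lambda>c. F (shift \<zeta>' i c) (h k)) 0) \<in> V"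
        by (simp add: deriv_power_shift[OF F])
    qed (use B in auto)
    then show ?case by (simp add: \<zeta> F_def)
  qed
  have "(\<lambda>k. pderivs 0 [] (gen_fun a) \<zeta> (h k)) \<in> V"
    by (rule main[of index_enum]) (auto simp: index_enum)
  then show ?thesis by (simp add: pderivs_def)
qed

section \<open>The heat kernel as an integral of exponentials\<close>

definition heat1 :: "real \<Rightarrow> real \<Rightarrow> real" where
  "heat1 a \<tau> = (if \<tau> > 0 then exp (- a\<^sup>2 / (4 * \<tau>)) / sqrt \<tau> else 0)"

text \<open>The one-dimensional exponential solution of complex frequency \<open>z\<close>, seen
  from a pole at space distance \<open>a\<close> and time distance \<open>\<tau>\<close>.\<close>

definition wave :: "real \<Rightarrow> real \<Rightarrow> complex \<Rightarrow> complex" where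
  "wave a \<tau> z = exp (of_real \<tau> * z\<^sup>2 - of_real a * z)"

definition ray_integral :: "real \<Rightarrow> real \<Rightarrow> complex \<Rightarrow> real \<Rightarrow> complex" where
  "ray_integral a \<tau> w R = (LINT r:{0..R}|lborel. w * wave a \<tau> (w * of_real r))"

lemma norm_wave: "cmod (wave a \<tau> z) = exp (\<tau> * ((Re z)\<^sup>2 - (Im z)\<^sup>2) - a * Re z)"
  by (simp add: wave_def norm_exp_eq_Re Re_power2)

lemma wave_primitive: "\<exists>g. \<forall>z. (g has_field_derivative wave a \<tau> z) (at z)"
proof -
  have "wave a \<tau> holomorphic_on UNIV"
    unfolding wave_def[abs_def] by (intro holomorphic_intros)
  then obtain g where "\<And>x. x \<in> UNIV \<Longrightarrow> (g has_field_derivative wave a \<tau> x) (at x within UNIV)"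
    using holomorphic_convex_primitive'[OF convex_UNIV open_UNIV] by metis
  then show ?thesis by (intro exI[of _ g]) simp
qed

lemma primitive_on_line:
  assumes g: "\<And>z. (g has_field_derivative wave a \<tau> z) (at z)" and R: "R \<le> R'"
  shows "(LINT r:{R..R'}|lborel. w * wave a \<tau> (z + w * of_real r)) = g (z + w * of_real R') - g (z + w * of_real R)"
proof -
  let ?F = "\<lambda>r. w * wave a \<tau> (z + w * of_real r)"
  have D: "((\<lambda>r. g (z + w * of_real r)) has_vector_derivative ?F r) (at r within {R..R'})" for r :: real
  proof -
    have "((\<lambda>r. z + w * of_real r) has_vector_derivative w) (at r within {R..R'})"
      unfolding has_vector_derivative_def
      by (auto intro!: derivative_eq_intros simp: scaleR_conv_of_real)
    from field_vector_diff_chain_within[OF this, of g "wave a \<tau> (z + w * of_real r)"] g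
    show ?thesis by (auto simp: o_def intro: DERIV_subset)
  qed
  show ?thesis
    unfolding set_lebesgue_integral_def
    by (rule integral_FTC_atLeastAtMost[OF R D]) (auto simp: wave_def intro!: continuous_intros)
qed

text \<open>On both rays \<open>z\<^sup>2\<close> is imaginary, so the integrand has modulus at most
  \<open>2 * exp (- a * r)\<close> whatever the size and sign of \<open>\<tau>\<close>. The 2 is a
  crude bound for \<open>cmod w\<close>.\<close>

lemma ray_integral_diff_bound:
  assumes a: "0 < a" and R: "0 \<le> R" "R \<le> R'" and w: "w = 1 + \<i> \<or> w = 1 - \<i>"
  shows "cmod (ray_integral a \<tau> w R' - ray_integral a \<tau> w R) \<le> 2 / a * exp (- a * R)"
proof -
  obtain g where g: "\<And>z. (g has_field_derivative wave a \<tau> z) (at z)"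
    using wave_primitive by blast
  have "ray_integral a \<tau> w R' - ray_integral a \<tau> w R = g (w * of_real R') - g (w * of_real R)"
    using primitive_on_line[OF g, of 0 R w 0] primitive_on_line[OF g, of 0 R' w 0] R
    by (simp add: ray_integral_def)
  also have "\<dots> = (LINT r:{R..R'}|lborel. w * wave a \<tau> (w * of_real r))"
    using primitive_on_line[OF g, of R R' w 0] R by simp
  also have "cmod \<dots> \<le> (LINT r|lborel. indicator {R..R'} r *\<^sub>R (2 * exp (- a * r)))"
    unfolding set_lebesgue_integral_def
  proof (rule Bochner_Integration.integral_norm_bound_integral)
    show "integrable lborel (\<lambda>r. indicator {R..R'} r *\<^sub>R (w * wave a \<tau> (w * of_real r)))"
      by (rule borel_integrable_compact) (auto simp: wave_def intro!: continuous_intros)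
    show "integrable lborel (\<lambda>r. indicator {R..R'} r *\<^sub>R (2 * exp (- a * r)))"
      by (rule borel_integrable_compact) (auto intro!: continuous_intros)
    fix r
    have "cmod w \<le> 2"
      using w norm_triangle_ineq[of 1 \<i>] norm_triangle_ineq4[of 1 \<i>] by auto
    moreover have "cmod (wave a \<tau> (w * of_real r)) = exp (- a * r)"
      using w by (auto simp: norm_wave)
    ultimately show "norm (indicator {R..R'} r *\<^sub>R (w * wave a \<tau> (w * of_real r))) \<le> indicator {R..R'} r *\<^sub>R (2 * exp (- a * r))"
      by (auto simp: norm_mult indicator_def)
  qed
  also have "\<dots> = (- 2 / a * exp (- a * R')) - (- 2 / a * exp (- a * R))"
    by (rule integral_FTC_atLeastAtMost[OF R(2)])
       (use a in \<open>auto intro!: derivative_eq_intros continuous_intros simp flip: has_real_derivative_iff_has_vector_derivative\<close>)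
  also have "\<dots> \<le> 2 / a * exp (- a * R)" using a by simp
  finally show ?thesis .
qed

lemma integral_gauss:
  assumes "0 < \<tau>"
  shows "integrable lborel (\<lambda>v::real. exp (- \<tau> * v\<^sup>2))" "(LINT v|lborel. exp (- \<tau> * v\<^sup>2)) = sqrt (pi / \<tau>)"
proof -
  define \<sigma> where "\<sigma> = sqrt (1 / (2 * \<tau>))"
  have \<sigma>: "0 < \<sigma>" "\<sigma>\<^sup>2 = 1 / (2 * \<tau>)" using assms by (auto simp: \<sigma>_def)
  have eq: "exp (- \<tau> * v\<^sup>2) = sqrt (pi / \<tau>) * normal_density 0 \<sigma> v" for v
    using assms by (simp add: normal_density_def \<sigma>(2) real_sqrt_divide field_simps)
  show "integrable lborel (\<lambda>v::real. exp (- \<tau> * v\<^sup>2))"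
    unfolding eq using \<sigma> by simp
  show "(LINT v|lborel. exp (- \<tau> * v\<^sup>2)) = sqrt (pi / \<tau>)"
    unfolding eq using \<sigma> by simp
qed

text \<open>Since \<open>wave\<close> has a primitive, the difference of the two rays is the
  integral over the vertical segment that joins their end points on the line
  \<open>Re z = n\<close>. For \<open>\<tau> \<le> 0\<close> the integrand is at most
  \<open>exp (- a * n)\<close> there. For \<open>\<tau> > 0\<close> the segment is moved to the
  saddle point, where a Gaussian integral remains in the limit.\<close>

lemma ray_integral_limit:
  assumes a: "0 < a"
  shows "(\<lambda>n::nat. ray_integral a \<tau> (1 + \<i>) (real n) - ray_integral a \<tau> (1 - \<i>) (real n))
    \<longlonglongrightarrow> \<i> * sqrt pi * heat1 a \<tau>"
proof -
  obtain g where g: "\<And>z. (g has_field_derivative wave a \<tau> z) (at z)"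
    using wave_primitive by blast
  have J: "ray_integral a \<tau> (1 + \<i>) (real n) - ray_integral a \<tau> (1 - \<i>) (real n)
      = g (Complex n n) - g (Complex n (- n))" for n
    using primitive_on_line[OF g, of 0 n "1 + \<i>" 0] primitive_on_line[OF g, of 0 n "1 - \<i>" 0]
    by (simp add: ray_integral_def complex_eq_iff Complex_eq algebra_simps)
  have seg: "cmod (g y - g x) \<le> M * cmod (y - x)"
    if "\<And>z. z \<in> closed_segment x y \<Longrightarrow> cmod (wave a \<tau> z) \<le> M" for x y M
    using field_differentiable_bound[of "closed_segment x y" g "wave a \<tau>" M y x] g that
    by (auto intro: DERIV_subset has_field_derivative_at_within)
  show ?thesis
  proof (cases "\<tau> > 0")
    case False
    have b: "cmod (g (Complex n n) - g (Complex n (- n))) \<le> exp (- a * n) * (2 * n)" for n :: nat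
    proof -
      have "cmod (g (Complex n n) - g (Complex n (- n))) \<le> exp (- a * n) * cmod (Complex n n - Complex n (- n))"
      proof (rule seg)
        fix z assume z: "z \<in> closed_segment (Complex n (- n)) (Complex n n)"
        then have "Re z = n" "\<bar>Im z\<bar> \<le> n"
          by (auto simp: closed_segment_same_Re closed_segment_eq_real_ivl)
        then have "(Im z)\<^sup>2 \<le> (Re z)\<^sup>2" by (simp add: abs_le_square_iff[symmetric])
        then show "cmod (wave a \<tau> z) \<le> exp (- a * n)"
          using False \<open>Re z = n\<close> by (simp add: norm_wave mult_nonpos_nonneg)
      qed
      also have "cmod (Complex n n - Complex n (- n)) = 2 * n"
        by (simp add: complex_norm minus_complex.ctr real_sqrt_mult)
      finally show ?thesis .
    qed
    have "(\<lambda>n::nat. exp (- a * n) * (2 * n)) \<longlonglongrightarrow> 0" using a by real_asymp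
    then have "(\<lambda>n::nat. g (Complex n n) - g (Complex n (- n))) \<longlonglongrightarrow> 0"
      by (rule Lim_null_comparison[rotated]) (rule always_eventually, rule allI, use b in simp)
    then show ?thesis using False by (simp add: J heat1_def)
  next
    case True
    \<comment> \<open>The critical point of \<open>\<tau> * z\<^sup>2 - a * z\<close>. On the
      vertical line through it the exponent is real, and no oscillation is left.\<close>
    define x0 where "x0 = a / (2 * \<tau>)"
    have x0: "0 < x0" "2 * \<tau> * x0 = a" using a True by (auto simp: x0_def)
    have side: "cmod (g (Complex n s) - g (Complex x0 s)) \<le> (exp (- a * n / 2) + exp (- 3 / 4 * \<tau> * (real n)\<^sup>2)) * n"
      if s: "s = n \<or> s = - real n" and n: "x0 \<le> n" for n :: nat and s :: real
    proof -
      have "cmod (g (Complex n s) - g (Complex x0 s))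
        \<le> (exp (- a * n / 2) + exp (- 3 / 4 * \<tau> * (real n)\<^sup>2)) * cmod (Complex n s - Complex x0 s)"
      proof (rule seg)
        fix z assume z: "z \<in> closed_segment (Complex x0 s) (Complex n s)"
        then have z': "Im z = s" "x0 \<le> Re z" "Re z \<le> n"
          using n by (auto simp: closed_segment_same_Im closed_segment_eq_real_ivl)
        have s2: "s\<^sup>2 = (real n)\<^sup>2" using s by auto
        show "cmod (wave a \<tau> z) \<le> exp (- a * n / 2) + exp (- 3 / 4 * \<tau> * (real n)\<^sup>2)"
        \<comment> \<open>On the right half of the horizontal side the linear term decays. On the
          left half \<open>(Re z)\<^sup>2\<close> is at most a quarter of
          \<open>(Im z)\<^sup>2\<close>, so the quadratic term decays.\<close>
        proof (cases "Re z \<ge> n / 2")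
          case t: True
          have "(Re z)\<^sup>2 \<le> (real n)\<^sup>2" using z' x0 by (intro power_mono) auto
          then have "\<tau> * ((Re z)\<^sup>2 - (Im z)\<^sup>2) \<le> 0"
            using True z' s2 by (intro mult_nonneg_nonpos) auto
          moreover have "a * (n / 2) \<le> a * Re z"
            using t a by (intro mult_left_mono) auto
          ultimately have "\<tau> * ((Re z)\<^sup>2 - (Im z)\<^sup>2) - a * Re z \<le> - a * (n / 2)"
            by simp
          then have "cmod (wave a \<tau> z) \<le> exp (- a * n / 2)" by (simp add: norm_wave)
          then show ?thesis by (rule order_trans) simp
        next
          case t: False
          have "(Re z)\<^sup>2 \<le> (n / 2)\<^sup>2" using z' x0 t by (intro power_mono) auto
          then have "(Re z)\<^sup>2 - (Im z)\<^sup>2 \<le> - 3 / 4 * (real n)\<^sup>2" using s2 z' by (simp add: power_divide)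
          from mult_left_mono[OF this, of \<tau>] True
          have "\<tau> * ((Re z)\<^sup>2 - (Im z)\<^sup>2) \<le> - 3 / 4 * \<tau> * (real n)\<^sup>2"
            by (simp add: mult_ac)
          then have "\<tau> * ((Re z)\<^sup>2 - (Im z)\<^sup>2) - a * Re z \<le> - 3 / 4 * \<tau> * (real n)\<^sup>2"
            using mult_nonneg_nonneg[of a "Re z"] a z' x0 by linarith
          then have "cmod (wave a \<tau> z) \<le> exp (- 3 / 4 * \<tau> * (real n)\<^sup>2)" by (simp add: norm_wave)
          then show ?thesis by (rule order_trans) simp
        qed
      qed
      also have "cmod (Complex n s - Complex x0 s) = n - x0" using n by (simp add: complex_norm minus_complex.ctr)
      also have "(exp (- a * n / 2) + exp (- 3 / 4 * \<tau> * (real n)\<^sup>2)) * (n - x0)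
        \<le> (exp (- a * n / 2) + exp (- 3 / 4 * \<tau> * (real n)\<^sup>2)) * n"
        using x0 by (intro mult_left_mono) auto
      finally show ?thesis .
    qed
    have lim: "(\<lambda>n::nat. (exp (- a * n / 2) + exp (- 3 / 4 * \<tau> * (real n)\<^sup>2)) * n) \<longlonglongrightarrow> 0"
      using a True by real_asymp
    have ev: "\<forall>\<^sub>F n in sequentially. x0 \<le> real n"
      by (meson eventually_sequentiallyI nat_ceiling_le_eq)
    have s1: "(\<lambda>n::nat. g (Complex n n) - g (Complex x0 n)) \<longlonglongrightarrow> 0"
      by (rule Lim_null_comparison[OF _ lim]) (use ev side in \<open>auto elim!: eventually_mono\<close>)
    have s2: "(\<lambda>n::nat. g (Complex n (- n)) - g (Complex x0 (- n))) \<longlonglongrightarrow> 0"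
      by (rule Lim_null_comparison[OF _ lim]) (use ev side in \<open>auto elim!: eventually_mono\<close>)
    have mid: "g (Complex x0 (real n)) - g (Complex x0 (- real n))
        = \<i> * exp (- a\<^sup>2 / (4 * \<tau>)) * of_real (LINT v|lborel. indicator {- real n..real n} v * exp (- \<tau> * v\<^sup>2))" for n :: nat
    proof -
      have w: "wave a \<tau> (x0 + \<i> * of_real v) = of_real (exp (- a\<^sup>2 / (4 * \<tau>)) * exp (- \<tau> * v\<^sup>2))" for v
      proof -
        have "of_real \<tau> * (x0 + \<i> * of_real v)\<^sup>2 - of_real a * (x0 + \<i> * of_real v)
          = complex_of_real (\<tau> * x0\<^sup>2 - a * x0 - \<tau> * v\<^sup>2) + \<i> * (of_real v * of_real (2 * \<tau> * x0 - a))"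
          by (simp add: power2_eq_square algebra_simps)
        also have "\<tau> * x0\<^sup>2 - a * x0 = - a\<^sup>2 / (4 * \<tau>)"
          using True by (simp add: x0_def power2_eq_square field_simps)
        finally show ?thesis using x0 by (simp add: wave_def exp_of_real[symmetric] mult_exp_exp)
      qed
      have "g (Complex x0 n) - g (Complex x0 (- n)) = (LINT v:{- real n..real n}|lborel. \<i> * wave a \<tau> (x0 + \<i> * of_real v))"
        using primitive_on_line[OF g, of "- real n" "real n" \<i> "of_real x0"] by (simp add: Complex_eq)
      also have "\<dots> = (LINT v:{- real n..real n}|lborel. (\<i> * exp (- a\<^sup>2 / (4 * \<tau>))) * of_real (exp (- \<tau> * v\<^sup>2)))"
        unfolding w by (simp add: mult_ac exp_of_real[symmetric])
      also have "\<dots> = (\<i> * exp (- a\<^sup>2 / (4 * \<tau>))) * of_real (LINT v:{- real n..real n}|lborel. exp (- \<tau> * v\<^sup>2))"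
        by (subst set_integral_mult_right) (simp add: set_integral_complex_of_real)
      finally show ?thesis by (simp add: set_lebesgue_integral_def exp_of_real[symmetric])
    qed
    have "(\<lambda>n::nat. LINT v|lborel. indicator {- real n..real n} v * exp (- \<tau> * v\<^sup>2)) \<longlonglongrightarrow> (LINT v|lborel. exp (- \<tau> * v\<^sup>2))"
    proof (rule integral_dominated_convergence[where w = "\<lambda>v. exp (- \<tau> * v\<^sup>2)"])
      show "AE v in lborel. (\<lambda>n. indicator {- real n..real n} v * exp (- \<tau> * v\<^sup>2)) \<longlonglongrightarrow> exp (- \<tau> * v\<^sup>2)"
      proof (intro AE_I2 tendsto_eventually)
        fix v :: real
        have "\<forall>\<^sub>F n in sequentially. \<bar>v\<bar> \<le> real n" by (meson eventually_sequentiallyI nat_ceiling_le_eq)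
        then show "\<forall>\<^sub>F n in sequentially. indicator {- real n..real n} v * exp (- \<tau> * v\<^sup>2) = exp (- \<tau> * v\<^sup>2)"
          by eventually_elim (auto simp: indicator_def)
      qed
    qed (use integral_gauss[OF True] in \<open>auto simp: indicator_def\<close>)
    then have "(\<lambda>n::nat. \<i> * exp (- a\<^sup>2 / (4 * \<tau>)) * of_real (LINT v|lborel. indicator {- real n..real n} v * exp (- \<tau> * v\<^sup>2)))
      \<longlonglongrightarrow> \<i> * exp (- a\<^sup>2 / (4 * \<tau>)) * of_real (sqrt (pi / \<tau>))"
      unfolding integral_gauss(2)[OF True] by (intro tendsto_mult tendsto_const tendsto_of_real)
    then have m: "(\<lambda>n::nat. g (Complex x0 n) - g (Complex x0 (- n)))
      \<longlonglongrightarrow> \<i> * exp (- a\<^sup>2 / (4 * \<tau>)) * of_real (sqrt (pi / \<tau>))"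
      using mid by (simp add: exp_of_real[symmetric])
    have "(\<lambda>n::nat. (g (Complex n n) - g (Complex x0 n)) - (g (Complex n (- n)) - g (Complex x0 (- n)))
        + (g (Complex x0 n) - g (Complex x0 (- n))))
      \<longlonglongrightarrow> 0 - 0 + \<i> * exp (- a\<^sup>2 / (4 * \<tau>)) * of_real (sqrt (pi / \<tau>))"
      by (intro tendsto_intros s1 s2 m)
    also have "0 - 0 + \<i> * exp (- a\<^sup>2 / (4 * \<tau>)) * of_real (sqrt (pi / \<tau>)) = \<i> * sqrt pi * heat1 a \<tau>"
      using True by (simp add: heat1_def real_sqrt_divide exp_of_real[symmetric])
    finally show ?thesis unfolding J by simp
  qed
qed

lemma ray_integral_error:
  assumes a: "0 < a" and R: "0 \<le> R"
  shows "cmod (\<i> * sqrt pi * heat1 a \<tau> - (ray_integral a \<tau> (1 + \<i>) R - ray_integral a \<tau> (1 - \<i>) R)) \<le> 4 / a * exp (- a * R)"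
proof (rule tendsto_upperbound)
  show "(\<lambda>n::nat. cmod (ray_integral a \<tau> (1 + \<i>) (real n) - ray_integral a \<tau> (1 - \<i>) (real n)
      - (ray_integral a \<tau> (1 + \<i>) R - ray_integral a \<tau> (1 - \<i>) R)))
    \<longlonglongrightarrow> cmod (\<i> * sqrt pi * heat1 a \<tau> - (ray_integral a \<tau> (1 + \<i>) R - ray_integral a \<tau> (1 - \<i>) R))"
    by (intro tendsto_intros ray_integral_limit a)
  have "\<forall>\<^sub>F n in sequentially. R \<le> real n" by (meson eventually_sequentiallyI nat_ceiling_le_eq)
  then show "\<forall>\<^sub>F n in sequentially. cmod (ray_integral a \<tau> (1 + \<i>) (real n) - ray_integral a \<tau> (1 - \<i>) (real n)
      - (ray_integral a \<tau> (1 + \<i>) R - ray_integral a \<tau> (1 - \<i>) R)) \<le> 4 / a * exp (- a * R)"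
  proof eventually_elim
    case (elim n)
    have "cmod (ray_integral a \<tau> (1 + \<i>) (real n) - ray_integral a \<tau> (1 - \<i>) (real n)
      - (ray_integral a \<tau> (1 + \<i>) R - ray_integral a \<tau> (1 - \<i>) R))
      = cmod ((ray_integral a \<tau> (1 + \<i>) (real n) - ray_integral a \<tau> (1 + \<i>) R)
        - (ray_integral a \<tau> (1 - \<i>) (real n) - ray_integral a \<tau> (1 - \<i>) R))"
      by (simp add: algebra_simps)
    also have "\<dots> \<le> 2 / a * exp (- a * R) + 2 / a * exp (- a * R)"
      by (rule order_trans[OF norm_triangle_ineq4 add_mono]; rule ray_integral_diff_bound[OF a R elim]) auto
    finally show ?case by simp
  qed
qed simp

section \<open>The heat kernel away from its pole: bounds and continuity\<close>

lemma power_le_fact_exp: "x \<ge> 0 \<Longrightarrow> x ^ n \<le> fact n * exp (x::real)"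
proof -
  assume x: "x \<ge> 0"
  have "x ^ n /\<^sub>R fact n = (\<Sum>i\<in>{n}. x ^ i /\<^sub>R fact i)" by simp
  also have "\<dots> \<le> exp x"
    unfolding exp_def using x summable_exp_generic[of x] by (intro sum_le_suminf) auto
  finally show ?thesis by (simp add: field_simps)
qed

text \<open>The heat kernel in dimension \<open>N\<close> without its normalising constant, as a
  function of the squared distance \<open>q\<close>. Later \<open>q\<close> is also the real part of
  a complexified squared distance and may be negative.\<close>

definition gauss_profile :: "nat \<Rightarrow> real \<Rightarrow> real \<Rightarrow> real" where
  "gauss_profile N q \<tau> = (if \<tau> > 0 then (1 / sqrt \<tau>) ^ N * exp (- q / (4 * \<tau>)) else 0)"

lemma gauss_profile_nonneg: "0 \<le> gauss_profile N q \<tau>"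
  by (simp add: gauss_profile_def)

text \<open>With \<open>x = q / (4 * \<tau>)\<close> the inequality
  \<open>x ^ N \<le> fact N * exp x\<close> outweighs the singular factor and even leaves a positive
  power of \<open>sqrt \<tau>\<close>. This yields both boundedness and continuity at
  \<open>\<tau> = 0\<close>.\<close>

lemma gauss_profile_le:
  assumes "0 < q"
  shows "gauss_profile N q \<tau> \<le> fact N * (4 / q) ^ N * sqrt \<bar>\<tau>\<bar> ^ N"
proof (cases "\<tau> > 0")
  case True
  have "(q / (4 * \<tau>)) ^ N * exp (- q / (4 * \<tau>)) \<le> fact N * exp (q / (4 * \<tau>)) * exp (- q / (4 * \<tau>))"
    using assms True by (intro mult_right_mono power_le_fact_exp) auto
  then have "(q / (4 * \<tau>)) ^ N * exp (- q / (4 * \<tau>)) \<le> fact N"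
    by (simp add: mult.assoc flip: exp_add)
  then have le: "(4 / q * \<tau>) ^ N * (1 / sqrt \<tau>) ^ N * ((q / (4 * \<tau>)) ^ N * exp (- q / (4 * \<tau>)))
      \<le> (4 / q * \<tau>) ^ N * (1 / sqrt \<tau>) ^ N * fact N"
    using assms True by (intro mult_left_mono) auto
  have one: "(4 / q * \<tau>) ^ N * (q / (4 * \<tau>)) ^ N = 1"
    using assms True by (simp flip: power_mult_distrib)
  have simp: "(4 / q * \<tau>) ^ N * (1 / sqrt \<tau>) ^ N = (4 / q) ^ N * sqrt \<tau> ^ N"
  proof -
    have "4 / q * \<tau> * (1 / sqrt \<tau>) = 4 / q * sqrt \<tau>"
      using arg_cong[OF real_div_sqrt[of \<tau>], of "\<lambda>x. 4 / q * x"] True by simp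
    then show ?thesis by (simp only: flip: power_mult_distrib)
  qed
  have "gauss_profile N q \<tau> = ((4 / q * \<tau>) ^ N * (q / (4 * \<tau>)) ^ N) * ((1 / sqrt \<tau>) ^ N * exp (- q / (4 * \<tau>)))"
    unfolding one using True by (simp add: gauss_profile_def)
  also have "\<dots> = (4 / q * \<tau>) ^ N * (1 / sqrt \<tau>) ^ N * ((q / (4 * \<tau>)) ^ N * exp (- q / (4 * \<tau>)))"
    by (simp only: mult_ac)
  also note le
  finally show ?thesis unfolding simp using True by (simp add: mult_ac)
next
  case False
  then show ?thesis using assms by (simp add: gauss_profile_def)
qed

lemma gauss_profile_bound:
  assumes "0 < q"
  shows "gauss_profile N q \<tau> \<le> max 1 (fact N * (4 / q) ^ N)"
proof (cases "\<tau> > 1")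
  case True
  have "(1 / sqrt \<tau>) ^ N * exp (- q / (4 * \<tau>)) \<le> 1 * 1"
    using True assms by (intro mult_mono power_le_one) auto
  then show ?thesis using True by (simp add: gauss_profile_def max.coboundedI1)
next
  case False
  show ?thesis
  proof (cases "\<tau> > 0")
    case True
    have "gauss_profile N q \<tau> \<le> fact N * (4 / q) ^ N * sqrt \<bar>\<tau>\<bar> ^ N"
      by (rule gauss_profile_le[OF assms])
    also have "\<dots> \<le> fact N * (4 / q) ^ N * 1"
      using False True assms by (intro mult_left_mono power_le_one) auto
    finally show ?thesis by simp
  qed (simp add: gauss_profile_def)
qed

text \<open>The critical points are those with \<open>\<tau> = 0 < q\<close>, where
  \<open>gauss_profile_le\<close> squeezes the values to 0; there \<open>N > 0\<close>
  matters.\<close>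

lemma continuous_on_gauss_profile:
  assumes N: "N > 0"
  shows "continuous_on {(q, \<tau>). q > 0 \<or> \<tau> \<noteq> 0} (\<lambda>(q, \<tau>). gauss_profile N q \<tau>)"
  unfolding continuous_on_def
proof (clarify)
  fix q \<tau> :: real assume q: "q > 0 \<or> \<tau> \<noteq> 0"
  let ?S = "{(q, \<tau>). q > 0 \<or> (\<tau>::real) \<noteq> (0::real)}"
  have fst: "((\<lambda>p. fst p) \<longlongrightarrow> q) (at (q, \<tau>) within ?S)" and snd: "((\<lambda>p. snd p) \<longlongrightarrow> \<tau>) (at (q, \<tau>) within ?S)"
    by (auto intro!: tendsto_eq_intros)
  consider "\<tau> > 0" | "\<tau> < 0" | "\<tau> = 0" "q > 0" using q by linarith
  then have "((\<lambda>p. gauss_profile N (fst p) (snd p)) \<longlongrightarrow> gauss_profile N q \<tau>) (at (q, \<tau>) within ?S)"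
  proof cases
    case 1
    have ev: "\<forall>\<^sub>F p in at (q, \<tau>) within ?S. snd p > 0" using snd 1 by (rule order_tendstoD)
    have "((\<lambda>p. (1 / sqrt (snd p)) ^ N * exp (- fst p / (4 * snd p))) \<longlongrightarrow> (1 / sqrt \<tau>) ^ N * exp (- q / (4 * \<tau>)))
      (at (q, \<tau>) within ?S)"
      using 1 by (intro tendsto_intros fst snd) auto
    then show ?thesis
      using 1 ev by (subst tendsto_cong[of _ "\<lambda>p. (1 / sqrt (snd p)) ^ N * exp (- fst p / (4 * snd p))"])
        (auto simp: gauss_profile_def elim!: eventually_mono)
  next
    case 2
    have ev: "\<forall>\<^sub>F p in at (q, \<tau>) within ?S. snd p < 0" using snd 2 by (rule order_tendstoD)
    then show ?thesis
      using 2 by (intro tendsto_eventually) (auto simp: gauss_profile_def elim!: eventually_mono)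
  next
    case 3
    have ev: "\<forall>\<^sub>F p in at (q, \<tau>) within ?S. fst p > 0" using fst 3(2) by (rule order_tendstoD)
    have "((\<lambda>p. fact N * (4 / fst p) ^ N * sqrt \<bar>snd p\<bar> ^ N) \<longlongrightarrow> fact N * (4 / q) ^ N * sqrt \<bar>0\<bar> ^ N) (at (q, \<tau>) within ?S)"
      using 3 snd by (intro tendsto_intros fst) auto
    then have "((\<lambda>p. fact N * (4 / fst p) ^ N * sqrt \<bar>snd p\<bar> ^ N) \<longlongrightarrow> 0) (at (q, \<tau>) within ?S)"
      using N by (simp add: zero_power)
    then have "((\<lambda>p. gauss_profile N (fst p) (snd p)) \<longlongrightarrow> 0) (at (q, \<tau>) within ?S)"
      by (rule Lim_null_comparison[rotated])
         (use ev in \<open>eventually_elim, auto simp: gauss_profile_nonneg intro: gauss_profile_le\<close>)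
    then show ?thesis using 3 by (simp add: gauss_profile_def)
  qed
  then show "((\<lambda>(q, \<tau>). gauss_profile N q \<tau>) \<longlongrightarrow> gauss_profile N q \<tau>) (at (q, \<tau>) within ?S)"
    by (simp add: case_prod_beta')
qed

section \<open>Heat poles\<close>

lemma heat1_eq_gauss_profile: "heat1 a \<tau> = gauss_profile 1 (a\<^sup>2) \<tau>"
  by (simp add: heat1_def gauss_profile_def)

definition heat_kernel :: "(real^'n \<Rightarrow> real^'n) \<Rightarrow> (real^'n) \<times> real \<Rightarrow> real" where
  "heat_kernel L p = gauss_profile CARD('n) ((norm (L (fst p)))\<^sup>2) (snd p)"

lemma norm_vec_power2: "(norm (x :: real^'n))\<^sup>2 = (\<Sum>i\<in>UNIV. (x $ i)\<^sup>2)"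
  by (simp add: norm_vec_def L2_set_def sum_nonneg)

text \<open>The factorisation allows the kernel to be built coordinate by coordinate, each by a
  one-dimensional ray integral.\<close>

lemma heat_kernel_eq_prod: "heat_kernel L (z, \<tau>) = (\<Prod>i\<in>UNIV. heat1 (L z $ i) \<tau>)"
proof (cases "\<tau> > 0")
  case True
  have "(\<Prod>i\<in>UNIV. heat1 (L z $ i) \<tau>) = (\<Prod>i\<in>(UNIV :: 'a set). 1 / sqrt \<tau>) * (\<Prod>i\<in>UNIV. exp (- (L z $ i)\<^sup>2 / (4 * \<tau>)))"
    using True by (simp add: heat1_def prod_dividef power_one_over)
  also have "(\<Prod>i\<in>UNIV. exp (- (L z $ i)\<^sup>2 / (4 * \<tau>))) = exp (- (norm (L z))\<^sup>2 / (4 * \<tau>))"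
    by (simp add: norm_vec_power2 sum_divide_distrib sum_negf flip: exp_sum)
  finally show ?thesis using True by (simp add: heat_kernel_def gauss_profile_def)
qed (simp add: heat_kernel_def gauss_profile_def heat1_def)

text \<open>In the coordinates \<open>L\<close> the operator \<open>H^*\<close> is the Laplacian
  plus the time derivative, and \<open>wave_mem\<close> supplies its exponential solutions for all
  complex frequencies.\<close>

locale caloric_space = closed_function_space K V
  for K :: "((real^'n) \<times> real) set" and V +
  fixes L :: "real^'n \<Rightarrow> real^'n"
  assumes lin: "linear L" and inj: "inj L"
    and wave_mem: "\<And>z :: complex^'n. (\<lambda>k. exp (\<Sum>i\<in>UNIV. z $ i * of_real (L (fst k) $ i) - of_real (snd k) * (z $ i)\<^sup>2)) \<in> V"
begin

definition pole :: "real \<Rightarrow> real^'n \<Rightarrow> (real^'n) \<times> real \<Rightarrow> complex" where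
  "pole t x k = of_real (heat_kernel L (x - fst k, t - snd k))"

lemma continuous_on_L: "continuous_on S L"
  using lin by (simp add: linear_continuous_on linear_conv_bounded_linear)

text \<open>An interpolation between exponentials and kernels: the coordinates in \<open>I\<close>
  already carry a heat kernel, the others an exponential of free frequency. The induction integrates
  the frequency of one more coordinate along the two rays. The margin 1 in \<open>far\<close> makes
  the cut-off error \<open>exp (- R)\<close> uniform on \<open>K\<close>.\<close>

lemma partial_pole_mem:
  assumes far: "\<And>k i. k \<in> K \<Longrightarrow> 1 \<le> L x $ i - L (fst k) $ i"
  shows "(\<lambda>k. (\<Prod>i\<in>I. of_real (heat1 (L x $ i - L (fst k) $ i) (t - snd k)))
    * exp (\<Sum>i\<in>-I. z $ i * of_real (L (fst k) $ i) - of_real (snd k) * (z $ i)\<^sup>2)) \<in> V"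
proof -
  define P where "P I z k = (\<Prod>i\<in>I. of_real (heat1 (L x $ i - L (fst k) $ i) (t - snd k)))
    * exp (\<Sum>i\<in>-I. z $ i * of_real (L (fst k) $ i) - of_real (snd k) * (z $ i)\<^sup>2)" for I and z :: "complex^'n" and k
  have "finite I" by simp
  then have "P I z \<in> V"
  proof (induction I arbitrary: z rule: finite_induct)
    case empty
    then show ?case using wave_mem[of z] by (simp add: P_def[abs_def])
  next
    case (insert j I)
    define rest where "rest k = (\<Prod>i\<in>I. of_real (heat1 (L x $ i - L (fst k) $ i) (t - snd k)))
      * exp (\<Sum>i\<in>-insert j I. z $ i * of_real (L (fst k) $ i) - of_real (snd k) * (z $ i)\<^sup>2)" for k
    define zr where "zr w r = (\<chi> i. if i = j then w * of_real r else z $ i)" for w :: complex and r :: real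
    \<comment> \<open>The part of the integrand that does not depend on \<open>k\<close>. Multiplied
      by the exponential of frequency \<open>w * r\<close> in coordinate \<open>j\<close>, it
      becomes \<open>w * wave\<close>, centred at the pole.\<close>
    define c where "c w r = w * exp (of_real t * (w * of_real r)\<^sup>2 - of_real (L x $ j) * (w * of_real r))" for w :: complex and r :: real
    have eq: "c w r * P I (zr w r) k = rest k * (w * wave (L x $ j - L (fst k) $ j) (t - snd k) (w * of_real r))" for w r k
    proof -
      have "- I = insert j (- insert j I)" using insert.hyps by auto
      then have "(\<Sum>i\<in>-I. zr w r $ i * of_real (L (fst k) $ i) - of_real (snd k) * (zr w r $ i)\<^sup>2)
        = (w * of_real r * of_real (L (fst k) $ j) - of_real (snd k) * (w * of_real r)\<^sup>2)
          + (\<Sum>i\<in>-insert j I. zr w r $ i * of_real (L (fst k) $ i) - of_real (snd k) * (zr w r $ i)\<^sup>2)"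
        by (simp add: zr_def)
      also have "(\<Sum>i\<in>-insert j I. zr w r $ i * of_real (L (fst k) $ i) - of_real (snd k) * (zr w r $ i)\<^sup>2)
        = (\<Sum>i\<in>-insert j I. z $ i * of_real (L (fst k) $ i) - of_real (snd k) * (z $ i)\<^sup>2)"
        by (intro sum.cong) (auto simp: zr_def)
      finally have s: "P I (zr w r) k = rest k * exp (w * of_real r * of_real (L (fst k) $ j) - of_real (snd k) * (w * of_real r)\<^sup>2)"
        by (simp add: P_def rest_def exp_add mult_ac)
      have e: "exp (of_real t * (w * of_real r)\<^sup>2 - of_real (L x $ j) * (w * of_real r))
          * exp (w * of_real r * of_real (L (fst k) $ j) - of_real (snd k) * (w * of_real r)\<^sup>2)
        = wave (L x $ j - L (fst k) $ j) (t - snd k) (w * of_real r)"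
        unfolding wave_def mult_exp_exp by (rule arg_cong[of _ _ exp]) (simp add: algebra_simps)
      then show ?thesis unfolding s c_def e[symmetric] by (simp only: mult_ac)
    qed
    have cont_heat: "continuous_on K (\<lambda>k. heat1 (L x $ i - L (fst k) $ i) (t - snd k))" for i
    proof -
      have "continuous_on K (\<lambda>k. ((L x $ i - L (fst k) $ i)\<^sup>2, t - snd k))"
        by (intro continuous_intros continuous_on_compose2[OF continuous_on_L]) auto
      moreover have "(L x $ i - L (fst k) $ i)\<^sup>2 > 0" if "k \<in> K" for k
        using far[OF that, of i] by (intro zero_less_power) linarith
      ultimately have "continuous_on K (\<lambda>k. (\<lambda>(q, \<tau>). gauss_profile 1 q \<tau>) ((L x $ i - L (fst k) $ i)\<^sup>2, t - snd k))"
        by (intro continuous_on_compose2[OF continuous_on_gauss_profile[of 1]]) auto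
      then show ?thesis by (simp add: heat1_eq_gauss_profile)
    qed
    have cont_rest: "continuous_on K rest"
      unfolding rest_def
      by (intro continuous_intros cont_heat continuous_on_compose2[OF continuous_on_L]) auto
    have mem: "(\<lambda>k. rest k * ray_integral (L x $ j - L (fst k) $ j) (t - snd k) w R) \<in> V" for w R
    proof -
      have "continuous_on ({0..R} \<times> K) (\<lambda>p. rest (snd p))"
        by (rule continuous_on_compose2[OF cont_rest]) (auto intro!: continuous_intros)
      moreover have "continuous_on ({0..R} \<times> K) (\<lambda>p. L (fst (snd p)))"
        by (rule continuous_on_compose2[OF continuous_on_L[of UNIV]]) (auto intro!: continuous_intros)
      ultimately have "continuous_on ({0..R} \<times> K) (\<lambda>(r, k). c w r * P I (zr w r) k)"
        unfolding eq wave_def case_prod_beta' by (intro continuous_intros)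
      then have "(\<lambda>k. LINT r:{0..R}|lborel. of_real 1 * (c w r * P I (zr w r) k)) \<in> V"
        by (rule integral_mem[where B = 1, rotated]) (auto intro!: cmult insert.IH)
      then show ?thesis
        unfolding eq ray_integral_def by simp
    qed
    have "(\<lambda>k. rest k * (\<i> * sqrt pi * heat1 (L x $ j - L (fst k) $ j) (t - snd k))) \<in> V"
    proof (rule closed)
      fix e :: real assume e: "0 < e"
      obtain B where "\<forall>u\<in>rest ` K. cmod u \<le> B"
        using compact_imp_bounded[OF compact_continuous_image[OF cont_rest K]] unfolding bounded_iff by blast
      then have B: "cmod (rest k) \<le> \<bar>B\<bar>" if "k \<in> K" for k using that by fastforce
      \<comment> \<open>From \<open>R \<le> exp R\<close> this choice gives the error bound
        \<open>\<bar>B\<bar> * (4 * exp (- R)) \<le> e\<close>.\<close>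
      define R where "R = 4 * \<bar>B\<bar> / e"
      have R: "0 \<le> R" using e by (simp add: R_def)
      have "R \<le> exp R" using exp_ge_add_one_self[of R] by linarith
      then have Re: "\<bar>B\<bar> * (4 * exp (- R)) \<le> e" using e by (simp add: R_def exp_minus field_simps)
      let ?g = "\<lambda>k. rest k * ray_integral (L x $ j - L (fst k) $ j) (t - snd k) (1 + \<i>) R
        - rest k * ray_integral (L x $ j - L (fst k) $ j) (t - snd k) (1 - \<i>) R"
      have "?g \<in> V" by (intro diff mem)
      moreover have "cmod (rest k * (\<i> * sqrt pi * heat1 (L x $ j - L (fst k) $ j) (t - snd k)) - ?g k) \<le> e" if k: "k \<in> K" for k
      proof -
        let ?a = "L x $ j - L (fst k) $ j"
        have a: "1 \<le> ?a" by (rule far[OF k])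
        have "4 / ?a * exp (- ?a * R) \<le> 4 * exp (- R)"
        proof (rule mult_mono)
          show "4 / ?a \<le> 4" using a by (simp add: divide_le_eq)
          show "exp (- ?a * R) \<le> exp (- R)" using mult_right_mono[OF a R] by (simp only: exp_le_cancel_iff mult_minus_left mult_1_left neg_le_iff_le)
        qed auto
        then have "cmod (\<i> * sqrt pi * heat1 ?a (t - snd k)
            - (ray_integral ?a (t - snd k) (1 + \<i>) R - ray_integral ?a (t - snd k) (1 - \<i>) R)) \<le> 4 * exp (- R)"
          using ray_integral_error[of ?a R "t - snd k"] a R by linarith
        then have "cmod (rest k * (\<i> * sqrt pi * heat1 ?a (t - snd k)
            - (ray_integral ?a (t - snd k) (1 + \<i>) R - ray_integral ?a (t - snd k) (1 - \<i>) R))) \<le> \<bar>B\<bar> * (4 * exp (- R))"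
          unfolding norm_mult[of "rest k"] using B[OF k] by (intro mult_mono) auto
        then show ?thesis using Re by (simp add: right_diff_distrib)
      qed
      ultimately show "\<exists>g\<in>V. \<forall>k\<in>K. cmod (rest k * (\<i> * sqrt pi * heat1 (L x $ j - L (fst k) $ j) (t - snd k)) - g k) \<le> e"
        by (intro bexI[of _ ?g]) auto
    qed
    from cmult[OF this, of "1 / (\<i> * sqrt pi)"]
    have "(\<lambda>k. rest k * heat1 (L x $ j - L (fst k) $ j) (t - snd k)) \<in> V"
      by (rule cong) simp
    then show ?case
      using insert.hyps by (simp add: P_def[abs_def] rest_def mult_ac)
  qed
  then show ?thesis by (simp add: P_def[abs_def])
qed

lemma far_pole_mem:
  assumes far: "\<And>k i. k \<in> K \<Longrightarrow> 1 \<le> L x $ i - L (fst k) $ i"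
  shows "pole t x \<in> V"
  using partial_pole_mem[OF far, where I = UNIV and t = t and z = 0]
  by (simp add: pole_def[abs_def] heat_kernel_eq_prod linear_diff[OF lin])

text \<open>The pole moves along the complex line \<open>x + c * v\<close>. Its kernel is
  holomorphic in \<open>c\<close> and bounded on a disc of radius above 1 if the complexified
  squared distance keeps a positive real part, or if the pole is later than \<open>K\<close> by a
  fixed amount. For small real \<open>c\<close> the pole lies in the given ball, so
  \<open>analytic_continuation_mem\<close> reaches \<open>c = 1\<close>, however small
  \<open>e\<close> is.\<close>

lemma pole_line_mem:
  assumes e: "0 < e" and near: "\<And>y. y \<in> ball x e \<Longrightarrow> pole t y \<in> V"
    and dist: "(0 < m \<and> (\<forall>k\<in>K. m \<le> norm (L (x - fst k))) \<and> norm (L v) < m / 4) \<or> (0 < \<delta> \<and> (\<forall>k\<in>K. \<delta> \<le> t - snd k))"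
  shows "pole t (x + v) \<in> V"
proof -
  define b where "b = L v"
  \<comment> \<open>In the spatial case with \<open>b \<noteq> 0\<close> the disc keeps
    \<open>cmod c * norm b\<close> below \<open>m / 4\<close>, and the hypothesis makes its radius
    exceed 1. Otherwise any radius above 1 works.\<close>
  define r where "r = (if 0 < m \<and> (\<forall>k\<in>K. m \<le> norm (L (x - fst k))) \<and> norm b < m / 4 \<and> b \<noteq> 0
    then m / 4 / norm b else 2)"
  have r: "1 < r" by (auto simp: r_def field_simps)
  define S where "S c k = (\<Sum>i\<in>UNIV. (of_real (L (x - fst k) $ i) + c * of_real (b $ i))\<^sup>2)" for c :: complex and k :: "(real^'n) \<times> real"
  define f where "f c k = (if t - snd k > 0 then of_real ((1 / sqrt (t - snd k)) ^ CARD('n)) * exp (- S c k / of_real (4 * (t - snd k))) else 0)"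
    for c :: complex and k :: "(real^'n) \<times> real"
  have f_real: "f (of_real u) = pole t (x + u *\<^sub>R v)" for u
  proof
    fix k
    have "S (of_real u) k = of_real ((norm (L (x + u *\<^sub>R v - fst k)))\<^sup>2)"
    proof -
      have "L (x + u *\<^sub>R v - fst k) $ i = L (x - fst k) $ i + u * b $ i" for i
        using linear_add[OF lin, of "x - fst k" "u *\<^sub>R v"] linear_scale[OF lin, of u v]
        by (simp add: b_def algebra_simps)
      then show ?thesis by (simp add: S_def norm_vec_power2)
    qed
    then show "f (of_real u) k = pole t (x + u *\<^sub>R v) k"
      by (simp add: f_def pole_def heat_kernel_def gauss_profile_def flip: exp_of_real)
  qed
  \<comment> \<open>\<open>S\<close> is the squared distance continued to complex \<open>c\<close>.
    The mixed term is bounded by Cauchy-Schwarz, the quadratic one by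
    \<open>(cmod c)\<^sup>2\<close>.\<close>
  have ReS: "(norm (L (x - fst k)))\<^sup>2 - 2 * cmod c * norm (L (x - fst k)) * norm b - (cmod c)\<^sup>2 * (norm b)\<^sup>2 \<le> Re (S c k)" for c k
  proof -
    let ?a = "L (x - fst k)"
    have "Re (S c k) = (\<Sum>i\<in>UNIV. (?a $ i)\<^sup>2 + 2 * Re c * (?a $ i * b $ i) + ((Re c)\<^sup>2 - (Im c)\<^sup>2) * (b $ i)\<^sup>2)"
      by (simp add: S_def Re_power2 power2_eq_square algebra_simps)
    also have "\<dots> = (norm ?a)\<^sup>2 + 2 * Re c * (?a \<bullet> b) + ((Re c)\<^sup>2 - (Im c)\<^sup>2) * (norm b)\<^sup>2"
      by (simp add: sum.distrib norm_vec_power2 inner_vec_def flip: sum_distrib_left)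
    finally have eq: "Re (S c k) = \<dots>" .
    have "\<bar>Re c * (?a \<bullet> b)\<bar> \<le> cmod c * (norm ?a * norm b)"
      unfolding abs_mult by (intro mult_mono abs_Re_le_cmod Cauchy_Schwarz_ineq2) auto
    moreover have "- (cmod c)\<^sup>2 * (norm b)\<^sup>2 \<le> ((Re c)\<^sup>2 - (Im c)\<^sup>2) * (norm b)\<^sup>2"
      by (intro mult_right_mono) (auto simp: cmod_power2)
    ultimately show ?thesis unfolding eq by (simp add: mult.assoc)
  qed
  have nf: "cmod (f c k) = gauss_profile CARD('n) (Re (S c k)) (t - snd k)" for c k
    by (simp add: f_def gauss_profile_def norm_mult norm_power norm_divide Re_divide_of_real del: of_real_mult of_real_diff)
  have gp_mono: "gauss_profile N q \<tau> \<le> gauss_profile N q' \<tau>" if "q' \<le> q" for N q q' \<tau>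
    using that by (auto simp: gauss_profile_def intro!: mult_left_mono divide_right_mono)
  obtain B where B: "\<And>c k. cmod c < r \<Longrightarrow> k \<in> K \<Longrightarrow> cmod (f c k) \<le> B"
  proof -
    consider (space) "0 < m" "\<And>k. k \<in> K \<Longrightarrow> m \<le> norm (L (x - fst k))" "norm b < m / 4" "b \<noteq> 0"
      | (zero) "b = 0" "0 < m" "\<And>k. k \<in> K \<Longrightarrow> m \<le> norm (L (x - fst k))"
      | (time) "0 < \<delta>" "\<And>k. k \<in> K \<Longrightarrow> \<delta> \<le> t - snd k" "r = 2"
    proof (cases "0 < m \<and> (\<forall>k\<in>K. m \<le> norm (L (x - fst k))) \<and> norm b < m / 4")
      case True
      then show ?thesis using space zero by (cases "b = 0") blast+
    next
      case False
      then have "r = 2" unfolding r_def by (subst if_not_P) auto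
      then show ?thesis using dist False time unfolding b_def[symmetric] by blast
    qed
    then show ?thesis
    proof cases
      case space
      then have rb: "r = m / 4 / norm b" by (simp add: r_def)
      show ?thesis
      proof (rule that)
        fix c k assume c: "cmod c < r" and k: "k \<in> K"
        let ?A = "norm (L (x - fst k))"
        have A: "m \<le> ?A" using space k by auto
        have cb: "cmod c * norm b \<le> ?A / 4"
          using c A space(4) unfolding rb by (simp add: field_simps)
        have "(cmod c * norm b) * ?A \<le> ?A / 4 * ?A" using cb by (rule mult_right_mono) simp
        then have "(cmod c * norm b) * ?A \<le> ?A\<^sup>2 / 4" by (simp add: power2_eq_square)
        moreover have "(cmod c * norm b)\<^sup>2 \<le> (?A / 4)\<^sup>2" using cb by (intro power_mono) auto
        then have "(cmod c * norm b)\<^sup>2 \<le> ?A\<^sup>2 / 16" by (simp add: power_divide)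
        moreover have "m\<^sup>2 \<le> ?A\<^sup>2" using A space(1) by (intro power_mono) auto
        moreover have "?A\<^sup>2 - 2 * ((cmod c * norm b) * ?A) - (cmod c * norm b)\<^sup>2 \<le> Re (S c k)"
          using ReS[of k c] by (simp add: power_mult_distrib mult_ac)
        \<comment> \<open>With \<open>cmod c * norm b \<le> ?A / 4\<close> there remain
          \<open>1 - 1/2 - 1/16 = 7/16\<close> of \<open>?A\<^sup>2\<close>, more than a
          quarter.\<close>
        ultimately have "m\<^sup>2 / 4 \<le> Re (S c k)" using zero_le_power2[of ?A] by linarith
        then have "cmod (f c k) \<le> gauss_profile CARD('n) (m\<^sup>2 / 4) (t - snd k)"
          unfolding nf by (rule gp_mono)
        also have "\<dots> \<le> max 1 (fact CARD('n) * (4 / (m\<^sup>2 / 4)) ^ CARD('n))"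
          using space(1) by (intro gauss_profile_bound) auto
        finally show "cmod (f c k) \<le> max 1 (fact CARD('n) * (4 / (m\<^sup>2 / 4)) ^ CARD('n))" .
      qed
    next
      case zero
      show ?thesis
      proof (rule that)
        fix c k assume k: "k \<in> K"
        have le: "m\<^sup>2 \<le> (norm (L (x - fst k)))\<^sup>2" using zero k by (intro power_mono) auto
        have "(norm (L (x - fst k)))\<^sup>2 \<le> Re (S c k)" using ReS[of k c] zero(1) by simp
        with le have "m\<^sup>2 \<le> Re (S c k)" by (rule order_trans)
        then have "cmod (f c k) \<le> gauss_profile CARD('n) (m\<^sup>2) (t - snd k)"
          unfolding nf by (rule gp_mono)
        also have "\<dots> \<le> max 1 (fact CARD('n) * (4 / m\<^sup>2) ^ CARD('n))"
          using zero by (intro gauss_profile_bound) auto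
        finally show "cmod (f c k) \<le> max 1 (fact CARD('n) * (4 / m\<^sup>2) ^ CARD('n))" .
      qed
    next
      case time
      show ?thesis
      proof (rule that)
        fix c k assume c: "cmod c < r" and k: "k \<in> K"
        let ?A = "norm (L (x - fst k))"
        \<comment> \<open>Completing the square in \<open>ReS\<close> bounds the real part below
          independently of the distance. A negative bound suffices here because the time gap
          \<open>\<delta>\<close> keeps the exponent bounded.\<close>
        have "0 \<le> (?A - cmod c * norm b)\<^sup>2" by simp
        then have "- 2 * (cmod c * norm b)\<^sup>2 \<le> Re (S c k)"
          using ReS[of k c] by (simp add: power2_eq_square algebra_simps)
        moreover have "(cmod c * norm b)\<^sup>2 \<le> (2 * norm b)\<^sup>2"
          using c time by (intro power_mono mult_right_mono) auto
        ultimately have "- 8 * (norm b)\<^sup>2 \<le> Re (S c k)" by (simp add: power_mult_distrib)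
        then have "cmod (f c k) \<le> gauss_profile CARD('n) (- 8 * (norm b)\<^sup>2) (t - snd k)"
          unfolding nf by (rule gp_mono)
        also have "\<dots> \<le> (1 / sqrt \<delta>) ^ CARD('n) * exp (8 * (norm b)\<^sup>2 / (4 * \<delta>))"
        proof -
          have d: "0 < t - snd k" "\<delta> \<le> t - snd k" using time(1) time(2)[OF k] by auto
          have "(1 / sqrt (t - snd k)) ^ CARD('n) \<le> (1 / sqrt \<delta>) ^ CARD('n)"
            using d time(1) by (intro power_mono frac_le) auto
          moreover have "8 * (norm b)\<^sup>2 / (4 * (t - snd k)) \<le> 8 * (norm b)\<^sup>2 / (4 * \<delta>)"
            using d time(1) by (intro frac_le) auto
          then have "exp (- (- 8 * (norm b)\<^sup>2) / (4 * (t - snd k))) \<le> exp (8 * (norm b)\<^sup>2 / (4 * \<delta>))"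
            by simp
          ultimately show ?thesis
            unfolding gauss_profile_def if_P[OF d(1)] using time(1) by (intro mult_mono) auto
        qed
        finally show "cmod (f c k) \<le> (1 / sqrt \<delta>) ^ CARD('n) * exp (8 * (norm b)\<^sup>2 / (4 * \<delta>))" .
      qed
    qed
  qed
  have "f 1 \<in> V"
  proof (rule analytic_continuation_mem[where r = r and B = B and d = "e / (norm v + 1)"])
    show "(\<lambda>c. f c k) holomorphic_on ball 0 r" if "k \<in> K" for k
    proof (cases "t - snd k > 0")
      case True
      then show ?thesis
        unfolding f_def S_def by (simp del: of_real_mult of_real_diff) (intro holomorphic_intros, simp)
    qed (simp add: f_def)
    show "f (of_real u) \<in> V" if u: "0 < u" "u < e / (norm v + 1)" for u
    proof -
      have "u * norm v < e"
      proof -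
        have "u * norm v \<le> u * (norm v + 1)" using u by simp
        also have "\<dots> < e" using u(2) by (simp add: pos_less_divide_eq add_nonneg_pos)
        finally show ?thesis .
      qed
      then show ?thesis unfolding f_real using u by (intro near) (simp add: dist_norm)
    qed
    show "0 < e / (norm v + 1)" using e by (intro divide_pos_pos add_nonneg_pos) auto
  qed (use B r in auto)
  then show ?thesis using f_real[of 1] by simp
qed

text \<open>\<open>Y\<close> is open and relatively closed in \<open>D\<close>. The radius
  \<open>\<sigma>\<close> of the local step depends on the distance from \<open>y\<close> to the
  complement of \<open>D\<close> but not on the size of the good ball that it starts from; this is
  what makes \<open>D - Y\<close> open.\<close>

lemma pole_mem_connected:
  assumes D: "open D" "connected D" and KD: "\<And>k. k \<in> K \<Longrightarrow> fst k \<notin> D"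
    and x0: "x0 \<in> D" "0 < e0" "\<And>y. y \<in> ball x0 e0 \<Longrightarrow> pole t y \<in> V" and x: "x \<in> D"
  shows "pole t x \<in> V"
proof -
  define X where "X = {y. pole t y \<in> V}"
  define Y where "Y = {y\<in>D. \<exists>e>0. ball y e \<subseteq> X}"
  obtain \<mu> where \<mu>: "0 < \<mu>" "\<And>z. \<mu> * norm z \<le> norm (L z)"
    using linear_inj_bounded_below_pos[OF lin inj] by blast
  obtain M where M: "0 < M" "\<And>z. norm (L z) \<le> M * norm z"
    using linear_bounded_pos[OF lin] by blast
  have local: "\<exists>\<sigma>>0. ball y \<sigma> \<subseteq> D \<and> (ball y \<sigma> \<inter> Y \<noteq> {} \<longrightarrow> ball y \<sigma> \<subseteq> X)" if y: "y \<in> D" for y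
  proof -
    obtain \<rho> where \<rho>: "0 < \<rho>" "ball y \<rho> \<subseteq> D" using D(1) y by (auto simp: open_contains_ball)
    define m where "m = \<mu> * (\<rho> / 2)"
    have m: "0 < m" using \<mu> \<rho> by (simp add: m_def)
    \<comment> \<open>\<open>\<sigma> \<le> \<rho> / 2\<close> keeps \<open>w\<close> at distance
      \<open>\<rho> / 2\<close> from the spatial part of \<open>K\<close>. Points of the ball are
      less than \<open>2 * \<sigma> \<le> m / (4 * M)\<close> apart, so \<open>L\<close> moves them
      by less than \<open>m / 4\<close>.\<close>
    define \<sigma> where "\<sigma> = min (\<rho> / 2) (m / (8 * M))"
    have \<sigma>: "0 < \<sigma>" "\<sigma> \<le> \<rho> / 2" "\<sigma> \<le> m / (8 * M)" using \<rho> m M by (auto simp: \<sigma>_def)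
    have "ball y \<sigma> \<subseteq> X" if ne: "ball y \<sigma> \<inter> Y \<noteq> {}"
    proof
      fix z assume z: "z \<in> ball y \<sigma>"
      obtain w e where w: "w \<in> ball y \<sigma>" "0 < e" "ball w e \<subseteq> X" using ne by (auto simp: Y_def)
      have "pole t (w + (z - w)) \<in> V"
      proof (rule pole_line_mem[OF w(2), where m = m and \<delta> = 0])
        show "pole t u \<in> V" if "u \<in> ball w e" for u using w(3) that by (auto simp: X_def)
        have "m \<le> norm (L (w - fst k))" if "k \<in> K" for k
        proof -
          have "fst k \<notin> ball y \<rho>" using KD[OF that] \<rho> by auto
          then have "\<rho> \<le> dist y w + dist w (fst k)" using dist_triangle[of y "fst k" w] by simp
          then have "\<rho> / 2 \<le> norm (w - fst k)" using w(1) \<sigma> by (simp add: dist_norm)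
          then have "m \<le> \<mu> * norm (w - fst k)" unfolding m_def using \<mu>(1) by (intro mult_left_mono) auto
          then show ?thesis using \<mu>(2) order_trans by blast
        qed
        moreover have "norm (L (z - w)) < m / 4"
        proof -
          have "dist w z < 2 * \<sigma>" using w(1) z dist_triangle[of w z y] by (simp add: dist_commute)
          then have "norm (z - w) < m / (4 * M)" using \<sigma>(3) by (simp add: dist_norm norm_minus_commute field_simps)
          then have "M * norm (z - w) < m / 4" using M(1) by (simp add: field_simps)
          then show ?thesis using M(2)[of "z - w"] by linarith
        qed
        ultimately show "(0 < m \<and> (\<forall>k\<in>K. m \<le> norm (L (w - fst k))) \<and> norm (L (z - w)) < m / 4) \<or> (0 < (0::real) \<and> (\<forall>k\<in>K. 0 \<le> t - snd k))"
          using m by blast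
      qed
      then show "z \<in> X" by (simp add: X_def)
    qed
    moreover have "ball y \<sigma> \<subseteq> D" using \<rho> \<sigma> by (auto simp: subset_eq)
    ultimately show ?thesis using \<sigma>(1) by blast
  qed
  have oY: "open Y"
  proof (unfold open_contains_ball, intro ballI)
    fix y assume y: "y \<in> Y"
    then obtain \<sigma> where \<sigma>: "0 < \<sigma>" "ball y \<sigma> \<subseteq> D" "ball y \<sigma> \<inter> Y \<noteq> {} \<longrightarrow> ball y \<sigma> \<subseteq> X"
      using local[of y] by (auto simp: Y_def)
    moreover have "y \<in> ball y \<sigma>" using \<sigma>(1) by simp
    ultimately have "ball y \<sigma> \<subseteq> X" using y by blast
    have "ball y \<sigma> \<subseteq> Y"
    proof
      fix z assume z: "z \<in> ball y \<sigma>"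
      then obtain e where "0 < e" "ball z e \<subseteq> ball y \<sigma>" using open_ball open_contains_ball by metis
      then show "z \<in> Y" using z \<sigma>(2) \<open>ball y \<sigma> \<subseteq> X\<close> unfolding Y_def by blast
    qed
    then show "\<exists>e>0. ball y e \<subseteq> Y" using \<sigma>(1) by blast
  qed
  have oZ: "open (D - Y)"
  proof (unfold open_contains_ball, intro ballI)
    fix y assume y: "y \<in> D - Y"
    then obtain \<sigma> where \<sigma>: "0 < \<sigma>" "ball y \<sigma> \<subseteq> D" "ball y \<sigma> \<inter> Y \<noteq> {} \<longrightarrow> ball y \<sigma> \<subseteq> X"
      using local[of y] by auto
    then have "ball y \<sigma> \<inter> Y = {}" using y by (auto simp: Y_def)
    then show "\<exists>e>0. ball y e \<subseteq> D - Y" using \<sigma> by blast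
  qed
  have "x0 \<in> Y" using x0 by (auto simp: Y_def X_def)
  then have "D \<subseteq> Y"
    using connectedD[OF D(2) oY oZ] by (auto simp: Y_def)
  then obtain e where "0 < e" "ball x e \<subseteq> X" using x by (auto simp: Y_def)
  then have "x \<in> X" using centre_in_ball[of x e] by blast
  then show ?thesis by (simp add: X_def)
qed

text \<open>All poles near a remote point are available from the ray integrals. A pole later than
  \<open>T\<close> is reached from there in a single analytic step across \<open>S\<close>, since
  the time gap excludes singularities; any other exterior pole is reached inside the connected
  complement of \<open>S\<close>.\<close>

lemma pole_mem:
  assumes S: "closed S" "bounded S" "connected (- S)" and KS: "\<And>k. k \<in> K \<Longrightarrow> fst k \<in> S \<and> snd k \<le> T"
    and x: "x \<notin> S \<or> T < t"
  shows "pole t x \<in> V"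
proof -
  have "bounded (L ` S)" using S(2) lin by (simp add: bounded_linear_image linear_conv_bounded_linear)
  then obtain M where M: "\<And>y. y \<in> S \<Longrightarrow> norm (L y) \<le> M" by (auto simp: bounded_iff)
  obtain B where B: "0 < B" "\<And>z. norm (L z) \<le> B * norm z"
    using linear_bounded_pos[OF lin] by blast
  have "surj L" using lin inj by (rule linear_injective_imp_surjective) (rule refl)
  \<comment> \<open>\<open>M + 2\<close> leaves the margin 1 of \<open>far_pole_mem\<close> after
    subtracting at most \<open>M\<close> for points of \<open>S\<close> and less than 1 for the ball
    around \<open>x0\<close>.\<close>
  then obtain x0 where x0: "L x0 = (\<chi> i. M + 2)" by (metis surjD)
  have far: "1 \<le> L y $ i - L z $ i" if y: "y \<in> ball x0 (1 / B)" and z: "z \<in> S" for y z i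
  proof -
    have "norm (L (x0 - y)) < 1" using B(2)[of "x0 - y"] y B(1) by (simp add: dist_norm field_simps)
    then have "\<bar>L (x0 - y) $ i\<bar> < 1" using component_le_norm_cart[of "L (x0 - y)" i] by linarith
    moreover have "\<bar>L z $ i\<bar> \<le> M" using component_le_norm_cart[of "L z" i] M[OF z] by linarith
    ultimately show ?thesis using x0 by (simp add: linear_diff[OF lin])
  qed
  have near: "pole t y \<in> V" if "y \<in> ball x0 (1 / B)" for y
    using far[OF that] KS by (intro far_pole_mem) auto
  show ?thesis
  proof (cases "T < t")
    case True
    have "pole t (x0 + (x - x0)) \<in> V"
      by (rule pole_line_mem[where e = "1 / B" and \<delta> = "t - T" and m = 0]) (use near B True KS in force)+
    then show ?thesis by simp
  next
    case False
    have "x0 \<notin> S" using far[of x0 x0] B(1) by auto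
    then show ?thesis
      using S x False KS B(1) by (intro pole_mem_connected[of "- S" x0 "1 / B", OF _ _ _ _ _ near]) auto
  qed
qed

end

section \<open>Geometry of continuously differentiable boundaries\<close>

text \<open>\<open>\<Phi>\<close> is the height above the graph. The Lipschitz bound is stated on
  the doubled ball because points of the boundary are later translated by up to \<open>r\<close>
  along \<open>\<nu>\<close>.\<close>

definition boundary_chart :: "'a::euclidean_space set \<Rightarrow> 'a \<Rightarrow> real \<Rightarrow> 'a \<Rightarrow> real \<Rightarrow> ('a \<Rightarrow> real) \<Rightarrow> bool" where
  "boundary_chart \<Omega> z r \<nu> \<Lambda> \<Phi> \<longleftrightarrow> 0 < r \<and> norm \<nu> = 1 \<and> 1 \<le> \<Lambda> \<and>
    (\<forall>x c. \<Phi> (x + c *\<^sub>R \<nu>) = \<Phi> x + c) \<and>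
    (\<forall>x\<in>ball z (2 * r). \<forall>y\<in>ball z (2 * r). \<bar>\<Phi> x - \<Phi> y\<bar> \<le> \<Lambda> * dist x y) \<and>
    (\<forall>x\<in>ball z r. x \<in> \<Omega> \<longleftrightarrow> 0 < \<Phi> x) \<and>
    (\<forall>x\<in>ball z r. x \<in> frontier \<Omega> \<longrightarrow> \<Phi> x = 0)"

text \<open>The gradient of \<open>g\<close> is bounded on a compact ball, so \<open>g\<close> is
  Lipschitz there, and projection along \<open>\<nu>\<close> does not increase distances.\<close>

lemma C1_boundary_chart:
  fixes \<Omega> :: "'a::euclidean_space set"
  assumes "C1_boundary \<Omega>" and op: "open \<Omega>" and z: "z \<in> frontier \<Omega>"
  shows "\<exists>r \<nu> \<Lambda> \<Phi>. boundary_chart \<Omega> z r \<nu> \<Lambda> \<Phi>"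
proof -
  obtain r \<nu> g G where r: "0 < r" and \<nu>: "norm \<nu> = 1" and G: "continuous_on UNIV G"
    and g: "\<And>y. (g has_derivative (\<lambda>v. G y \<bullet> v)) (at y)"
    and eq: "\<Omega> \<inter> ball z r = {x \<in> ball z r. g (x - (x \<bullet> \<nu>) *\<^sub>R \<nu>) < x \<bullet> \<nu>}"
    using assms(1) z unfolding C1_boundary_def by blast
  define \<pi> where "\<pi> x = x - (x \<bullet> \<nu>) *\<^sub>R \<nu>" for x
  define \<Phi> where "\<Phi> x = x \<bullet> \<nu> - g (\<pi> x)" for x
  have \<nu>\<nu>: "\<nu> \<bullet> \<nu> = 1" using \<nu> by (simp add: norm_eq_1)
  have \<pi>_le: "norm (\<pi> x - \<pi> y) \<le> norm (x - y)" for x y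
  proof -
    let ?w = "x - y"
    have "\<pi> x - \<pi> y = ?w - (?w \<bullet> \<nu>) *\<^sub>R \<nu>" by (simp add: \<pi>_def algebra_simps)
    moreover have "(norm (?w - (?w \<bullet> \<nu>) *\<^sub>R \<nu>))\<^sup>2 = (norm ?w)\<^sup>2 - (?w \<bullet> \<nu>)\<^sup>2"
      unfolding power2_norm_eq_inner using \<nu>\<nu>
      by (simp add: inner_diff_left inner_diff_right inner_commute power2_eq_square algebra_simps)
    ultimately have "(norm (\<pi> x - \<pi> y))\<^sup>2 \<le> (norm ?w)\<^sup>2" by simp
    then show ?thesis by (rule power2_le_imp_le) simp
  qed
  have "bounded (G ` cball (\<pi> z) (2 * r))"
    by (intro compact_imp_bounded compact_continuous_image continuous_on_subset[OF G]) auto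
  then obtain M where "\<forall>w\<in>G ` cball (\<pi> z) (2 * r). norm w \<le> M"
    unfolding bounded_iff by blast
  then have M: "\<And>y. y \<in> cball (\<pi> z) (2 * r) \<Longrightarrow> norm (G y) \<le> M" by blast
  have M0: "0 \<le> M" using M[of "\<pi> z"] r by (auto intro: order_trans[OF norm_ge_zero])
  have gl: "\<bar>g x - g y\<bar> \<le> M * norm (x - y)" if "x \<in> cball (\<pi> z) (2 * r)" "y \<in> cball (\<pi> z) (2 * r)" for x y
    using differentiable_bound[of "cball (\<pi> z) (2 * r)" g "\<lambda>y v. G y \<bullet> v" M x y] that g M
    by (force intro: has_derivative_at_withinI onorm_bound M0 order_trans[OF Cauchy_Schwarz_ineq2] mult_right_mono)
  have shift: "\<Phi> (x + c *\<^sub>R \<nu>) = \<Phi> x + c" for x c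
    using \<nu>\<nu> by (simp add: \<Phi>_def \<pi>_def inner_add_left algebra_simps)
  have lip: "\<bar>\<Phi> x - \<Phi> y\<bar> \<le> (1 + M) * dist x y" if "x \<in> ball z (2 * r)" "y \<in> ball z (2 * r)" for x y
  proof -
    have "\<pi> x \<in> cball (\<pi> z) (2 * r)" "\<pi> y \<in> cball (\<pi> z) (2 * r)"
      using that \<pi>_le[of z x] \<pi>_le[of z y] by (auto simp: dist_norm)
    then have "\<bar>g (\<pi> x) - g (\<pi> y)\<bar> \<le> M * norm (\<pi> x - \<pi> y)" by (rule gl)
    also have "\<dots> \<le> M * dist x y" using \<pi>_le[of x y] M0 by (simp add: dist_norm mult_left_mono)
    finally have "\<bar>g (\<pi> x) - g (\<pi> y)\<bar> \<le> M * dist x y" .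
    moreover have "\<bar>x \<bullet> \<nu> - y \<bullet> \<nu>\<bar> \<le> dist x y"
      using Cauchy_Schwarz_ineq2[of "x - y" \<nu>] \<nu> by (simp add: inner_diff_left dist_norm)
    ultimately show ?thesis by (simp add: \<Phi>_def algebra_simps abs_diff_triangle_ineq)
  qed
  have mem: "x \<in> \<Omega> \<longleftrightarrow> 0 < \<Phi> x" if "x \<in> ball z r" for x
    using eq that by (auto simp: \<Phi>_def \<pi>_def set_eq_iff)
  have fr: "\<Phi> x = 0" if x: "x \<in> ball z r" "x \<in> frontier \<Omega>" for x
  proof -
    have "x \<notin> \<Omega>" using x(2) op by (simp add: frontier_def interior_open)
    then have le: "\<Phi> x \<le> 0" using mem[OF x(1)] by simp
    \<comment> \<open>Otherwise \<open>\<Phi>\<close> would be negative on a ball around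
      \<open>x\<close>, while \<open>\<Omega>\<close> comes arbitrarily close to
      \<open>x\<close>.\<close>
    have "\<not> \<Phi> x < 0"
    proof
      assume neg: "\<Phi> x < 0"
      define e where "e = min (r - dist z x) (- \<Phi> x / (1 + M))"
      have e: "0 < e" using x(1) neg M0 by (auto simp: e_def divide_less_0_iff)
      have "x \<in> closure \<Omega>" using x(2) by (simp add: frontier_def)
      then obtain y where y: "y \<in> \<Omega>" "dist y x < e" using e by (auto simp: closure_approachable)
      have "dist z y < r" using y(2) dist_triangle[of z y x] by (simp add: e_def dist_commute)
      then have "0 < \<Phi> y" using mem[of y] y(1) by simp
      moreover have "\<bar>\<Phi> y - \<Phi> x\<bar> \<le> (1 + M) * dist y x"
        using \<open>dist z y < r\<close> x(1) r by (intro lip) auto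
      moreover have "(1 + M) * dist y x < - \<Phi> x"
      proof -
        have "dist y x < - \<Phi> x / (1 + M)" using y(2) unfolding e_def by (rule less_le_trans) simp
        then show ?thesis using M0 by (simp only: pos_less_divide_eq mult.commute)
      qed
      ultimately show False by linarith
    qed
    then show ?thesis using le by simp
  qed
  show ?thesis
    by (rule exI[of _ r], rule exI[of _ \<nu>], rule exI[of _ "1 + M"], rule exI[of _ \<Phi>])
       (use r \<nu> M0 shift lip mem fr in \<open>auto simp: boundary_chart_def\<close>)
qed

text \<open>Descending by \<open>\<rho>\<close> from a boundary point gives height
  \<open>- \<rho>\<close>, and the Lipschitz bound keeps the height negative within distance
  \<open>\<rho> / \<Lambda>\<close>. Compactness of the boundary makes the proportion
  uniform.\<close>

lemma exterior_balls:
  fixes \<Omega> :: "'a::euclidean_space set"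
  assumes C1: "C1_boundary \<Omega>" and op: "open \<Omega>" and bd: "bounded \<Omega>"
  shows "\<exists>\<kappa> r0. 0 < \<kappa> \<and> \<kappa> \<le> 1 \<and> 0 < r0 \<and>
    (\<forall>y\<in>frontier \<Omega>. \<forall>\<rho>. 0 < \<rho> \<longrightarrow> \<rho> < r0 \<longrightarrow> (\<exists>x. dist x y \<le> \<rho> \<and> ball x (\<kappa> * \<rho>) \<inter> closure \<Omega> = {}))"
proof -
  have chart: "\<exists>\<kappa> r. 0 < \<kappa> \<and> \<kappa> \<le> 1 \<and> 0 < r \<and> (\<forall>y\<in>frontier \<Omega> \<inter> ball z r. \<forall>\<rho>. 0 < \<rho> \<and> \<rho> < r \<longrightarrow>
      (\<exists>x. dist x y \<le> \<rho> \<and> ball x (\<kappa> * \<rho>) \<inter> closure \<Omega> = {}))" if z: "z \<in> frontier \<Omega>" for z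
  proof -
    obtain r \<nu> \<Lambda> \<Phi> where "boundary_chart \<Omega> z r \<nu> \<Lambda> \<Phi>"
      using C1_boundary_chart[OF C1 op z] by blast
    then have c: "0 < r" "norm \<nu> = 1" "1 \<le> \<Lambda>" "\<And>x c. \<Phi> (x + c *\<^sub>R \<nu>) = \<Phi> x + c"
      "\<And>x y. x \<in> ball z (2 * r) \<Longrightarrow> y \<in> ball z (2 * r) \<Longrightarrow> \<bar>\<Phi> x - \<Phi> y\<bar> \<le> \<Lambda> * dist x y"
      "\<And>x. x \<in> ball z r \<Longrightarrow> x \<in> \<Omega> \<longleftrightarrow> 0 < \<Phi> x"
      "\<And>x. x \<in> ball z r \<Longrightarrow> x \<in> frontier \<Omega> \<Longrightarrow> \<Phi> x = (0::real)"
      unfolding boundary_chart_def by simp_all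
    \<comment> \<open>With \<open>y\<close>, the descent and the ball each contributing at most a
      quarter of \<open>r\<close>, the whole exterior ball stays inside the chart.\<close>
    have "\<exists>x. dist x y \<le> \<rho> \<and> ball x (1 / \<Lambda> * \<rho>) \<inter> closure \<Omega> = {}"
      if y: "y \<in> frontier \<Omega> \<inter> ball z (r / 4)" and \<rho>: "0 < \<rho>" "\<rho> < r / 4" for y \<rho>
    proof (intro exI conjI)
      let ?x = "y + (- \<rho>) *\<^sub>R \<nu>"
      have yx: "dist ?x y = \<rho>" using c(2) \<rho> by (simp add: dist_norm)
      then show "dist ?x y \<le> \<rho>" by simp
      have \<Lambda>\<rho>: "1 / \<Lambda> * \<rho> \<le> \<rho>" using c(3) \<rho> by (simp add: divide_le_eq)
      have x2: "?x \<in> ball z (2 * r)" using y \<rho> yx dist_triangle[of z ?x y] c(1) by (simp add: dist_commute)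
      have "ball ?x (1 / \<Lambda> * \<rho>) \<inter> \<Omega> = {}"
      proof (intro equals0I)
        fix w assume w: "w \<in> ball ?x (1 / \<Lambda> * \<rho>) \<inter> \<Omega>"
        then have wx: "dist w ?x < 1 / \<Lambda> * \<rho>" by (simp add: dist_commute)
        have wz: "w \<in> ball z r"
          using wx \<Lambda>\<rho> y \<rho> yx dist_triangle[of z w ?x] dist_triangle[of z ?x y] by (simp add: dist_commute)
        have "\<bar>\<Phi> w - \<Phi> ?x\<bar> \<le> \<Lambda> * dist w ?x" using wz x2 c(1) by (intro c(5)) auto
        also have "\<dots> < \<Lambda> * (1 / \<Lambda> * \<rho>)" using wx c(3) by (intro mult_strict_left_mono) auto
        also have "\<dots> = \<rho>" using c(3) by simp
        finally have "\<bar>\<Phi> w - \<Phi> ?x\<bar> < \<rho>" .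
        moreover have "\<Phi> ?x = - \<rho>" using c(4)[of y "- \<rho>"] c(7)[of y] y c(1) by simp
        ultimately have "\<Phi> w < 0" by linarith
        then show False using c(6)[OF wz] w by simp
      qed
      then show "ball ?x (1 / \<Lambda> * \<rho>) \<inter> closure \<Omega> = {}"
        by (simp add: open_Int_closure_eq_empty)
    qed
    then show ?thesis
      using c(1,3) by (intro exI[of _ "1 / \<Lambda>"] exI[of _ "r / 4"]) auto
  qed
  then obtain \<kappa> r where kr: "\<And>z. z \<in> frontier \<Omega> \<Longrightarrow> 0 < \<kappa> z \<and> \<kappa> z \<le> 1 \<and> 0 < r z \<and>
      (\<forall>y\<in>frontier \<Omega> \<inter> ball z (r z). \<forall>\<rho>. 0 < \<rho> \<and> \<rho> < r z \<longrightarrow>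
      (\<exists>x. dist x y \<le> \<rho> \<and> ball x (\<kappa> z * \<rho>) \<inter> closure \<Omega> = {}))"
    by metis
  have "compact (frontier \<Omega>)" using bd by (rule compact_frontier_bounded)
  then obtain F where F: "F \<subseteq> frontier \<Omega>" "finite F" "frontier \<Omega> \<subseteq> (\<Union>z\<in>F. ball z (r z))"
    by (rule compactE_image[where C = "frontier \<Omega>" and f = "\<lambda>z. ball z (r z)"]) (use kr in auto)
  define \<kappa>0 where "\<kappa>0 = Min (insert 1 (\<kappa> ` F))"
  define r0 where "r0 = Min (insert 1 (r ` F))"
  show ?thesis
  proof (rule exI[of _ \<kappa>0], rule exI[of _ r0], intro conjI ballI allI impI)
    show "0 < \<kappa>0" "\<kappa>0 \<le> 1" "0 < r0" using F kr by (auto simp: \<kappa>0_def r0_def)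
    fix y \<rho> assume y: "y \<in> frontier \<Omega>" "0 < \<rho>" "\<rho> < r0"
    obtain z where z: "z \<in> F" "y \<in> ball z (r z)" using F y by blast
    have "\<rho> < r z" using y(3) z(1) F(2) by (auto simp: r0_def)
    then obtain x where x: "dist x y \<le> \<rho>" "ball x (\<kappa> z * \<rho>) \<inter> closure \<Omega> = {}"
      using kr[of z] z F y by blast
    have "\<kappa>0 * \<rho> \<le> \<kappa> z * \<rho>" using z(1) F(2) y by (intro mult_right_mono) (auto simp: \<kappa>0_def)
    then have "ball x (\<kappa>0 * \<rho>) \<subseteq> ball x (\<kappa> z * \<rho>)" by (rule subset_ball)
    then show "\<exists>x. dist x y \<le> \<rho> \<and> ball x (\<kappa>0 * \<rho>) \<inter> closure \<Omega> = {}" using x by blast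
  qed
qed

section \<open>Packing numbers and finiteness of the surface measure\<close>

definition separated :: "real \<Rightarrow> 'a::metric_space set \<Rightarrow> bool" where
  "separated \<epsilon> F \<longleftrightarrow> (\<forall>x\<in>F. \<forall>y\<in>F. x \<noteq> y \<longrightarrow> \<epsilon> \<le> dist x y)"

text \<open>Volume comparison: the balls of radius \<open>\<epsilon> / 2\<close> are disjoint, and
  by \<open>\<epsilon> \<le> 2\<close> they lie in the ball of radius \<open>R + 1\<close>.\<close>

lemma separated_card_le:
  fixes F :: "'a::euclidean_space set"
  assumes F: "finite F" "separated \<epsilon> F" "F \<subseteq> ball z R" and \<epsilon>: "0 < \<epsilon>" "\<epsilon> \<le> 2" and R0: "0 \<le> R"
  shows "real (card F) * (\<epsilon> / 2) ^ DIM('a) \<le> (R + 1) ^ DIM('a)"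
proof (cases "F = {}")
  case False
  then obtain x where "x \<in> ball z R" using F(3) by blast
  then have R: "0 < R" using zero_le_dist[of z x] by (simp del: zero_le_dist)
  define v where "v = measure lborel (ball (0::'a) 1)"
  have v: "0 < v" unfolding v_def by (simp add: content_ball_pos)
  have ball: "measure lborel (ball x r) = r ^ DIM('a) * v" if "0 \<le> r" for x :: 'a and r
    using content_ball_conv_unit_ball[OF that, of x] by (simp add: v_def)
  have disj: "disjoint_family_on (\<lambda>x. ball x (\<epsilon> / 2)) F"
    unfolding disjoint_family_on_def
  proof (intro ballI impI equals0I)
    fix x y w assume xy: "x \<in> F" "y \<in> F" "x \<noteq> y" and w: "w \<in> ball x (\<epsilon> / 2) \<inter> ball y (\<epsilon> / 2)"
    then have "dist x y < \<epsilon>" using dist_triangle[of x y w] by (simp add: dist_commute)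
    then show False using F(2) xy by (force simp: separated_def)
  qed
  have "(\<Sum>x\<in>F. measure lborel (ball x (\<epsilon> / 2))) = measure lborel (\<Union>x\<in>F. ball x (\<epsilon> / 2))"
    by (rule measure_finite_Union[symmetric]) (use F(1) disj emeasure_lborel_ball_finite in \<open>auto simp: less_top\<close>)
  also have "\<dots> \<le> measure lborel (ball z (R + 1))"
  proof (rule measure_mono_fmeasurable)
    show "(\<Union>x\<in>F. ball x (\<epsilon> / 2)) \<subseteq> ball z (R + 1)"
    proof
      fix w assume "w \<in> (\<Union>x\<in>F. ball x (\<epsilon> / 2))"
      then obtain x where "x \<in> F" "dist x w < \<epsilon> / 2" by auto
      then show "w \<in> ball z (R + 1)" using F(3) dist_triangle[of z w x] \<epsilon> by fastforce
    qed
    show "(\<Union>x\<in>F. ball x (\<epsilon> / 2)) \<in> sets lborel" by (auto intro: borel_open)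
    show "ball z (R + 1) \<in> fmeasurable lborel"
      using emeasure_lborel_ball_finite[of z "R + 1"] by (intro fmeasurableI) auto
  qed
  finally have "real (card F) * (\<epsilon> / 2) ^ DIM('a) * v \<le> (R + 1) ^ DIM('a) * v"
    using \<epsilon> R by (simp add: ball)
  then show ?thesis using v by simp
qed (use R0 in simp)

text \<open>A scale-invariant form of having dimension one less than the space: a set of finite
  upper Minkowski content in codimension one satisfies it.\<close>

definition packing_bound :: "'a::euclidean_space set \<Rightarrow> real \<Rightarrow> real \<Rightarrow> bool" where
  "packing_bound S C \<epsilon>0 \<longleftrightarrow> 0 \<le> C \<and> 0 < \<epsilon>0 \<and>
    (\<forall>F \<epsilon>. finite F \<longrightarrow> F \<subseteq> S \<longrightarrow> separated \<epsilon> F \<longrightarrow> 0 < \<epsilon> \<longrightarrow> \<epsilon> \<le> \<epsilon>0 \<longrightarrow>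
      real (card F) * \<epsilon> ^ (DIM('a) - 1) \<le> C)"

text \<open>Translating a separated set of boundary points in the direction \<open>\<nu>\<close> gives about \<open>1 / \<epsilon>\<close>
  disjoint copies whose union is still separated, which gains one power of \<open>\<epsilon>\<close>.\<close>

lemma chart_packing:
  fixes \<Omega> :: "'a::euclidean_space set"
  assumes C1: "C1_boundary \<Omega>" and op: "open \<Omega>" and z: "z \<in> frontier \<Omega>"
  shows "\<exists>r C \<epsilon>0. 0 < r \<and> packing_bound (frontier \<Omega> \<inter> ball z r) C \<epsilon>0"
proof -
  obtain r \<nu> \<Lambda> \<Phi> where "boundary_chart \<Omega> z r \<nu> \<Lambda> \<Phi>"
      using C1_boundary_chart[OF C1 op z] by blast
    then have c: "0 < r" "norm \<nu> = 1" "1 \<le> \<Lambda>" "\<And>x c. \<Phi> (x + c *\<^sub>R \<nu>) = \<Phi> x + c"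
    "\<And>x y. x \<in> ball z (2 * r) \<Longrightarrow> y \<in> ball z (2 * r) \<Longrightarrow> \<bar>\<Phi> x - \<Phi> y\<bar> \<le> \<Lambda> * dist x y"
    "\<And>x. x \<in> ball z r \<Longrightarrow> x \<in> \<Omega> \<longleftrightarrow> 0 < \<Phi> x"
    "\<And>x. x \<in> ball z r \<Longrightarrow> x \<in> frontier \<Omega> \<Longrightarrow> \<Phi> x = (0::real)"
    unfolding boundary_chart_def by simp_all
  define C where "C = 2 * \<Lambda> / r * (2 ^ DIM('a) * (2 * r + 1) ^ DIM('a))"
  show ?thesis
    unfolding packing_bound_def
  proof (rule exI[of _ r], rule exI[of _ C], rule exI[of _ "min 2 (r / (2 * \<Lambda>))"], intro conjI allI impI)
    show "0 < r" "0 \<le> C" "0 < min 2 (r / (2 * \<Lambda>))" using c(1,3) by (auto simp: C_def)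
    fix F \<epsilon> assume F: "finite F" "F \<subseteq> frontier \<Omega> \<inter> ball z r" "separated \<epsilon> F"
      and \<epsilon>: "0 < \<epsilon>" "\<epsilon> \<le> min 2 (r / (2 * \<Lambda>))"
    have \<epsilon>2: "\<epsilon> * (2 * \<Lambda>) \<le> r" using \<epsilon>(2) c(3) by (simp add: le_divide_eq)
    \<comment> \<open>The number of copies: shifts by multiples of
      \<open>\<Lambda> * \<epsilon>\<close> stay below \<open>r\<close>, hence inside the doubled
      ball. The bound on \<open>\<epsilon>\<close> makes \<open>r / (\<Lambda> * \<epsilon>)\<close>
      at least 2, so rounding down loses no more than half.\<close>
    define N where "N = nat \<lfloor>r / (\<Lambda> * \<epsilon>)\<rfloor>"
    have q1: "2 \<le> r / (\<Lambda> * \<epsilon>)" using \<epsilon>2 \<epsilon>(1) c(3) by (simp add: le_divide_eq mult_ac)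
    then have "real N = of_int \<lfloor>r / (\<Lambda> * \<epsilon>)\<rfloor>" unfolding N_def by simp
    then have N: "real N \<le> r / (\<Lambda> * \<epsilon>)" "r / (\<Lambda> * \<epsilon>) < real N + 1"
      using of_int_floor_le[of "r / (\<Lambda> * \<epsilon>)"] real_of_int_floor_add_one_gt[of "r / (\<Lambda> * \<epsilon>)"] by linarith+
    have N2: "r / (2 * \<Lambda> * \<epsilon>) \<le> real N" using N q1 by (simp add: field_simps)
    define p where "p = (\<lambda>(x, k). x + (real k * (\<Lambda> * \<epsilon>)) *\<^sub>R \<nu>)"
    have inball: "p (x, k) \<in> ball z (2 * r)" if "x \<in> F" "k < N" for x k
    proof -
      have "real k * (\<Lambda> * \<epsilon>) \<le> real N * (\<Lambda> * \<epsilon>)" using that \<epsilon> c(3) by (intro mult_right_mono) auto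
      also have "\<dots> \<le> r" using N(1) \<epsilon> c(3) by (simp add: le_divide_eq)
      finally have "dist x (p (x, k)) \<le> r" using c(2,3) \<epsilon> by (simp add: p_def dist_norm)
      moreover have "dist z x < r" using that F(2) by auto
      ultimately show ?thesis using dist_triangle[of z "p (x, k)" x] by simp
    qed
    have \<Phi>p: "\<Phi> (p (x, k)) = real k * (\<Lambda> * \<epsilon>)" if "x \<in> F" for x k
    proof -
      have "x \<in> ball z r" "x \<in> frontier \<Omega>" using that F(2) by blast+
      then show ?thesis using c(4)[of x] c(7)[of x] by (simp add: p_def)
    qed
    \<comment> \<open>Points of one copy are separated because \<open>F\<close> is. Points of
      different copies differ in height by at least \<open>\<Lambda> * \<epsilon>\<close>, which the
      Lipschitz bound converts into distance \<open>\<epsilon>\<close>.\<close>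
    have sep: "\<epsilon> \<le> dist (p (x, k)) (p (y, l))" if "x \<in> F" "y \<in> F" "k < N" "l < N" "(x, k) \<noteq> (y, l)" for x y k l
    proof (cases "k = l")
      case True
      then show ?thesis using that F(3) by (auto simp: p_def separated_def)
    next
      case False
      then have "1 \<le> \<bar>real k - real l\<bar>" by linarith
      then have "1 * (\<Lambda> * \<epsilon>) \<le> \<bar>real k - real l\<bar> * (\<Lambda> * \<epsilon>)"
        using \<epsilon> c(3) by (intro mult_right_mono) auto
      also have "\<dots> = \<bar>(real k - real l) * (\<Lambda> * \<epsilon>)\<bar>" using \<epsilon> c(3) by (simp add: abs_mult)
      also have "\<dots> = \<bar>\<Phi> (p (x, k)) - \<Phi> (p (y, l))\<bar>"
        using \<Phi>p that by (simp add: left_diff_distrib)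
      also have "\<dots> \<le> \<Lambda> * dist (p (x, k)) (p (y, l))" by (intro c(5) inball that)
      finally show ?thesis using c(3) by simp
    qed
    have inj: "inj_on p (F \<times> {..<N})"
    proof (rule inj_onI)
      fix u w assume "u \<in> F \<times> {..<N}" "w \<in> F \<times> {..<N}" "p u = p w"
      then show "u = w" using sep[of "fst u" "fst w" "snd u" "snd w"] \<epsilon>(1) by (cases u; cases w) force
    qed
    have "real (card (p ` (F \<times> {..<N}))) * (\<epsilon> / 2) ^ DIM('a) \<le> (2 * r + 1) ^ DIM('a)"
    proof (rule separated_card_le)
      show "separated \<epsilon> (p ` (F \<times> {..<N}))" using sep unfolding separated_def by fastforce
      show "p ` (F \<times> {..<N}) \<subseteq> ball z (2 * r)" using inball by fastforce
    qed (use F(1) \<epsilon> c(1) in auto)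
    then have "real (card F) * real N * (\<epsilon> / 2) ^ DIM('a) \<le> (2 * r + 1) ^ DIM('a)"
      by (simp add: card_image[OF inj] card_cartesian_product)
    moreover have "real (card F) * (r / (2 * \<Lambda> * \<epsilon>)) * (\<epsilon> / 2) ^ DIM('a) \<le> real (card F) * real N * (\<epsilon> / 2) ^ DIM('a)"
      using N2 \<epsilon> by (intro mult_right_mono mult_left_mono) auto
    ultimately have *: "real (card F) * (r / (2 * \<Lambda> * \<epsilon>)) * (\<epsilon> / 2) ^ DIM('a) \<le> (2 * r + 1) ^ DIM('a)" by linarith
    have "\<epsilon> ^ DIM('a) = \<epsilon> * \<epsilon> ^ (DIM('a) - 1)"
      using DIM_positive[where 'a = 'a] by (simp flip: power_Suc)
    then have "real (card F) * (r / (2 * \<Lambda> * \<epsilon>)) * (\<epsilon> / 2) ^ DIM('a)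
        = real (card F) * \<epsilon> ^ (DIM('a) - 1) * (r / (2 * \<Lambda>) / 2 ^ DIM('a))"
      using \<epsilon> by (simp add: power_divide)
    with * have "real (card F) * \<epsilon> ^ (DIM('a) - 1) * (r / (2 * \<Lambda>) / 2 ^ DIM('a)) \<le> (2 * r + 1) ^ DIM('a)" by simp
    then show "real (card F) * \<epsilon> ^ (DIM('a) - 1) \<le> C"
      using c(1,3) by (simp add: C_def field_simps)
  qed
qed

lemma frontier_packing:
  fixes \<Omega> :: "'a::euclidean_space set"
  assumes C1: "C1_boundary \<Omega>" and op: "open \<Omega>" and bd: "bounded \<Omega>"
  shows "\<exists>C \<epsilon>0. packing_bound (frontier \<Omega>) C \<epsilon>0"
proof -
  obtain r C e where rC: "\<And>z. z \<in> frontier \<Omega> \<Longrightarrow> 0 < r z \<and> packing_bound (frontier \<Omega> \<inter> ball z (r z)) (C z) (e z)"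
    using chart_packing[OF C1 op] by metis
  have "compact (frontier \<Omega>)" using bd by (rule compact_frontier_bounded)
  then obtain Z where Z: "Z \<subseteq> frontier \<Omega>" "finite Z" "frontier \<Omega> \<subseteq> (\<Union>z\<in>Z. ball z (r z))"
    by (rule compactE_image[where C = "frontier \<Omega>" and f = "\<lambda>z. ball z (r z)"]) (use rC in auto)
  show ?thesis
    unfolding packing_bound_def[of "frontier \<Omega>"]
  proof (rule exI[of _ "\<Sum>z\<in>Z. C z"], rule exI[of _ "Min (insert 1 (e ` Z))"], intro conjI allI impI)
    show "0 \<le> (\<Sum>z\<in>Z. C z)" using rC Z(1) unfolding packing_bound_def by (intro sum_nonneg) blast
    show "0 < Min (insert 1 (e ` Z))" using rC Z(1,2) by (auto simp: packing_bound_def)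
    fix F \<epsilon> assume F: "finite F" "F \<subseteq> frontier \<Omega>" "separated \<epsilon> F" "0 < \<epsilon>" "\<epsilon> \<le> Min (insert 1 (e ` Z))"
    have "F = (\<Union>z\<in>Z. F \<inter> ball z (r z))" using F(2) Z(3) by blast
    then have "card F \<le> (\<Sum>z\<in>Z. card (F \<inter> ball z (r z)))" using card_UN_le[OF Z(2)] by metis
    then have "real (card F) \<le> (\<Sum>z\<in>Z. real (card (F \<inter> ball z (r z))))"
      by (metis of_nat_le_iff of_nat_sum)
    then have "real (card F) * \<epsilon> ^ (DIM('a) - 1) \<le> (\<Sum>z\<in>Z. real (card (F \<inter> ball z (r z)))) * \<epsilon> ^ (DIM('a) - 1)"
      using F(4) by (intro mult_right_mono) auto
    also have "\<dots> \<le> (\<Sum>z\<in>Z. C z)"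
      unfolding sum_distrib_right
    proof (rule sum_mono)
      fix z assume z: "z \<in> Z"
      have "separated \<epsilon> (F \<inter> ball z (r z))" using F(3) by (auto simp: separated_def)
      moreover have "\<epsilon> \<le> e z" using F(5) z Z(2) by auto
      ultimately show "real (card (F \<inter> ball z (r z))) * \<epsilon> ^ (DIM('a) - 1) \<le> C z"
        using rC[of z] z Z(1) F(1,2,4) unfolding packing_bound_def
        by (metis finite_Int inf_le2 inf_mono order_refl subset_iff)
    qed
    finally show "real (card F) * \<epsilon> ^ (DIM('a) - 1) \<le> (\<Sum>z\<in>Z. C z)" .
  qed
qed

lemma maximal_separated:
  fixes S :: "'a::metric_space set"
  assumes "\<And>F. finite F \<Longrightarrow> F \<subseteq> S \<Longrightarrow> separated \<epsilon> F \<Longrightarrow> card F \<le> N"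
  obtains F where "finite F" "F \<subseteq> S" "separated \<epsilon> F" "S \<subseteq> (\<Union>x\<in>F. ball x \<epsilon>) \<union> F"
proof -
  define P where "P F \<longleftrightarrow> finite F \<and> F \<subseteq> S \<and> separated \<epsilon> F" for F
  have "P {}" by (simp add: P_def separated_def)
  then have "\<exists>F. P F \<and> (\<forall>F'. P F' \<longrightarrow> card F' \<le> card F)"
    by (rule ex_has_greatest_nat[where b = "Suc N"]) (use assms in \<open>auto simp: P_def less_Suc_eq_le\<close>)
  then obtain F where F: "P F" "\<And>F'. P F' \<Longrightarrow> card F' \<le> card F" by blast
  have "x \<in> (\<Union>x\<in>F. ball x \<epsilon>) \<union> F" if x: "x \<in> S" for x
  proof (rule ccontr)
    assume n: "x \<notin> (\<Union>x\<in>F. ball x \<epsilon>) \<union> F"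
    then have "P (insert x F)"
      using F(1) x by (auto simp: P_def separated_def not_less dist_commute)
    from F(2)[OF this] show False using n F(1) by (simp add: P_def)
  qed
  then have "S \<subseteq> (\<Union>x\<in>F. ball x \<epsilon>) \<union> F" by blast
  then show ?thesis using F(1) unfolding P_def by (intro that[of F]) blast+
qed

text \<open>The balls of radius \<open>\<epsilon>\<close> around a largest
  \<open>\<epsilon>\<close>-separated set cover the boundary, and the packing bound limits the sum
  of their gauges by a constant that does not depend on \<open>\<delta>\<close>.\<close>

lemma hausdorff_outer_frontier_finite:
  fixes \<Omega> :: "'a::euclidean_space set"
  assumes C1: "C1_boundary \<Omega>" and op: "open \<Omega>" and bd: "bounded \<Omega>" and dim: "2 \<le> DIM('a)"
  shows "hausdorff_outer (real DIM('a) - 1) (frontier \<Omega>) < \<infinity>"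
proof -
  let ?s = "real DIM('a) - 1"
  obtain C \<epsilon>0 where "packing_bound (frontier \<Omega>) C \<epsilon>0"
    using frontier_packing[OF C1 op bd] by blast
  then have C: "0 \<le> C" "0 < \<epsilon>0"
    "\<And>F \<epsilon>. finite F \<Longrightarrow> F \<subseteq> frontier \<Omega> \<Longrightarrow> separated \<epsilon> F \<Longrightarrow> 0 < \<epsilon> \<Longrightarrow> \<epsilon> \<le> \<epsilon>0 \<Longrightarrow>
      real (card F) * \<epsilon> ^ (DIM('a) - 1) \<le> C"
    by (auto simp: packing_bound_def)
  have "hausdorff_content ?s \<delta> (frontier \<Omega>) \<le> ennreal (unit_ball_vol ?s * C)" if \<delta>: "0 < \<delta>" for \<delta>
  proof -
    \<comment> \<open>A ball of radius \<open>\<epsilon>\<close> has diameter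
      \<open>2 * \<epsilon>\<close>, which must not exceed \<open>\<delta>\<close> for the gauge to
      be finite.\<close>
    define \<epsilon> where "\<epsilon> = min (\<delta> / 2) \<epsilon>0"
    have \<epsilon>: "0 < \<epsilon>" "\<epsilon> \<le> \<epsilon>0" "2 * \<epsilon> \<le> \<delta>" using \<delta> C(2) by (auto simp: \<epsilon>_def)
    have "card F \<le> nat \<lfloor>C / \<epsilon> ^ (DIM('a) - 1)\<rfloor>" if "finite F" "F \<subseteq> frontier \<Omega>" "separated \<epsilon> F" for F
      using C(3)[OF that \<epsilon>(1,2)] \<epsilon>(1) by (simp add: le_nat_floor pos_le_divide_eq)
    then obtain F where F: "finite F" "F \<subseteq> frontier \<Omega>" "separated \<epsilon> F" "frontier \<Omega> \<subseteq> (\<Union>x\<in>F. ball x \<epsilon>) \<union> F"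
      by (rule maximal_separated)
    obtain xs where xs: "set xs = F" "distinct xs" using F(1) finite_distinct_list by blast
    define U where "U i = (if i < length xs then ball (xs ! i) \<epsilon> else {})" for i
    have "frontier \<Omega> \<subseteq> (\<Union>i. U i)"
    proof
      fix x assume "x \<in> frontier \<Omega>"
      then obtain y where "y \<in> F" "x \<in> ball y \<epsilon>" using F(4) \<epsilon>(1) by fastforce
      then obtain i where "i < length xs" "x \<in> ball (xs ! i) \<epsilon>" using xs(1) by (auto simp: in_set_conv_nth)
      then show "x \<in> (\<Union>i. U i)" by (intro UN_I[of i]) (auto simp: U_def)
    qed
    then have "hausdorff_content ?s \<delta> (frontier \<Omega>) \<le> (\<Sum>i. hausdorff_gauge ?s \<delta> (U i))"
      unfolding hausdorff_content_def by (intro INF_lower) auto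
    also have "\<dots> = (\<Sum>i<length xs. hausdorff_gauge ?s \<delta> (U i))"
      by (rule suminf_finite) (use \<delta> in \<open>auto simp: U_def hausdorff_gauge_empty\<close>)
    also have "\<dots> \<le> (\<Sum>i<length xs. ennreal (unit_ball_vol ?s * \<epsilon> ^ (DIM('a) - 1)))"
    proof (rule sum_mono)
      fix i assume i: "i \<in> {..<length xs}"
      have diam: "diameter (ball (xs ! i) \<epsilon>) = 2 * \<epsilon>" using \<epsilon>(1) by (simp add: diameter_ball)
      have "\<epsilon> powr ?s = \<epsilon> ^ (DIM('a) - 1)"
        using \<epsilon>(1) dim powr_realpow[of \<epsilon> "DIM('a) - 1"] by (simp add: of_nat_diff)
      then show "hausdorff_gauge ?s \<delta> (U i) \<le> ennreal (unit_ball_vol ?s * \<epsilon> ^ (DIM('a) - 1))"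
        using i \<epsilon> diam by (simp add: U_def hausdorff_gauge_def)
    qed
    also have "\<dots> = ennreal (real (length xs) * (unit_ball_vol ?s * \<epsilon> ^ (DIM('a) - 1)))"
    proof -
      have "0 \<le> unit_ball_vol ?s * \<epsilon> ^ (DIM('a) - 1)"
        using dim \<epsilon>(1) by (intro mult_nonneg_nonneg unit_ball_vol_nonneg) auto
      then show ?thesis by (simp add: ennreal_mult ennreal_of_nat_eq_real_of_nat)
    qed
    also have "\<dots> \<le> ennreal (unit_ball_vol ?s * C)"
    proof (rule ennreal_leI)
      have "real (length xs) * \<epsilon> ^ (DIM('a) - 1) \<le> C"
        using C(3)[OF F(1-3) \<epsilon>(1,2)] xs distinct_card by fastforce
      then have "unit_ball_vol ?s * (real (length xs) * \<epsilon> ^ (DIM('a) - 1)) \<le> unit_ball_vol ?s * C"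
        using dim by (intro mult_left_mono) auto
      then show "real (length xs) * (unit_ball_vol ?s * \<epsilon> ^ (DIM('a) - 1)) \<le> unit_ball_vol ?s * C"
        by (simp add: mult_ac)
    qed
    finally show ?thesis .
  qed
  then have "hausdorff_outer ?s (frontier \<Omega>) \<le> ennreal (unit_ball_vol ?s * C)"
    unfolding hausdorff_outer_def by (intro SUP_least) auto
  then show ?thesis by (rule le_less_trans) simp
qed

section \<open>The heat resolvent\<close>

lemma measurable_fst_borel [measurable]:
  "fst \<in> (borel :: ('a::topological_space \<times> 'b::topological_space) measure) \<rightarrow>\<^sub>M borel"
  by (intro borel_measurable_continuous_onI continuous_intros)

lemma measurable_snd_borel [measurable]:
  "snd \<in> (borel :: ('a::topological_space \<times> 'b::topological_space) measure) \<rightarrow>\<^sub>M borel"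
  by (intro borel_measurable_continuous_onI continuous_intros)

lemma nn_integral_lborel_scaleR:
  fixes f :: "'a::euclidean_space \<Rightarrow> ennreal"
  assumes [measurable]: "f \<in> borel_measurable borel" and c: "0 < c"
  shows "(\<integral>\<^sup>+x. f x \<partial>lborel) = ennreal (c ^ DIM('a)) * (\<integral>\<^sup>+x. f (t + c *\<^sub>R x) \<partial>lborel)"
  using c
  by (subst lborel_affine[of c t]) (simp_all add: nn_integral_density nn_integral_distr nn_integral_cmult ennreal_power)

lemma nn_integral_lborel_translate:
  fixes f :: "'a::euclidean_space \<Rightarrow> ennreal"
  assumes [measurable]: "f \<in> borel_measurable borel"
  shows "(\<integral>\<^sup>+x. f (t + x) \<partial>lborel) = (\<integral>\<^sup>+x. f x \<partial>lborel)"
  using nn_integral_lborel_scaleR[OF assms, of 1 t] by simp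

lemma integral_lborel_translate:
  fixes f :: "'a::euclidean_space \<Rightarrow> real"
  assumes [measurable]: "f \<in> borel_measurable borel"
  shows "(LINT x|lborel. f (t + x)) = (LINT x|lborel. f x)"
  by (subst (2) lborel_distr_plus[symmetric, of t]) (simp add: integral_distr)

lemma nn_integral_gauss_finite:
  assumes c: "0 < c"
  shows "nn_integral lborel (\<lambda>x::'a::euclidean_space. ennreal (exp (- c * (norm x)\<^sup>2))) < \<infinity>"
proof -
  have "exp (- c * (norm x)\<^sup>2) = (\<Prod>b\<in>Basis. exp (- c * (x \<bullet> b)\<^sup>2))" for x :: 'a
  proof -
    have "(norm x)\<^sup>2 = x \<bullet> x" by (rule power2_norm_eq_inner)
    also have "\<dots> = (\<Sum>b\<in>Basis. (x \<bullet> b)\<^sup>2)" by (subst euclidean_inner) (simp add: power2_eq_square)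
    finally show ?thesis by (simp add: sum_distrib_left sum_negf flip: exp_sum)
  qed
  then have "nn_integral lborel (\<lambda>x::'a. ennreal (exp (- c * (norm x)\<^sup>2)))
      = nn_integral lborel (\<lambda>x::'a. (\<Prod>b\<in>Basis. ennreal (exp (- c * (x \<bullet> b)\<^sup>2))))"
    by (simp add: prod_ennreal)
  also have "\<dots> = (\<Prod>b\<in>(Basis :: 'a set). (\<integral>\<^sup>+v. ennreal (exp (- c * v\<^sup>2)) \<partial>lborel))"
    by (rule nn_integral_lborel_prod) auto
  also have "(\<integral>\<^sup>+v. ennreal (exp (- c * v\<^sup>2)) \<partial>lborel) = ennreal (sqrt (pi / c))"
    using integral_gauss[OF c] by (subst nn_integral_eq_integral) auto
  finally show ?thesis using c by (simp add: ennreal_power)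
qed

lemma nn_integral_power_exp:
  assumes \<mu>: "0 < \<mu>"
  shows "(\<integral>\<^sup>+\<tau>. ennreal (\<tau> ^ k * exp (- \<mu> * \<tau>)) * indicator {0<..} \<tau> \<partial>lborel) = ennreal (fact k / \<mu> ^ Suc k)"
proof -
  have "(\<integral>\<^sup>+\<tau>. ennreal (\<tau> ^ k * exp (- \<mu> * \<tau>)) * indicator {0<..} \<tau> \<partial>lborel)
      = (\<integral>\<^sup>+\<tau>. ennreal (\<tau> ^ k * exp (- \<mu> * \<tau>)) * indicator {0..} \<tau> \<partial>lborel)"
    by (intro nn_integral_cong_AE AE_I[where N = "{0}"]) (auto simp: indicator_def)
  also have "\<dots> = ennreal (1 / \<mu>) * (\<integral>\<^sup>+x. ennreal ((x / \<mu>) ^ k * exp (- x)) * indicator {0..} x \<partial>lborel)"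
    using \<mu> by (subst nn_integral_real_affine[where c = "1 / \<mu>" and t = 0])
      (auto intro!: arg_cong2[where f = times] nn_integral_cong simp: indicator_def zero_le_divide_iff)
  also have "(\<integral>\<^sup>+x. ennreal ((x / \<mu>) ^ k * exp (- x)) * indicator {0..} x \<partial>lborel)
      = (\<integral>\<^sup>+x. ennreal (1 / \<mu> ^ k) * (ennreal (x ^ k * exp (- x)) * indicator {0..} x) \<partial>lborel)"
    using \<mu> by (intro nn_integral_cong) (auto simp: indicator_def power_divide simp flip: ennreal_mult)
  also have "\<dots> = ennreal (1 / \<mu> ^ k) * ennreal (fact k)"
    by (subst nn_integral_cmult) (simp_all add: nn_intergal_power_times_exp_Ici)
  finally show ?thesis using \<mu> by (simp add: mult_ac flip: ennreal_mult)
qed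

lemma nn_integral_lborel_pair:
  fixes f :: "'a::euclidean_space \<times> 'b::euclidean_space \<Rightarrow> ennreal"
  assumes [measurable]: "f \<in> borel_measurable borel"
  shows "(\<integral>\<^sup>+p. f p \<partial>lborel) = (\<integral>\<^sup>+y. \<integral>\<^sup>+x. f (x, y) \<partial>lborel \<partial>lborel)"
proof -
  have "(\<integral>\<^sup>+p. f p \<partial>lborel) = (\<integral>\<^sup>+p. f p \<partial>(lborel \<Otimes>\<^sub>M lborel))" by (simp add: lborel_prod)
  also have "\<dots> = (\<integral>\<^sup>+y. \<integral>\<^sup>+x. f (x, y) \<partial>lborel \<partial>lborel)"
    by (subst lborel_pair.nn_integral_snd[symmetric]) (simp_all add: lborel_prod)
  finally show ?thesis .
qed

locale heat_resolvent =
  fixes L :: "real^'n \<Rightarrow> real^'n"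
  assumes lin: "linear L" and inj: "inj L"
begin

lemma L_measurable [measurable]: "L \<in> borel_measurable borel"
  using lin by (intro borel_measurable_continuous_onI linear_continuous_on) (simp add: linear_conv_bounded_linear)

text \<open>The spatial integral of \<open>heat_kernel\<close> at every positive time. It is left
  unevaluated and serves as the normalising constant.\<close>

definition gauss_mass :: real where
  "gauss_mass = (LINT z|lborel. exp (- (norm (L z))\<^sup>2 / 4))"

definition second_moment :: real where
  "second_moment = (LINT z|lborel. (norm z)\<^sup>2 * exp (- (norm (L z))\<^sup>2 / 4))"

lemma integrable_gauss:
  "integrable lborel (\<lambda>z. exp (- (norm (L z))\<^sup>2 / 4))"
  "integrable lborel (\<lambda>z. (norm z)\<^sup>2 * exp (- (norm (L z))\<^sup>2 / 4))"
proof -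
  obtain m where m: "0 < m" "\<And>z. m * norm z \<le> norm (L z)"
    using linear_inj_bounded_below_pos[OF lin inj] by blast
  \<comment> \<open>With this \<open>c\<close> the exponent \<open>(norm (L z))\<^sup>2 / 4\<close>
    is at least \<open>2 * c * (norm z)\<^sup>2\<close>: one Gaussian factor absorbs
    \<open>(norm z)\<^sup>2\<close>, the other stays integrable.\<close>
  define c where "c = m\<^sup>2 / 8"
  have c: "0 < c" using m by (simp add: c_def)
  have L2: "8 * c * (norm z)\<^sup>2 \<le> (norm (L z))\<^sup>2" for z
    using power_mono[OF m(2)[of z], of 2] m(1) by (simp add: c_def power_mult_distrib)
  have int: "integrable lborel (\<lambda>z::real^'n. exp (- c * (norm z)\<^sup>2))"
    using nn_integral_gauss_finite[OF c, where 'a = "real^'n"] by (intro integrableI_nonneg) auto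
  show "integrable lborel (\<lambda>z. exp (- (norm (L z))\<^sup>2 / 4))"
  proof (rule Bochner_Integration.integrable_bound[OF int])
    show "AE z in lborel. norm (exp (- (norm (L z))\<^sup>2 / 4)) \<le> norm (exp (- c * (norm z)\<^sup>2))"
    proof (rule AE_I2)
      fix z
      have "c * (norm z)\<^sup>2 \<le> (norm (L z))\<^sup>2 / 4" 
      proof -
        have "0 \<le> c * (norm z)\<^sup>2" using c by simp
        then show ?thesis using L2[of z] unfolding mult.assoc by linarith
      qed
      then show "norm (exp (- (norm (L z))\<^sup>2 / 4)) \<le> norm (exp (- c * (norm z)\<^sup>2))" by simp
    qed
  qed measurable
  have int': "integrable lborel (\<lambda>z::real^'n. (1 / c) * exp (- c * (norm z)\<^sup>2))"
    using int by simp
  show "integrable lborel (\<lambda>z. (norm z)\<^sup>2 * exp (- (norm (L z))\<^sup>2 / 4))"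
  proof (rule Bochner_Integration.integrable_bound[OF int'])
    show "AE z in lborel. norm ((norm z)\<^sup>2 * exp (- (norm (L z))\<^sup>2 / 4)) \<le> norm ((1 / c) * exp (- c * (norm z)\<^sup>2))"
    proof (rule AE_I2)
      fix z :: "real^'n"
      have "exp (- (norm (L z))\<^sup>2 / 4) \<le> exp (- c * (norm z)\<^sup>2) * exp (- c * (norm z)\<^sup>2)"
        using L2[of z] by (simp flip: exp_add)
      moreover have "c * (norm z)\<^sup>2 * exp (- c * (norm z)\<^sup>2) \<le> 1"
      proof -
        have "c * (norm z)\<^sup>2 \<le> exp (c * (norm z)\<^sup>2)"
          using exp_ge_add_one_self[of "c * (norm z)\<^sup>2"] by linarith
        then have "c * (norm z)\<^sup>2 * exp (- c * (norm z)\<^sup>2) \<le> exp (c * (norm z)\<^sup>2) * exp (- c * (norm z)\<^sup>2)"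
          by (intro mult_right_mono) auto
        then show ?thesis by (simp flip: exp_add)
      qed
      then have "(norm z)\<^sup>2 * exp (- c * (norm z)\<^sup>2) \<le> 1 / c" using c by (simp add: field_simps)
      ultimately have "(norm z)\<^sup>2 * exp (- (norm (L z))\<^sup>2 / 4) \<le> (1 / c) * exp (- c * (norm z)\<^sup>2)"
      proof -
        assume a: "exp (- (norm (L z))\<^sup>2 / 4) \<le> exp (- c * (norm z)\<^sup>2) * exp (- c * (norm z)\<^sup>2)"
          and b: "(norm z)\<^sup>2 * exp (- c * (norm z)\<^sup>2) \<le> 1 / c"
        have "(norm z)\<^sup>2 * exp (- (norm (L z))\<^sup>2 / 4) \<le> (norm z)\<^sup>2 * (exp (- c * (norm z)\<^sup>2) * exp (- c * (norm z)\<^sup>2))"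
          using a by (rule mult_left_mono) simp
        also have "\<dots> = (norm z)\<^sup>2 * exp (- c * (norm z)\<^sup>2) * exp (- c * (norm z)\<^sup>2)" by (simp only: mult.assoc)
        also have "\<dots> \<le> (1 / c) * exp (- c * (norm z)\<^sup>2)" using b by (rule mult_right_mono) simp
        finally show ?thesis .
      qed
      then show "norm ((norm z)\<^sup>2 * exp (- (norm (L z))\<^sup>2 / 4)) \<le> norm ((1 / c) * exp (- c * (norm z)\<^sup>2))"
        using c by simp
    qed
  qed measurable
qed

lemma gauss_mass_pos: "0 < gauss_mass"
proof -
  have "0 \<le> gauss_mass" unfolding gauss_mass_def by simp
  moreover have "gauss_mass \<noteq> 0"
  proof
    assume "gauss_mass = 0"
    then have "AE z in lborel. exp (- (norm (L z))\<^sup>2 / 4) = 0"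
      using integral_nonneg_eq_0_iff_AE[OF integrable_gauss(1)] by (simp add: gauss_mass_def)
    then have "AE z in (lborel :: (real^'n) measure). False" by (rule AE_mp) simp
    then have "emeasure (lborel :: (real^'n) measure) UNIV = 0"
      using AE_iff_measurable[of UNIV "lborel :: (real^'n) measure" "\<lambda>_. False"] by simp
    then show False by simp
  qed
  ultimately show ?thesis by simp
qed

text \<open>Parabolic scaling \<open>z = sqrt \<tau> * y\<close> reduces both integrals to time
  1.\<close>

lemma nn_integral_gauss_profile:
  assumes \<tau>: "0 < \<tau>"
  shows "(\<integral>\<^sup>+z. ennreal (heat_kernel L (z - m, \<tau>)) \<partial>lborel) = ennreal gauss_mass"
    and "(\<integral>\<^sup>+z. ennreal ((norm z)\<^sup>2 * heat_kernel L (z, \<tau>)) \<partial>lborel) = ennreal (\<tau> * second_moment)"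
proof -
  have hk: "heat_kernel L (sqrt \<tau> *\<^sub>R z, \<tau>) = (1 / sqrt \<tau>) ^ CARD('n) * exp (- (norm (L z))\<^sup>2 / 4)" for z
    using \<tau> by (simp add: heat_kernel_def gauss_profile_def linear_scale[OF lin] power_mult_distrib)
  have [measurable]: "(\<lambda>z. heat_kernel L (z, \<tau>)) \<in> borel_measurable borel"
    unfolding heat_kernel_def gauss_profile_def fst_conv snd_conv by measurable
  have one: "sqrt \<tau> ^ CARD('n) * (1 / sqrt \<tau>) ^ CARD('n) = 1"
    using \<tau> by (simp flip: power_mult_distrib)
  have "(\<integral>\<^sup>+z. ennreal (heat_kernel L (z - m, \<tau>)) \<partial>lborel) = (\<integral>\<^sup>+z. ennreal (heat_kernel L (z, \<tau>)) \<partial>lborel)"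
    using nn_integral_lborel_translate[of "\<lambda>z. ennreal (heat_kernel L (z, \<tau>))" "- m"] by simp
  also have "\<dots> = ennreal (sqrt \<tau> ^ CARD('n)) * (\<integral>\<^sup>+z. ennreal (heat_kernel L (sqrt \<tau> *\<^sub>R z, \<tau>)) \<partial>lborel)"
    using \<tau> by (subst nn_integral_lborel_scaleR[where c = "sqrt \<tau>" and t = 0]) auto
  also have "\<dots> = ennreal (sqrt \<tau> ^ CARD('n)) * (ennreal ((1 / sqrt \<tau>) ^ CARD('n)) * ennreal gauss_mass)"
  proof -
    have "(\<integral>\<^sup>+z. ennreal (heat_kernel L (sqrt \<tau> *\<^sub>R z, \<tau>)) \<partial>lborel)
        = (\<integral>\<^sup>+z. ennreal ((1 / sqrt \<tau>) ^ CARD('n)) * ennreal (exp (- (norm (L z))\<^sup>2 / 4)) \<partial>lborel)"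
      unfolding hk using \<tau> by (intro nn_integral_cong) (simp add: ennreal_mult)
    also have "\<dots> = ennreal ((1 / sqrt \<tau>) ^ CARD('n)) * (\<integral>\<^sup>+z. ennreal (exp (- (norm (L z))\<^sup>2 / 4)) \<partial>lborel)"
      by (rule nn_integral_cmult) measurable
    also have "(\<integral>\<^sup>+z. ennreal (exp (- (norm (L z))\<^sup>2 / 4)) \<partial>lborel) = ennreal gauss_mass"
      unfolding gauss_mass_def by (rule nn_integral_eq_integral[OF integrable_gauss(1)]) simp
    finally show ?thesis by simp
  qed
  also have "\<dots> = ennreal (sqrt \<tau> ^ CARD('n) * (1 / sqrt \<tau>) ^ CARD('n) * gauss_mass)"
    using \<tau> gauss_mass_pos by (simp add: ennreal_mult mult.assoc)
  finally show "(\<integral>\<^sup>+z. ennreal (heat_kernel L (z - m, \<tau>)) \<partial>lborel) = ennreal gauss_mass"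
    unfolding one by simp
  have sm: "0 \<le> second_moment" unfolding second_moment_def by simp
  have "(\<integral>\<^sup>+z. ennreal ((norm z)\<^sup>2 * heat_kernel L (z, \<tau>)) \<partial>lborel)
    = ennreal (sqrt \<tau> ^ CARD('n)) * (\<integral>\<^sup>+z. ennreal ((norm (sqrt \<tau> *\<^sub>R z))\<^sup>2 * heat_kernel L (sqrt \<tau> *\<^sub>R z, \<tau>)) \<partial>lborel)"
    using \<tau> by (subst nn_integral_lborel_scaleR[where c = "sqrt \<tau>" and t = 0]) auto
  also have "\<dots> = ennreal (sqrt \<tau> ^ CARD('n)) * (\<integral>\<^sup>+z. ennreal (\<tau> * (1 / sqrt \<tau>) ^ CARD('n)) * ennreal ((norm z)\<^sup>2 * exp (- (norm (L z))\<^sup>2 / 4)) \<partial>lborel)"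
    unfolding hk using \<tau>
    by (intro arg_cong2[where f = times] nn_integral_cong refl) (simp add: power_mult_distrib mult_ac flip: ennreal_mult)
  also have "\<dots> = ennreal (sqrt \<tau> ^ CARD('n)) * (ennreal (\<tau> * (1 / sqrt \<tau>) ^ CARD('n)) * ennreal second_moment)"
  proof -
    have e: "(\<integral>\<^sup>+z. ennreal ((norm z)\<^sup>2 * exp (- (norm (L z))\<^sup>2 / 4)) \<partial>lborel) = ennreal second_moment"
      unfolding second_moment_def by (rule nn_integral_eq_integral[OF integrable_gauss(2)]) simp
    show ?thesis by (subst nn_integral_cmult) (measurable, simp only: e)
  qed
  also have "\<dots> = ennreal (sqrt \<tau> ^ CARD('n) * (1 / sqrt \<tau>) ^ CARD('n) * (\<tau> * second_moment))"
    using \<tau> sm by (simp add: mult_ac flip: ennreal_mult)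
  finally show "(\<integral>\<^sup>+z. ennreal ((norm z)\<^sup>2 * heat_kernel L (z, \<tau>)) \<partial>lborel) = ennreal (\<tau> * second_moment)"
    unfolding one by simp
qed

lemma heat_kernel_nonneg [simp]: "0 \<le> heat_kernel L p"
  by (simp add: heat_kernel_def gauss_profile_nonneg)

lemma heat_kernel_measurable [measurable]: "heat_kernel L \<in> borel_measurable borel"
  unfolding heat_kernel_def gauss_profile_def by measurable

text \<open>The resolvent kernel of the operator \<open>H\<^sup>*\<close>: heat flow up to an exponential time of rate \<open>\<mu>\<close>.\<close>

definition kern :: "real \<Rightarrow> (real^'n) \<times> real \<Rightarrow> real" where
  "kern \<mu> p = exp (- \<mu> * snd p) * heat_kernel L p / gauss_mass"

lemma kern_nonneg [simp]: "0 \<le> kern \<mu> p"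
  using gauss_mass_pos by (simp add: kern_def)

lemma kern_measurable [measurable]: "kern \<mu> \<in> borel_measurable borel"
  unfolding kern_def[abs_def] by measurable

lemma kern_eq_0: "snd p \<le> 0 \<Longrightarrow> kern \<mu> p = 0"
  by (simp add: kern_def heat_kernel_def gauss_profile_def)

lemma nn_integral_kern:
  assumes \<mu>: "0 < \<mu>"
  shows "(\<integral>\<^sup>+p. ennreal (kern \<mu> p * \<bar>snd p\<bar> ^ k) \<partial>lborel) = ennreal (fact k / \<mu> ^ Suc k)"
    and "(\<integral>\<^sup>+p. ennreal (kern \<mu> p * (norm (fst p))\<^sup>2) \<partial>lborel) = ennreal (second_moment / gauss_mass / \<mu>\<^sup>2)"
proof -
  note gm = gauss_mass_pos
  have sm: "0 \<le> second_moment" unfolding second_moment_def by simp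
  have "(\<integral>\<^sup>+z. ennreal (kern \<mu> (z, \<tau>) * \<bar>snd (z, \<tau>)\<bar> ^ k) \<partial>lborel) = ennreal (\<tau> ^ k * exp (- \<mu> * \<tau>)) * indicator {0<..} \<tau>" for \<tau>
  proof (cases "0 < \<tau>")
    case True
    have "(\<integral>\<^sup>+z. ennreal (kern \<mu> (z, \<tau>) * \<bar>snd (z, \<tau>)\<bar> ^ k) \<partial>lborel)
        = (\<integral>\<^sup>+z. ennreal (\<tau> ^ k * exp (- \<mu> * \<tau>) / gauss_mass) * ennreal (heat_kernel L (z - 0, \<tau>)) \<partial>lborel)"
      using True gm by (intro nn_integral_cong) (simp add: kern_def mult_ac flip: ennreal_mult)
    also have "\<dots> = ennreal (\<tau> ^ k * exp (- \<mu> * \<tau>) / gauss_mass) * ennreal gauss_mass"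
      by (subst nn_integral_cmult) (simp, simp only: nn_integral_gauss_profile[OF True])
    finally show ?thesis using True gm by (simp flip: ennreal_mult)
  qed (simp add: kern_eq_0)
  then show "(\<integral>\<^sup>+p. ennreal (kern \<mu> p * \<bar>snd p\<bar> ^ k) \<partial>lborel) = ennreal (fact k / \<mu> ^ Suc k)"
    by (subst nn_integral_lborel_pair) (measurable, simp only: nn_integral_power_exp[OF \<mu>])
  have "(\<integral>\<^sup>+z. ennreal (kern \<mu> (z, \<tau>) * (norm (fst (z, \<tau>)))\<^sup>2) \<partial>lborel)
      = ennreal (second_moment / gauss_mass) * (ennreal (\<tau> ^ 1 * exp (- \<mu> * \<tau>)) * indicator {0<..} \<tau>)" for \<tau>
  proof (cases "0 < \<tau>")
    case True
    have "(\<integral>\<^sup>+z. ennreal (kern \<mu> (z, \<tau>) * (norm (fst (z, \<tau>)))\<^sup>2) \<partial>lborel)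
        = (\<integral>\<^sup>+z. ennreal (exp (- \<mu> * \<tau>) / gauss_mass) * ennreal ((norm z)\<^sup>2 * heat_kernel L (z, \<tau>)) \<partial>lborel)"
      using True gm by (intro nn_integral_cong) (simp add: kern_def mult_ac flip: ennreal_mult)
    also have "\<dots> = ennreal (exp (- \<mu> * \<tau>) / gauss_mass) * ennreal (\<tau> * second_moment)"
      by (subst nn_integral_cmult) (simp_all add: nn_integral_gauss_profile[OF True])
    finally show ?thesis using True gm sm by (simp add: mult_ac flip: ennreal_mult)
  qed (simp add: kern_eq_0)
  then have "(\<integral>\<^sup>+p. ennreal (kern \<mu> p * (norm (fst p))\<^sup>2) \<partial>lborel)
      = (\<integral>\<^sup>+\<tau>. ennreal (second_moment / gauss_mass) * (ennreal (\<tau> ^ 1 * exp (- \<mu> * \<tau>)) * indicator {0<..} \<tau>) \<partial>lborel)"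
    by (subst nn_integral_lborel_pair) (simp_all del: fst_conv)
  also have "\<dots> = ennreal (second_moment / gauss_mass) * ennreal (1 / \<mu>\<^sup>2)"
    using nn_integral_power_exp[OF \<mu>, of 1] by (subst nn_integral_cmult) (simp_all add: power2_eq_square)
  finally show "(\<integral>\<^sup>+p. ennreal (kern \<mu> p * (norm (fst p))\<^sup>2) \<partial>lborel) = ennreal (second_moment / gauss_mass / \<mu>\<^sup>2)"
    using gm sm by (simp flip: ennreal_mult)
qed

lemma kern_integral:
  assumes \<mu>: "0 < \<mu>"
  shows "integrable lborel (kern \<mu>)" "(LINT p|lborel. kern \<mu> p) = 1 / \<mu>"
    and "integrable lborel (\<lambda>p. kern \<mu> p * \<bar>snd p\<bar>)" "(LINT p|lborel. kern \<mu> p * \<bar>snd p\<bar>) = 1 / \<mu>\<^sup>2"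
    and "integrable lborel (\<lambda>p. kern \<mu> p * (norm (fst p))\<^sup>2)"
    and "(LINT p|lborel. kern \<mu> p * (norm (fst p))\<^sup>2) = second_moment / gauss_mass / \<mu>\<^sup>2"
proof -
  have sm: "0 \<le> second_moment" unfolding second_moment_def by simp
  have fst[measurable]: "(\<lambda>p. kern \<mu> p * (norm (fst p))\<^sup>2) \<in> borel_measurable borel"
    and snd[measurable]: "(\<lambda>p. kern \<mu> p * \<bar>snd p\<bar>) \<in> borel_measurable borel"
    by measurable
  have *: "has_bochner_integral lborel (kern \<mu>) (1 / \<mu>)"
    using nn_integral_kern(1)[OF \<mu>, of 0] \<mu> by (intro has_bochner_integral_nn_integral) auto
  show "integrable lborel (kern \<mu>)" "(LINT p|lborel. kern \<mu> p) = 1 / \<mu>"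
    using * by (auto simp: has_bochner_integral_iff)
  have *: "has_bochner_integral lborel (\<lambda>p. kern \<mu> p * \<bar>snd p\<bar>) (1 / \<mu>\<^sup>2)"
    using nn_integral_kern(1)[OF \<mu>, of 1] \<mu> by (intro has_bochner_integral_nn_integral) (auto simp: power2_eq_square)
  show "integrable lborel (\<lambda>p. kern \<mu> p * \<bar>snd p\<bar>)" "(LINT p|lborel. kern \<mu> p * \<bar>snd p\<bar>) = 1 / \<mu>\<^sup>2"
    using * by (auto simp: has_bochner_integral_iff)
  have *: "has_bochner_integral lborel (\<lambda>p. kern \<mu> p * (norm (fst p))\<^sup>2) (second_moment / gauss_mass / \<mu>\<^sup>2)"
    using nn_integral_kern(2)[OF \<mu>] \<mu> sm gauss_mass_pos by (intro has_bochner_integral_nn_integral) auto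
  show "integrable lborel (\<lambda>p. kern \<mu> p * (norm (fst p))\<^sup>2)"
    "(LINT p|lborel. kern \<mu> p * (norm (fst p))\<^sup>2) = second_moment / gauss_mass / \<mu>\<^sup>2"
    using * by (auto simp: has_bochner_integral_iff)
qed

text \<open>Chebyshev's inequality with the second moment in space and the first in time. Both are
  of order \<open>1 / \<mu>\<^sup>2\<close> while the mass is \<open>1 / \<mu>\<close>, so the
  probability density \<open>\<mu> * kern \<mu>\<close> concentrates at the origin with error of
  order \<open>1 / \<mu>\<close>.\<close>

lemma kern_concentration:
  "\<exists>s\<ge>0. \<forall>\<delta> \<mu>. 0 < \<delta> \<longrightarrow> 0 < \<mu> \<longrightarrow>
    \<mu> * (LINT q|lborel. kern \<mu> q * indicator {q. \<delta> \<le> norm q} q) \<le> (s / \<delta>\<^sup>2 + 2 / \<delta>) / \<mu>"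
proof -
  have sm: "0 \<le> second_moment" unfolding second_moment_def by simp
  show ?thesis
  proof (intro exI[of _ "4 * (second_moment / gauss_mass)"] conjI allI impI)
    show "0 \<le> 4 * (second_moment / gauss_mass)" using sm gauss_mass_pos by simp
    fix \<delta> :: real assume \<delta>: "0 < \<delta>"
    define C where "C = 4 * (second_moment / gauss_mass) / \<delta>\<^sup>2 + 2 / \<delta>"
    fix \<mu> :: real assume \<mu>: "0 < \<mu>"
    note k = kern_integral[OF \<mu>]
    have "(LINT q|lborel. kern \<mu> q * indicator {q. \<delta> \<le> norm q} q)
        \<le> (LINT q|lborel. 4 / \<delta>\<^sup>2 * (kern \<mu> q * (norm (fst q))\<^sup>2) + 2 / \<delta> * (kern \<mu> q * \<bar>snd q\<bar>))"
    proof (rule integral_mono')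
      show "integrable lborel (\<lambda>q. 4 / \<delta>\<^sup>2 * (kern \<mu> q * (norm (fst q))\<^sup>2) + 2 / \<delta> * (kern \<mu> q * \<bar>snd q\<bar>))"
        by (intro Bochner_Integration.integrable_add integrable_mult_right k)
      fix q :: "(real^'n) \<times> real"
      show "0 \<le> 4 / \<delta>\<^sup>2 * (kern \<mu> q * (norm (fst q))\<^sup>2) + 2 / \<delta> * (kern \<mu> q * \<bar>snd q\<bar>)"
        using \<delta> by (intro add_nonneg_nonneg mult_nonneg_nonneg) auto
      have "indicator {q. \<delta> \<le> norm q} q \<le> 4 / \<delta>\<^sup>2 * (norm (fst q))\<^sup>2 + 2 / \<delta> * \<bar>snd q\<bar>"
      proof (cases "\<delta> \<le> norm q")
        case True
        have "norm q \<le> norm (fst q) + \<bar>snd q\<bar>" using norm_Pair_le[of "fst q" "snd q"] by simp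
        then consider "\<delta> / 2 \<le> norm (fst q)" | "\<delta> / 2 \<le> \<bar>snd q\<bar>" using True by linarith
        then show ?thesis
        proof cases
          case 1
          have "(\<delta> / 2)\<^sup>2 \<le> (norm (fst q))\<^sup>2" using 1 \<delta> by (intro power_mono) auto
          then have "1 \<le> 4 / \<delta>\<^sup>2 * (norm (fst q))\<^sup>2" using \<delta> by (simp add: field_simps power_divide)
          moreover have "0 \<le> 2 / \<delta> * \<bar>snd q\<bar>" using \<delta> by simp
          ultimately show ?thesis using True by simp
        next
          case 2
          then have "1 \<le> 2 / \<delta> * \<bar>snd q\<bar>" using \<delta> by (simp add: field_simps)
          moreover have "0 \<le> 4 / \<delta>\<^sup>2 * (norm (fst q))\<^sup>2" by simp
          ultimately have "1 \<le> 4 / \<delta>\<^sup>2 * (norm (fst q))\<^sup>2 + 2 / \<delta> * \<bar>snd q\<bar>" by linarith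
          then show ?thesis using True by simp
        qed
      qed (use \<delta> in simp)
      then have "kern \<mu> q * indicator {q. \<delta> \<le> norm q} q \<le> kern \<mu> q * (4 / \<delta>\<^sup>2 * (norm (fst q))\<^sup>2 + 2 / \<delta> * \<bar>snd q\<bar>)"
        by (rule mult_left_mono) simp
      then show "kern \<mu> q * indicator {q. \<delta> \<le> norm q} q
          \<le> 4 / \<delta>\<^sup>2 * (kern \<mu> q * (norm (fst q))\<^sup>2) + 2 / \<delta> * (kern \<mu> q * \<bar>snd q\<bar>)"
        by (simp add: algebra_simps)
    qed
    also have "\<dots> = 4 / \<delta>\<^sup>2 * (LINT q|lborel. kern \<mu> q * (norm (fst q))\<^sup>2) + 2 / \<delta> * (LINT q|lborel. kern \<mu> q * \<bar>snd q\<bar>)"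
      by (subst Bochner_Integration.integral_add) (intro integrable_mult_right k, intro integrable_mult_right k, simp)
    also have "\<dots> = C / \<mu>\<^sup>2"
      unfolding k(4,6) by (simp add: C_def add_divide_distrib)
    finally have "\<mu> * (LINT q|lborel. kern \<mu> q * indicator {q. \<delta> \<le> norm q} q) \<le> \<mu> * (C / \<mu>\<^sup>2)"
      using \<mu> by (intro mult_left_mono) auto
    then show "\<mu> * (LINT q|lborel. kern \<mu> q * indicator {q. \<delta> \<le> norm q} q) \<le> (4 * (second_moment / gauss_mass) / \<delta>\<^sup>2 + 2 / \<delta>) / \<mu>"
      unfolding C_def[symmetric] using \<mu> by (simp add: power2_eq_square)
  qed
qed

end

section \<open>Mass at parabolic scales, the semigroup law and the resolvent equation\<close>

context heat_resolvent
begin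

text \<open>Scaling by \<open>r\<close> in space and \<open>r\<^sup>2\<close> in time makes the
  constant independent of \<open>r\<close>. The box is half of an exterior ball of radius
  \<open>\<kappa> * r\<close>, and it starts only at time \<open>2 * r\<^sup>2\<close> so that a
  base point less than \<open>r\<^sup>2\<close> below the top is still carried past the top by
  \<open>r\<^sup>2\<close>.\<close>

lemma kern_lower_mass:
  assumes \<kappa>: "0 < \<kappa>" "\<kappa> \<le> 1"
  shows "\<exists>c>0. \<forall>r z. 0 < r \<longrightarrow> norm z \<le> 2 * r \<longrightarrow>
    c \<le> 1 / r\<^sup>2 * (LINT q|lborel. kern (1 / r\<^sup>2) q * indicator (ball z (\<kappa> * r / 2) \<times> {2 * r\<^sup>2..3 * r\<^sup>2}) q)"
proof -
  obtain M where M: "0 < M" "\<And>z. norm (L z) \<le> M * norm z"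
    using linear_bounded_pos[OF lin] by blast
  define v where "v = measure lborel (ball (0::real^'n) 1)"
  have v: "0 < v" unfolding v_def by (simp add: content_ball_pos)
  \<comment> \<open>On the box, \<open>\<tau> \<le> 3 * r\<^sup>2\<close> accounts for
    \<open>exp (- 3)\<close>, and \<open>norm y \<le> 3 * r\<close> with
    \<open>\<tau> \<ge> 2 * r\<^sup>2\<close> for the exponent
    \<open>9 * M\<^sup>2 / 8\<close>.\<close>
  define c0 where "c0 = exp (- 3) * exp (- 9 * M\<^sup>2 / 8) / gauss_mass"
  have c0: "0 < c0" using gauss_mass_pos by (simp add: c0_def)
  define c where "c = c0 * (\<kappa> / (2 * sqrt 3)) ^ CARD('n) * v"
  show ?thesis
  proof (intro exI[of _ c] conjI allI impI)
    show "0 < c" using c0 \<kappa> v by (simp add: c_def)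
    fix r :: real and z :: "real^'n" assume r: "0 < r" and z: "norm z \<le> 2 * r"
    let ?S = "ball z (\<kappa> * r / 2) \<times> {2 * r\<^sup>2..3 * r\<^sup>2}"
    have S[measurable]: "?S \<in> sets borel" by (intro borel_Times) auto
    have "measure lborel (ball z (\<kappa> * r / 2)) = (\<kappa> * r / 2) ^ CARD('n) * v"
      using content_ball_conv_unit_ball[of "\<kappa> * r / 2" z] \<kappa> r by (simp add: v_def)
    then have mb: "emeasure lborel (ball z (\<kappa> * r / 2)) = ennreal ((\<kappa> * r / 2) ^ CARD('n) * v)"
      using emeasure_lborel_ball_finite[of z "\<kappa> * r / 2"] by (subst emeasure_eq_ennreal_measure) auto
    have "emeasure (lborel \<Otimes>\<^sub>M lborel) ?S = emeasure lborel (ball z (\<kappa> * r / 2)) * emeasure lborel {2 * r\<^sup>2..3 * r\<^sup>2}"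
      by (rule lborel.emeasure_pair_measure_Times) auto
    then have mS: "emeasure lborel ?S = ennreal ((\<kappa> * r / 2) ^ CARD('n) * v * r\<^sup>2)"
      using mb v \<kappa> r by (simp add: lborel_prod flip: ennreal_mult)
    define k where "k = c0 * (1 / (sqrt 3 * r)) ^ CARD('n)"
    have k: "0 < k" using c0 r by (simp add: k_def)
    have kS: "k \<le> kern (1 / r\<^sup>2) q" if q: "q \<in> ?S" for q
    proof -
      obtain y \<tau> where q': "q = (y, \<tau>)" by (cases q)
      have y: "dist z y < \<kappa> * r / 2" and \<tau>: "2 * r\<^sup>2 \<le> \<tau>" "\<tau> \<le> 3 * r\<^sup>2" using q q' by auto
      have r2: "0 < r\<^sup>2" using r by simp
      have \<tau>0: "0 < \<tau>" using \<tau>(1) r2 by linarith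
      have "\<kappa> * r \<le> 1 * r" using \<kappa> r by (intro mult_right_mono) auto
      moreover have "norm (y - z) < \<kappa> * r / 2" using y by (simp add: dist_norm norm_minus_commute)
      ultimately have "norm y \<le> 3 * r"
        using z r norm_triangle_ineq2[of y z] by linarith
      then have "norm (L y) \<le> M * (3 * r)" using M by (meson mult_left_mono less_imp_le order_trans)
      then have "(norm (L y))\<^sup>2 \<le> (M * (3 * r))\<^sup>2" by (rule power_mono) simp
      then have "(norm (L y))\<^sup>2 / (4 * \<tau>) \<le> (M * (3 * r))\<^sup>2 / (4 * (2 * r\<^sup>2))"
        using \<tau> r2 by (intro frac_le) auto
      also have "\<dots> = 9 * M\<^sup>2 / 8" using r by (simp add: power_mult_distrib)
      finally have e1: "exp (- 9 * M\<^sup>2 / 8) \<le> exp (- (norm (L y))\<^sup>2 / (4 * \<tau>))" by simp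
      have "sqrt \<tau> \<le> sqrt (3 * r\<^sup>2)" using \<tau>(2) by simp
      also have "\<dots> = sqrt 3 * r" using r by (simp add: real_sqrt_mult)
      finally have "sqrt \<tau> \<le> sqrt 3 * r" .
      then have e2: "(1 / (sqrt 3 * r)) ^ CARD('n) \<le> (1 / sqrt \<tau>) ^ CARD('n)"
        using \<tau>0 r by (intro power_mono divide_left_mono mult_pos_pos) auto
      have e3: "exp (- 3) \<le> exp (- (1 / r\<^sup>2) * \<tau>)"
        using \<tau>(2) r2 by (simp add: field_simps)
      have "exp (- 3) * ((1 / (sqrt 3 * r)) ^ CARD('n) * exp (- 9 * M\<^sup>2 / 8))
          \<le> exp (- (1 / r\<^sup>2) * \<tau>) * ((1 / sqrt \<tau>) ^ CARD('n) * exp (- (norm (L y))\<^sup>2 / (4 * \<tau>)))"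
        using r \<tau>0 by (intro mult_mono e1 e2 e3) auto
      then have "exp (- 3) * ((1 / (sqrt 3 * r)) ^ CARD('n) * exp (- 9 * M\<^sup>2 / 8)) / gauss_mass \<le> kern (1 / r\<^sup>2) q"
        unfolding kern_def q' heat_kernel_def gauss_profile_def fst_conv snd_conv if_P[OF \<tau>0]
        using gauss_mass_pos by (intro divide_right_mono) auto
      then show ?thesis by (simp add: k_def c0_def mult_ac)
    qed
    have "k * ((\<kappa> * r / 2) ^ CARD('n) * v * r\<^sup>2) = (LINT q|lborel. k * indicator ?S q)"
      using mS v \<kappa> r by (simp add: measure_def)
    also have "\<dots> \<le> (LINT q|lborel. kern (1 / r\<^sup>2) q * indicator ?S q)"
    proof (rule integral_mono')
      show "integrable lborel (\<lambda>q. kern (1 / r\<^sup>2) q * indicator ?S q)"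
        using kern_integral(1)[of "1 / r\<^sup>2"] r by (intro integrable_real_mult_indicator) auto
      show "k * indicator ?S q \<le> kern (1 / r\<^sup>2) q * indicator ?S q" for q
        using kS[of q] by (cases "q \<in> ?S") auto
    qed auto
    finally have "1 / r\<^sup>2 * (k * ((\<kappa> * r / 2) ^ CARD('n) * v * r\<^sup>2))
        \<le> 1 / r\<^sup>2 * (LINT q|lborel. kern (1 / r\<^sup>2) q * indicator ?S q)"
      by (rule mult_left_mono) simp
    moreover have "1 / r\<^sup>2 * (k * ((\<kappa> * r / 2) ^ CARD('n) * v * r\<^sup>2)) = c"
    proof -
      have "(1 / (sqrt 3 * r)) ^ CARD('n) * (\<kappa> * r / 2) ^ CARD('n) = (\<kappa> / (2 * sqrt 3)) ^ CARD('n)"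
      proof -
        have "1 / (sqrt 3 * r) * (\<kappa> * r / 2) = \<kappa> / (2 * sqrt 3)" using r by simp
        then show ?thesis by (simp only: flip: power_mult_distrib)
      qed
      then show ?thesis using r by (simp add: c_def k_def)
    qed
    ultimately show "c \<le> 1 / r\<^sup>2 * (LINT q|lborel. kern (1 / r\<^sup>2) q * indicator ?S q)" by simp
  qed
qed

text \<open>Completing the square in \<open>y\<close>: the product of two Gaussians is the kernel at
  the added times, multiplied by the Gaussian of the bridge from \<open>0\<close> to
  \<open>z\<close>. Integrating out \<open>y\<close> gives the semigroup law.\<close>

lemma heat_kernel_mult:
  assumes \<sigma>: "0 < \<sigma>" and \<rho>: "0 < \<rho>"
  shows "heat_kernel L (y, \<sigma>) * heat_kernel L (z - y, \<rho>)
    = heat_kernel L (z, \<sigma> + \<rho>) * heat_kernel L (y - (\<sigma> / (\<sigma> + \<rho>)) *\<^sub>R z, \<sigma> * \<rho> / (\<sigma> + \<rho>))"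
proof -
  let ?\<tau> = "\<sigma> + \<rho>" and ?s = "\<sigma> * \<rho> / (\<sigma> + \<rho>)"
  have \<tau>: "0 < ?\<tau>" "0 < ?s" using assms by auto
  define A C B where "A = L y \<bullet> L y" and "C = L y \<bullet> L z" and "B = L z \<bullet> L z"
  have n1: "(norm (L (z - y)))\<^sup>2 = B - 2 * C + A"
    unfolding linear_diff[OF lin] power2_norm_eq_inner A_def B_def C_def
    by (simp add: inner_diff_left inner_diff_right inner_commute)
  have n2: "(norm (L (y - (\<sigma> / ?\<tau>) *\<^sub>R z)))\<^sup>2 = A - 2 * (\<sigma> / ?\<tau>) * C + (\<sigma> / ?\<tau>)\<^sup>2 * B"
    unfolding linear_diff[OF lin] linear_scale[OF lin] power2_norm_eq_inner A_def B_def C_def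
    by (simp add: inner_diff_left inner_diff_right inner_commute power2_eq_square)
  have n3: "(norm (L y))\<^sup>2 = A" "(norm (L z))\<^sup>2 = B"
    unfolding power2_norm_eq_inner A_def B_def by auto
  have ex: "- A / (4 * \<sigma>) + - (B - 2 * C + A) / (4 * \<rho>)
      = - B / (4 * ?\<tau>) + - (A - 2 * (\<sigma> / ?\<tau>) * C + (\<sigma> / ?\<tau>)\<^sup>2 * B) / (4 * ?s)"
  proof -
    have "(A - 2 * (\<sigma> / ?\<tau>) * C + (\<sigma> / ?\<tau>)\<^sup>2 * B) / (4 * ?s) = (A * ?\<tau> - 2 * \<sigma> * C + \<sigma>\<^sup>2 / ?\<tau> * B) / (4 * \<sigma> * \<rho>)"
    proof -
      have *: "(A - 2 * (\<sigma> / t) * C + (\<sigma> / t)\<^sup>2 * B) / (4 * (\<sigma> * \<rho> / t)) = (A * t - 2 * \<sigma> * C + \<sigma>\<^sup>2 / t * B) / (4 * \<sigma> * \<rho>)"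
        if "t \<noteq> 0" for t
        using assms that by (simp add: field_simps power2_eq_square)
      have "?\<tau> \<noteq> 0" using \<tau>(1) by simp
      then show ?thesis by (rule *)
    qed
    moreover have "A / (4 * \<sigma>) + (B - 2 * C + A) / (4 * \<rho>) = B / (4 * ?\<tau>) + (A * ?\<tau> - 2 * \<sigma> * C + \<sigma>\<^sup>2 / ?\<tau> * B) / (4 * \<sigma> * \<rho>)"
    proof -
      define b where "b = B / ?\<tau>"
      have bB: "B / (4 * ?\<tau>) = b / 4" "\<sigma>\<^sup>2 / ?\<tau> * B = \<sigma> * B - \<sigma> * \<rho> * b"
      proof -
        have B: "B = b * ?\<tau>" using \<tau>(1) by (simp add: b_def)
        show "B / (4 * ?\<tau>) = b / 4" by (simp add: b_def)
        have "\<sigma>\<^sup>2 / ?\<tau> * B = \<sigma>\<^sup>2 * b" by (simp add: b_def)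
        also have "\<dots> = \<sigma> * B - \<sigma> * \<rho> * b" unfolding B by (simp add: algebra_simps power2_eq_square)
        finally show "\<sigma>\<^sup>2 / ?\<tau> * B = \<sigma> * B - \<sigma> * \<rho> * b" .
      qed
      have "A / (4 * \<sigma>) + (B - 2 * C + A) / (4 * \<rho>)
          = b / 4 + (A * (\<sigma> + \<rho>) - 2 * \<sigma> * C + (\<sigma> * B - \<sigma> * \<rho> * b)) / (4 * \<sigma> * \<rho>)" for b
      proof -
        have 1: "A * (\<sigma> + \<rho>) / (4 * \<sigma> * \<rho>) = A / (4 * \<rho>) + A / (4 * \<sigma>)"
          using assms by (simp add: field_simps)
        have 2: "2 * \<sigma> * C / (4 * \<sigma> * \<rho>) = 2 * C / (4 * \<rho>)" "\<sigma> * B / (4 * \<sigma> * \<rho>) = B / (4 * \<rho>)" "\<sigma> * \<rho> * b / (4 * \<sigma> * \<rho>) = b / 4"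
          using assms by simp_all
        show ?thesis unfolding add_divide_distrib diff_divide_distrib 1 2 by simp
      qed
      then show ?thesis unfolding bB .
    qed
    ultimately show ?thesis unfolding minus_divide_left[symmetric] by linarith
  qed
  have sq: "1 / sqrt \<sigma> * (1 / sqrt \<rho>) = 1 / sqrt ?\<tau> * (1 / sqrt ?s)"
    using assms \<tau> by (simp add: real_sqrt_mult real_sqrt_divide)
  have "heat_kernel L (y, \<sigma>) * heat_kernel L (z - y, \<rho>)
      = (1 / sqrt \<sigma> * (1 / sqrt \<rho>)) ^ CARD('n) * exp (- A / (4 * \<sigma>) + - (B - 2 * C + A) / (4 * \<rho>))"
    unfolding heat_kernel_def gauss_profile_def fst_conv snd_conv n1 n3 if_P[OF \<sigma>] if_P[OF \<rho>] power_mult_distrib exp_add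
    by (simp only: mult_ac)
  also have "\<dots> = heat_kernel L (z, ?\<tau>) * heat_kernel L (y - (\<sigma> / ?\<tau>) *\<^sub>R z, ?s)"
    unfolding sq ex heat_kernel_def gauss_profile_def fst_conv snd_conv n2 n3 if_P[OF \<tau>(1)] if_P[OF \<tau>(2)] power_mult_distrib exp_add
    by (simp only: mult_ac)
  finally show ?thesis .
qed

text \<open>The resolvent equation on the level of kernels. Integrating the intermediate point in
  space leaves \<open>exp (- (\<beta> - \<alpha>) * \<sigma>)\<close>, and its integral over the
  intermediate time produces the quotient, for either sign of
  \<open>\<beta> - \<alpha>\<close>.\<close>

lemma kern_convolution:
  assumes ne: "\<alpha> \<noteq> \<beta>"
  shows "(\<integral>\<^sup>+q. ennreal (kern \<beta> q * kern \<alpha> (w - q)) \<partial>lborel) = ennreal ((kern \<alpha> w - kern \<beta> w) / (\<beta> - \<alpha>))"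
proof -
  obtain z \<tau> where w: "w = (z, \<tau>)" by (cases w)
  note gm = gauss_mass_pos
  have inner: "(\<integral>\<^sup>+y. ennreal (kern \<beta> (y, \<sigma>) * kern \<alpha> (w - (y, \<sigma>))) \<partial>lborel)
      = ennreal (heat_kernel L w / gauss_mass * exp (- \<alpha> * \<tau>)) * (ennreal (exp (- (\<beta> - \<alpha>) * \<sigma>)) * indicator {0<..<\<tau>} \<sigma>)" for \<sigma>
  proof (cases "0 < \<sigma> \<and> \<sigma> < \<tau>")
    case True
    then have \<sigma>: "0 < \<sigma>" "0 < \<tau> - \<sigma>" by auto
    define c where "c = exp (- \<beta> * \<sigma>) * exp (- \<alpha> * (\<tau> - \<sigma>)) / gauss_mass\<^sup>2 * heat_kernel L w"
    have c: "0 \<le> c" by (simp add: c_def)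
    let ?m = "(\<sigma> / (\<sigma> + (\<tau> - \<sigma>))) *\<^sub>R z" and ?s = "\<sigma> * (\<tau> - \<sigma>) / (\<sigma> + (\<tau> - \<sigma>))"
    have s: "0 < ?s" using \<sigma> by simp
    have "kern \<beta> (y, \<sigma>) * kern \<alpha> (w - (y, \<sigma>)) = c * heat_kernel L (y - ?m, ?s)" for y
    proof -
      have "kern \<beta> (y, \<sigma>) * kern \<alpha> (w - (y, \<sigma>))
        = exp (- \<beta> * \<sigma>) * exp (- \<alpha> * (\<tau> - \<sigma>)) / gauss_mass\<^sup>2 * (heat_kernel L (y, \<sigma>) * heat_kernel L (z - y, \<tau> - \<sigma>))"
        by (simp add: kern_def w power2_eq_square)
      also have "heat_kernel L (y, \<sigma>) * heat_kernel L (z - y, \<tau> - \<sigma>)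
          = heat_kernel L (z, \<sigma> + (\<tau> - \<sigma>)) * heat_kernel L (y - ?m, ?s)"
        by (rule heat_kernel_mult[OF \<sigma>])
      finally show ?thesis by (simp add: c_def w)
    qed
    then have "(\<integral>\<^sup>+y. ennreal (kern \<beta> (y, \<sigma>) * kern \<alpha> (w - (y, \<sigma>))) \<partial>lborel)
        = (\<integral>\<^sup>+y. ennreal c * ennreal (heat_kernel L (y - ?m, ?s)) \<partial>lborel)"
      using c by (simp add: ennreal_mult)
    also have "\<dots> = ennreal c * ennreal gauss_mass"
      by (subst nn_integral_cmult) (measurable, simp only: nn_integral_gauss_profile(1)[OF s])
    also have "\<dots> = ennreal (c * gauss_mass)" using c gm by (simp add: ennreal_mult)
    also have "c * gauss_mass = heat_kernel L w / gauss_mass * exp (- \<alpha> * \<tau>) * exp (- (\<beta> - \<alpha>) * \<sigma>)"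
    proof -
      have "exp (- \<beta> * \<sigma>) * exp (- \<alpha> * (\<tau> - \<sigma>)) = exp (- \<alpha> * \<tau>) * exp (- (\<beta> - \<alpha>) * \<sigma>)"
        unfolding mult_exp_exp by (simp add: algebra_simps)
      then show ?thesis using gm by (simp add: c_def power2_eq_square)
    qed
    also have "ennreal \<dots> = ennreal (heat_kernel L w / gauss_mass * exp (- \<alpha> * \<tau>)) * ennreal (exp (- (\<beta> - \<alpha>) * \<sigma>))"
      using gm by (intro ennreal_mult) auto
    finally show ?thesis using True by simp
  next
    case False
    then have "kern \<beta> (y, \<sigma>) * kern \<alpha> (w - (y, \<sigma>)) = 0" for y
      using kern_eq_0[of "(y, \<sigma>)" \<beta>] kern_eq_0[of "w - (y, \<sigma>)" \<alpha>] by (auto simp: w)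
    then show ?thesis using False by (simp only: ennreal_0 nn_integral_const) simp
  qed
  have m: "(\<lambda>q. ennreal (kern \<beta> q * kern \<alpha> (w - q))) \<in> borel_measurable borel" by measurable
  have "(\<integral>\<^sup>+q. ennreal (kern \<beta> q * kern \<alpha> (w - q)) \<partial>lborel)
      = ennreal (heat_kernel L w / gauss_mass * exp (- \<alpha> * \<tau>)) * (\<integral>\<^sup>+\<sigma>. ennreal (exp (- (\<beta> - \<alpha>) * \<sigma>)) * indicator {0<..<\<tau>} \<sigma> \<partial>lborel)"
    unfolding nn_integral_lborel_pair[OF m] inner by (rule nn_integral_cmult) measurable
  also have "\<dots> = ennreal ((kern \<alpha> w - kern \<beta> w) / (\<beta> - \<alpha>))"
  proof (cases "0 < \<tau>")
    case False
    then have "heat_kernel L w = 0" by (simp add: w heat_kernel_def gauss_profile_def)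
    then show ?thesis by (simp add: kern_def)
  next
    case True
    have "(\<integral>\<^sup>+\<sigma>. ennreal (exp (- (\<beta> - \<alpha>) * \<sigma>)) * indicator {0<..<\<tau>} \<sigma> \<partial>lborel)
        = (\<integral>\<^sup>+\<sigma>. ennreal (exp (- (\<beta> - \<alpha>) * \<sigma>)) * indicator {0..\<tau>} \<sigma> \<partial>lborel)"
      by (intro nn_integral_cong_AE AE_I[where N = "{0, \<tau>}"]) (auto simp: indicator_def intro!: emeasure_lborel_countable)
    also have "\<dots> = ennreal ((- exp (- (\<beta> - \<alpha>) * \<tau>) / (\<beta> - \<alpha>)) - (- exp (- (\<beta> - \<alpha>) * 0) / (\<beta> - \<alpha>)))"
      using True ne by (intro nn_integral_FTC_Icc) (auto intro!: derivative_eq_intros simp: divide_simps, simp add: algebra_simps)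
    finally have e: "(\<integral>\<^sup>+\<sigma>. ennreal (exp (- (\<beta> - \<alpha>) * \<sigma>)) * indicator {0<..<\<tau>} \<sigma> \<partial>lborel)
      = ennreal ((1 - exp (- (\<beta> - \<alpha>) * \<tau>)) / (\<beta> - \<alpha>))" by (simp add: diff_divide_distrib)
    have pos: "0 \<le> (1 - exp (- (\<beta> - \<alpha>) * \<tau>)) / (\<beta> - \<alpha>)"
    proof (cases "\<alpha> < \<beta>")
      case True
      then show ?thesis using \<open>0 < \<tau>\<close> by (intro divide_nonneg_pos) (auto intro: mult_nonpos_nonneg)
    next
      case False
      then have "0 \<le> - (\<beta> - \<alpha>) * \<tau>" using \<open>0 < \<tau>\<close> by (intro mult_nonneg_nonneg) auto
      then have "1 - exp (- (\<beta> - \<alpha>) * \<tau>) \<le> 0" using one_le_exp_iff[of "- (\<beta> - \<alpha>) * \<tau>"] by linarith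
      then show ?thesis using False ne by (intro divide_nonpos_neg) auto
    qed
    have "heat_kernel L w / gauss_mass * exp (- \<alpha> * \<tau>) * ((1 - exp (- (\<beta> - \<alpha>) * \<tau>)) / (\<beta> - \<alpha>))
        = (kern \<alpha> w - kern \<beta> w) / (\<beta> - \<alpha>)"
    proof -
      have "exp (- \<alpha> * \<tau>) * exp (- (\<beta> - \<alpha>) * \<tau>) = exp (- \<beta> * \<tau>)"
        unfolding mult_exp_exp by (simp add: algebra_simps)
      then have "exp (- \<alpha> * \<tau>) * (1 - exp (- (\<beta> - \<alpha>) * \<tau>)) = exp (- \<alpha> * \<tau>) - exp (- \<beta> * \<tau>)"
        by (simp add: right_diff_distrib)
      then have "heat_kernel L w / gauss_mass * (exp (- \<alpha> * \<tau>) * (1 - exp (- (\<beta> - \<alpha>) * \<tau>))) / (\<beta> - \<alpha>)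
        = heat_kernel L w / gauss_mass * (exp (- \<alpha> * \<tau>) - exp (- \<beta> * \<tau>)) / (\<beta> - \<alpha>)" by simp
      then show ?thesis by (simp add: kern_def w algebra_simps diff_divide_distrib)
    qed
    then show ?thesis unfolding e using gm pos by (simp flip: ennreal_mult)
  qed
  finally show ?thesis .
qed

text \<open>The resolvent of \<open>H^*\<close> at \<open>\<mu>\<close>: heuristically
  \<open>R \<mu> f\<close> solves \<open>\<mu> * u - H^* u = f\<close>.\<close>

definition R :: "real \<Rightarrow> ((real^'n) \<times> real \<Rightarrow> real) \<Rightarrow> (real^'n) \<times> real \<Rightarrow> real" where
  "R \<mu> f p = (LINT q|lborel. kern \<mu> q * f (p + q))"

lemma R_measurable [measurable]:
  assumes [measurable]: "f \<in> borel_measurable borel"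
  shows "R \<mu> f \<in> borel_measurable borel"
  unfolding R_def[abs_def] by measurable

lemma R_integrable:
  assumes \<mu>: "0 < \<mu>" and [measurable]: "f \<in> borel_measurable borel" and B: "\<And>p. \<bar>f p\<bar> \<le> B"
  shows "integrable lborel (\<lambda>q. kern \<mu> q * f (p + q))"
proof (rule Bochner_Integration.integrable_bound)
  show "integrable lborel (\<lambda>q. kern \<mu> q * B)" using kern_integral(1)[OF \<mu>] by simp
  show "AE q in lborel. norm (kern \<mu> q * f (p + q)) \<le> norm (kern \<mu> q * B)"
    using B by (intro AE_I2) (auto simp: abs_mult intro!: mult_left_mono order_trans[OF B])
qed measurable

lemma R_const: "0 < \<mu> \<Longrightarrow> R \<mu> (\<lambda>p. c) p = c / \<mu>"
  using kern_integral(2)[of \<mu>] by (simp add: R_def)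

lemma R_mono:
  assumes \<mu>: "0 < \<mu>" and f: "f \<in> borel_measurable borel" "\<And>p. \<bar>f p\<bar> \<le> B"
    and g: "g \<in> borel_measurable borel" "\<And>p. \<bar>g p\<bar> \<le> B'" and le: "\<And>p. f p \<le> g p"
  shows "R \<mu> f p \<le> R \<mu> g p"
  unfolding R_def
  by (intro integral_mono R_integrable[OF \<mu> f] R_integrable[OF \<mu> g] mult_left_mono le) auto

lemma R_bound:
  assumes \<mu>: "0 < \<mu>" and f: "f \<in> borel_measurable borel" "\<And>p. \<bar>f p\<bar> \<le> B"
  shows "\<bar>R \<mu> f p\<bar> \<le> B / \<mu>"
proof -
  have "R \<mu> f p \<le> R \<mu> (\<lambda>p. B) p"
    by (rule R_mono[OF \<mu> f, where B' = "\<bar>B\<bar>"]) (use f(2) in \<open>auto intro: order_trans[OF abs_ge_self]\<close>)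
  moreover have "R \<mu> (\<lambda>p. - B) p \<le> R \<mu> f p"
    by (rule R_mono[OF \<mu> _ _ f, where B = "\<bar>B\<bar>"]) (use f(2) in \<open>auto intro: abs_le_D2 minus_le_iff[THEN iffD1]\<close>)
  ultimately show ?thesis using R_const[OF \<mu>, of B p] R_const[OF \<mu>, of "- B" p] by auto
qed

lemma R_add:
  assumes \<mu>: "0 < \<mu>" and f: "f \<in> borel_measurable borel" "\<And>p. \<bar>f p\<bar> \<le> B"
    and g: "g \<in> borel_measurable borel" "\<And>p. \<bar>g p\<bar> \<le> B'"
  shows "R \<mu> (\<lambda>p. f p + c * g p) p = R \<mu> f p + c * R \<mu> g p"
proof -
  have "R \<mu> (\<lambda>p. f p + c * g p) p = (LINT q|lborel. kern \<mu> q * f (p + q) + c * (kern \<mu> q * g (p + q)))"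
    unfolding R_def by (rule arg_cong[where f = "lebesgue_integral lborel"]) (auto simp: algebra_simps)
  also have "\<dots> = R \<mu> f p + c * R \<mu> g p"
    unfolding R_def using R_integrable[OF \<mu> f] R_integrable[OF \<mu> g] by simp
  finally show ?thesis .
qed

text \<open>Fubini reduces the claim to \<open>kern_convolution\<close>; positivity of the kernels
  and boundedness of \<open>g\<close> give absolute integrability.\<close>

lemma R_R:
  assumes \<alpha>: "0 < \<alpha>" and \<beta>: "0 < \<beta>" and ne: "\<alpha> \<noteq> \<beta>"
    and g[measurable]: "g \<in> borel_measurable borel" and B: "\<And>p. \<bar>g p\<bar> \<le> B"
  shows "R \<beta> (R \<alpha> g) p = (R \<alpha> g p - R \<beta> g p) / (\<beta> - \<alpha>)"
proof -
  have tr: "(LINT w|lborel. kern \<alpha> (w - q) * h (p + w)) = R \<alpha> h (p + q)"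
    if [measurable]: "h \<in> borel_measurable borel" for h :: "_ \<Rightarrow> real" and q
    using integral_lborel_translate[of "\<lambda>w. kern \<alpha> (w - q) * h (p + w)" q]
    by (simp add: R_def add.assoc)
  have ti: "integrable lborel (\<lambda>w. kern \<alpha> (w - q) * g (p + w))" for q
  proof -
    have "integrable (distr lborel borel ((+) q)) (\<lambda>w. kern \<alpha> (w - q) * g (p + w))"
      using R_integrable[OF \<alpha> g B, of "p + q"] by (subst integrable_distr_eq) (auto simp: add.assoc)
    then show ?thesis by (simp add: lborel_distr_plus)
  qed
  have int: "integrable (lborel \<Otimes>\<^sub>M lborel) (\<lambda>(q, w). kern \<beta> q * (kern \<alpha> (w - q) * g (p + w)))"
  proof (rule lborel_pair.Fubini_integrable)
    show "(\<lambda>(q, w). kern \<beta> q * (kern \<alpha> (w - q) * g (p + w))) \<in> borel_measurable (lborel \<Otimes>\<^sub>M lborel)"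
      by measurable
    have "integrable lborel (\<lambda>q. kern \<beta> q * R \<alpha> (\<lambda>p. \<bar>g p\<bar>) (p + q))"
      by (rule R_integrable[OF \<beta>, where B = "B / \<alpha>"]) (use R_bound[OF \<alpha>, of "\<lambda>p. \<bar>g p\<bar>" B] B in auto)
    then show "integrable lborel (\<lambda>q. LINT w|lborel. norm (case (q, w) of (q, w) \<Rightarrow> kern \<beta> q * (kern \<alpha> (w - q) * g (p + w))))"
      by (simp add: abs_mult tr[symmetric])
    show "AE q in lborel. integrable lborel (\<lambda>w. case (q, w) of (q, w) \<Rightarrow> kern \<beta> q * (kern \<alpha> (w - q) * g (p + w)))"
      using ti by simp
  qed
  have conv: "(LINT q|lborel. kern \<beta> q * kern \<alpha> (w - q)) = (kern \<alpha> w - kern \<beta> w) / (\<beta> - \<alpha>)" for w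
  proof -
    have "0 \<le> (kern \<alpha> w - kern \<beta> w) / (\<beta> - \<alpha>)"
    proof (cases "snd w > 0")
      case True
      have "kern \<alpha> w - kern \<beta> w = heat_kernel L w / gauss_mass * (exp (- \<alpha> * snd w) - exp (- \<beta> * snd w))"
        by (simp add: kern_def algebra_simps diff_divide_distrib)
      moreover have "0 \<le> (exp (- \<alpha> * snd w) - exp (- \<beta> * snd w)) / (\<beta> - \<alpha>)"
        using True ne by (cases "\<alpha> < \<beta>") (auto intro!: divide_nonneg_pos divide_nonpos_neg)
      ultimately show ?thesis using gauss_mass_pos
        by (simp only: times_divide_eq_right[symmetric]) (intro mult_nonneg_nonneg, auto)
    qed (simp add: kern_eq_0)
    then have "has_bochner_integral lborel (\<lambda>q. kern \<beta> q * kern \<alpha> (w - q)) ((kern \<alpha> w - kern \<beta> w) / (\<beta> - \<alpha>))"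
      by (intro has_bochner_integral_nn_integral kern_convolution[OF ne]) auto
    then show ?thesis by (simp add: has_bochner_integral_iff)
  qed
  have "R \<beta> (R \<alpha> g) p = (LINT q|lborel. LINT w|lborel. kern \<beta> q * (kern \<alpha> (w - q) * g (p + w)))"
    unfolding R_def[of \<beta>] by (simp add: tr)
  also have "\<dots> = (LINT w|lborel. LINT q|lborel. kern \<beta> q * (kern \<alpha> (w - q) * g (p + w)))"
    using lborel_pair.Fubini_integral[OF int] by simp
  also have "\<dots> = (LINT w|lborel. 1 / (\<beta> - \<alpha>) * (kern \<alpha> w * g (p + w) - kern \<beta> w * g (p + w)))"
  proof (rule arg_cong[where f = "lebesgue_integral lborel"], rule ext)
    fix w
    have "(LINT q|lborel. kern \<beta> q * (kern \<alpha> (w - q) * g (p + w))) = (LINT q|lborel. kern \<beta> q * kern \<alpha> (w - q)) * g (p + w)"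
      by (simp only: mult.assoc[symmetric] integral_mult_left_zero)
    then show "(LINT q|lborel. kern \<beta> q * (kern \<alpha> (w - q) * g (p + w)))
      = 1 / (\<beta> - \<alpha>) * (kern \<alpha> w * g (p + w) - kern \<beta> w * g (p + w))"
      unfolding conv by (simp add: left_diff_distrib)
  qed
  also have "\<dots> = (R \<alpha> g p - R \<beta> g p) / (\<beta> - \<alpha>)"
    unfolding R_def using R_integrable[OF \<alpha> g B] R_integrable[OF \<beta> g B] by simp
  finally show ?thesis .
qed

lemma resolvent_identity:
  assumes \<alpha>: "0 < \<alpha>" and \<beta>: "0 < \<beta>" and g: "g \<in> borel_measurable borel" "\<And>p. \<bar>g p\<bar> \<le> B"
  shows "R \<alpha> g p = R \<beta> (\<lambda>p. g p + (\<beta> - \<alpha>) * R \<alpha> g p) p"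
proof -
  have "R \<beta> (\<lambda>p. g p + (\<beta> - \<alpha>) * R \<alpha> g p) p = R \<beta> g p + (\<beta> - \<alpha>) * R \<beta> (R \<alpha> g) p"
    by (rule R_add[OF \<beta> g _ R_bound[OF \<alpha> g]]) (use g in measurable)
  also have "\<dots> = R \<alpha> g p"
    using R_R[OF \<alpha> \<beta> _ g, of p] by (cases "\<alpha> = \<beta>") simp_all
  finally show ?thesis ..
qed

text \<open>The converse of \<open>resolvent_identity\<close>, and thereby a uniqueness statement:
  \<open>v\<close> is the potential at rate \<open>\<beta>\<close> of \<open>G\<close>, and moving
  this potential to rate \<open>\<alpha>\<close> changes the source back to
  \<open>g\<close>.\<close>

lemma resolvent_change:
  assumes \<alpha>: "0 < \<alpha>" and \<beta>: "0 < \<beta>" and g: "g \<in> borel_measurable borel" "\<And>p. \<bar>g p\<bar> \<le> B"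
    and v: "v \<in> borel_measurable borel" "\<And>p. \<bar>v p\<bar> \<le> B'" and eq: "\<And>p. v p = R \<beta> (\<lambda>p. g p + (\<beta> - \<alpha>) * v p) p"
  shows "v p = R \<alpha> g p"
proof -
  define G where "G p = g p + (\<beta> - \<alpha>) * v p" for p
  have G: "G \<in> borel_measurable borel" unfolding G_def using g(1) v(1) by measurable
  have GB: "\<bar>G p\<bar> \<le> B + \<bar>\<beta> - \<alpha>\<bar> * B'" for p
    unfolding G_def
    using g(2)[of p] mult_left_mono[OF v(2)[of p], of "\<bar>\<beta> - \<alpha>\<bar>"] abs_triangle_ineq[of "g p" "(\<beta> - \<alpha>) * v p"]
    by (simp add: abs_mult)
  have vG: "v = R \<beta> G" unfolding G_def[abs_def] by (rule ext, rule eq)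
  have "v p = R \<alpha> (\<lambda>p. G p + (\<alpha> - \<beta>) * v p) p"
    unfolding vG by (rule resolvent_identity[OF \<beta> \<alpha> G GB])
  also have "(\<lambda>p. G p + (\<alpha> - \<beta>) * v p) = g" by (auto simp: G_def algebra_simps)
  finally show ?thesis .
qed

end

section \<open>Killing and sweeping out\<close>

context heat_resolvent
begin

text \<open>Iterates for \<open>v = R (1 + M) (g + M * indicator (- E) * v)\<close>: the source \<open>g\<close> is killed
  at rate \<open>M\<close> inside \<open>E\<close>.\<close>

primrec killed_iter :: "((real^'n) \<times> real) set \<Rightarrow> real \<Rightarrow> ((real^'n) \<times> real \<Rightarrow> real) \<Rightarrow> nat \<Rightarrow> (real^'n) \<times> real \<Rightarrow> real" where
  "killed_iter E M g 0 = (\<lambda>p. 0)"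
| "killed_iter E M g (Suc j) = R (1 + M) (\<lambda>p. g p + M * (indicator (- E) p * killed_iter E M g j p))"

definition killed :: "((real^'n) \<times> real) set \<Rightarrow> real \<Rightarrow> ((real^'n) \<times> real \<Rightarrow> real) \<Rightarrow> (real^'n) \<times> real \<Rightarrow> real" where
  "killed E M g p = lim (\<lambda>j. killed_iter E M g j p)"

context
  fixes E :: "((real^'n) \<times> real) set" and M :: real
  assumes E [measurable]: "E \<in> sets borel" and M: "0 \<le> M"
begin

lemma killed_iter_measurable [measurable]:
  assumes [measurable]: "g \<in> borel_measurable borel"
  shows "killed_iter E M g j \<in> borel_measurable borel"
  by (induction j) simp_all

text \<open>A source of at most 1 and a return flow of at most \<open>M\<close> meet a kernel of
  mass \<open>1 / (1 + M)\<close>.\<close>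

lemma killed_iter_bounds:
  assumes g: "g \<in> borel_measurable borel" "\<And>p. 0 \<le> g p" "\<And>p. g p \<le> 1"
  shows "0 \<le> killed_iter E M g j p \<and> killed_iter E M g j p \<le> 1"
proof (induction j arbitrary: p)
  case (Suc j)
  let ?f = "\<lambda>p. g p + M * (indicator (- E) p * killed_iter E M g j p)"
  have M1: "0 < 1 + M" using M by simp
  have f: "?f \<in> borel_measurable borel" using g(1) by measurable
  have f0: "0 \<le> ?f p" for p using g(2)[of p] Suc[of p] M by simp
  have f1: "?f p \<le> 1 + M" for p
  proof -
    have "M * (indicator (- E) p * killed_iter E M g j p) \<le> M * 1"
      using Suc[of p] M by (intro mult_left_mono) (auto simp: indicator_def)
    then show ?thesis using g(3)[of p] by simp
  qed
  have fB: "\<bar>?f p\<bar> \<le> 1 + M" for p using f0[of p] f1[of p] by simp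
  have "R (1 + M) (\<lambda>p. 0) p \<le> R (1 + M) ?f p"
    by (rule R_mono[OF M1 _ _ f fB f0, where B = 0]) auto
  moreover have "R (1 + M) ?f p \<le> (1 + M) / (1 + M)"
    using R_bound[OF M1 f fB, of p] by linarith
  ultimately show ?case using R_const[OF M1, of 0 p] M1 by simp
qed simp

lemma killed_iter_mono:
  assumes g: "g \<in> borel_measurable borel" "\<And>p. 0 \<le> g p" "\<And>p. g p \<le> 1"
    and h: "h \<in> borel_measurable borel" "\<And>p. h p \<le> 1" and le: "\<And>p. g p \<le> h p"
  shows "killed_iter E M g j p \<le> killed_iter E M h j p" and "killed_iter E M g j p \<le> killed_iter E M g (Suc j) p"
proof -
  have M1: "0 < 1 + M" using M by simp
  have h0: "0 \<le> h p" for p using g(2)[of p] le[of p] by simp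
  note bg = killed_iter_bounds[OF g] and bh = killed_iter_bounds[OF h(1) h0 h(2)]
  have bound: "\<bar>f p + M * (indicator (- E) p * killed_iter E M f j p)\<bar> \<le> 1 + M"
    if f: "f \<in> borel_measurable borel" "\<And>p. 0 \<le> f p" "\<And>p. f p \<le> 1" for f j p
  proof -
    note bf = killed_iter_bounds[OF f, of j p]
    have "M * (indicator (- E) p * killed_iter E M f j p) \<le> M * 1"
      using bf M by (intro mult_left_mono) (auto simp: indicator_def)
    moreover have "0 \<le> M * (indicator (- E) p * killed_iter E M f j p)" using bf M by simp
    ultimately show ?thesis using f(2,3)[of p] by simp
  qed
  have step: "R (1 + M) (\<lambda>p. f p + M * (indicator (- E) p * killed_iter E M f i p)) p
      \<le> R (1 + M) (\<lambda>p. f' p + M * (indicator (- E) p * killed_iter E M f' j p)) p"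
    if f: "f \<in> borel_measurable borel" "\<And>p. 0 \<le> f p" "\<And>p. f p \<le> 1"
      and f': "f' \<in> borel_measurable borel" "\<And>p. 0 \<le> f' p" "\<And>p. f' p \<le> 1"
      and ff': "\<And>p. f p \<le> f' p" "\<And>p. killed_iter E M f i p \<le> killed_iter E M f' j p" for f f' i j p
  proof (rule R_mono[OF M1 _ bound[OF f] _ bound[OF f']])
    show "(\<lambda>p. f p + M * (indicator (- E) p * killed_iter E M f i p)) \<in> borel_measurable borel"
      "(\<lambda>p. f' p + M * (indicator (- E) p * killed_iter E M f' j p)) \<in> borel_measurable borel"
      using f(1) f'(1) by measurable
    show "f p + M * (indicator (- E) p * killed_iter E M f i p) \<le> f' p + M * (indicator (- E) p * killed_iter E M f' j p)" for p
      using ff' M by (intro add_mono mult_left_mono) auto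
  qed
  show "killed_iter E M g j p \<le> killed_iter E M h j p"
  proof (induction j arbitrary: p)
    case (Suc j)
    then show ?case using step[OF g h(1) h0 h(2) le] by simp
  qed simp
  show "killed_iter E M g j p \<le> killed_iter E M g (Suc j) p"
  proof (induction j arbitrary: p)
    case 0
    then show ?case using bg[of "Suc 0" p] by simp
  next
    case (Suc j)
    then show ?case using step[OF g g order_refl, of j "Suc j"] by simp
  qed
qed

lemma killed_limit:
  assumes g: "g \<in> borel_measurable borel" "\<And>p. 0 \<le> g p" "\<And>p. g p \<le> 1"
  shows "(\<lambda>j. killed_iter E M g j p) \<longlonglongrightarrow> killed E M g p"
proof -
  have "incseq (\<lambda>j. killed_iter E M g j p)"
    by (intro incseq_SucI killed_iter_mono(2)[OF g g(1) g(3) order_refl])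
  moreover have "\<And>j. killed_iter E M g j p \<le> 1" using killed_iter_bounds[OF g] by blast
  ultimately obtain l where "(\<lambda>j. killed_iter E M g j p) \<longlonglongrightarrow> l"
    using incseq_convergent[of "\<lambda>j. killed_iter E M g j p" 1] by blast
  then have "convergent (\<lambda>j. killed_iter E M g j p)" by (rule convergentI)
  then show ?thesis unfolding killed_def by (simp add: convergent_LIMSEQ_iff)
qed

text \<open>The iterates increase and are bounded by 1, so they converge, and dominated convergence
  carries the recursion over to the limit.\<close>

lemma killed_props:
  assumes g: "g \<in> borel_measurable borel" "\<And>p. 0 \<le> g p" "\<And>p. g p \<le> 1"
  shows "killed E M g \<in> borel_measurable borel" and "0 \<le> killed E M g p" and "killed E M g p \<le> 1"
    and "killed E M g p \<le> killed E M (\<lambda>p. 1) p"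
    and "killed E M g p = R (1 + M) (\<lambda>p. g p + M * (indicator (- E) p * killed E M g p)) p"
proof -
  have M1: "0 < 1 + M" using M by simp
  note lim = killed_limit[OF g]
  have lim1: "(\<lambda>j. killed_iter E M (\<lambda>p. 1) j p) \<longlonglongrightarrow> killed E M (\<lambda>p. 1) p" by (rule killed_limit) auto
  show "killed E M g \<in> borel_measurable borel"
    by (rule borel_measurable_LIMSEQ_real[OF lim]) (use g(1) in measurable)
  show "0 \<le> killed E M g p" by (rule LIMSEQ_le_const[OF lim]) (use killed_iter_bounds[OF g] in auto)
  show "killed E M g p \<le> 1" by (rule LIMSEQ_le_const2[OF lim]) (use killed_iter_bounds[OF g] in auto)
  show "killed E M g p \<le> killed E M (\<lambda>p. 1) p"
    by (rule LIMSEQ_le[OF lim lim1]) (use killed_iter_mono(1)[OF g, of "\<lambda>p. 1"] g(3) in auto)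
  have "(\<lambda>j. killed_iter E M g (Suc j) p) \<longlonglongrightarrow> R (1 + M) (\<lambda>p. g p + M * (indicator (- E) p * killed E M g p)) p"
    unfolding killed_iter.simps R_def
  proof (rule integral_dominated_convergence[where w = "\<lambda>q. kern (1 + M) q * (1 + M)"])
    have km: "killed E M g \<in> borel_measurable borel"
      by (rule borel_measurable_LIMSEQ_real[OF lim]) (use g(1) in measurable)
    show "(\<lambda>q. kern (1 + M) q * (g (p + q) + M * (indicator (- E) (p + q) * killed E M g (p + q)))) \<in> borel_measurable lborel"
      using km g(1) by measurable
    show "(\<lambda>q. kern (1 + M) q * (g (p + q) + M * (indicator (- E) (p + q) * killed_iter E M g j (p + q)))) \<in> borel_measurable lborel" for j
      using g(1) by measurable
    show "integrable lborel (\<lambda>q. kern (1 + M) q * (1 + M))" using kern_integral(1)[OF M1] by simp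
    show "AE q in lborel. (\<lambda>j. kern (1 + M) q * (g (p + q) + M * (indicator (- E) (p + q) * killed_iter E M g j (p + q))))
      \<longlonglongrightarrow> kern (1 + M) q * (g (p + q) + M * (indicator (- E) (p + q) * killed E M g (p + q)))"
      by (intro AE_I2 tendsto_intros lim)
    show "AE q in lborel. norm (kern (1 + M) q * (g (p + q) + M * (indicator (- E) (p + q) * killed_iter E M g j (p + q))))
      \<le> kern (1 + M) q * (1 + M)" for j
    proof (rule AE_I2)
      fix q
      note b = killed_iter_bounds[OF g, of j "p + q"]
      have "M * (indicator (- E) (p + q) * killed_iter E M g j (p + q)) \<le> M * 1"
        using b M by (intro mult_left_mono) (auto simp: indicator_def)
      moreover have "0 \<le> M * (indicator (- E) (p + q) * killed_iter E M g j (p + q))" using b M by simp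
      ultimately have "\<bar>g (p + q) + M * (indicator (- E) (p + q) * killed_iter E M g j (p + q))\<bar> \<le> 1 + M"
        using g(2,3)[of "p + q"] by simp
      then show "norm (kern (1 + M) q * (g (p + q) + M * (indicator (- E) (p + q) * killed_iter E M g j (p + q)))) \<le> kern (1 + M) q * (1 + M)"
        by (simp add: abs_mult mult_left_mono)
    qed
  qed
  then show "killed E M g p = R (1 + M) (\<lambda>p. g p + M * (indicator (- E) p * killed E M g p)) p"
    using LIMSEQ_Suc[OF lim[of p]] LIMSEQ_unique by blast
qed

text \<open>Seen at rate 1, killing is a negative source \<open>- M * v\<close> on \<open>E\<close>.
  Read the other way, the potential of \<open>g\<close> is \<open>v\<close> plus the potential of a
  source carried by \<open>E\<close>, which is the sweeping out.\<close>

lemma killed_eq_R1: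
  assumes g: "g \<in> borel_measurable borel" "\<And>p. 0 \<le> g p" "\<And>p. g p \<le> 1"
  shows "killed E M g p = R 1 (\<lambda>p. g p - M * (indicator E p * killed E M g p)) p"
proof (rule resolvent_change[where \<beta> = "1 + M" and B = "1 + M" and B' = 1])
  note k = killed_props[OF g]
  show "(\<lambda>p. g p - M * (indicator E p * killed E M g p)) \<in> borel_measurable borel"
    using g(1) k(1) by measurable
  show "\<bar>g p - M * (indicator E p * killed E M g p)\<bar> \<le> 1 + M" for p
  proof -
    have "M * (indicator E p * killed E M g p) \<le> M * 1"
      using k(2,3)[of p] M by (intro mult_left_mono) (auto simp: indicator_def)
    moreover have "0 \<le> M * (indicator E p * killed E M g p)" using k(2)[of p] M by simp
    ultimately show ?thesis using g(2,3)[of p] by (simp add: abs_le_iff)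
  qed
  show "\<bar>killed E M g p\<bar> \<le> 1" for p using k(2,3)[of p] by simp
  have "g p - M * (indicator E p * killed E M g p) + (1 + M - 1) * killed E M g p
      = g p + M * (indicator (- E) p * killed E M g p)" for p
    by (cases "p \<in> E") auto
  then have fn: "(\<lambda>p. g p - M * (indicator E p * killed E M g p) + (1 + M - 1) * killed E M g p)
      = (\<lambda>p. g p + M * (indicator (- E) p * killed E M g p))" by (rule ext)
  show "killed E M g p = R (1 + M) (\<lambda>p. g p - M * (indicator E p * killed E M g p) + (1 + M - 1) * killed E M g p) p" for p
    unfolding fn by (rule k(5))
  show "killed E M g \<in> borel_measurable borel" by (rule killed_props(1)[OF g])
qed (use M in auto)

text \<open>A mean value inequality at every scale: moving the equation of
  \<open>killed_eq_R1\<close> to rate \<open>\<mu>\<close> and dropping the killing term bounds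
  \<open>u\<close> by its average under \<open>\<mu> * kern \<mu>\<close>, up to the error
  \<open>1 / \<mu>\<close>.\<close>

lemma killed_le_R:
  assumes \<mu>: "0 < \<mu>"
  shows "killed E M (\<lambda>p. 1) p \<le> R \<mu> (\<lambda>p. 1 + \<mu> * killed E M (\<lambda>p. 1) p) p"
proof -
  let ?u = "killed E M (\<lambda>p. 1)"
  let ?g = "\<lambda>p. 1 - M * (indicator E p * ?u p)"
  have one: "(\<lambda>p. 1::real) \<in> borel_measurable borel" "\<And>p. 0 \<le> (1::real)" "\<And>p. (1::real) \<le> 1" by auto
  note k = killed_props[of "\<lambda>p. 1", OF one]
  have um[measurable]: "?u \<in> borel_measurable borel" by (rule k(1))
  have m: "0 \<le> M * (indicator E p * ?u p)" "M * (indicator E p * ?u p) \<le> M" for p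
    using k(2,3)[of p] M mult_left_mono[of "indicator E p * ?u p" 1 M] by (auto simp: indicator_def)
  have gB: "\<bar>?g p\<bar> \<le> 1 + M" for p using m[of p] by (simp add: abs_le_iff)
  have gm: "?g \<in> borel_measurable borel" by measurable
  have u: "?u = R 1 ?g" using killed_eq_R1[of "\<lambda>p. 1", OF one] by (rule ext)
  have "?u p = R \<mu> (\<lambda>p. ?g p + (\<mu> - 1) * ?u p) p"
    using resolvent_identity[OF zero_less_one \<mu> gm gB, of p] u by simp
  also have "\<dots> \<le> R \<mu> (\<lambda>p. 1 + \<mu> * ?u p) p"
  proof (rule R_mono[OF \<mu>])
    show "(\<lambda>p. ?g p + (\<mu> - 1) * ?u p) \<in> borel_measurable borel" "(\<lambda>p. 1 + \<mu> * ?u p) \<in> borel_measurable borel"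
      by measurable
    fix p
    have "\<bar>(\<mu> - 1) * ?u p\<bar> \<le> \<bar>\<mu> - 1\<bar> * 1"
      unfolding abs_mult using k(2,3)[of p] by (intro mult_left_mono) auto
    then show "\<bar>?g p + (\<mu> - 1) * ?u p\<bar> \<le> 1 + M + \<bar>\<mu> - 1\<bar>" by (intro order_trans[OF abs_triangle_ineq] add_mono gB) simp
    have "\<mu> * ?u p \<le> \<mu> * 1" using k(3)[of p] \<mu> by (intro mult_left_mono) auto
    then show "\<bar>1 + \<mu> * ?u p\<bar> \<le> 1 + \<mu>" using k(2)[of p] \<mu> by simp
    show "?g p + (\<mu> - 1) * ?u p \<le> 1 + \<mu> * ?u p"
      using m(1)[of p] k(2)[of p] by (simp add: left_diff_distrib)
  qed
  finally show ?thesis .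
qed

text \<open>At rate \<open>1 + M\<close> mass returns only from outside \<open>E\<close>, hence from
  distance at least \<open>\<delta>\<close>, and the kernel puts little mass there.\<close>

lemma killed_deep:
  assumes \<delta>: "0 < \<delta>" and p: "ball p \<delta> \<subseteq> E"
  shows "killed E M (\<lambda>p. 1) p \<le> 1 / (1 + M) + (1 + M) * (LINT q|lborel. kern (1 + M) q * indicator {q. \<delta> \<le> norm q} q)"
proof -
  let ?u = "killed E M (\<lambda>p. 1)"
  have one: "(\<lambda>p. 1::real) \<in> borel_measurable borel" "\<And>p. 0 \<le> (1::real)" "\<And>p. (1::real) \<le> 1" by auto
  note k = killed_props[of "\<lambda>p. 1", OF one]
  have M1: "0 < 1 + M" using M by simp
  have um[measurable]: "?u \<in> borel_measurable borel" by (rule k(1))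
  have le: "M * (indicator (- E) p * ?u p) \<le> M" "0 \<le> M * (indicator (- E) p * ?u p)" for p
    using k(2,3)[of p] M mult_left_mono[of "indicator (- E) p * ?u p" 1 M] by (auto simp: indicator_def)
  have int: "integrable lborel (\<lambda>q. kern (1 + M) q * indicator {q. \<delta> \<le> norm q} q)"
    using kern_integral(1)[OF M1] by (intro integrable_real_mult_indicator) auto
  have "?u p = R (1 + M) (\<lambda>p. 1 + M * (indicator (- E) p * ?u p)) p" by (rule k(5))
  also have "\<dots> \<le> (LINT q|lborel. kern (1 + M) q + (1 + M) * (kern (1 + M) q * indicator {q. \<delta> \<le> norm q} q))"
    unfolding R_def
  proof (rule integral_mono)
    show "integrable lborel (\<lambda>q. kern (1 + M) q * (1 + M * (indicator (- E) (p + q) * ?u (p + q))))"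
      by (rule R_integrable[OF M1, of "\<lambda>p. 1 + M * (indicator (- E) p * ?u p)" "1 + M"])
         (measurable, use le in \<open>auto simp: abs_le_iff\<close>)
    show "integrable lborel (\<lambda>q. kern (1 + M) q + (1 + M) * (kern (1 + M) q * indicator {q. \<delta> \<le> norm q} q))"
      using kern_integral(1)[OF M1] int by auto
    fix q
    have "M * (indicator (- E) (p + q) * ?u (p + q)) \<le> (1 + M) * indicator {q. \<delta> \<le> norm q} q"
    proof (cases "\<delta> \<le> norm q")
      case True
      then show ?thesis using le(1)[of "p + q"] M by simp
    next
      case False
      then have "p + q \<in> E" using p by (auto simp: dist_norm subset_eq)
      then show ?thesis using M by simp
    qed
    then have "kern (1 + M) q * (1 + M * (indicator (- E) (p + q) * ?u (p + q))) \<le> kern (1 + M) q * (1 + (1 + M) * indicator {q. \<delta> \<le> norm q} q)"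
      by (intro mult_left_mono add_left_mono) auto
    then show "kern (1 + M) q * (1 + M * (indicator (- E) (p + q) * ?u (p + q))) \<le> kern (1 + M) q + (1 + M) * (kern (1 + M) q * indicator {q. \<delta> \<le> norm q} q)"
      by (simp add: algebra_simps)
  qed
  also have "\<dots> = 1 / (1 + M) + (1 + M) * (LINT q|lborel. kern (1 + M) q * indicator {q. \<delta> \<le> norm q} q)"
    using kern_integral(1,2)[OF M1] int by simp
  finally show ?thesis .
qed

end

section \<open>Smallness of the killed potential on the parabolic boundary\<close>

text \<open>Exterior sets at positive distance from \<open>C\<close> that exhaust the complement of
  a closed nonempty \<open>C\<close>. The same \<open>m\<close> will also be the killing
  rate.\<close>

definition ext :: "((real^'n) \<times> real) set \<Rightarrow> nat \<Rightarrow> ((real^'n) \<times> real) set" where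
  "ext C m = {p. 1 / (real m + 1) \<le> infdist p C}"

lemma ext_measurable [measurable]: "ext C m \<in> sets borel"
proof -
  have "closed (ext C m)"
    unfolding ext_def by (intro closed_Collect_le continuous_intros)
  then show ?thesis by simp
qed

text \<open>Every point near \<open>K\<close> sees a fixed proportion of the complement of \<open>C\<close> at each parabolic scale
  \<open>r\<close>, in the sense of the kernel with parameter \<open>1 / r\<^sup>2\<close>.\<close>

definition nonthin :: "((real^'n) \<times> real) set \<Rightarrow> ((real^'n) \<times> real) set \<Rightarrow> real \<Rightarrow> real \<Rightarrow> bool" where
  "nonthin C K c r1 \<longleftrightarrow> (\<forall>r. 0 < r \<and> r < r1 \<longrightarrow> (\<exists>\<delta>>0. \<exists>\<rho>>0. \<forall>p. infdist p K < \<rho> \<longrightarrow>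
     c \<le> 1 / r\<^sup>2 * (LINT q|lborel. kern (1 / r\<^sup>2) q * indicator {q. \<delta> \<le> infdist (p + q) C} q)))"

text \<open>In the mean value inequality at scale \<open>r\<close>, a proportion of at least
  \<open>c\<close> of the mass falls deep into the exterior, where the potential is almost 0. The
  rest stays near \<open>K\<close>, where it is at most \<open>b\<close>, or travels far, which is
  rare. Averaging leaves \<open>K\<close>, so the bounds refer to neighbourhoods of
  \<open>K\<close>.\<close>

lemma killed_small_step:
  assumes nt: "nonthin C K c r1" and r1: "0 < r1" and c: "0 < c" and b: "0 \<le> b" and \<epsilon>: "0 < \<epsilon>"
    and \<rho>: "0 < \<rho>" "\<And>m p. m0 \<le> m \<Longrightarrow> infdist p K < \<rho> \<Longrightarrow> killed (ext C m) (real m) (\<lambda>p. 1) p \<le> b"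
  shows "\<exists>\<rho>>0. \<exists>m0. \<forall>m\<ge>m0. \<forall>p. infdist p K < \<rho> \<longrightarrow> killed (ext C m) (real m) (\<lambda>p. 1) p \<le> (1 - c) * b + \<epsilon>"
proof -
  obtain s where s: "0 \<le> s" "\<And>\<delta> \<mu>. 0 < \<delta> \<Longrightarrow> 0 < \<mu> \<Longrightarrow>
    \<mu> * (LINT q|lborel. kern \<mu> q * indicator {q. \<delta> \<le> norm q} q) \<le> (s / \<delta>\<^sup>2 + 2 / \<delta>) / \<mu>"
    using kern_concentration by blast
  define A where "A = s / (\<rho> / 2)\<^sup>2 + 2 / (\<rho> / 2)"
  have A: "0 \<le> A" using s \<rho>(1) by (simp add: A_def)
  \<comment> \<open>The mean value inequality costs \<open>r\<^sup>2\<close> and the far part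
    \<open>A * r\<^sup>2\<close>. This \<open>r\<close> makes the sum at most
    \<open>\<epsilon> / 3\<close>.\<close>
  define r where "r = min (r1 / 2) (min 1 (\<epsilon> / (3 * (A + 1))))"
  have r: "0 < r" "r < r1" "r \<le> 1" "r \<le> \<epsilon> / (3 * (A + 1))"
    using r1 \<epsilon> A by (auto simp: r_def)
  have r2: "r\<^sup>2 * (A + 1) \<le> \<epsilon> / 3"
  proof -
    have "r\<^sup>2 * (A + 1) \<le> r * 1 * (A + 1)" unfolding power2_eq_square using r A by (intro mult_right_mono mult_left_mono) auto
    also have "\<dots> \<le> \<epsilon> / 3" using r(4) A by (simp add: field_simps)
    finally show ?thesis .
  qed
  let ?\<mu> = "1 / r\<^sup>2"
  have \<mu>: "0 < ?\<mu>" using r by simp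
  obtain \<delta> \<rho>2 where \<delta>: "0 < \<delta>" and \<rho>2: "0 < \<rho>2" "\<And>p. infdist p K < \<rho>2 \<Longrightarrow>
     c \<le> ?\<mu> * (LINT q|lborel. kern ?\<mu> q * indicator {q. \<delta> \<le> infdist (p + q) C} q)"
    using nt r(1,2) unfolding nonthin_def by blast
  define A2 where "A2 = s / (\<delta> / 2)\<^sup>2 + 2 / (\<delta> / 2)"
  have A2: "0 \<le> A2" using s \<delta> by (simp add: A2_def)
  \<comment> \<open>The first term puts balls of radius \<open>\<delta> / 2\<close> around points at
    distance \<open>\<delta>\<close> from \<open>C\<close> inside \<open>ext C m\<close>. The second
    makes the bound of \<open>killed_deep\<close> at most \<open>\<epsilon> / 3\<close>.\<close>
  define m1 where "m1 = nat \<lceil>max (2 / \<delta>) (3 * (A2 + 1) / \<epsilon>)\<rceil>"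
  show ?thesis
  proof (intro exI[of _ "min (\<rho> / 2) \<rho>2"] exI[of _ "max m0 m1"] conjI allI impI)
    show "0 < min (\<rho> / 2) \<rho>2" using \<rho> \<rho>2 by simp
    fix m p assume m: "max m0 m1 \<le> m" and p: "infdist p K < min (\<rho> / 2) \<rho>2"
    let ?u = "killed (ext C m) (real m) (\<lambda>p. 1)"
    have one: "(\<lambda>p. 1::real) \<in> borel_measurable borel" "\<And>p. 0 \<le> (1::real)" "\<And>p. (1::real) \<le> 1" by auto
    note k = killed_props[OF ext_measurable[of C m] of_nat_0_le_iff[of m] one]
    have um[measurable]: "?u \<in> borel_measurable borel" by (rule k(1))
    have "max (2 / \<delta>) (3 * (A2 + 1) / \<epsilon>) \<le> real m1" unfolding m1_def by linarith
    then have m1: "2 / \<delta> \<le> real m" "3 * (A2 + 1) / \<epsilon> \<le> real m" using m by linarith+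
    have m\<delta>: "1 / (real m + 1) \<le> \<delta> / 2" using m1(1) \<delta> by (simp add: field_simps)
    define \<eta> where "\<eta> = \<epsilon> / 3"
    have deep: "?u x \<le> \<eta>" if x: "\<delta> \<le> infdist x C" for x
    proof -
      have "ball x (\<delta> / 2) \<subseteq> ext C m"
      proof
        fix y assume "y \<in> ball x (\<delta> / 2)"
        then have "\<delta> / 2 \<le> infdist y C" using x infdist_triangle[of x C y] by simp
        then show "y \<in> ext C m" using m\<delta> by (simp add: ext_def)
      qed
      then have "?u x \<le> 1 / (1 + real m) + (1 + real m) * (LINT q|lborel. kern (1 + real m) q * indicator {q. \<delta> / 2 \<le> norm q} q)"
        using \<delta> by (intro killed_deep) auto
      also have "\<dots> \<le> 1 / (1 + real m) + A2 / (1 + real m)"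
        using s(2)[of "\<delta> / 2" "1 + real m"] \<delta> unfolding A2_def by simp
      also have "\<dots> \<le> \<eta>"
        using m1(2) \<epsilon> A2 unfolding \<eta>_def add_divide_distrib[symmetric] by (simp add: field_simps)
      finally show ?thesis .
    qed
    let ?Q1 = "{q. \<delta> \<le> infdist (p + q) C}" and ?Q2 = "{q. \<rho> / 2 \<le> norm q}"
    have Q1[measurable]: "?Q1 \<in> sets borel"
      by (intro borel_closed closed_Collect_le continuous_intros)
    have Q2[measurable]: "?Q2 \<in> sets borel"
      by (intro borel_closed closed_Collect_le continuous_intros)
    \<comment> \<open>On \<open>?Q1\<close> the bound \<open>b\<close> is cancelled; on
      \<open>?Q2\<close> the trivial bound 1 is paid.\<close>
    have split: "?u (p + q) \<le> \<eta> + b + indicator ?Q2 q - b * indicator ?Q1 q" for q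
    proof (cases "q \<in> ?Q1")
      case True
      then have "?u (p + q) \<le> \<eta>" using deep by simp
      then show ?thesis using True by (simp add: add_increasing2)
    next
      case nq1: False
      show ?thesis
      proof (cases "q \<in> ?Q2")
        case True
        then show ?thesis using nq1 k(3)[of "p + q"] b \<epsilon> by (simp add: \<eta>_def)
      next
        case False
        have "infdist (p + q) K \<le> infdist p K + norm q" using infdist_triangle[of "p + q" K p] by (simp add: dist_norm)
        then have "infdist (p + q) K < \<rho>" using p False by simp
        then have "?u (p + q) \<le> b" using \<rho>(2)[of m] m by simp
        then show ?thesis using nq1 False \<epsilon> by (simp add: \<eta>_def)
      qed
    qed
    have i0: "integrable lborel (kern ?\<mu>)" using kern_integral(1)[OF \<mu>] .
    have i1: "integrable lborel (\<lambda>q. kern ?\<mu> q * indicator ?Q1 q)" and i2: "integrable lborel (\<lambda>q. kern ?\<mu> q * indicator ?Q2 q)"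
      using i0 by (auto intro!: integrable_real_mult_indicator)
    have "?u p \<le> R ?\<mu> (\<lambda>p. 1 + ?\<mu> * ?u p) p" by (rule killed_le_R[OF _ _ \<mu>]) auto
    also have "\<dots> \<le> (LINT q|lborel. kern ?\<mu> q * (1 + ?\<mu> * (\<eta> + b)) + (?\<mu> * (kern ?\<mu> q * indicator ?Q2 q) - b * (?\<mu> * (kern ?\<mu> q * indicator ?Q1 q))))"
      unfolding R_def
    proof (rule integral_mono)
      have B: "\<bar>1 + ?\<mu> * ?u x\<bar> \<le> 1 + ?\<mu>" for x
      proof -
        have "?\<mu> * ?u x \<le> ?\<mu> * 1" using k(3)[of x] \<mu> by (intro mult_left_mono) auto
        then show ?thesis using k(2)[of x] \<mu> by simp
      qed
      show "integrable lborel (\<lambda>q. kern ?\<mu> q * (1 + ?\<mu> * ?u (p + q)))"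
        by (rule R_integrable[OF \<mu> _ B]) measurable
      show "integrable lborel (\<lambda>q. kern ?\<mu> q * (1 + ?\<mu> * (\<eta> + b)) + (?\<mu> * (kern ?\<mu> q * indicator ?Q2 q) - b * (?\<mu> * (kern ?\<mu> q * indicator ?Q1 q))))"
        by (intro Bochner_Integration.integrable_add Bochner_Integration.integrable_diff integrable_mult_left integrable_mult_right i0 i1 i2)
      fix q
      have "kern ?\<mu> q * (1 + ?\<mu> * ?u (p + q)) \<le> kern ?\<mu> q * (1 + ?\<mu> * (\<eta> + b + indicator ?Q2 q - b * indicator ?Q1 q))"
        using \<mu> split[of q] by (intro mult_left_mono add_left_mono) auto
      then show "kern ?\<mu> q * (1 + ?\<mu> * ?u (p + q)) \<le> kern ?\<mu> q * (1 + ?\<mu> * (\<eta> + b)) + (?\<mu> * (kern ?\<mu> q * indicator ?Q2 q) - b * (?\<mu> * (kern ?\<mu> q * indicator ?Q1 q)))"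
        by (simp add: distrib_left right_diff_distrib mult_ac)
    qed
    also have "\<dots> = 1 / ?\<mu> * (1 + ?\<mu> * (\<eta> + b)) + (?\<mu> * (LINT q|lborel. kern ?\<mu> q * indicator ?Q2 q) - b * (?\<mu> * (LINT q|lborel. kern ?\<mu> q * indicator ?Q1 q)))"
      using i0 i1 i2 kern_integral(2)[OF \<mu>]
      by (simp only: Bochner_Integration.integral_add Bochner_Integration.integral_diff integrable_mult_left integrable_mult_right
          Bochner_Integration.integrable_diff integral_mult_right_zero integral_mult_left_zero)
    also have "1 / ?\<mu> * (1 + ?\<mu> * (\<eta> + b)) = r\<^sup>2 + (\<eta> + b)" using r by (simp add: field_simps)
    also have "r\<^sup>2 + (\<eta> + b) + (?\<mu> * (LINT q|lborel. kern ?\<mu> q * indicator ?Q2 q) - b * (?\<mu> * (LINT q|lborel. kern ?\<mu> q * indicator ?Q1 q)))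
        \<le> r\<^sup>2 + (\<eta> + b) + (A * r\<^sup>2 - b * c)"
    proof (intro add_left_mono diff_mono mult_left_mono)
      show "?\<mu> * (LINT q|lborel. kern ?\<mu> q * indicator ?Q2 q) \<le> A * r\<^sup>2"
        using s(2)[of "\<rho> / 2" ?\<mu>] \<rho>(1) \<mu> unfolding A_def by simp
      show "c \<le> ?\<mu> * (LINT q|lborel. kern ?\<mu> q * indicator ?Q1 q)" using p by (intro \<rho>2) simp
    qed (rule b)
    also have "\<dots> = r\<^sup>2 * (A + 1) + \<eta> + (1 - c) * b" by (simp add: algebra_simps)
    also have "\<dots> \<le> (1 - c) * b + \<epsilon>" using r2 \<epsilon> by (simp add: \<eta>_def)
    finally show "?u p \<le> (1 - c) * b + \<epsilon>" .
  qed
qed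

text \<open>\<open>X\<close> collects the bounds valid near \<open>K\<close> for all large
  \<open>m\<close>. The step improves any such bound by the factor \<open>1 - c\<close> up to an
  arbitrary error, so the infimum of \<open>X\<close> cannot be positive.\<close>

lemma killed_small:
  assumes nt: "nonthin C K c r1" and r1: "0 < r1" and c: "0 < c" "c \<le> 1" and \<epsilon>: "0 < \<epsilon>"
  shows "\<exists>m. \<forall>p\<in>K. killed (ext C m) (real m) (\<lambda>p. 1) p \<le> \<epsilon>"
proof -
  define P where "P b \<longleftrightarrow> (\<exists>\<rho>>0. \<exists>m0. \<forall>m\<ge>m0. \<forall>p. infdist p K < \<rho> \<longrightarrow> killed (ext C m) (real m) (\<lambda>p. 1) p \<le> b)" for b
  define X where "X = {b. 0 \<le> b \<and> P b}"
  have "P 1"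
    unfolding P_def
    by (intro exI[of _ 1] exI[of _ 0] conjI allI impI killed_props(3)) auto
  then have X1: "1 \<in> X" by (simp add: X_def)
  have bdd: "bdd_below X" by (rule bdd_belowI[of _ 0]) (simp add: X_def)
  have I0: "0 \<le> Inf X" using X1 by (intro cInf_greatest) (blast, simp add: X_def)
  have "Inf X = 0"
  proof (rule ccontr)
    assume "Inf X \<noteq> 0"
    then have I: "0 < Inf X" using I0 by simp
    \<comment> \<open>With \<open>c * Inf X = 4 * e\<close> the improved bound is at most
      \<open>Inf X - 4 * e + e + e\<close>, below the infimum.\<close>
    define e where "e = c * Inf X / 4"
    have e: "0 < e" using c I by (simp add: e_def)
    obtain b where b: "b \<in> X" "b < Inf X + e"
      using cInf_lessD[of X "Inf X + e"] X1 e by auto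
    obtain \<rho> m0 where "0 < \<rho>" "\<And>m p. m0 \<le> m \<Longrightarrow> infdist p K < \<rho> \<Longrightarrow> killed (ext C m) (real m) (\<lambda>p. 1) p \<le> b"
      using b(1) unfolding X_def P_def by blast
    from killed_small_step[OF nt r1 c(1) _ e this] b(1)
    have "P ((1 - c) * b + e)" by (simp add: X_def P_def)
    then have "(1 - c) * b + e \<in> X" using b(1) c(2) e by (simp add: X_def)
    then have "Inf X \<le> (1 - c) * b + e" using bdd by (rule cInf_lower)
    also have "(1 - c) * b \<le> (1 - c) * (Inf X + e)" using b(2) c(2) by (intro mult_left_mono) auto
    also have "(1 - c) * (Inf X + e) = Inf X - 4 * e + (1 - c) * e" by (simp add: e_def algebra_simps)
    also have "(1 - c) * e \<le> 1 * e" using c e by (intro mult_right_mono) auto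
    finally show False using e by simp
  qed
  then obtain b where b: "b \<in> X" "b < \<epsilon>" using cInf_lessD[of X \<epsilon>] X1 \<epsilon> by auto
  then obtain \<rho> m0 where \<rho>: "0 < \<rho>" "\<forall>m\<ge>m0. \<forall>p. infdist p K < \<rho> \<longrightarrow> killed (ext C m) (real m) (\<lambda>p. 1) p \<le> b"
    unfolding X_def P_def by blast
  have "\<forall>p\<in>K. killed (ext C m0) (real m0) (\<lambda>p. 1) p \<le> b"
  proof
    fix p assume "p \<in> K"
    then have "infdist p K < \<rho>" using \<rho>(1) by simp
    then show "killed (ext C m0) (real m0) (\<lambda>p. 1) p \<le> b" using \<rho>(2) by blast
  qed
  then show ?thesis using b(2) by (meson less_imp_le order_trans)
qed

section \<open>Approximation by potentials of exterior sources\<close>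

lemma R_approx_identity:
  assumes f: "f \<in> borel_measurable borel" "\<And>p. \<bar>f p\<bar> \<le> B" and uc: "uniformly_continuous_on UNIV f" and \<epsilon>: "0 < \<epsilon>"
  shows "\<exists>\<mu>>0. \<forall>p. \<bar>\<mu> * R \<mu> f p - f p\<bar> \<le> \<epsilon>"
proof -
  obtain s where s: "0 \<le> s" "\<And>\<delta> \<mu>. 0 < \<delta> \<Longrightarrow> 0 < \<mu> \<Longrightarrow>
    \<mu> * (LINT q|lborel. kern \<mu> q * indicator {q. \<delta> \<le> norm q} q) \<le> (s / \<delta>\<^sup>2 + 2 / \<delta>) / \<mu>"
    using kern_concentration by blast
  obtain \<delta> where \<delta>: "0 < \<delta>" "\<And>p p'. dist p' p < \<delta> \<Longrightarrow> dist (f p') (f p) < \<epsilon> / 2"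
    using uc \<epsilon> unfolding uniformly_continuous_on_def by (metis UNIV_I half_gt_zero)
  have B: "0 \<le> B" using f(2)[of 0] by linarith
  define A where "A = s / \<delta>\<^sup>2 + 2 / \<delta>"
  have A: "0 \<le> A" using s \<delta> by (simp add: A_def)
  define \<mu> where "\<mu> = 4 * B * A / \<epsilon> + 1"
  have \<mu>: "0 < \<mu>" using A B \<epsilon> by (simp add: \<mu>_def add_nonneg_pos)
  have "\<bar>\<mu> * R \<mu> f p - f p\<bar> \<le> \<epsilon>" for p
  proof -
    let ?Q = "{q. \<delta> \<le> norm q}"
    have i0: "integrable lborel (kern \<mu>)" using kern_integral(1)[OF \<mu>] .
    have i1: "integrable lborel (\<lambda>q. kern \<mu> q * indicator ?Q q)"
      using i0 by (intro integrable_real_mult_indicator) auto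
    have "\<mu> * R \<mu> f p - f p = \<mu> * (LINT q|lborel. kern \<mu> q * f (p + q) - kern \<mu> q * f p)"
      using R_integrable[OF \<mu> f, of p] i0 kern_integral(2)[OF \<mu>] \<mu> by (simp add: R_def right_diff_distrib)
    also have "\<bar>\<dots>\<bar> \<le> \<mu> * (LINT q|lborel. kern \<mu> q * (\<epsilon> / 2) + 2 * B * (kern \<mu> q * indicator ?Q q))"
      unfolding abs_mult abs_of_pos[OF \<mu>]
    proof (rule mult_left_mono)
      have "norm (LINT q|lborel. kern \<mu> q * f (p + q) - kern \<mu> q * f p) \<le> (LINT q|lborel. kern \<mu> q * (\<epsilon> / 2) + 2 * B * (kern \<mu> q * indicator ?Q q))"
      proof (rule Bochner_Integration.integral_norm_bound_integral)
        show "integrable lborel (\<lambda>q. kern \<mu> q * f (p + q) - kern \<mu> q * f p)"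
          using R_integrable[OF \<mu> f, of p] i0 by simp
        show "integrable lborel (\<lambda>q. kern \<mu> q * (\<epsilon> / 2) + 2 * B * (kern \<mu> q * indicator ?Q q))"
          using i0 i1 by simp
        fix q
        have "\<bar>f (p + q) - f p\<bar> \<le> \<epsilon> / 2 + 2 * B * indicator ?Q q"
        proof (cases "\<delta> \<le> norm q")
          case True
          then show ?thesis using f(2)[of p] f(2)[of "p + q"] \<epsilon> by simp
        next
          case False
          then show ?thesis using \<delta>(2)[of "p + q" p] by (simp add: dist_norm)
        qed
        then have "kern \<mu> q * \<bar>f (p + q) - f p\<bar> \<le> kern \<mu> q * (\<epsilon> / 2 + 2 * B * indicator ?Q q)"
          by (rule mult_left_mono) simp
        moreover have "norm (kern \<mu> q * f (p + q) - kern \<mu> q * f p) = kern \<mu> q * \<bar>f (p + q) - f p\<bar>"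
          unfolding right_diff_distrib[symmetric] by (simp add: abs_mult)
        moreover have "kern \<mu> q * (\<epsilon> / 2 + 2 * B * indicator ?Q q) = kern \<mu> q * (\<epsilon> / 2) + 2 * B * (kern \<mu> q * indicator ?Q q)"
          by (simp only: distrib_left mult_ac)
        ultimately
        show "norm (kern \<mu> q * f (p + q) - kern \<mu> q * f p) \<le> kern \<mu> q * (\<epsilon> / 2) + 2 * B * (kern \<mu> q * indicator ?Q q)"
          by linarith
      qed
      then show "\<bar>LINT q|lborel. kern \<mu> q * f (p + q) - kern \<mu> q * f p\<bar> \<le> (LINT q|lborel. kern \<mu> q * (\<epsilon> / 2) + 2 * B * (kern \<mu> q * indicator ?Q q))" by simp
    qed (use \<mu> in simp)
    also have "\<dots> = \<epsilon> / 2 + 2 * B * (\<mu> * (LINT q|lborel. kern \<mu> q * indicator ?Q q))"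
      using i0 i1 kern_integral(2)[OF \<mu>] \<mu> by (simp add: distrib_left)
    also have "\<dots> \<le> \<epsilon> / 2 + 2 * B * (A / \<mu>)"
      using s(2)[OF \<delta>(1) \<mu>] B unfolding A_def by (intro add_left_mono mult_left_mono) auto
    also have "2 * B * (A / \<mu>) \<le> \<epsilon> / 2"
    proof -
      have "4 * B * A / \<epsilon> \<le> \<mu>" by (simp add: \<mu>_def)
      then have "4 * B * A \<le> \<mu> * \<epsilon>" using \<epsilon> by (simp add: field_simps)
      then show ?thesis using \<mu> by (simp add: field_simps)
    qed
    finally show ?thesis by simp
  qed
  then show ?thesis using \<mu> by blast
qed

lemma R_cmult: "R \<mu> (\<lambda>p. c * f p) p = c * R \<mu> f p"
proof -
  have "R \<mu> (\<lambda>p. c * f p) p = (LINT q|lborel. c * (kern \<mu> q * f (p + q)))"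
    unfolding R_def by (simp add: mult_ac)
  then show ?thesis by (simp add: R_def)
qed

text \<open>Three errors of \<open>\<epsilon> / 3\<close> occur: replacing \<open>f\<close> by
  \<open>\<mu> * R \<mu> f\<close>, sweeping the source of the latter out to the exterior, and
  cutting the swept source off far away. Its positive distance from \<open>C\<close> comes from
  killing only in \<open>ext C m\<close>.\<close>

lemma exterior_potential_approx:
  assumes nt: "nonthin C K c r1" and r1: "0 < r1" and c: "0 < c" "c \<le> 1" and Kb: "bounded K"
    and f: "f \<in> borel_measurable borel" "\<And>p. \<bar>f p\<bar> \<le> B" and uc: "uniformly_continuous_on UNIV f" and \<epsilon>: "0 < \<epsilon>"
  shows "\<exists>G D \<delta> S. G \<in> borel_measurable borel \<and> (\<forall>p. \<bar>G p\<bar> \<le> D) \<and> 0 < \<delta> \<and>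
    (\<forall>p. G p \<noteq> 0 \<longrightarrow> \<delta> \<le> infdist p C \<and> norm p \<le> S) \<and> (\<forall>p\<in>K. \<bar>f p - R 1 G p\<bar> \<le> \<epsilon>)"
proof -
  obtain \<mu> where \<mu>: "0 < \<mu>" "\<And>p. \<bar>\<mu> * R \<mu> f p - f p\<bar> \<le> \<epsilon> / 3"
    using R_approx_identity[OF f uc, of "\<epsilon> / 3"] \<epsilon> by auto
  \<comment> \<open>By the resolvent identity this is the rate-1 source of
    \<open>\<mu> * R \<mu> f\<close>.\<close>
  define \<rho> where "\<rho> p = \<mu> * (f p + (1 - \<mu>) * R \<mu> f p)" for p
  have \<rho>m[measurable]: "\<rho> \<in> borel_measurable borel" unfolding \<rho>_def using f(1) by measurable
  have B: "0 \<le> B" using f(2)[of 0] by linarith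
  define D where "D = \<mu> * (B + \<bar>1 - \<mu>\<bar> * (B / \<mu>)) + 1"
  have D: "0 < D" using \<mu>(1) B by (simp add: D_def add_nonneg_pos)
  have \<rho>B: "\<bar>\<rho> p\<bar> \<le> D" for p
  proof -
    have "\<bar>(1 - \<mu>) * R \<mu> f p\<bar> \<le> \<bar>1 - \<mu>\<bar> * (B / \<mu>)"
      unfolding abs_mult by (intro mult_left_mono R_bound[OF \<mu>(1) f]) auto
    then have "\<bar>f p + (1 - \<mu>) * R \<mu> f p\<bar> \<le> B + \<bar>1 - \<mu>\<bar> * (B / \<mu>)"
      using f(2)[of p] by linarith
    then have "\<mu> * \<bar>f p + (1 - \<mu>) * R \<mu> f p\<bar> \<le> \<mu> * (B + \<bar>1 - \<mu>\<bar> * (B / \<mu>))"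
      using \<mu>(1) by (intro mult_left_mono) auto
    moreover have "\<bar>\<rho> p\<bar> = \<mu> * \<bar>f p + (1 - \<mu>) * R \<mu> f p\<bar>" using \<mu>(1) by (simp add: \<rho>_def abs_mult)
    ultimately show ?thesis unfolding D_def by linarith
  qed
  have R\<rho>: "\<mu> * R \<mu> f p = R 1 \<rho> p" for p
    using resolvent_identity[OF \<mu>(1) zero_less_one f, of p] unfolding \<rho>_def R_cmult by simp
  obtain m where m: "\<And>p. p \<in> K \<Longrightarrow> killed (ext C m) (real m) (\<lambda>p. 1) p \<le> \<epsilon> / 3 / D"
    using killed_small[OF nt r1 c, of "\<epsilon> / 3 / D"] \<epsilon> D by auto
  let ?E = "ext C m" and ?M = "real m"
  \<comment> \<open>Killed potentials are available for sources in \<open>[0, 1]\<close> only. Here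
    \<open>\<rho> = D * (2 * g - 1)\<close>, so by linearity the combination \<open>w\<close> of the
    killed potentials of \<open>g\<close> and of 1 serves for \<open>\<rho>\<close>.\<close>
  define g where "g p = (\<rho> p / D + 1) / 2" for p
  have g: "g \<in> borel_measurable borel" "\<And>p. 0 \<le> g p" "\<And>p. g p \<le> 1"
  proof -
    have "- D \<le> \<rho> p" "\<rho> p \<le> D" for p using \<rho>B[of p] by linarith+
    then have "- 1 \<le> \<rho> p / D" "\<rho> p / D \<le> 1" for p using D by (simp_all add: le_divide_eq)
    then have x: "- 1 \<le> \<rho> p / D" "\<rho> p / D \<le> 1" for p by blast+
    show "0 \<le> g p" for p unfolding g_def using x(1)[of p] by simp
    show "g p \<le> 1" for p unfolding g_def using x(2)[of p] by simp
    show "g \<in> borel_measurable borel" unfolding g_def by measurable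
  qed
  have one: "(\<lambda>p. 1::real) \<in> borel_measurable borel" "\<And>p. 0 \<le> (1::real)" "\<And>p. (1::real) \<le> 1" by auto
  define v u where "v = killed ?E ?M g" and "u = killed ?E ?M (\<lambda>p. 1)"
  note kv = killed_props[OF ext_measurable[of C m] of_nat_0_le_iff[of m] g, folded v_def u_def]
  note ku = killed_props[OF ext_measurable[of C m] of_nat_0_le_iff[of m] one, folded u_def]
  have vm[measurable]: "v \<in> borel_measurable borel" and um[measurable]: "u \<in> borel_measurable borel"
    using kv(1) ku(1) by auto
  define w where "w p = D * (2 * v p - u p)" for p
  define G where "G p = ?M * (indicator ?E p * w p)" for p
  have Gm[measurable]: "G \<in> borel_measurable borel" unfolding G_def w_def by measurable
  \<comment> \<open>From \<open>0 \<le> v \<le> u\<close> follows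
    \<open>\<bar>2 * v - u\<bar> \<le> u\<close>, so smallness of the killed potential of the
    constant 1 controls all sources at once.\<close>
  have w_le: "\<bar>w p\<bar> \<le> D * u p" for p
    using kv(2,4)[of p] D by (auto simp: w_def abs_mult intro!: mult_left_mono)
  have wD: "\<bar>w p\<bar> \<le> D" for p
    using w_le[of p] mult_left_mono[OF ku(3)[of p], of D] D by linarith
  have GB: "\<bar>G p\<bar> \<le> ?M * D" for p
    unfolding G_def abs_mult using wD[of p] D by (intro mult_mono) (auto simp: indicator_def)
  have main: "R 1 \<rho> p = w p + R 1 G p" for p
  proof -
    have iB: "\<bar>h p - ?M * (indicator ?E p * x p)\<bar> \<le> 1 + ?M"
      if "\<And>p. 0 \<le> h p" "\<And>p. h p \<le> 1" "\<And>p. 0 \<le> x p" "\<And>p. x p \<le> 1" for h x :: "(real^'n) \<times> real \<Rightarrow> real" and p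
    proof -
      have "?M * (indicator ?E p * x p) \<le> ?M * 1" using that(3,4)[of p] by (intro mult_left_mono) (auto simp: indicator_def)
      moreover have "0 \<le> ?M * (indicator ?E p * x p)" using that(3)[of p] by simp
      ultimately show ?thesis using that(1,2)[of p] by (simp add: abs_le_iff)
    qed
    let ?hv = "\<lambda>p. g p - ?M * (indicator ?E p * v p)" and ?hu = "\<lambda>p. 1 - ?M * (indicator ?E p * u p)"
    have v1: "v p = R 1 ?hv p" and u1: "u p = R 1 ?hu p"
      using killed_eq_R1[OF ext_measurable[of C m] of_nat_0_le_iff[of m] g, of p]
        killed_eq_R1[OF ext_measurable[of C m] of_nat_0_le_iff[of m] one, of p]
      unfolding v_def u_def by auto
    have hv: "?hv \<in> borel_measurable borel" "\<bar>?hv p\<bar> \<le> 1 + ?M" and hu: "?hu \<in> borel_measurable borel" "\<bar>?hu p\<bar> \<le> 1 + ?M" for p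
      using g(1) by (measurable, intro iB g kv, measurable, intro iB ku one)
    have r1: "R 1 (\<lambda>p. ?hv p + (- (1 / 2)) * ?hu p) p = R 1 ?hv p + (- (1 / 2)) * R 1 ?hu p"
      by (rule R_add[OF zero_less_one hv hu])
    have hB: "\<bar>?hv p + (- (1 / 2)) * ?hu p\<bar> \<le> 2 * (1 + ?M)" for p
    proof -
      have "\<bar>a + (- (1 / 2)) * b\<bar> \<le> 2 * X" if "\<bar>a\<bar> \<le> X" "\<bar>b\<bar> \<le> X" for a b X :: real
        using that by linarith
      then show ?thesis using hv(2)[of p] hu(2)[of p] .
    qed
    have hm: "(\<lambda>p. ?hv p + (- (1 / 2)) * ?hu p) \<in> borel_measurable borel" using hv(1) hu(1) by measurable
    have "R 1 (\<lambda>p. G p + 2 * D * (?hv p + (- (1 / 2)) * ?hu p)) p = R 1 G p + 2 * D * R 1 (\<lambda>p. ?hv p + (- (1 / 2)) * ?hu p) p"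
      by (rule R_add[OF zero_less_one Gm GB hm hB])
    moreover have "(\<lambda>p. G p + 2 * D * (?hv p + (- (1 / 2)) * ?hu p)) = \<rho>"
      using D by (auto simp: fun_eq_iff G_def w_def g_def field_simps)
    ultimately show ?thesis unfolding r1 using v1 u1 by (simp add: w_def algebra_simps)
  qed
  have approx: "\<bar>f p - R 1 G p\<bar> \<le> 2 * \<epsilon> / 3" if p: "p \<in> K" for p
  proof -
    have "\<bar>w p\<bar> \<le> D * (\<epsilon> / 3 / D)"
      using w_le[of p] m[OF p] mult_left_mono[of "u p" "\<epsilon> / 3 / D" D] D unfolding u_def by linarith
    then have "\<bar>w p\<bar> \<le> \<epsilon> / 3" using D by simp
    then show ?thesis using \<mu>(2)[of p] R\<rho>[of p] main[of p] by linarith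
  qed
  obtain S0 where S0: "\<And>p. p \<in> K \<Longrightarrow> norm p \<le> S0" using Kb by (auto simp: bounded_iff)
  obtain s where s: "0 \<le> s" "\<And>\<delta> \<mu>. 0 < \<delta> \<Longrightarrow> 0 < \<mu> \<Longrightarrow>
    \<mu> * (LINT q|lborel. kern \<mu> q * indicator {q. \<delta> \<le> norm q} q) \<le> (s / \<delta>\<^sup>2 + 2 / \<delta>) / \<mu>"
    using kern_concentration by blast
  \<comment> \<open>\<open>t \<ge> 1\<close> allows \<open>s / t\<^sup>2 \<le> s / t\<close>; the
    other term then makes the tail beyond radius \<open>t\<close> at most
    \<open>\<epsilon> / 3\<close>.\<close>
  define t where "t = max 1 ((s + 2) * (?M * D + 1) * 3 / \<epsilon>)"
  have t: "1 \<le> t" "(s + 2) * (?M * D + 1) * 3 / \<epsilon> \<le> t" by (auto simp: t_def)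
  have tail: "(?M * D) * (s / t\<^sup>2 + 2 / t) \<le> \<epsilon> / 3"
  proof -
    have "t * 1 \<le> t * t" using t by (intro mult_left_mono) auto
    then have "s / t\<^sup>2 \<le> s / t" using t s(1) by (intro divide_left_mono) (auto simp: power2_eq_square)
    then have "(?M * D) * (s / t\<^sup>2 + 2 / t) \<le> (?M * D + 1) * ((s + 2) / t)"
      using s(1) D t by (intro mult_mono) (auto simp: add_divide_distrib)
    also have "\<dots> \<le> \<epsilon> / 3" using t \<epsilon> by (simp add: field_simps)
    finally show ?thesis .
  qed
  define G' where "G' p = indicator (cball 0 (S0 + t)) p * G p" for p
  have G'm[measurable]: "G' \<in> borel_measurable borel" unfolding G'_def
    by (intro borel_measurable_times borel_measurable_indicator Gm) auto
  have G'B: "\<bar>G' p\<bar> \<le> ?M * D" for p using GB[of p] D by (auto simp: G'_def indicator_def)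
  have trunc: "\<bar>R 1 G p - R 1 G' p\<bar> \<le> \<epsilon> / 3" if p: "p \<in> K" for p
  proof -
    let ?Q = "{q. t \<le> norm q}"
    have i1: "integrable lborel (\<lambda>q. kern 1 q * indicator ?Q q)"
      using kern_integral(1)[OF zero_less_one] by (intro integrable_real_mult_indicator) auto
    have iG: "integrable lborel (\<lambda>q. kern 1 q * G (p + q))" "integrable lborel (\<lambda>q. kern 1 q * G' (p + q))"
      using R_integrable[OF zero_less_one Gm GB] R_integrable[OF zero_less_one G'm G'B] by auto
    have "R 1 G p - R 1 G' p = (LINT q|lborel. kern 1 q * G (p + q) - kern 1 q * G' (p + q))"
      unfolding R_def using iG by simp
    also have "norm \<dots> \<le> (LINT q|lborel. (?M * D) * (kern 1 q * indicator ?Q q))"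
    proof (rule Bochner_Integration.integral_norm_bound_integral)
      show "integrable lborel (\<lambda>q. kern 1 q * G (p + q) - kern 1 q * G' (p + q))" using iG by simp
      show "integrable lborel (\<lambda>q. (?M * D) * (kern 1 q * indicator ?Q q))" using i1 by simp
      fix q
      have "\<bar>G (p + q) - G' (p + q)\<bar> \<le> ?M * D * indicator ?Q q"
      proof (cases "t \<le> norm q")
        case True
        then show ?thesis using GB[of "p + q"] D by (auto simp: G'_def indicator_def)
      next
        case False
        then have "p + q \<in> cball 0 (S0 + t)" using S0[OF p] norm_triangle_ineq[of p q] by simp
        then show ?thesis using D by (simp add: G'_def)
      qed
      then have "kern 1 q * \<bar>G (p + q) - G' (p + q)\<bar> \<le> kern 1 q * (?M * D * indicator ?Q q)" by (rule mult_left_mono) simp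
      moreover have "norm (kern 1 q * G (p + q) - kern 1 q * G' (p + q)) = kern 1 q * \<bar>G (p + q) - G' (p + q)\<bar>"
        unfolding right_diff_distrib[symmetric] by (simp add: abs_mult)
      moreover have "kern 1 q * (?M * D * indicator ?Q q) = (?M * D) * (kern 1 q * indicator ?Q q)"
        by (simp only: mult_ac)
      ultimately show "norm (kern 1 q * G (p + q) - kern 1 q * G' (p + q)) \<le> (?M * D) * (kern 1 q * indicator ?Q q)"
        by linarith
    qed
    also have "\<dots> = (?M * D) * (LINT q|lborel. kern 1 q * indicator ?Q q)" by simp
    also have "\<dots> \<le> (?M * D) * (s / t\<^sup>2 + 2 / t)"
      using s(2)[of t 1] t(1) D by (intro mult_left_mono) auto
    also note tail
    finally show ?thesis by simp
  qed
  show ?thesis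
  proof (rule exI[of _ G'], rule exI[of _ "?M * D"], rule exI[of _ "1 / (real m + 1)"], rule exI[of _ "S0 + t"], intro conjI allI ballI impI)
    fix p assume "G' p \<noteq> 0"
    then show "1 / (real m + 1) \<le> infdist p C" "norm p \<le> S0 + t"
      by (auto simp: G'_def G_def ext_def indicator_def split: if_splits)
  next
    fix p assume p: "p \<in> K"
    show "\<bar>f p - R 1 G' p\<bar> \<le> \<epsilon>" using approx[OF p] trunc[OF p] by linarith
  qed (use G'm G'B in auto)
qed

end

section \<open>Density in Lebesgue spaces\<close>

lemma powr_add_le:
  fixes a b p :: real
  assumes p: "0 < p"
  shows "\<bar>a + b\<bar> powr p \<le> 2 powr p * (\<bar>a\<bar> powr p + \<bar>b\<bar> powr p)"
proof -
  have "\<bar>a + b\<bar> powr p \<le> (2 * max \<bar>a\<bar> \<bar>b\<bar>) powr p" using p by (intro powr_mono2) auto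
  also have "\<dots> = 2 powr p * max \<bar>a\<bar> \<bar>b\<bar> powr p" by (simp add: powr_mult)
  also have "max \<bar>a\<bar> \<bar>b\<bar> powr p \<le> \<bar>a\<bar> powr p + \<bar>b\<bar> powr p" by (simp add: max_def)
  finally show ?thesis by simp
qed

locale uniform_approximation = finite_measure M for M :: "'a::metric_space measure" +
  fixes S :: "'a set" and w :: "'i \<Rightarrow> 'a \<Rightarrow> real" and p :: real
  assumes S: "S \<in> sets borel" and space_M: "space M = S" and sets_M: "sets M = sets (restrict_space borel S)"
    and p: "1 \<le> p"
    and w: "\<And>\<alpha>. w \<alpha> \<in> borel_measurable borel"
    and unif: "\<And>\<psi> B e. uniformly_continuous_on UNIV \<psi> \<Longrightarrow> (\<And>z. \<bar>\<psi> z\<bar> \<le> B) \<Longrightarrow> 0 < e \<Longrightarrow>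
      \<exists>F c. finite F \<and> (\<forall>z\<in>S. \<bar>\<psi> z - (\<Sum>\<alpha>\<in>F. c \<alpha> * w \<alpha> z)\<bar> \<le> e)"
begin

lemma measurable_M: "f \<in> borel_measurable borel \<Longrightarrow> f \<in> borel_measurable M"
  unfolding measurable_cong_sets[OF sets_M refl] by (rule measurable_restrict_space1)

text \<open>The \<open>p\<close>-th power of the norm as an extended real, free of integrability
  conditions. \<open>pint_add\<close> with its factor \<open>2 powr p\<close> takes the place of
  Minkowski's inequality.\<close>

definition pint :: "('a \<Rightarrow> real) \<Rightarrow> ennreal" where
  "pint f = (\<integral>\<^sup>+z. ennreal (\<bar>f z\<bar> powr p) \<partial>M)"

definition lincomb :: "'i set \<Rightarrow> ('i \<Rightarrow> real) \<Rightarrow> 'a \<Rightarrow> real" where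
  "lincomb F c z = (\<Sum>\<alpha>\<in>F. c \<alpha> * w \<alpha> z)"

definition apx :: "('a \<Rightarrow> real) \<Rightarrow> bool" where
  "apx f \<longleftrightarrow> (\<forall>e>0. \<exists>F c. finite F \<and> pint (\<lambda>z. f z - lincomb F c z) \<le> ennreal e)"

lemma lincomb_measurable: "lincomb F c \<in> borel_measurable borel"
  unfolding lincomb_def using w by measurable

lemma pint_add:
  assumes "f \<in> borel_measurable borel" "g \<in> borel_measurable borel"
  shows "pint (\<lambda>z. f z + g z) \<le> ennreal (2 powr p) * (pint f + pint g)"
proof -
  have [measurable]: "f \<in> borel_measurable M" "g \<in> borel_measurable M"
    using assms by (auto intro: measurable_M)
  have "pint (\<lambda>z. f z + g z) \<le> (\<integral>\<^sup>+z. ennreal (2 powr p) * (ennreal (\<bar>f z\<bar> powr p) + ennreal (\<bar>g z\<bar> powr p)) \<partial>M)"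
    unfolding pint_def using powr_add_le[of p] p
    by (intro nn_integral_mono) (simp add: ennreal_leI flip: ennreal_plus ennreal_mult)
  also have "\<dots> = ennreal (2 powr p) * (pint f + pint g)"
    unfolding pint_def by (simp add: nn_integral_cmult nn_integral_add)
  finally show ?thesis .
qed

lemma apx_limit:
  assumes f: "f \<in> borel_measurable borel"
    and ex: "\<And>e. 0 < e \<Longrightarrow> \<exists>g\<in>borel_measurable borel. apx g \<and> pint (\<lambda>z. f z - g z) \<le> ennreal e"
  shows "apx f"
  unfolding apx_def
proof (intro allI impI)
  fix e :: real assume e: "0 < e"
  define d where "d = e / 2 / 2 powr p"
  have d: "0 < d" using e by (simp add: d_def)
  obtain g where g: "g \<in> borel_measurable borel" "apx g" "pint (\<lambda>z. f z - g z) \<le> ennreal d"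
    using ex[OF d] by blast
  obtain F c where F: "finite F" "pint (\<lambda>z. g z - lincomb F c z) \<le> ennreal d"
    using g(2) d unfolding apx_def by blast
  have "pint (\<lambda>z. (f z - g z) + (g z - lincomb F c z)) \<le> ennreal (2 powr p) * (pint (\<lambda>z. f z - g z) + pint (\<lambda>z. g z - lincomb F c z))"
    by (rule pint_add) (use f g(1) lincomb_measurable in measurable)
  also have "\<dots> \<le> ennreal (2 powr p) * (ennreal d + ennreal d)"
    using g(3) F(2) by (intro mult_left_mono add_mono) auto
  also have "\<dots> = ennreal e" using d by (simp add: d_def flip: ennreal_plus ennreal_mult)
  finally show "\<exists>F c. finite F \<and> pint (\<lambda>z. f z - lincomb F c z) \<le> ennreal e" using F(1) by auto
qed

lemma apx_dominated:
  assumes f: "f \<in> borel_measurable borel" and g: "\<And>i::nat. g i \<in> borel_measurable borel" "\<And>i. apx (g i)"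
    and lim: "\<And>z. z \<in> S \<Longrightarrow> (\<lambda>i. g i z) \<longlonglongrightarrow> f z"
    and W: "\<And>i z. z \<in> S \<Longrightarrow> \<bar>f z - g i z\<bar> powr p \<le> W z" "W \<in> borel_measurable borel" "(\<integral>\<^sup>+z. ennreal (W z) \<partial>M) < \<infinity>"
  shows "apx f"
proof (rule apx_limit[OF f])
  fix e :: real assume e: "0 < e"
  have [measurable]: "f \<in> borel_measurable M" "\<And>i. g i \<in> borel_measurable M" "W \<in> borel_measurable M"
    using f g W by (auto intro: measurable_M)
  have "(\<lambda>i. \<integral>\<^sup>+z. ennreal (\<bar>f z - g i z\<bar> powr p) \<partial>M) \<longlonglongrightarrow> (\<integral>\<^sup>+z. 0 \<partial>M)"
  proof (rule nn_integral_dominated_convergence[where w = "\<lambda>z. ennreal (W z)"])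
    show "AE z in M. (\<lambda>i. ennreal (\<bar>f z - g i z\<bar> powr p)) \<longlonglongrightarrow> 0"
    proof (rule AE_I2)
      fix z assume "z \<in> space M"
      then have "(\<lambda>i. g i z) \<longlonglongrightarrow> f z" using lim space_M by simp
      then have "(\<lambda>i. \<bar>f z - g i z\<bar>) \<longlonglongrightarrow> \<bar>f z - f z\<bar>" by (intro tendsto_intros)
      then have "(\<lambda>i. \<bar>f z - g i z\<bar> powr p) \<longlonglongrightarrow> 0 powr p"
        using p by (intro tendsto_powr2) auto
      then have "(\<lambda>i. ennreal (\<bar>f z - g i z\<bar> powr p)) \<longlonglongrightarrow> ennreal (0 powr p)" by (rule tendsto_ennrealI)
      then show "(\<lambda>i. ennreal (\<bar>f z - g i z\<bar> powr p)) \<longlonglongrightarrow> 0" using p by simp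
    qed
    show "AE z in M. ennreal (\<bar>f z - g i z\<bar> powr p) \<le> ennreal (W z)" for i
      using W(1) space_M by (intro AE_I2 ennreal_leI) auto
  qed (use W(3) in auto)
  then have "(\<lambda>i. pint (\<lambda>z. f z - g i z)) \<longlonglongrightarrow> 0" by (simp add: pint_def)
  then have "\<forall>\<^sub>F i in sequentially. pint (\<lambda>z. f z - g i z) < ennreal e"
    by (rule order_tendstoD) (use e in simp)
  then obtain i where "pint (\<lambda>z. f z - g i z) < ennreal e" using eventually_happens[of _ sequentially] by auto
  then show "\<exists>g\<in>borel_measurable borel. apx g \<and> pint (\<lambda>z. f z - g z) \<le> ennreal e"
    using g by (intro bexI[of _ "g i"]) auto
qed

lemma pint_bounded:
  assumes "\<And>z. z \<in> S \<Longrightarrow> \<bar>f z\<bar> \<le> B"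
  shows "pint f \<le> ennreal (B powr p * measure M S)"
proof -
  have "pint f \<le> (\<integral>\<^sup>+z. ennreal (B powr p) \<partial>M)"
    unfolding pint_def using assms space_M p by (intro nn_integral_mono ennreal_leI powr_mono2) auto
  also have "\<dots> = ennreal (B powr p * measure M S)"
    by (simp add: space_M emeasure_eq_measure ennreal_mult)
  finally show ?thesis .
qed

lemma apx_uniformly_continuous:
  assumes "uniformly_continuous_on UNIV \<psi>" "\<And>z. \<bar>\<psi> z\<bar> \<le> B"
  shows "apx \<psi>"
  unfolding apx_def
proof (intro allI impI)
  fix e :: real assume e: "0 < e"
  \<comment> \<open>The uniform error whose \<open>p\<close>-th power times the total measure is at
    most \<open>e\<close>; the added 1 covers a null measure.\<close>
  define d where "d = (e / (measure M S + 1)) powr (1 / p)"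
  have m: "0 < measure M S + 1" by (simp add: add_nonneg_pos)
  have d: "0 < d" using e m by (simp add: d_def)
  obtain F c where F: "finite F" "\<And>z. z \<in> S \<Longrightarrow> \<bar>\<psi> z - lincomb F c z\<bar> \<le> d"
    using unif[OF assms d] unfolding lincomb_def by blast
  have "pint (\<lambda>z. \<psi> z - lincomb F c z) \<le> ennreal (d powr p * measure M S)"
    by (rule pint_bounded) (rule F(2))
  also have "d powr p = e / (measure M S + 1)" using e m p by (simp add: d_def powr_powr)
  also have "ennreal (e / (measure M S + 1) * measure M S) \<le> ennreal e"
    using e m by (intro ennreal_leI) (simp add: field_simps)
  finally show "\<exists>F c. finite F \<and> pint (\<lambda>z. \<psi> z - lincomb F c z) \<le> ennreal e" using F(1) by blast
qed

lemma lincomb_combine: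
  assumes "finite F" "finite F'"
  shows "\<exists>c''. \<forall>z. lincomb F c z + r * lincomb F' c' z = lincomb (F \<union> F') c'' z"
proof (intro exI allI)
  fix z
  let ?c'' = "\<lambda>\<alpha>. (if \<alpha> \<in> F then c \<alpha> else 0) + r * (if \<alpha> \<in> F' then c' \<alpha> else 0)"
  have 1: "lincomb F c z = (\<Sum>\<alpha>\<in>F \<union> F'. (if \<alpha> \<in> F then c \<alpha> else 0) * w \<alpha> z)"
    unfolding lincomb_def using assms by (intro sum.mono_neutral_cong_left) auto
  have 2: "lincomb F' c' z = (\<Sum>\<alpha>\<in>F \<union> F'. (if \<alpha> \<in> F' then c' \<alpha> else 0) * w \<alpha> z)"
    unfolding lincomb_def using assms by (intro sum.mono_neutral_cong_left) auto
  show "lincomb F c z + r * lincomb F' c' z = lincomb (F \<union> F') ?c'' z"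
    unfolding 1 2 unfolding lincomb_def sum_distrib_left sum.distrib[symmetric]
    by (intro sum.cong) (auto simp: algebra_simps)
qed

lemma pint_cmult: "f \<in> borel_measurable borel \<Longrightarrow> pint (\<lambda>z. r * f z) = ennreal (\<bar>r\<bar> powr p) * pint f"
proof -
  assume "f \<in> borel_measurable borel"
  then have [measurable]: "f \<in> borel_measurable M" by (rule measurable_M)
  show ?thesis
    unfolding pint_def by (subst nn_integral_cmult[symmetric]) (auto simp: abs_mult powr_mult ennreal_mult)
qed

lemma apx_add:
  assumes f: "f \<in> borel_measurable borel" "apx f" and g: "g \<in> borel_measurable borel" "apx g"
  shows "apx (\<lambda>z. f z + r * g z)"
  unfolding apx_def
proof (intro allI impI)
  fix e :: real assume e: "0 < e"
  define A where "A = 2 powr p * (1 + \<bar>r\<bar> powr p)"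
  have A: "0 < A" by (simp add: A_def add_pos_nonneg)
  define d where "d = e / A"
  have d: "0 < d" using e A by (simp add: d_def)
  obtain F c where F: "finite F" "pint (\<lambda>z. f z - lincomb F c z) \<le> ennreal d"
    using f(2) d unfolding apx_def by blast
  obtain F' c' where F': "finite F'" "pint (\<lambda>z. g z - lincomb F' c' z) \<le> ennreal d"
    using g(2) d unfolding apx_def by blast
  obtain c'' where c'': "\<And>z. lincomb F c z + r * lincomb F' c' z = lincomb (F \<union> F') c'' z"
    using lincomb_combine[OF F(1) F'(1)] by blast
  have "pint (\<lambda>z. f z + r * g z - lincomb (F \<union> F') c'' z)
      = pint (\<lambda>z. (f z - lincomb F c z) + r * (g z - lincomb F' c' z))"
    unfolding c''[symmetric] by (simp add: algebra_simps)
  also have "\<dots> \<le> ennreal (2 powr p) * (pint (\<lambda>z. f z - lincomb F c z) + pint (\<lambda>z. r * (g z - lincomb F' c' z)))"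
    by (rule pint_add) (use f(1) g(1) lincomb_measurable in measurable)
  also have "pint (\<lambda>z. r * (g z - lincomb F' c' z)) = ennreal (\<bar>r\<bar> powr p) * pint (\<lambda>z. g z - lincomb F' c' z)"
    by (rule pint_cmult) (use g(1) lincomb_measurable in measurable)
  also have "ennreal (2 powr p) * (pint (\<lambda>z. f z - lincomb F c z) + ennreal (\<bar>r\<bar> powr p) * pint (\<lambda>z. g z - lincomb F' c' z))
      \<le> ennreal (2 powr p) * (ennreal d + ennreal (\<bar>r\<bar> powr p) * ennreal d)"
    using F(2) F'(2) by (intro mult_left_mono add_mono) auto
  also have "\<dots> = ennreal (A * d)"
    using d by (simp add: A_def algebra_simps flip: ennreal_plus ennreal_mult)
  also have "A * d = e" using A by (simp add: d_def)
  finally show "\<exists>F c. finite F \<and> pint (\<lambda>z. f z + r * g z - lincomb F c z) \<le> ennreal e"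
    using F(1) F'(1) by blast
qed

lemma apx_0: "apx (\<lambda>z. 0)"
  by (rule apx_uniformly_continuous[OF uniformly_continuous_on_const, where B = 0]) simp

lemma finite_const: "(\<integral>\<^sup>+z. ennreal C \<partial>M) < \<infinity>"
  by (simp add: emeasure_eq_measure ennreal_mult_less_top)

text \<open>The Lipschitz functions \<open>max 0 (1 - n * infdist z A)\<close> decrease to the
  indicator of a nonempty closed set.\<close>

lemma apx_indicator_closed:
  assumes A: "closed A"
  shows "apx (indicator A)"
proof (cases "A = {}")
  case True
  then have "(indicator A :: 'a \<Rightarrow> real) = (\<lambda>z. 0)" by auto
  then show ?thesis using apx_0 by simp
next
  case False
  define g where "g n z = max 0 (1 - real n * infdist z A)" for n z
  have lip: "\<bar>g n x - g n y\<bar> \<le> real n * dist x y" for n x y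
  proof -
    have "\<bar>infdist x A - infdist y A\<bar> \<le> dist x y" by (rule infdist_triangle_abs)
    then have "real n * \<bar>infdist x A - infdist y A\<bar> \<le> real n * dist x y" by (rule mult_left_mono) simp
    moreover have "real n * \<bar>infdist x A - infdist y A\<bar> = \<bar>real n * infdist x A - real n * infdist y A\<bar>"
      by (simp add: abs_mult flip: right_diff_distrib)
    ultimately show ?thesis unfolding g_def by linarith
  qed
  have uc: "uniformly_continuous_on UNIV (g n)" for n
    unfolding uniformly_continuous_on_def
  proof (intro allI impI)
    fix e :: real assume e: "0 < e"
    show "\<exists>d>0. \<forall>x\<in>UNIV. \<forall>x'\<in>UNIV. dist x' x < d \<longrightarrow> dist (g n x') (g n x) < e"
    proof (intro exI[of _ "e / (real n + 1)"] conjI ballI impI)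
      show "0 < e / (real n + 1)" using e by simp
      fix x x' :: 'a assume "dist x' x < e / (real n + 1)"
      then have "(real n + 1) * dist x' x < e" by (simp add: field_simps)
      moreover have "real n * dist x' x \<le> (real n + 1) * dist x' x" by (intro mult_right_mono) auto
      ultimately show "dist (g n x') (g n x) < e" using lip[of n x' x] by (simp add: dist_real_def)
    qed
  qed
  have g01: "0 \<le> g n z" "g n z \<le> 1" for n z using infdist_nonneg[of z A] by (auto simp: g_def)
  have gm: "g n \<in> borel_measurable borel" for n
    by (intro borel_measurable_continuous_onI uniformly_continuous_imp_continuous uc)
  show ?thesis
  proof (rule apx_dominated[where g = g and W = "\<lambda>z. 1"])
    show "indicator A \<in> borel_measurable borel" using A by (intro borel_measurable_indicator borel_closed)
    show "g i \<in> borel_measurable borel" for i by (rule gm)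
    show "apx (g i)" for i
      by (rule apx_uniformly_continuous[OF uc, where B = 1]) (use g01 in \<open>auto simp: abs_le_iff intro: order_trans[of _ 0]\<close>)
    show "(\<lambda>i. g i z) \<longlonglongrightarrow> indicator A z" for z
    proof (cases "z \<in> A")
      case True
      then show ?thesis by (simp add: g_def)
    next
      case n: False
      then have pos: "0 < infdist z A" using A False by (simp add: infdist_pos_not_in_closed)
      obtain k :: nat where k: "1 / infdist z A \<le> real k" using real_arch_simple by blast
      have "g i z = 0" if "k \<le> i" for i
      proof -
        have "1 / infdist z A \<le> real i" using k that by linarith
        then show ?thesis using pos by (simp add: g_def field_simps)
      qed
      then have "\<forall>\<^sub>F i in sequentially. g i z = 0" by (auto simp: eventually_sequentially)
      then show ?thesis using n by (simp add: tendsto_eventually)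
    qed
    show "\<bar>indicator A z - g i z\<bar> powr p \<le> 1" for i z
    proof -
      have "\<bar>indicator A z - g i z\<bar> \<le> 1" using g01[of i z] by (auto simp: indicator_def)
      then have "\<bar>indicator A z - g i z\<bar> powr p \<le> 1 powr p" using p by (intro powr_mono2) auto
      then show ?thesis by simp
    qed
  qed (use finite_const[of 1] in auto)
qed

text \<open>Closed sets form an intersection-stable generator. Complements follow by linearity,
  disjoint unions by dominated convergence of the partial sums.\<close>

lemma apx_indicator:
  assumes A: "A \<in> sets borel"
  shows "apx (indicator A)"
proof -
  have gen: "sets (borel :: 'a measure) = sigma_sets UNIV (Collect closed)"
    by (simp add: borel_eq_closed)
  have one: "apx (\<lambda>z. 1)" by (rule apx_uniformly_continuous[OF uniformly_continuous_on_const, where B = 1]) simp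
  have "Int_stable (Collect closed :: 'a set set)" by (auto simp: Int_stable_def)
  moreover have "Collect closed \<subseteq> Pow (UNIV :: 'a set)" by simp
  moreover have "A \<in> sigma_sets UNIV (Collect closed)" using A gen by simp
  ultimately show ?thesis
  proof (induction rule: sigma_sets_induct_disjoint)
    case (basic A)
    then show ?case by (intro apx_indicator_closed) simp
  next
    case empty
    have "(indicator {} :: 'a \<Rightarrow> real) = (\<lambda>z. 0)" by auto
    then show ?case using apx_0 by simp
  next
    case (compl A)
    have "A \<in> sets borel" using compl(1) gen by simp
    then have "apx (\<lambda>z. 1 + - 1 * indicator A z)" by (intro apx_add one compl) auto
    moreover have "(\<lambda>z. 1 + - 1 * indicator A z) = (indicator (UNIV - A) :: 'a \<Rightarrow> real)"
      by (auto simp: indicator_def)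
    ultimately show ?case by simp
  next
    case (union A)
    have Am: "A i \<in> sets borel" for i using union(2) gen by blast
    define g where "g n z = (\<Sum>i<n. indicator (A i) z :: real)" for n :: nat and z
    have gm: "g n \<in> borel_measurable borel" for n unfolding g_def using Am by measurable
    have ga: "apx (g n)" for n
    proof (induction n)
      case 0
      then show ?case using apx_0 by (simp add: g_def[abs_def])
    next
      case (Suc n)
      have "apx (\<lambda>z. g n z + 1 * indicator (A n) z)" by (intro apx_add gm Suc union(3)) (use Am in auto)
      then show ?case by (simp add: g_def[abs_def])
    qed
    have sums: "(\<lambda>i. indicator (A i) z :: real) sums indicator (\<Union>i. A i) z" for z
    proof (cases "z \<in> (\<Union>i. A i)")
      case True
      then obtain j where j: "z \<in> A j" by blast
      have "(\<lambda>i. indicator (A i) z :: real) = (\<lambda>i. if i = j then 1 else 0)"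
        using union(1) j by (auto simp: fun_eq_iff indicator_def disjoint_family_on_def)
      then show ?thesis using True sums_single[of j "\<lambda>_. 1::real"] by simp
    next
      case False
      then have "(\<lambda>i. indicator (A i) z :: real) = (\<lambda>i. 0)" by (auto simp: indicator_def)
      then show ?thesis using False by simp
    qed
    have ind: "indicator (\<Union>i. A i) z = (\<Sum>i. indicator (A i) z :: real)" for z
      by (rule sums_unique[OF sums])
    show ?case
    proof (rule apx_dominated[where g = g and W = "\<lambda>z. 1"])
      show "indicator (\<Union>i. A i) \<in> borel_measurable borel" using Am by measurable
      show "(\<lambda>i. g i z) \<longlonglongrightarrow> indicator (\<Union>i. A i) z" for z using sums[of z] by (simp add: sums_def g_def)
      show "\<bar>indicator (\<Union>i. A i) z - g i z\<bar> powr p \<le> 1" for i z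
      proof -
        have "g i z \<le> indicator (\<Union>i. A i) z"
          unfolding ind g_def using sums_summable[OF sums[of z]] by (intro sum_le_suminf) auto
        moreover have "0 \<le> g i z" by (simp add: g_def sum_nonneg)
        moreover have "indicator (\<Union>i. A i) z \<le> (1::real)" by (simp add: indicator_def)
        ultimately have "\<bar>indicator (\<Union>i. A i) z - g i z\<bar> \<le> 1" by linarith
        then have "\<bar>indicator (\<Union>i. A i) z - g i z\<bar> powr p \<le> 1 powr p" using p by (intro powr_mono2) auto
        then show ?thesis by simp
      qed
    qed (use gm ga finite_const[of 1] in auto)
  qed
qed

text \<open>Finiteness of \<open>pint\<close> stands inside the induction claim: all pieces are
  nonnegative and lie below the function, so they inherit it, and the \<open>p\<close>-th power of
  the limit dominates the errors.\<close>

lemma apx_nonneg: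
  assumes u: "u \<in> borel_measurable borel" "\<And>z. 0 \<le> u z" and fin: "pint u < \<infinity>"
  shows "apx u"
proof -
  have mono: "pint f \<le> pint g" if "\<And>z. 0 \<le> f z" "\<And>z. f z \<le> g z" for f g
  proof -
    have "\<bar>f z\<bar> \<le> \<bar>g z\<bar>" for z using that[of z] by linarith
    then show ?thesis unfolding pint_def using p by (intro nn_integral_mono ennreal_leI powr_mono2) auto
  qed
  have "pint u < \<infinity> \<longrightarrow> apx u"
    using u
  proof (induction u rule: borel_measurable_induct_real)
    case (set A)
    then show ?case using apx_indicator by simp
  next
    case (mult u c)
    show ?case
    proof (cases "c = 0")
      case True
      then show ?thesis using apx_0 by simp
    next
      case False
      show ?thesis
      proof
        assume "pint (\<lambda>z. c * u z) < \<infinity>"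
        then have "pint u < \<infinity>" using False p unfolding pint_cmult[OF mult(2)]
          by (auto simp: ennreal_mult_less_top)
        then have "apx (\<lambda>z. 0 + c * u z)" using mult apx_0 by (intro apx_add) auto
        then show "apx (\<lambda>z. c * u z)" by simp
      qed
    qed
  next
    case (add u v)
    show ?case
    proof
      assume fin: "pint (\<lambda>z. v z + u z) < \<infinity>"
      have "pint u \<le> pint (\<lambda>z. v z + u z)" "pint v \<le> pint (\<lambda>z. v z + u z)"
        using add by (auto intro!: mono)
      then have "apx u" "apx v" using fin add by (auto dest: le_less_trans)
      then have "apx (\<lambda>z. v z + 1 * u z)" using add by (intro apx_add) auto
      then show "apx (\<lambda>z. v z + u z)" by simp
    qed
  next
    case (seq U)
    show ?case
    proof
      assume fin: "pint u < \<infinity>"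
      have lim: "(\<lambda>i. U i z) \<longlonglongrightarrow> u z" for z using seq.hyps(4)[of z] by simp
      have inc: "incseq (\<lambda>i. U i z)" for z using seq.hyps(3) by (auto simp: incseq_def le_fun_def)
      have le: "U i z \<le> u z" for i z
        using inc lim by (rule incseq_le)
      have "pint (U i) \<le> pint u" for i using seq.hyps(2) le by (intro mono) auto
      then have "pint (U i) < \<infinity>" for i using fin by (rule le_less_trans)
      then have a: "apx (U i)" for i using seq.IH by blast
      show "apx u"
      proof (rule apx_dominated[where g = U and W = "\<lambda>z. \<bar>u z\<bar> powr p"])
        show um: "u \<in> borel_measurable borel" by (rule borel_measurable_LIMSEQ_real[OF lim seq.hyps(1)])
        show "(\<lambda>z. \<bar>u z\<bar> powr p) \<in> borel_measurable borel" using um by measurable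
        show "\<bar>u z - U i z\<bar> powr p \<le> \<bar>u z\<bar> powr p" for i z
          using le[of i z] seq.hyps(2)[of i z] p by (intro powr_mono2) auto
        show "(\<integral>\<^sup>+z. ennreal (\<bar>u z\<bar> powr p) \<partial>M) < \<infinity>" using fin by (simp add: pint_def)
      qed (use seq.hyps(1) a lim in auto)
    qed
  qed
  then show ?thesis using fin by blast
qed

lemma apx_Lp:
  assumes f: "f \<in> borel_measurable borel" and fin: "pint f < \<infinity>"
  shows "apx f"
proof -
  have le: "pint (\<lambda>z. max 0 (f z)) \<le> pint f" "pint (\<lambda>z. max 0 (- f z)) \<le> pint f"
    unfolding pint_def using p by (auto intro!: nn_integral_mono ennreal_leI powr_mono2)
  have m: "(\<lambda>z. max 0 (f z)) \<in> borel_measurable borel" "(\<lambda>z. max 0 (- f z)) \<in> borel_measurable borel"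
    using f by measurable
  have "apx (\<lambda>z. max 0 (f z) + - 1 * max 0 (- f z))"
    using le fin m by (intro apx_add apx_nonneg) (auto dest: le_less_trans)
  moreover have "(\<lambda>z. max 0 (f z) + - 1 * max 0 (- f z)) = f" by (auto simp: max_def)
  ultimately show ?thesis by simp
qed

lemma complete_in_Lp:
  assumes wB: "\<And>\<alpha>. \<exists>B. \<forall>z\<in>S. \<bar>w \<alpha> z\<bar> \<le> B"
  shows "complete_in_Lp p M w"
  unfolding complete_in_Lp_def
proof (intro conjI allI ballI impI)
  fix \<alpha>
  obtain B where B: "\<And>z. z \<in> S \<Longrightarrow> \<bar>w \<alpha> z\<bar> \<le> B" using wB by blast
  have [measurable]: "w \<alpha> \<in> borel_measurable M" using w by (rule measurable_M)
  have "integrable M (\<lambda>z. \<bar>w \<alpha> z\<bar> powr p)"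
  proof (rule integrable_const_bound[where B = "B powr p"])
    show "AE z in M. norm (\<bar>w \<alpha> z\<bar> powr p) \<le> B powr p"
      using B p space_M by (intro AE_I2) (auto intro!: powr_mono2)
  qed measurable
  then show "w \<alpha> \<in> Lp p M" by (simp add: Lp_def)
next
  fix f \<epsilon> assume f: "f \<in> Lp p M" and \<epsilon>: "0 < (\<epsilon>::real)"
  \<comment> \<open>An element of \<open>Lp\<close> is measurable on \<open>S\<close> only; extended
    by 0 it becomes Borel on the whole space.\<close>
  define f' where "f' z = indicator S z * f z" for z
  have fM: "f \<in> borel_measurable M" and fi: "integrable M (\<lambda>z. \<bar>f z\<bar> powr p)" using f by (auto simp: Lp_def)
  have "f \<in> borel_measurable (restrict_space borel S)"
    using fM unfolding measurable_cong_sets[OF sets_M refl] .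
  then have f'm: "f' \<in> borel_measurable borel"
    unfolding f'_def using S by (simp add: borel_measurable_restrict_space_iff)
  have f'f: "f' z = f z" if "z \<in> space M" for z using that space_M by (simp add: f'_def)
  have "pint f' = (\<integral>\<^sup>+z. ennreal (\<bar>f z\<bar> powr p) \<partial>M)"
    unfolding pint_def by (intro nn_integral_cong) (simp add: f'f)
  also have "\<dots> < \<infinity>" using fi by (simp add: nn_integral_eq_integral)
  finally have "apx f'" using f'm by (intro apx_Lp)
  define e where "e = (\<epsilon> / 2) powr p"
  have e: "0 < e" using \<epsilon> by (simp add: e_def)
  obtain F c where F: "finite F" "pint (\<lambda>z. f' z - lincomb F c z) \<le> ennreal e"
    using \<open>apx f'\<close> e unfolding apx_def by blast
  let ?h = "\<lambda>z. f z - (\<Sum>\<alpha>\<in>F. c \<alpha> * w \<alpha> z)"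
  have hm: "?h \<in> borel_measurable M"
    using fM measurable_M[OF w] by measurable
  have "pint (\<lambda>z. f' z - lincomb F c z) = (\<integral>\<^sup>+z. ennreal (\<bar>?h z\<bar> powr p) \<partial>M)"
    unfolding pint_def by (intro nn_integral_cong) (simp add: f'f lincomb_def)
  then have nn: "(\<integral>\<^sup>+z. ennreal (\<bar>?h z\<bar> powr p) \<partial>M) \<le> ennreal e" using F(2) by simp
  have "(\<integral>z. \<bar>?h z\<bar> powr p \<partial>M) = enn2real (\<integral>\<^sup>+z. ennreal (\<bar>?h z\<bar> powr p) \<partial>M)"
    by (rule integral_eq_nn_integral) (use hm in auto)
  also have "\<dots> \<le> enn2real (ennreal e)" using nn by (intro enn2real_mono) auto
  finally have "(\<integral>z. \<bar>?h z\<bar> powr p \<partial>M) \<le> e" using e by simp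
  then have "Lp_norm p M ?h \<le> e powr (1 / p)"
    unfolding Lp_norm_def using p by (intro powr_mono2) auto
  also have "\<dots> = \<epsilon> / 2" using p \<epsilon> by (simp add: e_def powr_powr)
  also have "\<dots> < \<epsilon>" using \<epsilon> by simp
  finally show "\<exists>F c. finite F \<and> Lp_norm p M (\<lambda>z. f z - (\<Sum>\<alpha>\<in>F. c \<alpha> * w \<alpha> z)) < \<epsilon>"
    using F(1) by blast
qed

end

section \<open>The parabolic boundary of a cylinder\<close>

text \<open>Unbounded towards the past, so that an exterior point either lies over the complement of
  the closure of \<open>\<Omega>\<close> or is later than \<open>T\<close>. These are the two cases
  of \<open>pole_mem\<close>.\<close>

definition body :: "(real^'n) set \<Rightarrow> real \<Rightarrow> ((real^'n) \<times> real) set" where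
  "body \<Omega> T = closure \<Omega> \<times> {..T}"

text \<open>For \<open>T > 0\<close> the closure of the top and the lateral side, made compact by
  adding their edges. The bottom is absent because \<open>H^*\<close> runs backward in time.\<close>

definition parabolic_boundary :: "(real^'n) set \<Rightarrow> real \<Rightarrow> ((real^'n) \<times> real) set" where
  "parabolic_boundary \<Omega> T = closure \<Omega> \<times> {T} \<union> frontier \<Omega> \<times> {0..T}"

lemma compact_parabolic_boundary: "bounded \<Omega> \<Longrightarrow> compact (parabolic_boundary \<Omega> T)"
  unfolding parabolic_boundary_def
  by (intro compact_Un compact_Times compact_frontier_bounded) auto

lemma parabolic_boundary_subset_body: "parabolic_boundary \<Omega> T \<subseteq> body \<Omega> T"
  by (auto simp: parabolic_boundary_def body_def frontier_def)

lemma infdist_ge: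
  assumes "A \<noteq> {}" "\<And>a. a \<in> A \<Longrightarrow> d \<le> dist x a"
  shows "d \<le> infdist x A"
  using assms by (simp add: infdist_notempty cINF_greatest)

context heat_resolvent
begin

text \<open>Near the lateral side, the mass that \<open>kern_lower_mass\<close> finds in an exterior
  ball is used; near the top, mass around the origin in space suffices, because moving forward in
  time leaves the cylinder.\<close>

lemma nonthin_parabolic_boundary:
  assumes C1: "C1_boundary \<Omega>" and op: "open \<Omega>" and bd: "bounded \<Omega>" and ne: "\<Omega> \<noteq> {}"
  shows "\<exists>c r1. 0 < c \<and> c \<le> 1 \<and> 0 < r1 \<and> nonthin (body \<Omega> T) (parabolic_boundary \<Omega> T) c r1"
proof -
  let ?C = "body \<Omega> T" and ?K = "parabolic_boundary \<Omega> T"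
  obtain \<kappa> r0 :: real where \<kappa>: "0 < \<kappa>" "\<kappa> \<le> 1" and r0: "0 < r0"
    and ext: "\<And>y \<rho>. y \<in> frontier \<Omega> \<Longrightarrow> 0 < \<rho> \<Longrightarrow> \<rho> < r0 \<Longrightarrow> \<exists>x. dist x y \<le> \<rho> \<and> ball x (\<kappa> * \<rho>) \<inter> closure \<Omega> = {}"
    using exterior_balls[OF C1 op bd] by blast
  obtain c where c: "0 < c" "\<And>r z. 0 < r \<Longrightarrow> norm z \<le> 2 * r \<Longrightarrow>
    c \<le> 1 / r\<^sup>2 * (LINT q|lborel. kern (1 / r\<^sup>2) q * indicator (ball z (\<kappa> * r / 2) \<times> {2 * r\<^sup>2..3 * r\<^sup>2}) q)"
    using kern_lower_mass[OF \<kappa>] by blast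
  have Cne: "?C \<noteq> {}" and Kne: "?K \<noteq> {}" using ne by (auto simp: body_def parabolic_boundary_def)
  have Kcl: "closed ?K" using compact_parabolic_boundary[OF bd] by (rule compact_imp_closed)
  have "nonthin ?C ?K (min c 1) (min r0 1)"
    unfolding nonthin_def
  proof (intro allI impI)
    fix r assume "0 < r \<and> r < min r0 1"
    then have r: "0 < r" "r < r0" "r < 1" by auto
    have rr: "r\<^sup>2 \<le> r" using r by (simp add: power2_eq_square mult_left_le)
    \<comment> \<open>The clearance is \<open>\<kappa> * r / 2\<close> in space at the lateral side
      and \<open>r\<^sup>2\<close> in time above the top.\<close>
    define \<delta> where "\<delta> = min (\<kappa> * r / 2) (r\<^sup>2)"
    have \<delta>: "0 < \<delta>" using \<kappa> r by (simp add: \<delta>_def)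
    show "\<exists>\<delta>>0. \<exists>\<rho>>0. \<forall>p. infdist p ?K < \<rho> \<longrightarrow>
      min c 1 \<le> 1 / r\<^sup>2 * (LINT q|lborel. kern (1 / r\<^sup>2) q * indicator {q. \<delta> \<le> infdist (p + q) ?C} q)"
    proof (rule exI[of _ \<delta>], intro conjI \<delta>, rule exI[of _ "r\<^sup>2"], intro conjI allI impI)
      show "0 < r\<^sup>2" using r by simp
      fix p assume "infdist p ?K < r\<^sup>2"
      then obtain p0 where p0: "p0 \<in> ?K" "dist p p0 < r\<^sup>2"
        using infdist_attains_inf[OF Kcl Kne, of p] by metis
      have f: "dist (fst p) (fst p0) < r\<^sup>2" "dist (snd p) (snd p0) < r\<^sup>2"
        using p0(2) dist_fst_le[of p p0] dist_snd_le[of p p0] by auto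
      obtain z where z: "norm z \<le> 2 * r"
        "\<And>q. q \<in> ball z (\<kappa> * r / 2) \<times> {2 * r\<^sup>2..3 * r\<^sup>2} \<Longrightarrow> \<delta> \<le> infdist (p + q) ?C"
      proof (cases "fst p0 \<in> frontier \<Omega>")
        case True
        obtain x where x: "dist x (fst p0) \<le> r" "ball x (\<kappa> * r) \<inter> closure \<Omega> = {}"
          using ext[OF True r(1,2)] by blast
        show ?thesis
        proof (rule that[of "x - fst p"])
          show "norm (x - fst p) \<le> 2 * r"
            using x(1) f(1) rr dist_triangle[of x "fst p" "fst p0"] by (simp add: dist_norm norm_minus_commute)
          fix q assume q: "q \<in> ball (x - fst p) (\<kappa> * r / 2) \<times> {2 * r\<^sup>2..3 * r\<^sup>2}"
          then have "dist (x - fst p) (fst q) < \<kappa> * r / 2" by (auto simp: mem_Times_iff)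
          then have xq: "dist x (fst (p + q)) < \<kappa> * r / 2" by (simp add: dist_norm algebra_simps)
          show "\<delta> \<le> infdist (p + q) ?C"
          proof (rule infdist_ge[OF Cne])
            fix a assume "a \<in> ?C"
            then have "fst a \<in> closure \<Omega>" by (auto simp: body_def)
            then have "\<kappa> * r \<le> dist x (fst a)" using x(2) by (auto simp: disjoint_iff not_less)
            then have "\<kappa> * r / 2 \<le> dist (fst (p + q)) (fst a)"
              using xq dist_triangle[of x "fst a" "fst (p + q)"] by linarith
            also have "\<dots> \<le> dist (p + q) a" by (rule dist_fst_le)
            finally show "\<delta> \<le> dist (p + q) a" by (simp add: \<delta>_def min.coboundedI1)
          qed
        qed
      next
        case False
        \<comment> \<open>The base point is less than \<open>r\<^sup>2\<close> from time
          \<open>T\<close> and the box begins at \<open>2 * r\<^sup>2\<close>, so every point of the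
          shifted box is later than \<open>T + r\<^sup>2\<close>.\<close>
        then have T: "snd p0 = T" using p0(1) by (auto simp: parabolic_boundary_def)
        show ?thesis
        proof (rule that[of 0])
          show "norm (0::real^'n) \<le> 2 * r" using r by simp
          fix q assume q: "q \<in> ball (0::real^'n) (\<kappa> * r / 2) \<times> {2 * r\<^sup>2..3 * r\<^sup>2}"
          then have "2 * r\<^sup>2 \<le> snd q" by (auto simp: mem_Times_iff)
          then have s: "T + r\<^sup>2 \<le> snd (p + q)" using f(2) T by (simp add: dist_real_def)
          show "\<delta> \<le> infdist (p + q) ?C"
          proof (rule infdist_ge[OF Cne])
            fix a assume "a \<in> ?C"
            then have "snd a \<le> T" by (auto simp: body_def)
            then have "r\<^sup>2 \<le> dist (snd (p + q)) (snd a)" using s by (simp add: dist_real_def)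
            also have "\<dots> \<le> dist (p + q) a" by (rule dist_snd_le)
            finally show "\<delta> \<le> dist (p + q) a" by (simp add: \<delta>_def min.coboundedI2)
          qed
        qed
      qed
      let ?S = "ball z (\<kappa> * r / 2) \<times> {2 * r\<^sup>2..3 * r\<^sup>2}" and ?Q = "{q. \<delta> \<le> infdist (p + q) ?C}"
      have k: "integrable lborel (kern (1 / r\<^sup>2))" using r by (intro kern_integral(1)) simp
      have Sm: "?S \<in> sets borel" by (intro borel_Times) auto
      have Qm: "?Q \<in> sets borel" by (intro borel_closed closed_Collect_le continuous_intros)
      have "(LINT q|lborel. kern (1 / r\<^sup>2) q * indicator ?S q) \<le> (LINT q|lborel. kern (1 / r\<^sup>2) q * indicator ?Q q)"
      proof (rule integral_mono)
        show "integrable lborel (\<lambda>q. kern (1 / r\<^sup>2) q * indicator ?S q)" "integrable lborel (\<lambda>q. kern (1 / r\<^sup>2) q * indicator ?Q q)"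
          using k Sm Qm by (auto intro!: integrable_real_mult_indicator)
        show "kern (1 / r\<^sup>2) q * indicator ?S q \<le> kern (1 / r\<^sup>2) q * indicator ?Q q" for q
          using z(2)[of q] by (intro mult_left_mono) (auto simp: indicator_def)
      qed
      then have "1 / r\<^sup>2 * (LINT q|lborel. kern (1 / r\<^sup>2) q * indicator ?S q) \<le> 1 / r\<^sup>2 * (LINT q|lborel. kern (1 / r\<^sup>2) q * indicator ?Q q)"
        by (rule mult_left_mono) simp
      then show "min c 1 \<le> 1 / r\<^sup>2 * (LINT q|lborel. kern (1 / r\<^sup>2) q * indicator ?Q q)"
        using c(2)[OF r(1) z(1)] by linarith
    qed
  qed
  then show ?thesis using c(1) r0 by - (rule exI[of _ "min c 1"], rule exI[of _ "min r0 1"], auto)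
qed

end

sublocale caloric_space \<subseteq> heat_resolvent L
  by (rule heat_resolvent.intro, rule lin, rule inj)

context caloric_space
begin

lemma continuous_on_pole:
  assumes "\<And>w k. w \<in> X \<Longrightarrow> k \<in> K \<Longrightarrow> w \<noteq> k"
  shows "continuous_on (X \<times> K) (\<lambda>(w, k). pole (snd w) (fst w) k)"
proof -
  have c: "continuous_on (X \<times> K) (\<lambda>u. ((norm (L (fst (fst u) - fst (snd u))))\<^sup>2, snd (fst u) - snd (snd u)))"
    by (intro continuous_intros continuous_on_compose2[OF continuous_on_L[of UNIV]]) auto
  have "(norm (L (fst w - fst k)))\<^sup>2 > 0 \<or> snd w - snd k \<noteq> 0" if "w \<in> X" "k \<in> K" for w k
  proof (cases "fst w = fst k")
    case True
    then show ?thesis using assms[OF that] by (auto simp: prod_eq_iff)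
  next
    case False
    then have "L (fst w - fst k) \<noteq> 0" using inj linear_0[OF lin] by (metis injD right_minus_eq)
    then show ?thesis by simp
  qed
  then have "continuous_on (X \<times> K) (\<lambda>u. (\<lambda>(q, \<tau>). gauss_profile CARD('n) q \<tau>) ((norm (L (fst (fst u) - fst (snd u))))\<^sup>2, snd (fst u) - snd (snd u)))"
    by (intro continuous_on_compose2[OF continuous_on_gauss_profile[of "CARD('n)"] c]) auto
  then have "continuous_on (X \<times> K) (\<lambda>u. gauss_profile CARD('n) ((norm (L (fst (fst u) - fst (snd u))))\<^sup>2) (snd (fst u) - snd (snd u)))"
    by simp
  then show ?thesis
    unfolding pole_def heat_kernel_def case_prod_beta' fst_conv snd_conv by (intro continuous_intros)
qed

text \<open>The damping of \<open>kern 1\<close> from \<open>k\<close> to \<open>w\<close> times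
  \<open>exp (- snd k)\<close> equals \<open>exp (- snd w)\<close>, which does not depend on
  \<open>k\<close>. So the function is an integral of exterior poles with a bounded weight over the
  compact set \<open>X\<close>, to which \<open>integral_mem\<close> applies.\<close>

lemma potential_mem:
  assumes \<Omega>: "bounded \<Omega>" "connected (- closure \<Omega>)" and KC: "K \<subseteq> body \<Omega> T"
    and G: "G \<in> borel_measurable borel" "\<And>p. \<bar>G p\<bar> \<le> D" and \<delta>: "0 < \<delta>"
    and supp: "\<And>p. G p \<noteq> 0 \<Longrightarrow> \<delta> \<le> infdist p (body \<Omega> T) \<and> norm p \<le> S"
  shows "(\<lambda>k. of_real (exp (- snd k) * R 1 G k)) \<in> V"
proof -
  let ?C = "body \<Omega> T"
  define X where "X = cball 0 S \<inter> {w. \<delta> \<le> infdist w ?C}"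
  have X: "compact X"
    unfolding X_def by (intro compact_Int_closed closed_Collect_le continuous_intros) auto
  have XC: "w \<notin> ?C" if "w \<in> X" for w
  proof
    assume "w \<in> ?C"
    then have "infdist w ?C = 0" by simp
    then show False using that \<delta> by (simp add: X_def)
  qed
  have D: "0 \<le> D" using G(2)[of 0] by linarith
  define g where "g w = exp (- snd w) * G w" for w
  have gm: "g \<in> borel_measurable borel" unfolding g_def using G(1) by measurable
  have gB: "\<bar>g w\<bar> \<le> exp S * D" for w
  proof (cases "G w = 0")
    case False
    then have "norm w \<le> S" using supp by blast
    then have "- snd w \<le> S" using norm_snd_le[of "snd w" "fst w"] by simp
    then have "exp (- snd w) * \<bar>G w\<bar> \<le> exp S * D" using G(2) by (intro mult_mono) auto
    then show ?thesis by (simp add: g_def abs_mult)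
  qed (use D in \<open>simp add: g_def\<close>)
  have mem: "(\<lambda>k. LINT w:X|lborel. of_real (g w) * pole (snd w) (fst w) k) \<in> V"
  proof (rule integral_mem[OF X _ _ gm gB])
    show "continuous_on (X \<times> K) (\<lambda>(w, k). pole (snd w) (fst w) k)"
      using XC KC by (intro continuous_on_pole) blast
    fix w assume "w \<in> X"
    then have "fst w \<notin> closure \<Omega> \<or> T < snd w" using XC[of w] by (cases w) (auto simp: body_def)
    then show "pole (snd w) (fst w) \<in> V"
      using \<Omega> KC by (intro pole_mem[where S = "closure \<Omega>" and T = T]) (auto simp: body_def)
  qed
  have "(\<lambda>k. of_real (1 / gauss_mass) * (LINT w:X|lborel. of_real (g w) * pole (snd w) (fst w) k)) \<in> V"
    by (rule cmult[OF mem])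
  then show ?thesis
  proof (rule cong)
    fix k assume "k \<in> K"
    have "R 1 G k = (LINT w|lborel. kern 1 (w - k) * G w)"
      using integral_lborel_translate[of "\<lambda>w. kern 1 (w - k) * G w" k] G(1)
      unfolding R_def by simp
    then have "exp (- snd k) * R 1 G k = (LINT w|lborel. exp (- snd k) * (kern 1 (w - k) * G w))" by simp
    also have "\<dots> = (LINT w|lborel. 1 / gauss_mass * (indicator X w * (g w * heat_kernel L (w - k))))"
    proof (rule arg_cong[where f = "lebesgue_integral lborel"], rule ext)
      fix w
      show "exp (- snd k) * (kern 1 (w - k) * G w) = 1 / gauss_mass * (indicator X w * (g w * heat_kernel L (w - k)))"
      proof (cases "G w = 0")
        case False
        then have "w \<in> X" using supp[of w] by (simp add: X_def)
        moreover have "exp (- snd k) * exp (- 1 * snd (w - k)) = exp (- snd w)" unfolding mult_exp_exp by simp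
        ultimately have "exp (- snd k) * (kern 1 (w - k) * G w) = exp (- snd w) * (heat_kernel L (w - k) / gauss_mass * G w)"
          "indicator X w = (1::real)"
          unfolding kern_def by (simp_all only: times_divide_eq_left times_divide_eq_right mult.assoc[symmetric] indicator_simps)
        then show ?thesis by (simp add: g_def)
      qed (simp add: g_def)
    qed
    also have "\<dots> = 1 / gauss_mass * (LINT w|lborel. indicator X w * (g w * heat_kernel L (w - k)))" by simp
    finally have e: "exp (- snd k) * R 1 G k = 1 / gauss_mass * (LINT w|lborel. indicator X w * (g w * heat_kernel L (w - k)))" .
    have "(LINT w:X|lborel. of_real (g w) * pole (snd w) (fst w) k) = (LINT w|lborel. complex_of_real (indicator X w * (g w * heat_kernel L (w - k))))"
      unfolding set_lebesgue_integral_def pole_def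
      by (rule arg_cong[where f = "lebesgue_integral lborel"]) (auto simp: indicator_def minus_prod_def)
    then have "(LINT w:X|lborel. of_real (g w) * pole (snd w) (fst w) k) = of_real (LINT w|lborel. indicator X w * (g w * heat_kernel L (w - k)))"
      unfolding integral_complex_of_real .
    then show "of_real (exp (- snd k) * R 1 G k) = of_real (1 / gauss_mass) * (LINT w:X|lborel. of_real (g w) * pole (snd w) (fst w) k)"
      unfolding e by (simp only: of_real_mult)
  qed
qed

end

section \<open>The uniform closure of the parabolic polynomials and the conclusion\<close>

text \<open>The coefficients are complex, as the complex frequencies require; real parts are taken
  at the very end.\<close>

definition uniform_span :: "'k set \<Rightarrow> ('i \<Rightarrow> 'k \<Rightarrow> real) \<Rightarrow> ('k \<Rightarrow> complex) set" where
  "uniform_span K w = {f. \<forall>e>0. \<exists>F c. finite F \<and> (\<forall>k\<in>K. cmod (f k - (\<Sum>\<alpha>\<in>F. c \<alpha> * of_real (w \<alpha> k))) \<le> e)}"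

lemma uniform_spanI:
  "(\<And>e. 0 < e \<Longrightarrow> \<exists>F c. finite F \<and> (\<forall>k\<in>K. cmod (f k - (\<Sum>\<alpha>\<in>F. c \<alpha> * of_real (w \<alpha> k))) \<le> e)) \<Longrightarrow> f \<in> uniform_span K w"
  by (simp add: uniform_span_def)

lemma uniform_spanD:
  "f \<in> uniform_span K w \<Longrightarrow> 0 < e \<Longrightarrow> \<exists>F c. finite F \<and> (\<forall>k\<in>K. cmod (f k - (\<Sum>\<alpha>\<in>F. c \<alpha> * of_real (w \<alpha> k))) \<le> e)"
  by (simp add: uniform_span_def)

lemma uniform_span_generator: "(\<lambda>k. of_real (w \<alpha> k)) \<in> uniform_span K w"
  by (rule uniform_spanI) (auto intro!: exI[of _ "{\<alpha>}"] exI[of _ "\<lambda>_. 1"])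

lemma closed_function_space_uniform_span:
  assumes "compact K"
  shows "closed_function_space K (uniform_span K w)"
proof
  show "compact K" by fact
  show "(\<lambda>k. 0) \<in> uniform_span K w"
    by (rule uniform_spanI) (auto intro!: exI[of _ "{}"])
next
  fix f g assume f: "f \<in> uniform_span K w" and g: "g \<in> uniform_span K w"
  show "(\<lambda>k. f k + g k) \<in> uniform_span K w"
  proof (rule uniform_spanI)
    fix e :: real assume e: "0 < e"
    obtain F c where F: "finite F" "\<And>k. k \<in> K \<Longrightarrow> cmod (f k - (\<Sum>\<alpha>\<in>F. c \<alpha> * of_real (w \<alpha> k))) \<le> e / 2"
      using uniform_spanD[OF f half_gt_zero[OF e]] by blast
    obtain F' c' where F': "finite F'" "\<And>k. k \<in> K \<Longrightarrow> cmod (g k - (\<Sum>\<alpha>\<in>F'. c' \<alpha> * of_real (w \<alpha> k))) \<le> e / 2"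
      using uniform_spanD[OF g half_gt_zero[OF e]] by blast
    define d where "d \<alpha> = (if \<alpha> \<in> F then c \<alpha> else 0) + (if \<alpha> \<in> F' then c' \<alpha> else 0)" for \<alpha>
    have s: "(\<Sum>\<alpha>\<in>F \<union> F'. d \<alpha> * of_real (w \<alpha> k)) = (\<Sum>\<alpha>\<in>F. c \<alpha> * of_real (w \<alpha> k)) + (\<Sum>\<alpha>\<in>F'. c' \<alpha> * of_real (w \<alpha> k))" for k
    proof -
      have "(\<Sum>\<alpha>\<in>F. c \<alpha> * of_real (w \<alpha> k)) = (\<Sum>\<alpha>\<in>F \<union> F'. (if \<alpha> \<in> F then c \<alpha> else 0) * of_real (w \<alpha> k))"
        using F(1) F'(1) by (intro sum.mono_neutral_cong_left) auto
      moreover have "(\<Sum>\<alpha>\<in>F'. c' \<alpha> * of_real (w \<alpha> k)) = (\<Sum>\<alpha>\<in>F \<union> F'. (if \<alpha> \<in> F' then c' \<alpha> else 0) * of_real (w \<alpha> k))"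
        using F(1) F'(1) by (intro sum.mono_neutral_cong_left) auto
      ultimately show ?thesis by (simp only: d_def distrib_right sum.distrib)
    qed
    have "cmod (f k + g k - (\<Sum>\<alpha>\<in>F \<union> F'. d \<alpha> * of_real (w \<alpha> k))) \<le> e" if k: "k \<in> K" for k
    proof -
      have "f k + g k - (\<Sum>\<alpha>\<in>F \<union> F'. d \<alpha> * of_real (w \<alpha> k))
        = (f k - (\<Sum>\<alpha>\<in>F. c \<alpha> * of_real (w \<alpha> k))) + (g k - (\<Sum>\<alpha>\<in>F'. c' \<alpha> * of_real (w \<alpha> k)))"
        unfolding s by simp
      also have "cmod \<dots> \<le> e / 2 + e / 2" by (intro order_trans[OF norm_triangle_ineq] add_mono F(2) F'(2) k)
      finally show ?thesis by simp
    qed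
    then show "\<exists>F c. finite F \<and> (\<forall>k\<in>K. cmod (f k + g k - (\<Sum>\<alpha>\<in>F. c \<alpha> * of_real (w \<alpha> k))) \<le> e)"
      using F(1) F'(1) by (intro exI[of _ "F \<union> F'"] exI[of _ d]) auto
  qed
next
  fix f and r :: complex assume f: "f \<in> uniform_span K w"
  show "(\<lambda>k. r * f k) \<in> uniform_span K w"
  proof (rule uniform_spanI)
    fix e :: real assume e: "0 < e"
    have e': "0 < e / (cmod r + 1)" using e by (simp add: add_nonneg_pos)
    obtain F c where F: "finite F" "\<And>k. k \<in> K \<Longrightarrow> cmod (f k - (\<Sum>\<alpha>\<in>F. c \<alpha> * of_real (w \<alpha> k))) \<le> e / (cmod r + 1)"
      using uniform_spanD[OF f e'] by blast
    have "cmod (r * f k - (\<Sum>\<alpha>\<in>F. (r * c \<alpha>) * of_real (w \<alpha> k))) \<le> e" if k: "k \<in> K" for k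
    proof -
      have "r * f k - (\<Sum>\<alpha>\<in>F. (r * c \<alpha>) * of_real (w \<alpha> k)) = r * (f k - (\<Sum>\<alpha>\<in>F. c \<alpha> * of_real (w \<alpha> k)))"
        by (simp add: right_diff_distrib sum_distrib_left mult.assoc)
      also have "cmod \<dots> \<le> (cmod r + 1) * (e / (cmod r + 1))"
        unfolding norm_mult using F(2)[OF k] by (intro mult_mono) auto
      also have "\<dots> = e" by (simp add: add_nonneg_eq_0_iff)
      finally show ?thesis .
    qed
    then show "\<exists>F c. finite F \<and> (\<forall>k\<in>K. cmod (r * f k - (\<Sum>\<alpha>\<in>F. c \<alpha> * of_real (w \<alpha> k))) \<le> e)"
      using F(1) by (intro exI[of _ F] exI[of _ "\<lambda>\<alpha>. r * c \<alpha>"]) auto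
  qed
next
  fix f assume ex: "\<And>e. 0 < e \<Longrightarrow> \<exists>g\<in>uniform_span K w. \<forall>k\<in>K. cmod (f k - g k) \<le> e"
  show "f \<in> uniform_span K w"
  proof (rule uniform_spanI)
    fix e :: real assume e: "0 < e"
    obtain g where g: "g \<in> uniform_span K w" "\<And>k. k \<in> K \<Longrightarrow> cmod (f k - g k) \<le> e / 2"
      using ex[OF half_gt_zero[OF e]] by blast
    obtain F c where F: "finite F" "\<And>k. k \<in> K \<Longrightarrow> cmod (g k - (\<Sum>\<alpha>\<in>F. c \<alpha> * of_real (w \<alpha> k))) \<le> e / 2"
      using uniform_spanD[OF g(1) half_gt_zero[OF e]] by blast
    have "cmod (f k - (\<Sum>\<alpha>\<in>F. c \<alpha> * of_real (w \<alpha> k))) \<le> e" if k: "k \<in> K" for k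
      using norm_triangle_ineq[of "f k - g k" "g k - (\<Sum>\<alpha>\<in>F. c \<alpha> * of_real (w \<alpha> k))"] g(2)[OF k] F(2)[OF k] by simp
    then show "\<exists>F c. finite F \<and> (\<forall>k\<in>K. cmod (f k - (\<Sum>\<alpha>\<in>F. c \<alpha> * of_real (w \<alpha> k))) \<le> e)"
      using F(1) by blast
  qed
qed

lemma continuous_on_parabolic_poly: "continuous_on UNIV (parabolic_poly a \<alpha>)"
proof -
  \<comment> \<open>The coordinate \<open>undefined\<close> is an arbitrary choice: only
    \<open>c = 0\<close> is used, where the shift does nothing.\<close>
  have "continuous_on UNIV (\<lambda>(c, k). pderivs \<alpha> index_enum (gen_fun a) (shift 0 undefined c) k)"
    by (intro continuous_on_exp_poly_shift[of a] exp_poly_pderivs exp_poly_gen_fun)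
  then have "continuous_on UNIV (\<lambda>k. (\<lambda>(c, k). pderivs \<alpha> index_enum (gen_fun a) (shift 0 undefined c) k) (0, k))"
    by (rule continuous_on_compose2) (auto intro!: continuous_intros)
  then have "continuous_on UNIV (\<lambda>k. Re (of_real (parabolic_poly a \<alpha> k)))"
    unfolding parabolic_poly_eq_pderivs by (intro continuous_intros) simp
  then show ?thesis by simp
qed

text \<open>The frequency \<open>\<zeta>\<close> with coordinates \<open>z\<close> in the frame
  \<open>v\<close> turns the linear part of the phase into the pairing of \<open>z\<close> with the
  new coordinates, and by orthonormality the quadratic part into the sum of the squares of
  \<open>z\<close>.\<close>

lemma caloric_space_parabolic_poly:
  fixes a :: "real^'n^'n" and v :: "'n \<Rightarrow> real^'n"
  assumes K: "compact K"
    and orth: "\<And>i j. (\<Sum>h\<in>UNIV. \<Sum>k\<in>UNIV. a $ h $ k * v i $ h * v j $ k) = (if i = j then 1 else 0)"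
    and ker: "\<And>y. (\<And>i. v i \<bullet> y = 0) \<Longrightarrow> y = 0"
  shows "caloric_space K (uniform_span K (parabolic_poly a)) (\<lambda>y. \<chi> i. v i \<bullet> y)"
proof -
  interpret closed_function_space K "uniform_span K (parabolic_poly a)"
    by (rule closed_function_space_uniform_span[OF K])
  show ?thesis
  proof (rule caloric_space.intro[OF closed_function_space_axioms], rule caloric_space_axioms.intro)
    show "linear (\<lambda>y. \<chi> i. v i \<bullet> y)"
      by (intro linearI) (simp_all add: vec_eq_iff inner_add_right)
    show "inj (\<lambda>y. \<chi> i. v i \<bullet> y)"
    proof (rule injI)
      fix x y assume "(\<chi> i. v i \<bullet> x) = (\<chi> i. v i \<bullet> y)"
      then have "v i \<bullet> (x - y) = 0" for i by (simp add: vec_eq_iff inner_diff_right)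
      then show "x = y" using ker[of "x - y"] by simp
    qed
    fix z :: "complex^'n"
    define \<zeta> where "\<zeta> = (\<chi> j. \<Sum>i\<in>UNIV. z $ i * of_real (v i $ j))"
    have lin_part: "(\<Sum>j\<in>UNIV. of_real (x $ j) * \<zeta> $ j) = (\<Sum>i\<in>UNIV. z $ i * of_real (v i \<bullet> x))" for x
    proof -
      have "(\<Sum>j\<in>UNIV. of_real (x $ j) * \<zeta> $ j) = (\<Sum>j\<in>UNIV. \<Sum>i\<in>UNIV. z $ i * of_real (v i $ j * x $ j))"
        by (simp add: \<zeta>_def sum_distrib_left mult_ac)
      also have "\<dots> = (\<Sum>i\<in>UNIV. \<Sum>j\<in>UNIV. z $ i * of_real (v i $ j * x $ j))" by (rule sum.swap)
      finally show ?thesis by (simp add: inner_vec_def sum_distrib_left)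
    qed
    have quad: "(\<Sum>h\<in>UNIV. \<Sum>l\<in>UNIV. of_real (a $ h $ l) * \<zeta> $ h * \<zeta> $ l) = (\<Sum>i\<in>UNIV. (z $ i)\<^sup>2)"
    proof -
      have "(\<Sum>h\<in>UNIV. \<Sum>l\<in>UNIV. of_real (a $ h $ l) * \<zeta> $ h * \<zeta> $ l)
        = (\<Sum>h\<in>UNIV. \<Sum>l\<in>UNIV. \<Sum>i\<in>UNIV. \<Sum>j\<in>UNIV. z $ i * z $ j * of_real (a $ h $ l * v i $ h * v j $ l))"
        by (simp add: \<zeta>_def sum_distrib_left sum_distrib_right mult_ac)
      also have "\<dots> = (\<Sum>h\<in>UNIV. \<Sum>i\<in>UNIV. \<Sum>l\<in>UNIV. \<Sum>j\<in>UNIV. z $ i * z $ j * of_real (a $ h $ l * v i $ h * v j $ l))"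
        by (intro sum.cong refl sum.swap)
      also have "\<dots> = (\<Sum>i\<in>UNIV. \<Sum>h\<in>UNIV. \<Sum>l\<in>UNIV. \<Sum>j\<in>UNIV. z $ i * z $ j * of_real (a $ h $ l * v i $ h * v j $ l))"
        by (rule sum.swap)
      also have "\<dots> = (\<Sum>i\<in>UNIV. \<Sum>h\<in>UNIV. \<Sum>j\<in>UNIV. \<Sum>l\<in>UNIV. z $ i * z $ j * of_real (a $ h $ l * v i $ h * v j $ l))"
        by (intro sum.cong refl sum.swap)
      also have "\<dots> = (\<Sum>i\<in>UNIV. \<Sum>j\<in>UNIV. \<Sum>h\<in>UNIV. \<Sum>l\<in>UNIV. z $ i * z $ j * of_real (a $ h $ l * v i $ h * v j $ l))"
        by (intro sum.cong refl sum.swap)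
      also have "\<dots> = (\<Sum>i\<in>UNIV. \<Sum>j\<in>UNIV. z $ i * z $ j * of_real (\<Sum>h\<in>UNIV. \<Sum>l\<in>UNIV. a $ h $ l * v i $ h * v j $ l))"
        by (simp only: of_real_sum sum_distrib_left)
      also have "\<dots> = (\<Sum>i\<in>UNIV. \<Sum>j\<in>UNIV. if j = i then z $ i * z $ j else 0)"
        unfolding orth by (intro sum.cong refl) auto
      finally show ?thesis by (simp add: power2_eq_square)
    qed
    have "(\<lambda>k. gen_fun a \<zeta> k) \<in> uniform_span K (parabolic_poly a)"
    proof (rule gen_fun_mem[where h = "\<lambda>k. k"])
      show "(\<lambda>k. of_real (parabolic_poly a \<alpha> k)) \<in> uniform_span K (parabolic_poly a)" for \<alpha>
        by (rule uniform_span_generator)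
    qed (rule continuous_on_id)
    moreover have "gen_fun a \<zeta> k = exp (\<Sum>i\<in>UNIV. z $ i * of_real ((\<chi> i. v i \<bullet> fst k) $ i) - of_real (snd k) * (z $ i)\<^sup>2)" for k
      unfolding gen_fun_def gen_phase_def lin_part quad
      by (simp add: sum_subtractf flip: sum_distrib_left)
    ultimately show "(\<lambda>k. exp (\<Sum>i\<in>UNIV. z $ i * of_real ((\<chi> i. v i \<bullet> fst k) $ i) - of_real (snd k) * (z $ i)\<^sup>2)) \<in> uniform_span K (parabolic_poly a)"
      by simp
  qed
qed

text \<open>The potential approximates \<open>exp t * \<psi>\<close>. Multiplying back by
  \<open>exp (- t)\<close>, at most 1 on the boundary, gives an element of the uniform span and does
  not enlarge the error.\<close>

lemma uniform_approximation_parabolic_poly: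
  fixes \<Omega> :: "(real^'n) set" and a :: "real^'n^'n"
  assumes \<Omega>: "\<Omega> \<noteq> {}" "open \<Omega>" "bounded \<Omega>" "C1_boundary \<Omega>" "connected (- closure \<Omega>)" and T: "0 < T"
    and sym: "\<And>h k. a $ h $ k = a $ k $ h"
    and pos: "\<And>\<xi> :: real^'n. \<xi> \<noteq> 0 \<Longrightarrow> (\<Sum>h\<in>UNIV. \<Sum>k\<in>UNIV. a $ h $ k * \<xi> $ h * \<xi> $ k) > 0"
    and \<psi>: "uniformly_continuous_on UNIV \<psi>" "\<And>p. \<bar>\<psi> p\<bar> \<le> B" and e: "0 < (e::real)"
  shows "\<exists>F c. finite F \<and> (\<forall>p\<in>parabolic_boundary \<Omega> T. \<bar>\<psi> p - (\<Sum>\<alpha>\<in>F. c \<alpha> * parabolic_poly a \<alpha> p)\<bar> \<le> e)"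
proof -
  let ?K = "parabolic_boundary \<Omega> T"
  obtain v :: "'n \<Rightarrow> real^'n"
    where v: "\<And>i j. (\<Sum>h\<in>UNIV. \<Sum>k\<in>UNIV. a $ h $ k * v i $ h * v j $ k) = (if i = j then 1 else 0)"
      "\<And>y. (\<And>i. v i \<bullet> y = 0) \<Longrightarrow> y = 0"
    using orthonormal_frame[OF sym pos] by blast
  interpret caloric_space ?K "uniform_span ?K (parabolic_poly a)" "\<lambda>y. \<chi> i. v i \<bullet> y"
    by (rule caloric_space_parabolic_poly[OF compact_parabolic_boundary[OF \<Omega>(3)] v])
  obtain c r1 where c: "0 < c" "c \<le> 1" "0 < r1" "nonthin (body \<Omega> T) ?K c r1"
    using nonthin_parabolic_boundary[OF \<Omega>(4,2,3,1)] by blast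
  \<comment> \<open>Time is clamped to \<open>[0, T]\<close>, which changes nothing on the boundary
    but keeps the product with \<open>\<psi>\<close> bounded and uniformly continuous on the whole
    space.\<close>
  define s where "s p = exp (max 0 (min T (snd p)))" for p :: "(real^'n) \<times> real"
  define f where "f p = s p * \<psi> p" for p
  have B: "0 \<le> B" using \<psi>(2)[of 0] by linarith
  have s_le: "0 \<le> s p" "s p \<le> exp T" for p using T by (auto simp: s_def)
  have s_lip: "\<bar>s p - s q\<bar> \<le> exp T * dist p q" for p q
  proof -
    let ?x = "max 0 (min T (snd p))" and ?y = "max 0 (min T (snd q))"
    have "norm (exp ?x - exp ?y) \<le> exp T * norm (?x - ?y)"
    proof (rule field_differentiable_bound[of "{0..T}" exp exp])
      show "(exp has_field_derivative exp z) (at z within {0..T})" for z :: real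
        by (auto intro!: derivative_eq_intros)
    qed (use T in auto)
    also have "norm (?x - ?y) \<le> dist (snd p) (snd q)" by (auto simp: dist_real_def max_def min_def)
    also have "\<dots> \<le> dist p q" by (rule dist_snd_le)
    finally show ?thesis by (simp add: s_def)
  qed
  have fB: "\<bar>f p\<bar> \<le> exp T * B" for p
    unfolding f_def abs_mult using s_le[of p] \<psi>(2)[of p] by (intro mult_mono) auto
  have uc: "uniformly_continuous_on UNIV f"
    unfolding uniformly_continuous_on_def
  proof (intro allI impI)
    fix \<epsilon> :: real assume \<epsilon>: "0 < \<epsilon>"
    have \<epsilon>': "0 < \<epsilon> / (2 * exp T)" using \<epsilon> by simp
    obtain d where d: "0 < d" "\<And>p q. dist q p < d \<Longrightarrow> dist (\<psi> q) (\<psi> p) < \<epsilon> / (2 * exp T)"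
      using \<psi>(1)[unfolded uniformly_continuous_on_def, rule_format, OF \<epsilon>'] by blast
    show "\<exists>d>0. \<forall>x\<in>UNIV. \<forall>x'\<in>UNIV. dist x' x < d \<longrightarrow> dist (f x') (f x) < \<epsilon>"
    proof (intro exI[of _ "min d (\<epsilon> / (2 * exp T * (B + 1)))"] conjI ballI impI)
      show "0 < min d (\<epsilon> / (2 * exp T * (B + 1)))" using d(1) \<epsilon> B by simp
      fix p q :: "(real^'n) \<times> real" assume pq: "dist q p < min d (\<epsilon> / (2 * exp T * (B + 1)))"
      have "f q - f p = s q * (\<psi> q - \<psi> p) + (s q - s p) * \<psi> p" by (simp add: f_def algebra_simps)
      moreover have "\<bar>s q * (\<psi> q - \<psi> p)\<bar> \<le> exp T * \<bar>\<psi> q - \<psi> p\<bar>"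
        unfolding abs_mult using s_le[of q] by (intro mult_right_mono) auto
      moreover have "exp T * \<bar>\<psi> q - \<psi> p\<bar> < \<epsilon> / 2"
        using d(2)[of q p] pq by (simp add: dist_real_def field_simps)
      moreover have "\<bar>(s q - s p) * \<psi> p\<bar> \<le> exp T * dist q p * (B + 1)"
        unfolding abs_mult using s_lip[of q p] \<psi>(2)[of p] by (intro mult_mono) auto
      moreover have "exp T * dist q p * (B + 1) < \<epsilon> / 2"
      proof -
        have "dist q p < \<epsilon> / (2 * exp T * (B + 1))" using pq by simp
        moreover have "0 < 2 * exp T * (B + 1)" using B by simp
        ultimately have "dist q p * (2 * exp T * (B + 1)) < \<epsilon>" by (simp only: pos_less_divide_eq)
        then show ?thesis by (simp add: algebra_simps)
      qed
      ultimately show "dist (f q) (f p) < \<epsilon>" unfolding dist_real_def by linarith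
    qed
  qed
  have fm: "f \<in> borel_measurable borel"
    by (intro borel_measurable_continuous_onI uniformly_continuous_imp_continuous uc)
  have Kb: "bounded ?K" using compact_parabolic_boundary[OF \<Omega>(3)] by (rule compact_imp_bounded)
  obtain G D \<delta> S where G: "G \<in> borel_measurable borel" "\<And>p. \<bar>G p\<bar> \<le> D" "0 < \<delta>"
    "\<And>p. G p \<noteq> 0 \<Longrightarrow> \<delta> \<le> infdist p (body \<Omega> T) \<and> norm p \<le> S" "\<And>p. p \<in> ?K \<Longrightarrow> \<bar>f p - R 1 G p\<bar> \<le> e / 2"
    using exterior_potential_approx[OF c(4,3,1,2) Kb fm fB uc half_gt_zero[OF e]] by blast
  have "(\<lambda>k. of_real (exp (- snd k) * R 1 G k)) \<in> uniform_span ?K (parabolic_poly a)"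
    by (rule potential_mem[OF \<Omega>(3,5) parabolic_boundary_subset_body G(1,2,3,4)])
  from uniform_spanD[OF this half_gt_zero[OF e]]
  obtain F b where Fb: "finite F \<and> (\<forall>k\<in>?K.
    cmod (of_real (exp (- snd k) * R 1 G k) - (\<Sum>\<alpha>\<in>F. b \<alpha> * of_real (parabolic_poly a \<alpha> k))) \<le> e / 2)"
    by (elim exE)
  note F = conjunct1[OF Fb] bspec[OF conjunct2[OF Fb]]
  have "\<bar>\<psi> k - (\<Sum>\<alpha>\<in>F. Re (b \<alpha>) * parabolic_poly a \<alpha> k)\<bar> \<le> e" if k: "k \<in> ?K" for k
  proof -
    have sk: "0 \<le> snd k" "snd k \<le> T" using k T by (auto simp: parabolic_boundary_def)
    then have "f k = exp (snd k) * \<psi> k" by (simp add: f_def s_def)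
    then have "\<psi> k = exp (- snd k) * f k" by (simp add: mult_exp_exp flip: mult.assoc)
    then have "\<bar>\<psi> k - exp (- snd k) * R 1 G k\<bar> = exp (- snd k) * \<bar>f k - R 1 G k\<bar>"
      by (simp add: abs_mult flip: right_diff_distrib)
    also have "\<dots> \<le> 1 * (e / 2)" using sk G(5)[OF k] by (intro mult_mono) auto
    finally have 1: "\<bar>\<psi> k - exp (- snd k) * R 1 G k\<bar> \<le> e / 2" by simp
    \<comment> \<open>The target and the polynomials are real, so the real parts of the coefficients
      approximate at least as well.\<close>
    have "Re (of_real (exp (- snd k) * R 1 G k) - (\<Sum>\<alpha>\<in>F. b \<alpha> * of_real (parabolic_poly a \<alpha> k)))
        = exp (- snd k) * R 1 G k - (\<Sum>\<alpha>\<in>F. Re (b \<alpha>) * parabolic_poly a \<alpha> k)" by simp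
    then have "\<bar>exp (- snd k) * R 1 G k - (\<Sum>\<alpha>\<in>F. Re (b \<alpha>) * parabolic_poly a \<alpha> k)\<bar> \<le> e / 2"
      using order_trans[OF abs_Re_le_cmod F(2)[OF k]] by simp
    then show ?thesis using 1 by linarith
  qed
  then show ?thesis using F(1) by (intro exI[of _ F] exI[of _ "\<lambda>\<alpha>. Re (b \<alpha>)"] conjI ballI)
qed

text \<open>The top has the volume of a bounded set. The lateral side has the surface measure of the
  boundary, finite by the packing estimate, times the length of the time interval.\<close>

lemma finite_measure_boundary_measure:
  fixes \<Omega> :: "(real^'n) set"
  assumes C1: "C1_boundary \<Omega>" and op: "open \<Omega>" and bd: "bounded \<Omega>" and dim: "2 \<le> CARD('n)"
  shows "finite_measure (boundary_measure \<Omega> T)"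
proof
  let ?S = "Sigma1 \<Omega> T \<union> Sigma3 \<Omega> T"
  have Sb: "?S \<in> sets borel" by (rule borel_Sigma13[OF op])
  have SM: "?S \<in> sets (boundary_measure \<Omega> T)"
    using sets.top[of "boundary_measure \<Omega> T"] by simp
  have 1: "emeasure (sigma1_measure \<Omega> T) ?S < \<infinity>"
  proof -
    have "emeasure (sigma1_measure \<Omega> T) ?S = emeasure lborel {x \<in> \<Omega>. (x, T) \<in> ?S}"
      by (rule emeasure_sigma1_measure[OF op Sb])
    also have "\<dots> \<le> emeasure lborel \<Omega>" using op by (intro emeasure_mono) auto
    also have "\<dots> < \<infinity>" using bd by (rule emeasure_bounded_finite)
    finally show ?thesis .
  qed
  have 3: "emeasure (sigma3_measure \<Omega> T) ?S < \<infinity>"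
  proof -
    let ?M = "restrict_space (hausdorff_measure (real CARD('n) - 1)) (frontier \<Omega>)"
    let ?N = "restrict_space lborel {0<..<T}"
    have "(\<lambda>z. (fst z, snd z)) \<in> measurable (?M \<Otimes>\<^sub>M ?N) (borel \<Otimes>\<^sub>M borel)"
      by (intro measurable_Pair measurable_compose[OF measurable_fst] measurable_compose[OF measurable_snd]
            measurable_restrict_space1) auto
    then have m: "(\<lambda>z. z) \<in> measurable (?M \<Otimes>\<^sub>M ?N) borel" by (simp add: borel_prod)
    have "emeasure (sigma3_measure \<Omega> T) ?S \<le> emeasure (sigma3_measure \<Omega> T) (frontier \<Omega> \<times> {0<..<T})"
    proof -
      have "emeasure (sigma3_measure \<Omega> T) A = emeasure (?M \<Otimes>\<^sub>M ?N) (A \<inter> (frontier \<Omega> \<times> {0<..<T}))"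
        if "A \<in> sets borel" for A
        unfolding sigma3_measure_def using that
        by (subst emeasure_distr[OF m]) (auto simp: space_pair_measure space_restrict_space)
      moreover have "frontier \<Omega> \<times> {0<..<T} \<in> sets borel" by (intro borel_Times) auto
      moreover have "?S \<inter> (frontier \<Omega> \<times> {0<..<T}) = frontier \<Omega> \<times> {0<..<T}"
        by (auto simp: Sigma3_def)
      ultimately show ?thesis using Sb by simp
    qed
    also have "\<dots> = hausdorff_outer (real CARD('n) - 1) (frontier \<Omega>) * emeasure lborel {0<..<T}"
      by (rule emeasure_sigma3_measure) auto
    also have "\<dots> < \<infinity>"
      using hausdorff_outer_frontier_finite[OF C1 op bd] dim emeasure_bounded_finite[of "{0<..<T}"]
      by (simp add: ennreal_mult_less_top)
    finally show ?thesis .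
  qed
  show "emeasure (boundary_measure \<Omega> T) (space (boundary_measure \<Omega> T)) \<noteq> \<infinity>"
    using 1 3 emeasure_boundary_measure[OF op SM] by (simp add: less_top)
qed

theorem theorem16:
  fixes \<Omega> :: "(real^'n) set" and a :: "real^'n^'n" and T p :: real
  assumes "CARD('n) \<ge> 3"
    and "\<Omega> \<noteq> {}" and "open \<Omega>" and "connected \<Omega>" and "bounded \<Omega>"
    and "C1_boundary \<Omega>"
    and "connected (- closure \<Omega>)"
    and "T > 0"
    and "\<And>h k. a $ h $ k = a $ k $ h"
    and "\<And>\<xi> :: real^'n. \<xi> \<noteq> 0 \<Longrightarrow> (\<Sum>h\<in>UNIV. \<Sum>k\<in>UNIV. a $ h $ k * \<xi> $ h * \<xi> $ k) > 0"
    and "1 \<le> p"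
  shows "complete_in_Lp p (boundary_measure \<Omega> T) (parabolic_poly a)"
proof -
  let ?S = "Sigma1 \<Omega> T \<union> Sigma3 \<Omega> T" and ?K = "parabolic_boundary \<Omega> T"
  have SK: "?S \<subseteq> ?K"
    using closure_subset[of \<Omega>] by (auto simp: Sigma1_def Sigma3_def parabolic_boundary_def)
  interpret uniform_approximation "boundary_measure \<Omega> T" ?S "parabolic_poly a" p
  proof (intro uniform_approximation.intro finite_measure_boundary_measure uniform_approximation_axioms.intro)
    show "?S \<in> sets borel" by (rule borel_Sigma13) fact
    show "parabolic_poly a \<alpha> \<in> borel_measurable borel" for \<alpha>
      by (intro borel_measurable_continuous_onI continuous_on_parabolic_poly)
    fix \<psi> :: "(real^'n) \<times> real \<Rightarrow> real" and B e assume "uniformly_continuous_on UNIV \<psi>" "\<And>z. \<bar>\<psi> z\<bar> \<le> B" "0 < (e::real)"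
    from uniform_approximation_parabolic_poly[OF assms(2,3,5,6,7,8,9,10) this]
    show "\<exists>F c. finite F \<and> (\<forall>z\<in>?S. \<bar>\<psi> z - (\<Sum>\<alpha>\<in>F. c \<alpha> * parabolic_poly a \<alpha> z)\<bar> \<le> e)"
      using SK by blast
  qed (use assms in \<open>auto simp: sets_boundary_measure\<close>)
  show ?thesis
  proof (rule complete_in_Lp)
    fix \<alpha>
    have "compact (parabolic_poly a \<alpha> ` ?K)"
      using continuous_on_parabolic_poly compact_parabolic_boundary[OF assms(5)]
      by (intro compact_continuous_image) (auto intro: continuous_on_subset)
    then have "bounded (parabolic_poly a \<alpha> ` ?K)" by (rule compact_imp_bounded)
    then have "\<exists>B. \<forall>x\<in>parabolic_poly a \<alpha> ` ?K. norm x \<le> B" unfolding bounded_iff .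
    then obtain B where B: "\<forall>x\<in>parabolic_poly a \<alpha> ` ?K. norm x \<le> B" by (rule exE)
    show "\<exists>B. \<forall>z\<in>?S. \<bar>parabolic_poly a \<alpha> z\<bar> \<le> B"
    proof (intro exI[of _ B] ballI)
      fix z assume "z \<in> ?S"
      then have "z \<in> ?K" using SK by (rule rev_subsetD)
      then show "\<bar>parabolic_poly a \<alpha> z\<bar> \<le> B"
        using bspec[OF B imageI] by simp
    qed
  qed
qed

end
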